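(* For every $B_{n-1}$-orbit $Q$ on $\mathcal{B}_n$ and every $\alpha\in\Pi_{\mathfrak{k}}\sqcup\Pi_{\mathfrak{g}}$, $$\mathcal{S}h(m(s_\alpha)*Q)=m(s_\alpha)*\mathcal{S}h(Q).$$ In particular, the restricted diagonal monoid action on $W\times W$ preserves the set $\mathcal{S}p$ of all Shareshian pairs. Moreover, the type of $\alpha$ for $Q$ and the type of $\alpha$ for $\mathcal{S}h(Q)=(w,u^* )$ are related as follows: \begin{enumerate} \item The root $\alpha$ is complex stable for $Q$ if and only if it is complex stable for both $w$ and $u^*$. \item The root $\alpha$ is non-compact for $Q$ if and only if $\alpha$ is complex stable for exactly one of $w$ and $u^*$ and complex unstable for the other. \item The root $\alpha$ is real or complex unstable for $Q$ if and only if $\alpha$ is complex unstable for both $w$ and $u^*$. \end{enumerate}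
   Context: Let $n\ge 2$, $G=GL(n,\mathbb{C})$, $\mathfrak{g}=\mathfrak{gl}(n)$, and let $\mathcal{B}_n$ be the variety of full flags in $\mathbb{C}^n$ with its natural $G$-action. Let $e_1,\dots,e_n$ be the standard basis; $(v_1\subset v_2\subset\dots\subset v_n)$ denotes the full flag whose $i$-th subspace is $\mathrm{span}\{v_1,\dots,v_i\}$. Embed $K=GL(n-1,\mathbb{C})$ in $G$ in the top left corner, $x\mapsto \mathrm{diag}(x,1)$, let $\mathfrak{k}=\mathfrak{gl}(n-1)$, and let $B_{n-1}$ be the upper triangular Borel subgroup of $K$, viewed as a subgroup of $G$. It acts on $\mathcal{B}_n$ with finitely many orbits. Put $\mathcal{E}_+=(e_1\subset e_2\subset\dots\subset e_n)$ and $\mathcal{E}^*=(e_n\subset e_1\subset e_2\subset\dots\subset e_{n-1})$, with stabilizers $B$ (the upper triangular matrices) and $B^*$ in $G$; identify $\mathcal{B}_n=G/B$ via $gB\leftrightarrow g\cdot\mathcal{E}_+$. The Weyl group $W=\mathcal{S}_n$ acts by $w(e_i)=e_{w(i)}$, and hence acts on the flags spanned by permutations of the standard basis. For a $B_{n-1}$-orbit $Q$, $\mathcal{S}h(Q):=(w,u^* )\in W\times W$, where $w,u^*$ are the unique elements with $B\cdot Q=B\cdot w(\mathcal{E}_+)$ and $B^*\cdot Q=B^*\cdot u^*(\mathcal{E}^* )$. A Shareshian pair is an element of the image $\mathcal{S}p\subset W\times W$ of $\mathcal{S}h$. Roots: let $\epsilon_i$ be the $i$-th coordinate functional on diagonal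 matrices. $\Pi_{\mathfrak{g}}=\{\epsilon_i-\epsilon_{i+1}: 1\le i\le n-1\}$ and $\Pi_{\mathfrak{k}}=\{\epsilon_i-\epsilon_{i+1}:1\le i\le n-2\}$, regarded as disjoint copies in $\Pi_{\mathfrak{k}}\sqcup\Pi_{\mathfrak{g}}$. For $\alpha=\epsilon_i-\epsilon_{i+1}$, $s_\alpha=(i,i+1)$. For $\alpha\in\Pi_{\mathfrak{k}}$ let $P^K_\alpha\supset B_{n-1}$ be the standard minimal parabolic subgroup of $K$ attached to $\alpha$, with solvable radical $V^K_\alpha$; for $\alpha\in\Pi_{\mathfrak{g}}$ let $P_\alpha\supset B$ be the standard minimal parabolic subgroup of $G$ attached to $\alpha$, with solvable radical $V_\alpha$. Extended monoid action on orbits: let $Q=B_{n-1}\cdot v\mathcal{E}_+$ with $v\in G$. For $\alpha\in\Pi_{\mathfrak{k}}$, $m(s_\alpha)*Q$ is the unique open $B_{n-1}$-orbit in $P_\alpha^K v B/B$. For $\alpha\in\Pi_{\mathfrak{g}}$, $m(s_\alpha)*Q$ is the unique open $B_{n-1}$-orbit in $B_{n-1}vP_\alpha/B$. Type of $\alpha$ for $Q=B_{n-1}\cdot v\mathcal{E}_+$: define a group $M_\alpha$ contained in a group $S'_\alpha$ (isogenous to $SL(2)$) acting on a projective line with a base point: - for $\alpha\in\Pi_{\mathfrak{k}}$: $S'_\alpha=P^K_\alpha/V^K_\alpha$, $M_\alpha=(P^K_\alpha\cap vBv^{-1})/(V^K_\alpha\cap vBv^{-1})$, acting on $P^K_\alpha/B_{n-1}\cong\mathbb{P}^1$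 with base point the coset $B_{n-1}$; - for $\alpha\in\Pi_{\mathfrak{g}}$: $S'_\alpha=vP_\alpha v^{-1}/vV_\alpha v^{-1}$, $M_\alpha=(B_{n-1}\cap vP_\alpha v^{-1})/(B_{n-1}\cap vV_\alpha v^{-1})$, acting on $vP_\alpha v^{-1}/vBv^{-1}\cong\mathbb{P}^1$ with base point the coset $vBv^{-1}$. If $M_\alpha$ is solvable and contains the unipotent radical of a Borel subgroup of $S'_\alpha$, then $\alpha$ is complex for $Q$: complex stable if $M_\alpha$ fixes the base point, complex unstable otherwise. If $M_\alpha=S'_\alpha$, $\alpha$ is compact for $Q$. If $M_\alpha$ is one-dimensional and reductive, then $\alpha$ is non-compact for $Q$ if $M_\alpha$ fixes the base point, and real for $Q$ otherwise. The type depends only on $Q$, not on $v$. Restricted diagonal monoid action on $W\times W$: let $\ell$ be the length on $W$ with respect to $S=\{(1,2),\dots,(n-1,n)\}$ and $\ell^*$ the length on $W$ with respect to $S^*=\{s_1^*,\dots,s_{n-1}^*\}$, $s_1^*=(1,n)$, $s_i^*=(i-1,i)$ for $2\le i\le n-1$. Let $\sigma=(n,n-1,\dots,2,1)$, i.e. $\sigma(i)=i-1$ for $i\ge2$, $\sigma(1)=n$. For $\alpha\in\Pi_{\mathfrak{g}}$ let $\alpha^*=\sigma(\alpha)$, so $s_{\alpha^*}=\sigma s_\alpha\sigma^{-1}\in S^*$. Let $(w,u^* )\in W\times W$. - If $\alpha\in\Pi_{\mathfrak{k}}$ (so $s_\alpha\in S\cap S^*$): $\alpha$ is complex stable for $w$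 if $\ell(s_\alpha w)>\ell(w)$ and complex unstable for $w$ otherwise; $\alpha$ is complex stable for $u^*$ if $\ell^*(s_\alpha u^* )>\ell^*(u^* )$ and complex unstable for $u^*$ otherwise. Then $m(s_\alpha)*(w,u^* )$ is obtained by replacing $w$ by $s_\alpha w$ if $\alpha$ is complex stable for $w$, replacing $u^*$ by $s_\alpha u^*$ if $\alpha$ is complex stable for $u^*$, and leaving a component unchanged if $\alpha$ is complex unstable for it. - If $\alpha\in\Pi_{\mathfrak{g}}$: $\alpha$ is complex stable for $w$ if $\ell(ws_\alpha)>\ell(w)$ and complex unstable for $w$ otherwise; $\alpha$ (acting through $\alpha^*$) is complex stable for $u^*$ if $\ell^*(u^*s_{\alpha^*})>\ell^*(u^* )$ and complex unstable for $u^*$ otherwise. Then $m(s_\alpha)*(w,u^* )$ is obtained by replacing $w$ by $ws_\alpha$ if $\alpha$ is complex stable for $w$, replacing $u^*$ by $u^*s_{\alpha^*}$ if $\alpha$ is complex stable for $u^*$, and leaving a component unchanged if $\alpha$ is complex unstable for it. *)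

theory Defs
  imports
    "HOL-Analysis.Abstract_Topology"
    "HOL-Library.Extended_Nat"
    "HOL-Algebra.Solvable_Groups"
    "HOL-Combinatorics.Transposition"
    "Jordan_Normal_Form.VS_Connect"
begin

text \<open>
  Indices start at 0: the standard basis of \<open>\<complex>\<^sup>n\<close> is \<^term>\<open>unit_vec n j\<close> for \<open>j < n\<close>, and the Weyl group
  is the set of permutations of \<^term>\<open>{..<n}\<close>. An index \<open>j\<close> below is the index \<open>j + 1\<close> of
  the usual numbering \<open>1, \<dots>, n\<close>.
\<close>

section \<open>Zariski topology\<close>

inductive_set poly_functions :: "nat \<Rightarrow> (complex mat \<Rightarrow> complex) set" for n where
  const: "(\<lambda>_. c) \<in> poly_functions n"
| entry: "i < n \<Longrightarrow> j < n \<Longrightarrow> (\<lambda>A. A $$ (i, j)) \<in> poly_functions n"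
| add: "f \<in> poly_functions n \<Longrightarrow> g \<in> poly_functions n \<Longrightarrow> (\<lambda>A. f A + g A) \<in> poly_functions n"
| mult: "f \<in> poly_functions n \<Longrightarrow> g \<in> poly_functions n \<Longrightarrow> (\<lambda>A. f A * g A) \<in> poly_functions n"

definition zariski_open :: "nat \<Rightarrow> complex mat set \<Rightarrow> bool" where
  "zariski_open n U \<longleftrightarrow>
     (\<exists>F \<subseteq> poly_functions n. U = carrier_mat n n - {A \<in> carrier_mat n n. \<forall>f \<in> F. f A = 0})"

definition zariski :: "nat \<Rightarrow> complex mat topology" where
  "zariski n = topology (zariski_open n)"

lemma zariski_open_iff:
  "zariski_open n U \<longleftrightarrow>
     (\<exists>F \<subseteq> poly_functions n. U = {A \<in> carrier_mat n n. \<exists>f \<in> F. f A \<noteq> 0})"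
  unfolding zariski_open_def by (intro ex_cong1 conj_cong refl) auto

lemma istopology_zariski: "istopology (zariski_open n)"
  unfolding istopology_def
proof (intro conjI allI impI)
  fix S T assume "zariski_open n S" "zariski_open n T"
  then obtain F G where F: "F \<subseteq> poly_functions n" "S = {A \<in> carrier_mat n n. \<exists>f \<in> F. f A \<noteq> 0}"
    and G: "G \<subseteq> poly_functions n" "T = {A \<in> carrier_mat n n. \<exists>g \<in> G. g A \<noteq> 0}"
    unfolding zariski_open_iff by blast
  let ?H = "(\<lambda>(f, g) A. f A * g A) ` (F \<times> G)"
  have "?H \<subseteq> poly_functions n"
    using F(1) G(1) by (auto intro: poly_functions.mult)
  moreover have "S \<inter> T = {A \<in> carrier_mat n n. \<exists>h \<in> ?H. h A \<noteq> 0}"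
    unfolding F(2) G(2) by auto
  ultimately show "zariski_open n (S \<inter> T)"
    unfolding zariski_open_iff by blast
next
  fix \<K> assume "\<forall>K\<in>\<K>. zariski_open n K"
  then have "\<forall>K\<in>\<K>. \<exists>F. F \<subseteq> poly_functions n \<and> K = {A \<in> carrier_mat n n. \<exists>f \<in> F. f A \<noteq> 0}"
    unfolding zariski_open_iff by blast
  from bchoice[OF this] obtain F where
    F0: "\<forall>K\<in>\<K>. F K \<subseteq> poly_functions n \<and> K = {A \<in> carrier_mat n n. \<exists>f \<in> F K. f A \<noteq> 0}"
    by (elim exE)
  have F: "F K \<subseteq> poly_functions n" "K = {A \<in> carrier_mat n n. \<exists>f \<in> F K. f A \<noteq> 0}"
    if "K \<in> \<K>" for K
    using bspec[OF F0 that] by (rule conjunct1) (rule conjunct2[OF bspec[OF F0 that]])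
  have "(\<Union>K\<in>\<K>. F K) \<subseteq> poly_functions n"
    using F(1) by blast
  moreover have "\<Union>\<K> = {A \<in> carrier_mat n n. \<exists>f \<in> (\<Union>K\<in>\<K>. F K). f A \<noteq> 0}"
  proof (intro Set.set_eqI iffI)
    fix A assume "A \<in> \<Union>\<K>"
    then obtain K where "K \<in> \<K>" "A \<in> K" by blast
    moreover have "A \<in> carrier_mat n n \<and> (\<exists>f \<in> F K. f A \<noteq> 0)"
      using F(2)[OF \<open>K \<in> \<K>\<close>] \<open>A \<in> K\<close> by blast
    ultimately show "A \<in> {A \<in> carrier_mat n n. \<exists>f \<in> (\<Union>K\<in>\<K>. F K). f A \<noteq> 0}" by blast
  next
    fix A assume "A \<in> {A \<in> carrier_mat n n. \<exists>f \<in> (\<Union>K\<in>\<K>. F K). f A \<noteq> 0}"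
    then obtain K f where "K \<in> \<K>" "A \<in> carrier_mat n n" "f \<in> F K" "f A \<noteq> 0" by blast
    then have "A \<in> K" using F(2)[OF \<open>K \<in> \<K>\<close>] by blast
    with \<open>K \<in> \<K>\<close> show "A \<in> \<Union>\<K>" by blast
  qed
  ultimately show "zariski_open n (\<Union>\<K>)"
    unfolding zariski_open_iff by blast
qed

lemma openin_zariski: "openin (zariski n) U \<longleftrightarrow> zariski_open n U"
  unfolding zariski_def by (simp add: istopology_zariski topology_inverse')

text \<open>
  For an algebraic group \<open>H\<close> with closed subgroup \<open>N\<close>, the variety \<open>H/N\<close> carries the quotient
  topology, because \<open>H \<rightarrow> H/N\<close> is open and surjective.
\<close>

definition quot_topology :: "'a topology \<Rightarrow> ('a \<Rightarrow> 'b) \<Rightarrow> 'b topology" where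
  "quot_topology X f = topology (\<lambda>U. U \<subseteq> f ` topspace X \<and> openin X {x \<in> topspace X. f x \<in> U})"

lemma openin_quot_topology:
  "openin (quot_topology X f) U \<longleftrightarrow> U \<subseteq> f ` topspace X \<and> openin X {x \<in> topspace X. f x \<in> U}"
proof -
  have "istopology (\<lambda>U. U \<subseteq> f ` topspace X \<and> openin X {x \<in> topspace X. f x \<in> U})"
    unfolding istopology_def
  proof (intro conjI allI impI)
    fix S T
    assume S: "S \<subseteq> f ` topspace X \<and> openin X {x \<in> topspace X. f x \<in> S}"
      and T: "T \<subseteq> f ` topspace X \<and> openin X {x \<in> topspace X. f x \<in> T}"
    have "{x \<in> topspace X. f x \<in> S \<inter> T} = {x \<in> topspace X. f x \<in> S} \<inter> {x \<in> topspace X. f x \<in> T}"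
      by blast
    with S T show "openin X {x \<in> topspace X. f x \<in> S \<inter> T}"
      by (simp only: openin_Int)
    from S show "S \<inter> T \<subseteq> f ` topspace X" by blast
  next
    fix \<K> assume K: "\<forall>K\<in>\<K>. K \<subseteq> f ` topspace X \<and> openin X {x \<in> topspace X. f x \<in> K}"
    have "{x \<in> topspace X. f x \<in> \<Union>\<K>} = (\<Union>K\<in>\<K>. {x \<in> topspace X. f x \<in> K})"
      by blast
    moreover have "openin X (\<Union>K\<in>\<K>. {x \<in> topspace X. f x \<in> K})"
      by (intro openin_Union) (use K in blast)
    ultimately show "openin X {x \<in> topspace X. f x \<in> \<Union>\<K>}"
      by (simp only:)
    from K show "\<Union>\<K> \<subseteq> f ` topspace X" by blast
  qed
  then show ?thesis
    unfolding quot_topology_def by (simp add: topology_inverse')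
qed

definition irreducible_closed :: "'a topology \<Rightarrow> 'a set \<Rightarrow> bool" where
  "irreducible_closed X Z \<longleftrightarrow> closedin X Z \<and> Z \<noteq> {} \<and>
     (\<forall>A B. closedin X A \<longrightarrow> closedin X B \<longrightarrow> Z \<subseteq> A \<union> B \<longrightarrow> Z \<subseteq> A \<or> Z \<subseteq> B)"

definition krull_dimension :: "'a topology \<Rightarrow> enat" where
  "krull_dimension X = Sup {enat k | k. \<exists>Z. (\<forall>i \<le> k. irreducible_closed X (Z i)) \<and>
     (\<forall>i < k. Z i \<subset> Z (Suc i))}"

section \<open>Notions from the theory of algebraic groups\<close>

text \<open>
  A linear algebraic group is given by an abstract group \<open>H\<close>, its Zariski topology \<open>T\<close> and, where
  needed, its set \<open>Uni\<close> of unipotent elements.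
\<close>

definition solvable_radical :: "('a, 'b) monoid_scheme \<Rightarrow> 'a topology \<Rightarrow> 'a set" where
  "solvable_radical H T = (GREATEST R. closedin T R \<and> connectedin T R \<and> R \<lhd> H \<and>
     solvable (H\<lparr>carrier := R\<rparr>))"

definition is_unipotent_radical ::
  "('a, 'b) monoid_scheme \<Rightarrow> 'a topology \<Rightarrow> 'a set \<Rightarrow> 'a set \<Rightarrow> bool" where
  "is_unipotent_radical H T Uni R \<longleftrightarrow>
     (closedin T R \<and> connectedin T R \<and> R \<lhd> H \<and> R \<subseteq> Uni) \<and>
     (\<forall>N. closedin T N \<and> connectedin T N \<and> N \<lhd> H \<and> N \<subseteq> Uni \<longrightarrow> N \<subseteq> R)"

definition is_reductive :: "('a, 'b) monoid_scheme \<Rightarrow> 'a topology \<Rightarrow> 'a set \<Rightarrow> bool" where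
  "is_reductive H T Uni \<longleftrightarrow> is_unipotent_radical H T Uni {\<one>\<^bsub>H\<^esub>}"

definition closed_connected_solvable ::
  "('a, 'b) monoid_scheme \<Rightarrow> 'a topology \<Rightarrow> 'a set \<Rightarrow> bool" where
  "closed_connected_solvable H T C \<longleftrightarrow> subgroup C H \<and> closedin T C \<and> connectedin T C \<and>
     solvable (H\<lparr>carrier := C\<rparr>)"

definition is_Borel_subgroup :: "('a, 'b) monoid_scheme \<Rightarrow> 'a topology \<Rightarrow> 'a set \<Rightarrow> bool" where
  "is_Borel_subgroup H T C \<longleftrightarrow> closed_connected_solvable H T C \<and>
     (\<forall>D. closed_connected_solvable H T D \<longrightarrow> C \<subseteq> D \<longrightarrow> D = C)"

section \<open>The general linear group and its flags\<close>

definition GL :: "nat \<Rightarrow> complex mat monoid" where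
  "GL n = units_of (ring_mat TYPE(complex) n ())"

abbreviation Cn :: "nat \<Rightarrow> (complex, complex vec) module" where
  "Cn n \<equiv> module_vec TYPE(complex) n"

text \<open>A full flag is the list of its subspaces, of dimensions \<open>1, \<dots>, n\<close> in this order.\<close>

type_synonym flag = "complex vec set list"

definition flags :: "nat \<Rightarrow> flag set" where
  "flags n = {F. length F = n \<and>
     (\<forall>i < n. VectorSpace.subspace class_ring (F ! i) (Cn n) \<and>
        vectorspace.dim class_ring ((Cn n)\<lparr>carrier := F ! i\<rparr>) = Suc i) \<and>
     (\<forall>i. Suc i < n \<longrightarrow> F ! i \<subseteq> F ! Suc i)}"

definition spanned_flag :: "nat \<Rightarrow> (nat \<Rightarrow> complex vec) \<Rightarrow> flag" where
  "spanned_flag n v =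
     map (\<lambda>i. LinearCombinations.module.span class_ring (Cn n) (v ` {..i})) [0..<n]"

definition flag_act :: "complex mat \<Rightarrow> flag \<Rightarrow> flag" where
  "flag_act g F = map (\<lambda>U. (\<lambda>x. g *\<^sub>v x) ` U) F"

definition translates :: "complex mat set \<Rightarrow> flag set \<Rightarrow> flag set" where
  "translates H X = (\<lambda>(h, F). flag_act h F) ` (H \<times> X)"

definition E_plus :: "nat \<Rightarrow> flag" where
  "E_plus n = spanned_flag n (unit_vec n)"

definition E_star :: "nat \<Rightarrow> flag" where
  "E_star n = spanned_flag n (\<lambda>i. if i = 0 then unit_vec n (n - 1) else unit_vec n (i - 1))"

definition flag_topology :: "nat \<Rightarrow> flag topology" where
  "flag_topology n =
     quot_topology (subtopology (zariski n) (carrier (GL n))) (\<lambda>g. flag_act g (E_plus n))"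

definition stabilizer :: "nat \<Rightarrow> flag \<Rightarrow> complex mat set" where
  "stabilizer n F = {g \<in> carrier (GL n). flag_act g F = F}"

abbreviation B_plus :: "nat \<Rightarrow> complex mat set" where
  "B_plus n \<equiv> stabilizer n (E_plus n)"

abbreviation B_star :: "nat \<Rightarrow> complex mat set" where
  "B_star n \<equiv> stabilizer n (E_star n)"

definition embK :: "nat \<Rightarrow> complex mat \<Rightarrow> complex mat" where
  "embK n x = four_block_mat x (0\<^sub>m (n - 1) 1) (0\<^sub>m 1 (n - 1)) (1\<^sub>m 1)"

definition B_K :: "nat \<Rightarrow> complex mat set" where
  "B_K n = embK n ` {x \<in> carrier (GL (n - 1)). upper_triangular x}"

definition orbits :: "nat \<Rightarrow> flag set set" where
  "orbits n = {translates (B_K n) {F} | F. F \<in> flags n}"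

section \<open>The Weyl group and Shareshian pairs\<close>

definition Weyl :: "nat \<Rightarrow> (nat \<Rightarrow> nat) set" where
  "Weyl n = {w. w permutes {..<n}}"

text \<open>The matrix with \<open>e\<^sub>j \<mapsto> e\<^bsub>w(j)\<^esub>\<close>.\<close>

definition perm_mat :: "nat \<Rightarrow> (nat \<Rightarrow> nat) \<Rightarrow> complex mat" where
  "perm_mat n w = mat n n (\<lambda>(i, j). if i = w j then 1 else 0)"

definition Sh :: "nat \<Rightarrow> flag set \<Rightarrow> (nat \<Rightarrow> nat) \<times> (nat \<Rightarrow> nat)" where
  "Sh n Q =
    (THE w. w \<in> Weyl n \<and>
       translates (B_plus n) Q = translates (B_plus n) {flag_act (perm_mat n w) (E_plus n)},
     THE u. u \<in> Weyl n \<and>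
       translates (B_star n) Q = translates (B_star n) {flag_act (perm_mat n u) (E_star n)})"

definition Sp :: "nat \<Rightarrow> ((nat \<Rightarrow> nat) \<times> (nat \<Rightarrow> nat)) set" where
  "Sp n = Sh n ` orbits n"

section \<open>Simple roots and parabolic subgroups\<close>

text \<open>
  \<^term>\<open>KRoot i\<close> and \<^term>\<open>GRoot i\<close> are the copies of \<open>\<epsilon>\<^bsub>i+1\<^esub> - \<epsilon>\<^bsub>i+2\<^esub>\<close> (in the usual numbering from 1) in
  \<open>\<Pi>\<^sub>\<kk>\<close> and \<open>\<Pi>\<^sub>\<gg>\<close>.
\<close>

datatype simple_root = KRoot nat | GRoot nat

definition simple_roots :: "nat \<Rightarrow> simple_root set" where
  "simple_roots n = KRoot ` {i. i + 2 < n} \<union> GRoot ` {i. i + 1 < n}"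

abbreviation simple_refl :: "nat \<Rightarrow> nat \<Rightarrow> nat" where
  "simple_refl i \<equiv> Transposition.transpose i (Suc i)"

text \<open>\<open>H \<union> H s\<^sub>\<alpha> H\<close> for a Borel subgroup \<open>H\<close>\<close>

definition min_parabolic :: "nat \<Rightarrow> complex mat set \<Rightarrow> nat \<Rightarrow> complex mat set" where
  "min_parabolic n H i = H \<union> ((H #>\<^bsub>GL n\<^esub> perm_mat n (simple_refl i)) <#>\<^bsub>GL n\<^esub> H)"

abbreviation P_K :: "nat \<Rightarrow> nat \<Rightarrow> complex mat set" where
  "P_K n i \<equiv> min_parabolic n (B_K n) i"

abbreviation P_G :: "nat \<Rightarrow> nat \<Rightarrow> complex mat set" where
  "P_G n i \<equiv> min_parabolic n (B_plus n) i"

definition radical_in_GL :: "nat \<Rightarrow> complex mat set \<Rightarrow> complex mat set" where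
  "radical_in_GL n P = solvable_radical ((GL n)\<lparr>carrier := P\<rparr>) (subtopology (zariski n) P)"

definition conj_by :: "nat \<Rightarrow> complex mat \<Rightarrow> complex mat set \<Rightarrow> complex mat set" where
  "conj_by n v H = (\<lambda>h. v \<otimes>\<^bsub>GL n\<^esub> h \<otimes>\<^bsub>GL n\<^esub> inv\<^bsub>GL n\<^esub> v) ` H"

section \<open>The extended monoid action on orbits\<close>

text \<open>\<open>P\<^sup>K\<^sub>\<alpha> v B/B\<close> and \<open>B\<^bsub>n-1\<^esub> v P\<^sub>\<alpha>/B\<close>, respectively\<close>

fun sweep :: "nat \<Rightarrow> simple_root \<Rightarrow> complex mat \<Rightarrow> flag set" where
  "sweep n (KRoot i) v = translates (P_K n i) {flag_act v (E_plus n)}"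
| "sweep n (GRoot i) v = translates (B_K n) (translates {v} (translates (P_G n i) {E_plus n}))"

definition represents :: "nat \<Rightarrow> flag set \<Rightarrow> complex mat \<Rightarrow> bool" where
  "represents n Q v \<longleftrightarrow> v \<in> carrier (GL n) \<and> Q = translates (B_K n) {flag_act v (E_plus n)}"

definition orbit_act :: "nat \<Rightarrow> simple_root \<Rightarrow> flag set \<Rightarrow> flag set" where
  "orbit_act n \<alpha> Q = (THE Q'. Q' \<in> orbits n \<and>
     (\<exists>v. represents n Q v \<and> Q' \<subseteq> sweep n \<alpha> v \<and>
        openin (subtopology (flag_topology n) (sweep n \<alpha> v)) Q'))"

section \<open>The type of a root for an orbit\<close>

text \<open>
  For \<open>Q = B\<^bsub>n-1\<^esub> v E\<^sub>+\<close> write \<open>S' = P/V\<close>, let \<open>M \<subseteq> S'\<close> be the image of a subgroup \<open>A\<close> of \<open>P\<close>, i.e.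
  \<open>M = A/(A \<inter> V)\<close>, and let \<open>C\<close> be the base point, a coset of itself in \<open>P/C = \<pp>\<^sup>1\<close>.
\<close>

fun type_P :: "nat \<Rightarrow> simple_root \<Rightarrow> complex mat \<Rightarrow> complex mat set" where
  "type_P n (KRoot i) v = P_K n i"
| "type_P n (GRoot i) v = conj_by n v (P_G n i)"

fun type_V :: "nat \<Rightarrow> simple_root \<Rightarrow> complex mat \<Rightarrow> complex mat set" where
  "type_V n (KRoot i) v = radical_in_GL n (P_K n i)"
| "type_V n (GRoot i) v = conj_by n v (radical_in_GL n (P_G n i))"

fun type_A :: "nat \<Rightarrow> simple_root \<Rightarrow> complex mat \<Rightarrow> complex mat set" where
  "type_A n (KRoot i) v = P_K n i \<inter> conj_by n v (B_plus n)"
| "type_A n (GRoot i) v = B_K n \<inter> conj_by n v (P_G n i)"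

fun base_point :: "nat \<Rightarrow> simple_root \<Rightarrow> complex mat \<Rightarrow> complex mat set" where
  "base_point n (KRoot i) v = B_K n"
| "base_point n (GRoot i) v = conj_by n v (B_plus n)"

definition S_grp :: "nat \<Rightarrow> simple_root \<Rightarrow> complex mat \<Rightarrow> complex mat set monoid" where
  "S_grp n \<alpha> v = ((GL n)\<lparr>carrier := type_P n \<alpha> v\<rparr>) Mod (type_V n \<alpha> v)"

definition S_top :: "nat \<Rightarrow> simple_root \<Rightarrow> complex mat \<Rightarrow> complex mat set topology" where
  "S_top n \<alpha> v = quot_topology (subtopology (zariski n) (type_P n \<alpha> v))
     (\<lambda>p. type_V n \<alpha> v #>\<^bsub>GL n\<^esub> p)"

text \<open>
  Since \<open>P \<rightarrow> P/V\<close> preserves Jordan decompositions, the unipotent elements of \<open>P/V\<close> are the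
  images of the unipotent matrices in \<open>P\<close>.
\<close>

definition S_unip :: "nat \<Rightarrow> simple_root \<Rightarrow> complex mat \<Rightarrow> complex mat set set" where
  "S_unip n \<alpha> v = {x \<in> carrier (S_grp n \<alpha> v). \<exists>u \<in> x. (u - 1\<^sub>m n) ^\<^sub>m n = 0\<^sub>m n n}"

definition M_set :: "nat \<Rightarrow> simple_root \<Rightarrow> complex mat \<Rightarrow> complex mat set set" where
  "M_set n \<alpha> v = (\<lambda>a. type_V n \<alpha> v #>\<^bsub>GL n\<^esub> a) ` type_A n \<alpha> v"

abbreviation M_grp :: "nat \<Rightarrow> simple_root \<Rightarrow> complex mat \<Rightarrow> complex mat set monoid" where
  "M_grp n \<alpha> v \<equiv> (S_grp n \<alpha> v)\<lparr>carrier := M_set n \<alpha> v\<rparr>"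

abbreviation M_top :: "nat \<Rightarrow> simple_root \<Rightarrow> complex mat \<Rightarrow> complex mat set topology" where
  "M_top n \<alpha> v \<equiv> subtopology (S_top n \<alpha> v) (M_set n \<alpha> v)"

text \<open>
  For \<open>V \<subseteq> C \<subseteq> P\<close> with \<open>V\<close> normal in \<open>P\<close>, the action \<open>(pV) \<cdot> (qC) = pqC\<close> of \<open>P/V\<close> on \<open>P/C\<close> is
  multiplication of subsets of the group.
\<close>

definition fixes_base_point :: "nat \<Rightarrow> simple_root \<Rightarrow> complex mat \<Rightarrow> bool" where
  "fixes_base_point n \<alpha> v \<longleftrightarrow>
     (\<forall>x \<in> M_set n \<alpha> v. x <#>\<^bsub>GL n\<^esub> base_point n \<alpha> v = base_point n \<alpha> v)"

definition complex_at :: "nat \<Rightarrow> simple_root \<Rightarrow> complex mat \<Rightarrow> bool" where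
  "complex_at n \<alpha> v \<longleftrightarrow> solvable (M_grp n \<alpha> v) \<and>
     (\<exists>C R. is_Borel_subgroup (S_grp n \<alpha> v) (S_top n \<alpha> v) C \<and>
        is_unipotent_radical ((S_grp n \<alpha> v)\<lparr>carrier := C\<rparr>) (subtopology (S_top n \<alpha> v) C)
          (S_unip n \<alpha> v) R \<and>
        R \<subseteq> M_set n \<alpha> v)"

definition one_dim_reductive_at :: "nat \<Rightarrow> simple_root \<Rightarrow> complex mat \<Rightarrow> bool" where
  "one_dim_reductive_at n \<alpha> v \<longleftrightarrow> krull_dimension (M_top n \<alpha> v) = 1 \<and>
     is_reductive (M_grp n \<alpha> v) (M_top n \<alpha> v) (S_unip n \<alpha> v)"

datatype root_type = Complex_Stable | Complex_Unstable | Compact | Noncompact | Real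

fun type_at :: "nat \<Rightarrow> simple_root \<Rightarrow> complex mat \<Rightarrow> root_type \<Rightarrow> bool" where
  "type_at n \<alpha> v Complex_Stable \<longleftrightarrow> complex_at n \<alpha> v \<and> fixes_base_point n \<alpha> v"
| "type_at n \<alpha> v Complex_Unstable \<longleftrightarrow> complex_at n \<alpha> v \<and> \<not> fixes_base_point n \<alpha> v"
| "type_at n \<alpha> v Compact \<longleftrightarrow> M_set n \<alpha> v = carrier (S_grp n \<alpha> v)"
| "type_at n \<alpha> v Noncompact \<longleftrightarrow> one_dim_reductive_at n \<alpha> v \<and> fixes_base_point n \<alpha> v"
| "type_at n \<alpha> v Real \<longleftrightarrow> one_dim_reductive_at n \<alpha> v \<and> \<not> fixes_base_point n \<alpha> v"

definition has_type :: "nat \<Rightarrow> simple_root \<Rightarrow> flag set \<Rightarrow> root_type \<Rightarrow> bool" where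
  "has_type n \<alpha> Q \<tau> \<longleftrightarrow> (\<exists>v. represents n Q v \<and> type_at n \<alpha> v \<tau>)"

section \<open>The restricted diagonal monoid action\<close>

definition word_length :: "(nat \<Rightarrow> nat) set \<Rightarrow> (nat \<Rightarrow> nat) \<Rightarrow> nat" where
  "word_length S w = (LEAST k. \<exists>ss. length ss = k \<and> set ss \<subseteq> S \<and> w = foldr (\<circ>) ss id)"

definition len :: "nat \<Rightarrow> (nat \<Rightarrow> nat) \<Rightarrow> nat" where
  "len n = word_length {simple_refl i | i. i + 1 < n}"

definition len_star :: "nat \<Rightarrow> (nat \<Rightarrow> nat) \<Rightarrow> nat" where
  "len_star n =
     word_length (insert (Transposition.transpose 0 (n - 1)) {simple_refl i | i. i + 2 < n})"

definition sigma :: "nat \<Rightarrow> nat \<Rightarrow> nat" where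
  "sigma n i = (if i \<ge> n then i else if i = 0 then n - 1 else i - 1)"

definition star_refl :: "nat \<Rightarrow> nat \<Rightarrow> nat \<Rightarrow> nat" where
  "star_refl n i = sigma n \<circ> simple_refl i \<circ> inv_into UNIV (sigma n)"

fun refl_w :: "nat \<Rightarrow> simple_root \<Rightarrow> (nat \<Rightarrow> nat) \<Rightarrow> (nat \<Rightarrow> nat)" where
  "refl_w n (KRoot i) w = simple_refl i \<circ> w"
| "refl_w n (GRoot i) w = w \<circ> simple_refl i"

fun refl_u :: "nat \<Rightarrow> simple_root \<Rightarrow> (nat \<Rightarrow> nat) \<Rightarrow> (nat \<Rightarrow> nat)" where
  "refl_u n (KRoot i) u = simple_refl i \<circ> u"
| "refl_u n (GRoot i) u = u \<circ> star_refl n i"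

text \<open>\<open>\<alpha>\<close> is complex unstable for \<open>w\<close> (or \<open>u\<close>) iff it is not complex stable for it.\<close>

definition stable_w :: "nat \<Rightarrow> simple_root \<Rightarrow> (nat \<Rightarrow> nat) \<Rightarrow> bool" where
  "stable_w n \<alpha> w \<longleftrightarrow> len n (refl_w n \<alpha> w) > len n w"

definition stable_u :: "nat \<Rightarrow> simple_root \<Rightarrow> (nat \<Rightarrow> nat) \<Rightarrow> bool" where
  "stable_u n \<alpha> u \<longleftrightarrow> len_star n (refl_u n \<alpha> u) > len_star n u"

fun pair_act :: "nat \<Rightarrow> simple_root \<Rightarrow> (nat \<Rightarrow> nat) \<times> (nat \<Rightarrow> nat) \<Rightarrow> (nat \<Rightarrow> nat) \<times> (nat \<Rightarrow> nat)" where
  "pair_act n \<alpha> (w, u) =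
     (if stable_w n \<alpha> w then refl_w n \<alpha> w else w, if stable_u n \<alpha> u then refl_u n \<alpha> u else u)"

end

theory Submission
  imports Defs "HOL-Computational_Algebra.Polynomial"
begin

text \<open>
  The orbit of \<open>B\<^bsub>n-1\<^esub>\<close> through the flag of \<open>v\<close> determines the Bruhat cell of \<open>v\<close> and, since
  conjugation by the matrix of the cycle \<open>\<sigma>\<close> carries \<open>B\<^bsub>n-1\<^esub>\<close> into \<open>B\<close> (\<open>BK_B_star\<close>), also the
  cell of \<open>\<sigma>\<^sup>-\<^sup>1 v\<close>. These two permutations \<open>pos n v\<close> and \<open>pos_star n v\<close> are the Shareshian
  pair, up to conjugation of the second one by \<open>\<sigma>\<close> (\<open>Sh_orb\<close>), and this conjugation turns \<open>\<ell>\<^sup>*\<close>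
  into \<open>\<ell>\<close>.

  Fix a simple root \<open>\<alpha>\<close>. Moving the flag within \<open>v P\<^sub>\<alpha> / B\<close>, or the group element within
  \<open>P\<^sup>K\<^sub>\<alpha>\<close>, is a matter of one projective line. On it, the first permutation has one value \<open>w\<close> at
  a single point \<open>p\<close>, and the value \<open>w s\<^sub>\<alpha>\<close> or \<open>s\<^sub>\<alpha> w\<close> of greater length elsewhere. The second one
  behaves in the same way, with a point \<open>q\<close>. So \<open>\<alpha>\<close> is stable for a component exactly when the
  corresponding point is the base point, and everything is governed by the pair \<open>p\<close>, \<open>q\<close>.

  The group \<open>M\<^sub>\<alpha>\<close> preserves both permutations, hence fixes \<open>p\<close> and \<open>q\<close>. Conversely it contains
  the classes of the invertible matrices \<open>1 + t y\<close>, where \<open>y\<close> has rank one, image \<open>p\<close> and kernel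
  \<open>q\<close>. The existence of these elements is the geometric core (\<open>line_in_flag_direction\<close>,
  \<open>line_in_reference_direction\<close>). It comes from the fact that the matrix of \<open>\<sigma>\<close> has a
  single entry on or below the diagonal.

  \<^item> If \<open>p = q\<close>, then \<open>y\<close> is nilpotent, and \<open>M\<^sub>\<alpha>\<close> lies between the unipotent radical of the Borel
    subgroup that fixes \<open>p\<close> and this Borel subgroup: \<open>\<alpha>\<close> is complex, and stable if and only if \<open>p\<close>
    is the base point.

  \<^item> If \<open>p \<noteq> q\<close>, then \<open>y\<close> is semisimple, and \<open>M\<^sub>\<alpha>\<close> is the torus that fixes \<open>p\<close> and \<open>q\<close>: \<open>\<alpha>\<close> is
    non-compact if one of these points is the base point, and real otherwise.

  This is the comparison of types (\<open>dichotomy_equal\<close>, \<open>dichotomy_different\<close>,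
  \<open>types_from_lines\<close>). It also requires the solvable radical of \<open>P\<^sub>\<alpha>\<close>, the Borel subgroup of
  \<open>P\<^sub>\<alpha> / V\<^sub>\<alpha>\<close> that fixes a given line, and a nontrivial element in the unipotent radical of each
  Borel subgroup. These are obtained for any linear group with a two by two block (locale
  \<open>block_group\<close>). All connectedness and dimension arguments use lines in the space of matrices
  in place of general algebraic geometry.

  For the monoid action, the same elements \<open>1 + t y\<close> act transitively on the points other than
  \<open>p\<close> and \<open>q\<close> (\<open>two_lines\<close>). Hence the elements of the sweep with both permutations long form a
  single orbit. It is open, because on the sweep it is the nonvanishing set of functions that
  separate two adjacent Bruhat cells (\<open>cell_separating_function\<close>). It is the only open
  orbit, because the sweep is irreducible (\<open>orbit_act_eqI\<close>). By construction its
  Shareshian pair is the result of the action on pairs.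
\<close>

section \<open>Matrices and regular functions\<close>

lemma carrier_GL: "carrier (GL n) = {A \<in> carrier_mat n n. det A \<noteq> 0}"
  unfolding GL_def units_of_def
  using det_non_zero_imp_unit[of _ n "()"] unit_imp_det_non_zero[of _ n "()"]
  by (auto simp: Units_def ring_mat_simps)

lemma GL_D: "A \<in> carrier (GL n) \<Longrightarrow> A \<in> carrier_mat n n"
  by (simp add: carrier_GL)

lemma mult_GL [simp]: "x \<otimes>\<^bsub>GL n\<^esub> y = x * y"
  by (simp add: GL_def units_of_def ring_mat_simps)

lemma one_GL [simp]: "\<one>\<^bsub>GL n\<^esub> = 1\<^sub>m n"
  by (simp add: GL_def units_of_def ring_mat_simps)

interpretation GLn: group "GL n" for n
proof -
  interpret ring "ring_mat TYPE(complex) n ()" by (rule ring_mat)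
  show "group (GL n)" unfolding GL_def by (rule units_group)
qed

abbreviation minv :: "nat \<Rightarrow> complex mat \<Rightarrow> complex mat" where
  "minv n v \<equiv> inv\<^bsub>GL n\<^esub> v"

lemma GL_inv:
  assumes "v \<in> carrier (GL n)"
  shows "minv n v \<in> carrier (GL n)" "v * minv n v = 1\<^sub>m n" "minv n v * v = 1\<^sub>m n"
  using GLn.inv_closed[OF assms] GLn.r_inv[OF assms] GLn.l_inv[OF assms] by simp_all

lemma GL_mult: "a \<in> carrier (GL n) \<Longrightarrow> b \<in> carrier (GL n) \<Longrightarrow> a * b \<in> carrier (GL n)"
  using GLn.m_closed[of a n b] by simp

lemma mmult_assoc:
  "A \<in> carrier_mat n n \<Longrightarrow> B \<in> carrier_mat n n \<Longrightarrow> C \<in> carrier_mat n n \<Longrightarrow> A * B * C = A * (B * C)"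
  by (rule assoc_mult_mat)

lemma mmult_carrier [simp]:
  "A \<in> carrier_mat n n \<Longrightarrow> B \<in> carrier_mat n n \<Longrightarrow> A * B \<in> carrier_mat n n"
  by (rule mult_carrier_mat)

lemmas mmult_one [simp] = right_mult_one_mat[of _ n n for n] left_mult_one_mat[of _ n n for n]

lemma mmult_entry:
  assumes "A \<in> carrier_mat n n" "B \<in> carrier_mat n n" "i < n" "j < n"
  shows "(A * B) $$ (i, j) = (\<Sum>k<n. A $$ (i, k) * B $$ (k, j))"
  using assms by (simp add: scalar_prod_def lessThan_atLeast0)

lemma mmult_cancel:
  assumes "v \<in> carrier (GL n)" "A \<in> carrier_mat n n"
  shows "v * (minv n v * A) = A" "minv n v * (v * A) = A"
    "A * v * minv n v = A" "A * minv n v * v = A"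
  using assms GL_inv[OF assms(1)] GL_D[OF assms(1)] GL_D[OF GL_inv(1)[OF assms(1)]]
  by (simp_all add: mmult_assoc[symmetric, of v n "minv n v" A] mmult_assoc[symmetric, of "minv n v" n v A]
      mmult_assoc[of A n v "minv n v"] mmult_assoc[of A n "minv n v" v])

text \<open>The regular functions on the affine space of matrices; only values on square matrices of
  the right size matter.\<close>

definition regular :: "nat \<Rightarrow> (complex mat \<Rightarrow> complex) \<Rightarrow> bool" where
  "regular n f \<longleftrightarrow> (\<exists>g \<in> poly_functions n. \<forall>A \<in> carrier_mat n n. f A = g A)"

lemma regular_const [intro, simp]: "regular n (\<lambda>_. c)"
  unfolding regular_def by (rule bexI[of _ "\<lambda>_. c"]) (auto intro: poly_functions.const)

lemma regular_entry [intro]: "i < n \<Longrightarrow> j < n \<Longrightarrow> regular n (\<lambda>A. A $$ (i, j))"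
  unfolding regular_def by (rule rev_bexI[OF poly_functions.entry[of i n j]]) auto

lemma regular_add [intro]: "regular n f \<Longrightarrow> regular n g \<Longrightarrow> regular n (\<lambda>A. f A + g A)"
proof -
  assume "regular n f" "regular n g"
  then obtain f' g' where f: "f' \<in> poly_functions n" "\<forall>A \<in> carrier_mat n n. f A = f' A"
    and g: "g' \<in> poly_functions n" "\<forall>A \<in> carrier_mat n n. g A = g' A" unfolding regular_def by (elim bexE)
  have "(\<lambda>A. f' A + g' A) \<in> poly_functions n" using f(1) g(1) by (rule poly_functions.add)
  then show "regular n (\<lambda>A. f A + g A)"
    unfolding regular_def by (rule rev_bexI) (use f(2) g(2) in simp)
qed

lemma regular_mult [intro]: "regular n f \<Longrightarrow> regular n g \<Longrightarrow> regular n (\<lambda>A. f A * g A)"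
proof -
  assume "regular n f" "regular n g"
  then obtain f' g' where f: "f' \<in> poly_functions n" "\<forall>A \<in> carrier_mat n n. f A = f' A"
    and g: "g' \<in> poly_functions n" "\<forall>A \<in> carrier_mat n n. g A = g' A" unfolding regular_def by (elim bexE)
  have "(\<lambda>A. f' A * g' A) \<in> poly_functions n" using f(1) g(1) by (rule poly_functions.mult)
  then show "regular n (\<lambda>A. f A * g A)"
    unfolding regular_def by (rule rev_bexI) (use f(2) g(2) in simp)
qed

lemma regular_minus [intro]: "regular n f \<Longrightarrow> regular n (\<lambda>A. - f A)"
  using regular_mult[OF regular_const[of n "-1"], of f] by simp

lemma regular_diff [intro]: "regular n f \<Longrightarrow> regular n g \<Longrightarrow> regular n (\<lambda>A. f A - g A)"
  using regular_add[OF _ regular_minus, of n f g] by simp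

lemma regular_sum [intro]:
  "(\<And>s. s \<in> S \<Longrightarrow> regular n (f s)) \<Longrightarrow> regular n (\<lambda>A. \<Sum>s\<in>S. f s A)"
  by (induction S rule: infinite_finite_induct) (simp_all add: regular_add)

lemma regular_prod [intro]:
  "(\<And>s. s \<in> S \<Longrightarrow> regular n (f s)) \<Longrightarrow> regular n (\<lambda>A. \<Prod>s\<in>S. f s A)"
  by (induction S rule: infinite_finite_induct) (simp_all add: regular_mult)

lemma regular_cong:
  "(\<And>A. A \<in> carrier_mat n n \<Longrightarrow> f A = g A) \<Longrightarrow> regular n f \<longleftrightarrow> regular n g"
  unfolding regular_def by simp

lemma poly_functions_compose:
  assumes "f \<in> poly_functions n" "\<And>i j. i < n \<Longrightarrow> j < n \<Longrightarrow> regular n (\<lambda>A. \<phi> A $$ (i, j))"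
  shows "regular n (\<lambda>A. f (\<phi> A))"
  using assms(1)
proof induction
  case (const c)
  show ?case by (rule regular_const)
next
  case (entry i j)
  then show ?case by (rule assms(2))
next
  case (add f g)
  then show ?case by (intro regular_add)
next
  case (mult f g)
  then show ?case by (intro regular_mult)
qed

lemma regular_compose:
  assumes "regular n f" "\<And>A. A \<in> carrier_mat n n \<Longrightarrow> \<phi> A \<in> carrier_mat n n"
    and "\<And>i j. i < n \<Longrightarrow> j < n \<Longrightarrow> regular n (\<lambda>A. \<phi> A $$ (i, j))"
  shows "regular n (\<lambda>A. f (\<phi> A))"
proof -
  obtain g where g: "g \<in> poly_functions n" "\<forall>A \<in> carrier_mat n n. f A = g A"
    using assms(1) unfolding regular_def by blast
  have "regular n (\<lambda>A. g (\<phi> A))" by (rule poly_functions_compose[OF g(1) assms(3)])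
  then show ?thesis using g(2) assms(2) by (subst regular_cong[where g = "\<lambda>A. g (\<phi> A)"]) auto
qed

lemma regular_entry_mult:
  assumes "g \<in> carrier_mat n n" "h \<in> carrier_mat n n" "i < n" "j < n"
  shows "regular n (\<lambda>A. (g * A * h) $$ (i, j))"
proof -
  have "(g * A * h) $$ (i, j) = (\<Sum>l<n. (\<Sum>k<n. g $$ (i, k) * A $$ (k, l)) * h $$ (l, j))"
    if "A \<in> carrier_mat n n" for A
    using that assms by (subst mmult_entry[of _ n]) (auto simp: mmult_entry[of _ n] simp del: index_mult_mat)
  moreover have "regular n (\<lambda>A. \<Sum>l<n. (\<Sum>k<n. g $$ (i, k) * A $$ (k, l)) * h $$ (l, j))"
    by (intro regular_sum regular_mult regular_const regular_entry) auto
  ultimately show ?thesis by (subst regular_cong) auto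
qed

lemma regular_translate:
  assumes "regular n f" "g \<in> carrier_mat n n" "h \<in> carrier_mat n n"
  shows "regular n (\<lambda>A. f (g * A * h))"
proof (rule regular_compose[OF assms(1)])
  show "g * A * h \<in> carrier_mat n n" if "A \<in> carrier_mat n n" for A using that assms by simp
qed (rule regular_entry_mult[OF assms(2,3)])

lemma regular_det:
  assumes "\<And>A. A \<in> carrier_mat n n \<Longrightarrow> \<phi> A \<in> carrier_mat n n"
    and "\<And>i j. i < n \<Longrightarrow> j < n \<Longrightarrow> regular n (\<lambda>A. \<phi> A $$ (i, j))"
  shows "regular n (\<lambda>A. det (\<phi> A))"
proof -
  have "regular n (\<lambda>A. \<Sum>p\<in>{p. p permutes {0..<n}}. signof p * (\<Prod>i = 0..<n. \<phi> A $$ (i, p i)))"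
    by (intro regular_sum regular_mult regular_const regular_prod assms(2))
      (auto simp: permutes_in_image)
  then show ?thesis
    using assms(1) by (subst regular_cong) (auto simp: det_def'[of _ n])
qed

text \<open>The affine line through two matrices. It replaces curves in the arguments on irreducibility
  and dimension, because regular functions restrict to polynomials on it.\<close>

definition seg :: "complex mat \<Rightarrow> complex mat \<Rightarrow> complex \<Rightarrow> complex mat" where
  "seg A B t = (1 - t) \<cdot>\<^sub>m A + t \<cdot>\<^sub>m B"

lemma seg_carrier [simp]: "A \<in> carrier_mat n n \<Longrightarrow> B \<in> carrier_mat n n \<Longrightarrow> seg A B t \<in> carrier_mat n n"
  by (simp add: seg_def)

lemma seg_ends:
  assumes "A \<in> carrier_mat n n" "B \<in> carrier_mat n n"
  shows "seg A B 0 = A" "seg A B 1 = B"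
  using assms by (auto simp: seg_def intro!: eq_matI)

lemma seg_entry:
  assumes "A \<in> carrier_mat n n" "B \<in> carrier_mat n n" "i < n" "j < n"
  shows "seg A B t $$ (i, j) = (1 - t) * A $$ (i, j) + t * B $$ (i, j)"
  using assms by (simp add: seg_def)

lemma seg_mult:
  assumes "A \<in> carrier_mat n n" "B \<in> carrier_mat n n" "g \<in> carrier_mat n n" "h \<in> carrier_mat n n"
  shows "g * seg A B t * h = seg (g * A * h) (g * B * h) t"
proof -
  have "g * seg A B t = (1 - t) \<cdot>\<^sub>m (g * A) + t \<cdot>\<^sub>m (g * B)"
    unfolding seg_def using assms by (subst mult_add_distrib_mat[of _ n n _ n]) (auto simp: mult_smult_distrib[of _ n n _ n])
  then show ?thesis using assms unfolding seg_def
    by (simp only:) (subst add_mult_distrib_mat[of _ n n], auto simp: mult_smult_assoc_mat[of _ n n _ n])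
qed

lemma regular_on_seg:
  assumes "regular n f" "A \<in> carrier_mat n n" "B \<in> carrier_mat n n"
  shows "\<exists>q. \<forall>t. f (seg A B t) = poly q t"
proof -
  obtain g where g: "g \<in> poly_functions n" "\<forall>A \<in> carrier_mat n n. f A = g A"
    using assms(1) unfolding regular_def by blast
  have "\<exists>q. \<forall>t. g (seg A B t) = poly q t"
    using g(1)
  proof induction
    case (const c)
    then show ?case by (intro exI[of _ "[:c:]"]) simp
  next
    case (entry i j)
    then show ?case using assms
      by (intro exI[of _ "[:A $$ (i,j), B $$ (i,j) - A $$ (i,j):]"]) (simp add: seg_entry[of _ n] algebra_simps)
  next
    case (add f g)
    then show ?case by (metis poly_add)
  next
    case (mult f g)
    then show ?case by (metis poly_mult)
  qed
  then show ?thesis using g(2) assms by simp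
qed

lemma finite_zeros_on_seg:
  assumes "regular n f" "A \<in> carrier_mat n n" "B \<in> carrier_mat n n" "f (seg A B s) \<noteq> 0"
  shows "finite {t. f (seg A B t) = 0}"
proof -
  obtain q where q: "\<forall>t. f (seg A B t) = poly q t" using regular_on_seg[OF assms(1-3)] by blast
  with assms(4) have "q \<noteq> 0" by auto
  with q show ?thesis by (simp add: poly_roots_finite)
qed

section \<open>Zariski closed and Zariski connected sets of matrices\<close>

lemma topspace_zariski [simp]: "topspace (zariski n) = carrier_mat n n"
proof (rule subset_antisym)
  show "topspace (zariski n) \<subseteq> carrier_mat n n"
    using openin_topspace[of "zariski n"] unfolding openin_zariski zariski_open_iff by blast
  have "openin (zariski n) (carrier_mat n n)"
    unfolding openin_zariski zariski_open_iff
    by (rule exI[of _ "{\<lambda>_. 1}"]) (auto intro: poly_functions.const)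
  then show "carrier_mat n n \<subseteq> topspace (zariski n)" by (rule openin_subset)
qed

lemma open_nonzero:
  assumes "regular n f"
  shows "openin (zariski n) {A \<in> carrier_mat n n. f A \<noteq> 0}"
proof -
  obtain g where g: "g \<in> poly_functions n" "\<forall>A \<in> carrier_mat n n. f A = g A"
    using assms(1) unfolding regular_def by blast
  show ?thesis unfolding openin_zariski zariski_open_iff
    by (rule exI[of _ "{g}"]) (use g in auto)
qed

lemma open_basic:
  assumes "openin (zariski n) U" "A \<in> U"
  obtains f where "regular n f" "f A \<noteq> 0" "\<And>B. B \<in> carrier_mat n n \<Longrightarrow> f B \<noteq> 0 \<Longrightarrow> B \<in> U"
proof -
  obtain F where F: "F \<subseteq> poly_functions n" "U = {A \<in> carrier_mat n n. \<exists>f \<in> F. f A \<noteq> 0}"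
    using assms(1) unfolding openin_zariski zariski_open_iff by blast
  then obtain f where "f \<in> F" "f A \<noteq> 0" using assms(2) by blast
  with F show ?thesis by (intro that[of f]) (auto simp: regular_def)
qed

lemma closed_zero:
  assumes "regular n f"
  shows "closedin (zariski n) {A \<in> carrier_mat n n. f A = 0}"
proof -
  have "carrier_mat n n - {A \<in> carrier_mat n n. f A = 0} = {A \<in> carrier_mat n n. f A \<noteq> 0}"
    by blast
  then show ?thesis using open_nonzero[OF assms] by (simp add: closedin_def)
qed

definition line_dense :: "complex mat set \<Rightarrow> bool" where
  "line_dense S \<longleftrightarrow> (\<forall>A \<in> S. \<forall>B \<in> S. finite {t. seg A B t \<notin> S})"

text \<open>A nonempty open subset of a line is cofinite, and two cofinite subsets of a complex line
  meet; so a set that contains almost all of each line through two of its points is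
  irreducible.\<close>

lemma line_dense_open_meet:
  assumes "S \<subseteq> carrier_mat n n" "line_dense S"
    and "openin (zariski n) U" "openin (zariski n) U'" "U \<inter> S \<noteq> {}" "U' \<inter> S \<noteq> {}"
  shows "U \<inter> U' \<inter> S \<noteq> {}"
proof -
  obtain A B where A: "A \<in> U" "A \<in> S" and B: "B \<in> U'" "B \<in> S" using assms(5,6) by blast
  then have AB: "A \<in> carrier_mat n n" "B \<in> carrier_mat n n" using assms(1) by auto
  obtain f where f: "regular n f" "f A \<noteq> 0" "\<And>B. B \<in> carrier_mat n n \<Longrightarrow> f B \<noteq> 0 \<Longrightarrow> B \<in> U"
    by (rule open_basic[OF assms(3) A(1)]) blast
  obtain g where g: "regular n g" "g B \<noteq> 0" "\<And>B. B \<in> carrier_mat n n \<Longrightarrow> g B \<noteq> 0 \<Longrightarrow> B \<in> U'"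
    by (rule open_basic[OF assms(4) B(1)]) blast
  have "finite {t. f (seg A B t) = 0}" "finite {t. g (seg A B t) = 0}"
    using finite_zeros_on_seg[OF f(1) AB, of 0] finite_zeros_on_seg[OF g(1) AB, of 1]
    by (simp_all add: seg_ends[OF AB] f(2) g(2))
  moreover have "finite {t. seg A B t \<notin> S}" using assms(2) A B by (simp add: line_dense_def)
  ultimately have "finite ({t. f (seg A B t) = 0} \<union> {t. g (seg A B t) = 0} \<union> {t. seg A B t \<notin> S})"
    by simp
  then obtain t where "t \<notin> {t. f (seg A B t) = 0} \<union> {t. g (seg A B t) = 0} \<union> {t. seg A B t \<notin> S}"
    by (rule exE[OF ex_new_if_finite[OF infinite_UNIV_char_0]])
  then have "seg A B t \<in> U \<inter> U' \<inter> S" using f(3) g(3) AB by auto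
  then show ?thesis by blast
qed

lemma line_dense_connected:
  assumes "S \<subseteq> carrier_mat n n" "line_dense S"
  shows "connectedin (zariski n) S"
  unfolding connectedin
proof (intro conjI notI)
  show "S \<subseteq> topspace (zariski n)" using assms(1) by simp
  assume "\<exists>E1 E2. openin (zariski n) E1 \<and> openin (zariski n) E2 \<and> S \<subseteq> E1 \<union> E2 \<and> E1 \<inter> E2 \<inter> S = {} \<and>
      E1 \<inter> S \<noteq> {} \<and> E2 \<inter> S \<noteq> {}"
  then obtain E1 E2 where E: "openin (zariski n) E1" "openin (zariski n) E2" "E1 \<inter> E2 \<inter> S = {}"
    "E1 \<inter> S \<noteq> {}" "E2 \<inter> S \<noteq> {}" by (elim exE conjE)
  show False using line_dense_open_meet[OF assms E(1,2,4,5)] E(3) by (rule notE)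
qed

lemma line_dense_units:
  assumes "\<And>A B t. A \<in> carrier_mat n n \<Longrightarrow> B \<in> carrier_mat n n \<Longrightarrow> L A \<Longrightarrow> L B \<Longrightarrow> L (seg A B t)"
  shows "line_dense {A \<in> carrier (GL n). L A}"
  unfolding line_dense_def
proof (intro ballI)
  fix A B assume AB: "A \<in> {A \<in> carrier (GL n). L A}" "B \<in> {A \<in> carrier (GL n). L A}"
  have c: "A \<in> carrier_mat n n" "B \<in> carrier_mat n n" using AB by (auto simp: carrier_GL)
  have "finite {t. det (seg A B t) = 0}"
    by (rule finite_zeros_on_seg[OF regular_det[of n "\<lambda>A. A"] c, of 0])
      (use AB in \<open>auto simp: seg_ends[OF c] carrier_GL\<close>)
  moreover have "{t. seg A B t \<notin> {A \<in> carrier (GL n). L A}} \<subseteq> {t. det (seg A B t) = 0}"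
    using AB assms[of A B] by (auto simp: carrier_GL)
  ultimately show "finite {t. seg A B t \<notin> {A \<in> carrier (GL n). L A}}" by (rule finite_subset[rotated])
qed

section \<open>Lengths of permutations\<close>

abbreviation pinv :: "(nat \<Rightarrow> nat) \<Rightarrow> nat \<Rightarrow> nat" where
  "pinv \<equiv> inv_into UNIV"

definition inversions :: "nat \<Rightarrow> (nat \<Rightarrow> nat) \<Rightarrow> (nat \<times> nat) set" where
  "inversions n w = {(k, l). k < l \<and> l < n \<and> w l < w k}"

lemma finite_inversions [simp]: "finite (inversions n w)"
  by (rule finite_subset[of _ "{..<n} \<times> {..<n}"]) (auto simp: inversions_def)

lemma simple_refl_permutes: "i + 1 < n \<Longrightarrow> simple_refl i permutes {..<n}"
  by (intro permutes_swap_id) auto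

lemma simple_refl_invol [simp]: "w \<circ> simple_refl i \<circ> simple_refl i = w"
  "simple_refl i \<circ> (simple_refl i \<circ> w) = w"
  by (auto simp: fun_eq_iff)

text \<open>The transposition of neighbours exchanges the inversions of the two permutations, apart from
  the pair of these neighbours itself.\<close>

lemma inversions_refl:
  assumes "i + 1 < n" "w i < w (Suc i)"
  shows "card (inversions n (w \<circ> simple_refl i)) = card (inversions n w) + 1"
proof -
  let ?s = "simple_refl i"
  let ?f = "\<lambda>(k, l). (?s k, ?s l)"
  have less: "?s k < ?s l" if "k < l" "(k, l) \<noteq> (i, Suc i)" for k l
    using that by (auto simp: transpose_def)
  have bound: "?s l < n" if "l < n" for l
    using that assms(1) by (auto simp: transpose_def)
  have "inversions n (w \<circ> ?s) = insert (i, Suc i) (?f ` inversions n w)"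
  proof (intro Set.set_eqI iffI)
    fix p assume p: "p \<in> inversions n (w \<circ> ?s)"
    obtain k l where [simp]: "p = (k, l)" by force
    show "p \<in> insert (i, Suc i) (?f ` inversions n w)"
    proof (cases "(k, l) = (i, Suc i)")
      case False
      then have "(?s k, ?s l) \<in> inversions n w" using p less[of k l] bound[of l] by (auto simp: inversions_def)
      then have "?f (?s k, ?s l) \<in> ?f ` inversions n w" by (rule imageI)
      then show ?thesis by simp
    qed simp
  next
    fix p assume "p \<in> insert (i, Suc i) (?f ` inversions n w)"
    then consider "p = (i, Suc i)" | k l where "p = (?s k, ?s l)" "(k, l) \<in> inversions n w" by auto
    then show "p \<in> inversions n (w \<circ> ?s)"
    proof cases
      case 2
      then have "(k, l) \<noteq> (i, Suc i)" using assms(2) by (auto simp: inversions_def)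
      then show ?thesis using 2 less[of k l] bound[of l] by (auto simp: inversions_def)
    qed (use assms in \<open>auto simp: inversions_def\<close>)
  qed
  moreover have "(i, Suc i) \<notin> ?f ` inversions n w"
  proof
    assume "(i, Suc i) \<in> ?f ` inversions n w"
    then obtain k l where kl: "(k, l) \<in> inversions n w" "i = ?s k" "Suc i = ?s l" by auto
    then have "k = ?s i" "l = ?s (Suc i)" by (metis transpose_involutory)+
    with kl(1) show False by (simp add: inversions_def)
  qed
  moreover have "inj_on ?f (inversions n w)"
    by (rule inj_onI) (auto dest: injD[OF inj_transpose])
  ultimately show ?thesis by (simp add: card_image)
qed

lemma permutes_ne: "w permutes S \<Longrightarrow> a \<noteq> b \<Longrightarrow> w a \<noteq> w b"
  by (metis permutes_inj injD)

lemma inversions_refl':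
  assumes "i + 1 < n" "w permutes {..<n}" "\<not> w i < w (Suc i)"
  shows "card (inversions n w) = card (inversions n (w \<circ> simple_refl i)) + 1"
proof -
  have "w (Suc i) < w i" using assms(3) permutes_ne[OF assms(2), of i "Suc i"] by simp
  then show ?thesis using inversions_refl[OF assms(1), of "w \<circ> simple_refl i"] by simp
qed

lemma no_inversion_id:
  assumes "w permutes {..<n}" "\<And>i. i + 1 < n \<Longrightarrow> w i < w (Suc i)"
  shows "w = id"
proof (rule permutes_natset_ge[OF assms(1)])
  show "\<forall>i\<in>{..<n}. i \<le> w i"
  proof
    fix i assume "i \<in> {..<n}"
    then show "i \<le> w i"
    proof (induction i)
      case (Suc i)
      then show ?case using assms(2)[of i] by simp
    qed simp
  qed
qed

definition is_word :: "(nat \<Rightarrow> nat) set \<Rightarrow> nat \<Rightarrow> (nat \<Rightarrow> nat) \<Rightarrow> bool" where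
  "is_word S k w \<longleftrightarrow> (\<exists>ss. length ss = k \<and> set ss \<subseteq> S \<and> w = foldr (\<circ>) ss id)"

lemma foldr_comp_snoc: "foldr (\<circ>) (ss @ [s]) id = foldr (\<circ>) ss id \<circ> s"
proof -
  have "foldr (\<circ>) ss t = foldr (\<circ>) ss id \<circ> t" for t :: "'a \<Rightarrow> 'a"
    by (induction ss) (simp_all add: comp_assoc)
  from this[of s] show ?thesis by simp
qed

lemma is_word_0 [simp]: "is_word S 0 w \<longleftrightarrow> w = id"
  by (simp add: is_word_def)

lemma is_word_Suc: "is_word S (Suc k) w \<longleftrightarrow> (\<exists>v s. is_word S k v \<and> s \<in> S \<and> w = v \<circ> s)"
proof
  assume "is_word S (Suc k) w"
  then obtain ss where ss: "length ss = Suc k" "set ss \<subseteq> S" "w = foldr (\<circ>) ss id"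
    by (auto simp: is_word_def)
  then obtain ts s where "ss = ts @ [s]" by (metis length_Suc_conv_rev)
  with ss show "\<exists>v s. is_word S k v \<and> s \<in> S \<and> w = v \<circ> s"
    unfolding is_word_def
    by (intro exI[of _ "foldr (\<circ>) ts id"] exI[of _ s] conjI exI[of _ ts])
      (simp_all add: foldr_comp_snoc del: foldr_append)
next
  assume "\<exists>v s. is_word S k v \<and> s \<in> S \<and> w = v \<circ> s"
  then obtain ss s where "length ss = k" "set ss \<subseteq> S" "w = foldr (\<circ>) ss id \<circ> s" "s \<in> S"
    by (auto simp: is_word_def)
  then show "is_word S (Suc k) w"
    unfolding is_word_def by (intro exI[of _ "ss @ [s]"]) (simp add: foldr_comp_snoc del: foldr_append)
qed

lemma word_length_is_word: "word_length S w = (LEAST k. is_word S k w)"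
  by (simp add: word_length_def is_word_def)

text \<open>A multiplication by a simple reflection changes the number of inversions by one, so that no word
  is shorter than this number; and as long as there is an inversion, there is one between
  neighbours, which a simple reflection removes.\<close>

lemma len_eq_inversions:
  assumes "w permutes {..<n}"
  shows "len n w = card (inversions n w)"
proof -
  let ?S = "{simple_refl i | i. i + 1 < n}"
  have "is_word ?S (card (inversions n w)) w"
    using assms
  proof (induction "card (inversions n w)" arbitrary: w)
    case 0
    have "w = id"
    proof (rule no_inversion_id[OF 0(2)])
      fix i assume "i + 1 < n"
      then show "w i < w (Suc i)" using inversions_refl'[of i n w] 0 by fastforce
    qed
    with 0(1) show ?case by (metis is_word_0)
  next
    case (Suc k)
    have "\<exists>i. i + 1 < n \<and> \<not> w i < w (Suc i)"
    proof (rule ccontr)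
      assume "\<not> ?thesis"
      then have "w = id" by (intro no_inversion_id[OF Suc(3)]) blast
      then have "inversions n w = {}" by (auto simp: inversions_def)
      with Suc(2) show False by simp
    qed
    then obtain i where i: "i + 1 < n" "\<not> w i < w (Suc i)" by blast
    let ?v = "w \<circ> simple_refl i"
    have "card (inversions n ?v) = k" using inversions_refl'[OF i(1) Suc(3) i(2)] Suc(2) by simp
    moreover have "?v permutes {..<n}" by (rule permutes_compose[OF simple_refl_permutes[OF i(1)] Suc(3)])
    ultimately have "is_word ?S k ?v" using Suc(1)[of ?v] by simp
    moreover have "w = ?v \<circ> simple_refl i" by simp
    ultimately show ?case unfolding Suc(2)[symmetric] is_word_Suc using i(1) by blast
  qed
  moreover have "card (inversions n w) \<le> k" if "is_word ?S k w" for k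
    using that
  proof (induction k arbitrary: w)
    case 0
    then have "inversions n w = {}" by (auto simp: inversions_def)
    then show ?case by simp
  next
    case (Suc k)
    then obtain v i where v: "is_word ?S k v" "i + 1 < n" "w = v \<circ> simple_refl i"
      by (auto simp: is_word_Suc)
    have "v permutes {..<n}"
      using v(1)
    proof (induction k arbitrary: v)
      case (Suc k)
      then show ?case
        unfolding is_word_Suc by (auto intro!: permutes_compose simple_refl_permutes)
    qed (simp add: permutes_id[unfolded id_def] id_def)
    then have "card (inversions n w) \<le> card (inversions n v) + 1"
      using inversions_refl[OF v(2), of v] inversions_refl'[OF v(2), of v] v(3) by fastforce
    with Suc.IH[OF v(1)] show ?case by simp
  qed
  ultimately show ?thesis unfolding len_def word_length_is_word by (intro Least_equality)
qed

lemma len_less_right: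
  assumes "w permutes {..<n}" "i + 1 < n"
  shows "len n w < len n (w \<circ> simple_refl i) \<longleftrightarrow> w i < w (Suc i)"
proof -
  have "w \<circ> simple_refl i permutes {..<n}"
    by (rule permutes_compose[OF simple_refl_permutes[OF assms(2)] assms(1)])
  then have "len n (w \<circ> simple_refl i) = card (inversions n (w \<circ> simple_refl i))"
    by (rule len_eq_inversions)
  then show ?thesis
    using inversions_refl[OF assms(2), of w] inversions_refl'[OF assms(2,1)]
    by (cases "w i < w (Suc i)") (simp_all add: len_eq_inversions[OF assms(1)])
qed

lemma len_inv:
  assumes "w permutes {..<n}"
  shows "len n (pinv w) = len n w"
proof -
  have "bij_betw (\<lambda>(k, l). (w l, w k)) (inversions n w) (inversions n (pinv w))"
  proof (rule bij_betwI[where g = "\<lambda>(k, l). (pinv w l, pinv w k)"])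
    show "(\<lambda>(k, l). (w l, w k)) \<in> inversions n w \<rightarrow> inversions n (pinv w)"
      using permutes_inverses[OF assms] permutes_in_image[OF assms]
      by (auto simp: inversions_def)
    show "(\<lambda>(k, l). (pinv w l, pinv w k)) \<in> inversions n (pinv w) \<rightarrow> inversions n w"
      using permutes_inverses[OF assms] permutes_in_image[OF permutes_inv[OF assms]]
      by (auto simp: inversions_def)
  qed (use permutes_inverses[OF assms] in auto)
  then show ?thesis
    using len_eq_inversions[OF assms] len_eq_inversions[OF permutes_inv[OF assms]]
    by (simp add: bij_betw_same_card)
qed

lemma len_less_left:
  assumes "w permutes {..<n}" "i + 1 < n"
  shows "len n w < len n (simple_refl i \<circ> w) \<longleftrightarrow> pinv w i < pinv w (Suc i)"
proof -
  have s: "simple_refl i permutes {..<n}" by (rule simple_refl_permutes[OF assms(2)])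
  have "pinv (simple_refl i \<circ> w) = pinv w \<circ> simple_refl i"
    using o_inv_distrib[OF permutes_bij[OF s] permutes_bij[OF assms(1)]] by simp
  then have "len n (simple_refl i \<circ> w) = len n (pinv w \<circ> simple_refl i)"
    using len_inv[OF permutes_compose[OF assms(1) s]] by simp
  then show ?thesis
    using len_less_right[OF permutes_inv[OF assms(1)] assms(2)] len_inv[OF assms(1)] by simp
qed

section \<open>The cyclic permutation that carries one Coxeter system to the other\<close>

lemma sigma_permutes: "sigma n permutes {..<n}"
proof (rule bij_imp_permutes)
  show "bij_betw (sigma n) {..<n} {..<n}"
    by (rule bij_betwI[where g = "\<lambda>i. if i = n - 1 then 0 else i + 1"]) (auto simp: sigma_def)
qed (simp add: sigma_def)

lemma conj_transpose:
  assumes "bij f"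
  shows "f \<circ> Transposition.transpose a b \<circ> pinv f = Transposition.transpose (f a) (f b)"
proof
  fix x
  obtain y where [simp]: "x = f y" using assms by (metis bij_pointE)
  show "(f \<circ> Transposition.transpose a b \<circ> pinv f) x = Transposition.transpose (f a) (f b) x"
    using assms by (auto simp: transpose_def bij_is_inj inv_f_f dest: injD[OF bij_is_inj])
qed

text \<open>Conjugation carries words in \<open>S\<close> to words in the conjugate of \<open>S\<close>. With the cycle as the conjugating
  element this compares the two length functions.\<close>

lemma is_word_conj:
  assumes "bij f"
  shows "is_word ((\<lambda>s. f \<circ> s \<circ> pinv f) ` S) k (f \<circ> w \<circ> pinv f) \<longleftrightarrow> is_word S k w"
proof (induction k arbitrary: w)
  case 0
  have "f \<circ> w \<circ> pinv f = id \<longleftrightarrow> w = id"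
    using assms by (auto simp: fun_eq_iff bij_is_inj bij_is_surj surj_f_inv_f)
      (metis bij_inv_eq_iff)
  then show ?case unfolding is_word_0 .
next
  case (Suc k)
  have *: "f \<circ> (v \<circ> s) \<circ> pinv f = (f \<circ> v \<circ> pinv f) \<circ> (f \<circ> s \<circ> pinv f)" for v s
    using assms by (auto simp: fun_eq_iff bij_is_inj)
  have **: "f \<circ> (pinv f \<circ> v \<circ> f) \<circ> pinv f = v" for v
    using assms by (auto simp: fun_eq_iff bij_is_surj surj_f_inv_f)
  have inj: "v = w" if "f \<circ> v \<circ> pinv f = f \<circ> w \<circ> pinv f" for v w
  proof
    fix x
    have "(f \<circ> v \<circ> pinv f) (f x) = (f \<circ> w \<circ> pinv f) (f x)" using that by simp
    then show "v x = w x" using assms by (simp add: bij_is_inj inj_eq)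
  qed
  show ?case
  proof
    assume "is_word ((\<lambda>s. f \<circ> s \<circ> pinv f) ` S) (Suc k) (f \<circ> w \<circ> pinv f)"
    then obtain v s where v: "is_word ((\<lambda>s. f \<circ> s \<circ> pinv f) ` S) k v" "s \<in> S"
      "f \<circ> w \<circ> pinv f = v \<circ> (f \<circ> s \<circ> pinv f)" by (auto simp: is_word_Suc)
    define v' where "v' = pinv f \<circ> v \<circ> f"
    have v': "v = f \<circ> v' \<circ> pinv f" using **[of v] by (simp add: v'_def)
    have "is_word S k v'" using v(1) Suc.IH[of v'] v' by simp
    moreover have "w = v' \<circ> s" by (rule inj) (use v(3) v' * in simp)
    ultimately show "is_word S (Suc k) w" using v(2) by (auto simp: is_word_Suc)
  next
    assume "is_word S (Suc k) w"
    then obtain v s where "is_word S k v" "s \<in> S" "w = v \<circ> s" by (auto simp: is_word_Suc)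
    then show "is_word ((\<lambda>s. f \<circ> s \<circ> pinv f) ` S) (Suc k) (f \<circ> w \<circ> pinv f)"
      unfolding is_word_Suc using Suc.IH[of v] * by blast
  qed
qed

lemma star_refl_transpose: "star_refl n i = Transposition.transpose (sigma n i) (sigma n (Suc i))"
  unfolding star_refl_def by (rule conj_transpose[OF permutes_bij[OF sigma_permutes]])

lemma star_refl_Suc: "i + 2 < n \<Longrightarrow> star_refl n (Suc i) = simple_refl i"
  by (simp add: star_refl_transpose sigma_def)

lemma len_star_conj:
  assumes "n \<ge> 2"
  shows "len_star n (sigma n \<circ> w \<circ> pinv (sigma n)) = len n w"
proof -
  have "insert (Transposition.transpose 0 (n - 1)) {simple_refl i | i. i + 2 < n} = star_refl n ` {i. i + 1 < n}"
  proof -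
    have "{i. i + 1 < n} = insert 0 (Suc ` {i. i + 2 < n})"
      using assms by (auto simp: image_iff) presburger
    then have "star_refl n ` {i. i + 1 < n} = insert (star_refl n 0) (star_refl n ` Suc ` {i. i + 2 < n})"
      by simp
    also have "star_refl n 0 = Transposition.transpose 0 (n - 1)"
      using assms by (simp add: star_refl_transpose sigma_def transpose_commute)
    also have "star_refl n ` Suc ` {i. i + 2 < n} = simple_refl ` {i. i + 2 < n}"
      unfolding image_image by (rule image_cong) (simp_all add: star_refl_Suc)
    finally show ?thesis by (simp add: image_Collect)
  qed
  also have "\<dots> = (\<lambda>s. sigma n \<circ> s \<circ> pinv (sigma n)) ` {simple_refl i | i. i + 1 < n}"
    by (auto simp: star_refl_def)
  finally show ?thesis
    unfolding len_def len_star_def word_length_is_word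
    by (simp add: is_word_conj[OF permutes_bij[OF sigma_permutes]])
qed

section \<open>Permutation matrices, triangular matrices and parabolic subgroups\<close>

lemma GL_I:
  assumes "A \<in> carrier_mat n n" "B \<in> carrier_mat n n" "A * B = 1\<^sub>m n"
  shows "A \<in> carrier (GL n)"
proof -
  have "det A * det B = 1" using det_mult[OF assms(1,2)] assms(3) by simp
  then show ?thesis using assms(1) by (auto simp: carrier_GL)
qed

lemma minv_unique:
  assumes "A \<in> carrier (GL n)" "B \<in> carrier_mat n n" "A * B = 1\<^sub>m n"
  shows "minv n A = B"
proof -
  have "minv n A * (A * B) = B" by (rule mmult_cancel(2)[OF assms(1,2)])
  then show ?thesis using assms(3) GL_D[OF GL_inv(1)[OF assms(1)]] by simp
qed

lemma perm_mat_carrier [simp]: "perm_mat n w \<in> carrier_mat n n"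
  by (simp add: perm_mat_def)

lemma perm_mat_entry: "i < n \<Longrightarrow> j < n \<Longrightarrow> perm_mat n w $$ (i, j) = (if i = w j then 1 else 0)"
  by (simp add: perm_mat_def)

lemma mult_perm_entry:
  assumes "A \<in> carrier_mat n n" "w permutes {..<n}" "i < n" "j < n"
  shows "(A * perm_mat n w) $$ (i, j) = A $$ (i, w j)"
proof -
  have "w j < n" using permutes_in_image[OF assms(2)] assms(4) by blast
  then show ?thesis using assms
    by (subst mmult_entry[of _ n]) (simp_all add: perm_mat_entry if_distrib cong: if_cong)
qed

lemma perm_mult_entry:
  assumes "A \<in> carrier_mat n n" "w permutes {..<n}" "i < n" "j < n"
  shows "(perm_mat n w * A) $$ (w i, j) = A $$ (i, j)"
proof -
  have "w i < n" using permutes_in_image[OF assms(2)] assms(3) by blast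
  then have "(perm_mat n w * A) $$ (w i, j) = (\<Sum>k<n. (if w i = w k then 1 else 0) * A $$ (k, j))"
    using assms by (subst mmult_entry[of _ n]) (simp_all add: perm_mat_entry)
  also have "\<dots> = (\<Sum>k<n. (if i = k then A $$ (k, j) else 0))"
    by (rule sum.cong) (use permutes_inj[OF assms(2)] in \<open>auto simp: inj_eq\<close>)
  finally show ?thesis using assms(3) by simp
qed

lemma perm_mult_entry':
  assumes "A \<in> carrier_mat n n" "w permutes {..<n}" "i < n" "j < n"
  shows "(perm_mat n w * A) $$ (i, j) = A $$ (pinv w i, j)"
proof -
  have "pinv w i < n" using permutes_in_image[OF permutes_inv[OF assms(2)]] assms(3) by blast
  from perm_mult_entry[OF assms(1,2) this assms(4)] show ?thesis
    by (simp add: permutes_inverses[OF assms(2)])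
qed

lemma perm_mat_comp:
  assumes "w permutes {..<n}" "w' permutes {..<n}"
  shows "perm_mat n w * perm_mat n w' = perm_mat n (w \<circ> w')"
proof (rule eq_matI)
  fix i j assume "i < dim_row (perm_mat n (w \<circ> w'))" "j < dim_col (perm_mat n (w \<circ> w'))"
  then have ij: "i < n" "j < n" by (simp_all add: perm_mat_def)
  have "w' j < n" using permutes_in_image[OF assms(2)] ij by blast
  then show "(perm_mat n w * perm_mat n w') $$ (i, j) = perm_mat n (w \<circ> w') $$ (i, j)"
    using ij assms by (subst mult_perm_entry) (simp_all add: perm_mat_entry)
qed (simp_all add: perm_mat_def)

lemma perm_mat_id: "perm_mat n id = 1\<^sub>m n"
  by (rule eq_matI) (auto simp: perm_mat_def)

lemma perm_mat_inv:
  assumes "w permutes {..<n}"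
  shows "perm_mat n w \<in> carrier (GL n)" "minv n (perm_mat n w) = perm_mat n (pinv w)"
proof -
  have *: "perm_mat n w * perm_mat n (pinv w) = 1\<^sub>m n"
    by (simp add: perm_mat_comp[OF assms permutes_inv[OF assms]] permutes_inv_o[OF assms] perm_mat_id)
  show "perm_mat n w \<in> carrier (GL n)" by (rule GL_I[OF _ _ *]) simp_all
  from minv_unique[OF this _ *] show "minv n (perm_mat n w) = perm_mat n (pinv w)" by simp
qed

definition UT :: "nat \<Rightarrow> complex mat set" where
  "UT n = {g \<in> carrier (GL n). \<forall>k l. l < k \<longrightarrow> k < n \<longrightarrow> g $$ (k, l) = 0}"

text \<open>The parabolic subgroup of block upper triangular matrices with one diagonal block of
  size 2, in rows \<open>i\<close> and \<open>i + 1\<close>.\<close>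

definition parab :: "nat \<Rightarrow> nat \<Rightarrow> complex mat set" where
  "parab n i = {g \<in> carrier (GL n). \<forall>k l. l < k \<longrightarrow> k < n \<longrightarrow> (k, l) \<noteq> (Suc i, i) \<longrightarrow> g $$ (k, l) = 0}"

lemma UT_GL: "g \<in> UT n \<Longrightarrow> g \<in> carrier (GL n)" and parab_GL: "g \<in> parab n i \<Longrightarrow> g \<in> carrier (GL n)"
  by (simp_all add: UT_def parab_def)

lemma UT_D: "g \<in> UT n \<Longrightarrow> g \<in> carrier_mat n n" and parab_D: "g \<in> parab n i \<Longrightarrow> g \<in> carrier_mat n n"
  by (simp_all add: UT_def parab_def GL_D)

lemma UT_zero: "g \<in> UT n \<Longrightarrow> l < k \<Longrightarrow> k < n \<Longrightarrow> g $$ (k, l) = 0"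
  by (simp add: UT_def)

lemma parab_zero: "g \<in> parab n i \<Longrightarrow> l < k \<Longrightarrow> k < n \<Longrightarrow> (k, l) \<noteq> (Suc i, i) \<Longrightarrow> g $$ (k, l) = 0"
  by (auto simp: parab_def)

lemma UT_parab: "UT n \<subseteq> parab n i"
  by (auto simp: UT_def parab_def)

lemma UT_iff_parab: "i + 1 < n \<Longrightarrow> g \<in> UT n \<longleftrightarrow> g \<in> parab n i \<and> g $$ (Suc i, i) = 0"
  by (auto simp: UT_def parab_def)

lemma triangular_det:
  assumes "A \<in> carrier_mat n n" "\<And>k l. l < k \<Longrightarrow> k < n \<Longrightarrow> A $$ (k, l) = (0 :: complex)"
  shows "det A \<noteq> 0 \<longleftrightarrow> (\<forall>k<n. A $$ (k, k) \<noteq> 0)"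
proof -
  have "upper_triangular A" using assms by auto
  then have "det A = prod_list (diag_mat A)" by (rule det_upper_triangular[OF _ assms(1)])
  then show ?thesis using assms(1) by (auto simp: prod_list_zero_iff diag_mat_def)
qed

lemma UT_diag: "g \<in> UT n \<Longrightarrow> k < n \<Longrightarrow> g $$ (k, k) \<noteq> 0"
  using triangular_det[of g n] by (auto simp: UT_def carrier_GL)

lemma UT_I:
  assumes "A \<in> carrier_mat n n" "\<And>k l. l < k \<Longrightarrow> k < n \<Longrightarrow> A $$ (k, l) = (0 :: complex)"
    "\<And>k. k < n \<Longrightarrow> A $$ (k, k) \<noteq> 0"
  shows "A \<in> UT n"
  using triangular_det[OF assms(1,2)] assms by (auto simp: UT_def carrier_GL)

lemma UT_one [simp]: "1\<^sub>m n \<in> UT n"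
  by (rule UT_I) auto

lemma UT_mult:
  assumes "g \<in> UT n" "h \<in> UT n"
  shows "g * h \<in> UT n"
proof -
  have "(g * h) $$ (k, l) = 0" if "l < k" "k < n" for k l
  proof -
    have "g $$ (k, m) * h $$ (m, l) = 0" if "m < n" for m
      using UT_zero[OF assms(1), of m k] UT_zero[OF assms(2), of l m] \<open>l < k\<close> \<open>k < n\<close> that
      by (cases "m < k") auto
    then show ?thesis using that UT_D[OF assms(1)] UT_D[OF assms(2)]
      by (subst mmult_entry[of _ n]) (auto intro!: sum.neutral)
  qed
  then show ?thesis using GL_mult[OF UT_GL[OF assms(1)] UT_GL[OF assms(2)]] by (simp add: UT_def)
qed

lemma UT_inv:
  assumes "g \<in> UT n"
  shows "minv n g \<in> UT n"
proof -
  let ?h = "minv n g"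
  have G: "g \<in> carrier (GL n)" by (rule UT_GL[OF assms])
  have h: "?h \<in> carrier_mat n n" using GL_inv(1)[OF G] by (rule GL_D)
  have "?h $$ (k, l) = 0" if "l < k" "k < n" for k l
    using that
  proof (induction "n - k" arbitrary: k rule: less_induct)
    case less
    have "0 = (g * ?h) $$ (k, l)" using GL_inv(2)[OF G] less(2,3) by simp
    also have "\<dots> = (\<Sum>m<n. g $$ (k, m) * ?h $$ (m, l))"
      using UT_D[OF assms] h less(2,3) by (intro mmult_entry) auto
    also have "\<dots> = (\<Sum>m<n. if m = k then g $$ (k, k) * ?h $$ (k, l) else 0)"
    proof (rule sum.cong)
      fix m assume "m \<in> {..<n}"
      then show "g $$ (k, m) * ?h $$ (m, l) = (if m = k then g $$ (k, k) * ?h $$ (k, l) else 0)"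
        using less(1)[of m] less(2,3) UT_zero[OF assms, of m k] by (cases m k rule: linorder_cases) auto
    qed simp
    also have "\<dots> = g $$ (k, k) * ?h $$ (k, l)" using less(3) by simp
    finally show ?case using UT_diag[OF assms less(3)] by simp
  qed
  then show ?thesis using GL_inv(1)[OF G] by (simp add: UT_def)
qed

lemma parab_mult:
  assumes "g \<in> parab n i" "h \<in> parab n i"
  shows "g * h \<in> parab n i"
proof -
  have "(g * h) $$ (k, l) = 0" if "l < k" "k < n" "(k, l) \<noteq> (Suc i, i)" for k l
  proof -
    have "g $$ (k, m) * h $$ (m, l) = 0" if "m < n" for m
      using parab_zero[OF assms(1), of m k] parab_zero[OF assms(2), of l m]
        \<open>l < k\<close> \<open>k < n\<close> \<open>(k, l) \<noteq> (Suc i, i)\<close> that by (cases "m < k"; cases "l < m") auto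
    then show ?thesis using that parab_D[OF assms(1)] parab_D[OF assms(2)]
      by (subst mmult_entry[of _ n]) (auto intro!: sum.neutral)
  qed
  then show ?thesis using GL_mult[OF parab_GL[OF assms(1)] parab_GL[OF assms(2)]] by (auto simp: parab_def)
qed

lemma parab_mult_entry:
  assumes "g \<in> parab n i" "h \<in> parab n i" "i + 1 < n" "k \<in> {i, Suc i}" "l \<in> {i, Suc i}"
  shows "(g * h) $$ (k, l) = g $$ (k, i) * h $$ (i, l) + g $$ (k, Suc i) * h $$ (Suc i, l)"
proof -
  have "(g * h) $$ (k, l) = (\<Sum>m<n. g $$ (k, m) * h $$ (m, l))"
    using assms parab_D by (intro mmult_entry) auto
  also have "\<dots> = (\<Sum>m\<in>{i, Suc i}. g $$ (k, m) * h $$ (m, l))"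
  proof (rule sum.mono_neutral_right)
    show "\<forall>m\<in>{..<n} - {i, Suc i}. g $$ (k, m) * h $$ (m, l) = 0"
    proof
      fix m assume m: "m \<in> {..<n} - {i, Suc i}"
      show "g $$ (k, m) * h $$ (m, l) = 0"
        using parab_zero[OF assms(1), of m k] parab_zero[OF assms(2), of l m] assms(3-5) m
        by (cases "m < i") auto
    qed
  qed (use assms(3) in auto)
  finally show ?thesis by simp
qed

definition elementary :: "nat \<Rightarrow> nat \<Rightarrow> nat \<Rightarrow> complex \<Rightarrow> complex mat" where
  "elementary n a b t = mat n n (\<lambda>(k, l). (if k = l then 1 else 0) + (if k = a \<and> l = b then t else 0))"

lemma elementary_carrier [simp]: "elementary n a b t \<in> carrier_mat n n"
  by (simp add: elementary_def)

lemma elementary_entry: "k < n \<Longrightarrow> l < n \<Longrightarrow>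
    elementary n a b t $$ (k, l) = (if k = l then 1 else 0) + (if k = a \<and> l = b then t else 0)"
  by (simp add: elementary_def)

lemma elementary_mult_entry:
  assumes "A \<in> carrier_mat n n" "k < n" "l < n" "b < n"
  shows "(elementary n a b t * A) $$ (k, l) = A $$ (k, l) + (if k = a then t * A $$ (b, l) else 0)"
proof -
  have "(elementary n a b t * A) $$ (k, l) = (\<Sum>m<n. elementary n a b t $$ (k, m) * A $$ (m, l))"
    using assms by (intro mmult_entry) simp_all
  also have "\<dots> =
      (\<Sum>m<n. (if m = k then A $$ (m, l) else 0) + (if m = b then (if k = a then t * A $$ (m, l) else 0) else 0))"
    by (rule sum.cong) (use assms(2) in \<open>auto simp: elementary_entry algebra_simps\<close>)
  finally have "(elementary n a b t * A) $$ (k, l) =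
      (\<Sum>m<n. (if m = k then A $$ (m, l) else 0) + (if m = b then (if k = a then t * A $$ (m, l) else 0) else 0))" .
  then show ?thesis using assms(2,4) by (simp add: sum.distrib)
qed

lemma elementary_UT: "a < b \<Longrightarrow> b < n \<Longrightarrow> elementary n a b t \<in> UT n"
  by (rule UT_I) (auto simp: elementary_entry)

lemma elementary_inverse:
  assumes "a \<noteq> b" "a < n" "b < n"
  shows "elementary n a b t * elementary n a b (- t) = 1\<^sub>m n"
proof (rule eq_matI)
  fix k l assume "k < dim_row (1\<^sub>m n :: complex mat)" "l < dim_col (1\<^sub>m n :: complex mat)"
  then have kl: "k < n" "l < n" by simp_all
  show "(elementary n a b t * elementary n a b (- t)) $$ (k, l) = 1\<^sub>m n $$ (k, l)"
    using elementary_mult_entry[OF elementary_carrier kl assms(3), of a t a b "- t"] kl assms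
    by (auto simp: elementary_entry)
qed (simp_all add: elementary_def)

abbreviation smat :: "nat \<Rightarrow> nat \<Rightarrow> complex mat" where
  "smat n i \<equiv> perm_mat n (simple_refl i)"

lemma smat_sq: "i + 1 < n \<Longrightarrow> smat n i * smat n i = 1\<^sub>m n"
  using perm_mat_id by (simp add: perm_mat_comp simple_refl_permutes)

lemma smat_parab: "i + 1 < n \<Longrightarrow> smat n i \<in> parab n i"
  using perm_mat_inv(1)[OF simple_refl_permutes[of i n]]
  by (auto simp: parab_def perm_mat_entry transpose_def)

text \<open>The Bruhat decomposition of the block of size 2.\<close>

lemma parab_decomp:
  assumes "g \<in> parab n i" "i + 1 < n" "g $$ (Suc i, i) \<noteq> 0"
  defines "t \<equiv> g $$ (i, i) / g $$ (Suc i, i)"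
  defines "c \<equiv> smat n i * (elementary n i (Suc i) (- t) * g)"
  shows "c \<in> UT n" "g = elementary n i (Suc i) t * (smat n i * c)"
proof -
  have g: "g \<in> carrier_mat n n" using assms(1) by (rule parab_D)
  have s: "simple_refl i permutes {..<n}" by (rule simple_refl_permutes[OF assms(2)])
  let ?e = "elementary n i (Suc i) (- t)" and ?e' = "elementary n i (Suc i) t"
  have e: "?e \<in> UT n" "?e' \<in> UT n" using assms(2) by (auto intro: elementary_UT)
  have eg: "?e * g \<in> carrier_mat n n" using g by simp
  have c: "c \<in> carrier (GL n)" unfolding c_def
    by (intro GL_mult perm_mat_inv(1)[OF s] UT_GL[OF e(1)] parab_GL[OF assms(1)])
  have "c $$ (k, l) = 0" if "l < k" "k < n" for k l
  proof -
    have "c $$ (k, l) = (?e * g) $$ (simple_refl i k, l)"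
      unfolding c_def using perm_mult_entry'[OF eg s, of k l] that by simp
    also have "\<dots> = g $$ (simple_refl i k, l) + (if simple_refl i k = i then - t * g $$ (Suc i, l) else 0)"
      using that assms(2) by (intro elementary_mult_entry g) (auto simp: transpose_def)
    also have "\<dots> = 0"
      using parab_zero[OF assms(1), of l "simple_refl i k"] parab_zero[OF assms(1), of l "Suc i"] that assms(2,3)
      by (cases "l = i") (auto simp: transpose_def t_def split: if_splits)
    finally show ?thesis .
  qed
  with c show "c \<in> UT n" by (simp add: UT_def)
  have "smat n i * c = ?e * g"
    unfolding c_def mmult_assoc[OF perm_mat_carrier perm_mat_carrier eg, symmetric] smat_sq[OF assms(2)]
    using eg by simp
  then show "g = ?e' * (smat n i * c)"
    using g elementary_inverse[of i "Suc i" n t] assms(2) by (simp add: mmult_assoc[symmetric, of _ n])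
qed

lemma parab_inv:
  assumes "g \<in> parab n i" "i + 1 < n"
  shows "minv n g \<in> parab n i"
proof (cases "g $$ (Suc i, i) = 0")
  case True
  then have "g \<in> UT n" using assms UT_iff_parab by blast
  then show ?thesis using UT_inv UT_parab by blast
next
  case False
  note d = parab_decomp[OF assms False]
  let ?e = "elementary n i (Suc i) (g $$ (i, i) / g $$ (Suc i, i))"
  let ?c = "smat n i * (elementary n i (Suc i) (- (g $$ (i, i) / g $$ (Suc i, i))) * g)"
  have e: "?e \<in> UT n" using assms(2) by (auto intro: elementary_UT)
  have s: "smat n i \<in> carrier (GL n)" by (rule parab_GL[OF smat_parab[OF assms(2)]])
  have s': "minv n (smat n i) = smat n i" by (rule minv_unique[OF s perm_mat_carrier smat_sq[OF assms(2)]])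
  have "minv n (?e * (smat n i * ?c)) = (minv n ?c * smat n i) * minv n ?e"
    using GLn.inv_mult_group[OF UT_GL[OF e], of "smat n i * ?c"] GLn.inv_mult_group[OF s UT_GL[OF d(1)]]
      GL_mult[OF s UT_GL[OF d(1)]] s' by simp
  also have "\<dots> \<in> parab n i"
    by (intro parab_mult smat_parab assms(2) subsetD[OF UT_parab] UT_inv d(1) e)
  finally show ?thesis using d(2) by simp
qed

section \<open>Bruhat decomposition\<close>

definition in_cell :: "nat \<Rightarrow> (nat \<Rightarrow> nat) \<Rightarrow> complex mat \<Rightarrow> bool" where
  "in_cell n w v \<longleftrightarrow> w permutes {..<n} \<and> (\<exists>b \<in> UT n. \<exists>c \<in> UT n. v = b * perm_mat n w * c)"

lemma in_cellI: "w permutes {..<n} \<Longrightarrow> b \<in> UT n \<Longrightarrow> c \<in> UT n \<Longrightarrow> in_cell n w (b * perm_mat n w * c)"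
  by (auto simp: in_cell_def)

lemma in_cell_mult:
  assumes "in_cell n w v" "b \<in> UT n" "c \<in> UT n"
  shows "in_cell n w (b * v * c)"
proof -
  obtain b' c' where v: "w permutes {..<n}" "b' \<in> UT n" "c' \<in> UT n" "v = b' * perm_mat n w * c'"
    using assms(1) by (auto simp: in_cell_def)
  have "b * v * c = (b * b') * perm_mat n w * (c' * c)"
    unfolding v(4) using assms(2,3)[THEN UT_D] v(2,3)[THEN UT_D] by (simp add: mmult_assoc[of _ n])
  then show ?thesis using in_cellI[OF v(1) UT_mult[OF assms(2) v(2)] UT_mult[OF v(3) assms(3)]] by simp
qed

lemma in_cell_unique:
  assumes "in_cell n w v" "in_cell n w' v"
  shows "w = w'"
proof -
  obtain b c where v: "w permutes {..<n}" "b \<in> UT n" "c \<in> UT n" "v = b * perm_mat n w * c"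
    using assms(1) by (auto simp: in_cell_def)
  obtain b' c' where v': "w' permutes {..<n}" "b' \<in> UT n" "c' \<in> UT n" "v = b' * perm_mat n w' * c'"
    using assms(2) by (auto simp: in_cell_def)
  let ?b = "minv n b' * b" and ?c = "c' * minv n c"
  have bc: "?b \<in> UT n" "?c \<in> UT n" by (intro UT_mult UT_inv v v')+
  note D = v(2,3)[THEN UT_D] v'(2,3)[THEN UT_D] UT_inv[OF v'(2), THEN UT_D] UT_inv[OF v(3), THEN UT_D]
  have "?b * perm_mat n w = perm_mat n w' * ?c"
  proof -
    have "?b * perm_mat n w = minv n b' * (b * perm_mat n w * c) * minv n c"
      using D by (simp add: mmult_assoc[of _ n] mmult_cancel GL_inv(2)[OF UT_GL[OF v(3)]])
    also have "\<dots> = minv n b' * (b' * perm_mat n w' * c') * minv n c" using v(4) v'(4) by simp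
    also have "\<dots> = perm_mat n w' * ?c"
      using D by (simp add: mmult_assoc[of _ n] mmult_cancel(2)[OF UT_GL[OF v'(2)]])
    finally show ?thesis .
  qed
  moreover have "pinv w' (w j) \<le> j" if "j < n" for j
  proof (rule ccontr)
    assume gt: "\<not> pinv w' (w j) \<le> j"
    have wj: "w j < n" using permutes_in_image[OF v(1)] that by blast
    have "(?b * perm_mat n w) $$ (w j, j) = ?b $$ (w j, w j)"
      using UT_D[OF bc(1)] v(1) wj that by (intro mult_perm_entry)
    then have "(perm_mat n w' * ?c) $$ (w j, j) \<noteq> 0"
      using calculation UT_diag[OF bc(1) wj] by simp
    moreover have "(perm_mat n w' * ?c) $$ (w j, j) = ?c $$ (pinv w' (w j), j)"
      using UT_D[OF bc(2)] v'(1) wj that by (intro perm_mult_entry')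
    moreover have "pinv w' (w j) < n" using permutes_in_image[OF permutes_inv[OF v'(1)]] wj by blast
    ultimately show False using UT_zero[OF bc(2)] gt by simp
  qed
  then have "pinv w' \<circ> w = id"
    by (intro permutes_natset_le[OF permutes_compose[OF v(1) permutes_inv[OF v'(1)]]]) simp
  then show "w = w'" using permutes_inv_o(1)[OF v'(1)] by (metis comp_assoc comp_id id_comp)
qed

text \<open>Gaussian elimination: choose, in each coset \<open>g e\<^sub>k + span {g e\<^sub>j | j < k}\<close>, a vector whose
  last nonzero coordinate comes as early as possible. The positions of these coordinates are
  distinct, and they form the permutation.\<close>

lemma in_cell_exists:
  assumes g: "g \<in> carrier (GL n)"
  shows "\<exists>w. in_cell n w g"
proof -
  define lead :: "complex vec \<Rightarrow> nat \<Rightarrow> bool" where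
    "lead y m \<longleftrightarrow> m < n \<and> y $ m \<noteq> 0 \<and> (\<forall>r. m < r \<longrightarrow> r < n \<longrightarrow> y $ r = 0)" for y m
  define X where "X k = {x \<in> carrier_vec n. x $ k = 1 \<and> (\<forall>j. k < j \<longrightarrow> j < n \<longrightarrow> x $ j = (0::complex))}" for k
  have gc: "g \<in> carrier_mat n n" using g by (rule GL_D)
  have lead_ex: "\<exists>m. lead (g *\<^sub>v x) m" if x: "x \<in> X k" "k < n" for x k
  proof -
    have "\<not> (\<forall>m<n. (g *\<^sub>v x) $ m = 0)"
    proof
      assume "\<forall>m<n. (g *\<^sub>v x) $ m = 0"
      then have "g *\<^sub>v x = 0\<^sub>v n" using gc by (intro eq_vecI) auto
      moreover have "x \<noteq> 0\<^sub>v n" using x by (auto simp: X_def)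
      moreover have "x \<in> carrier_vec n" using x by (simp add: X_def)
      ultimately have "det g = 0" using det_0_iff_vec_prod_zero[OF gc] by blast
      then show False using g by (simp add: carrier_GL)
    qed
    then have ne: "{m. m < n \<and> (g *\<^sub>v x) $ m \<noteq> 0} \<noteq> {}" (is "?M \<noteq> {}") by blast
    have fin: "finite ?M" by simp
    have "Max ?M \<in> ?M" using fin ne by (rule Max_in)
    moreover have "r \<le> Max ?M" if "r \<in> ?M" for r using fin that by (rule Max_ge)
    ultimately have "lead (g *\<^sub>v x) (Max ?M)" unfolding lead_def using not_less by blast
    then show ?thesis by blast
  qed
  define L where "L k m \<longleftrightarrow> (\<exists>x \<in> X k. lead (g *\<^sub>v x) m)" for k m
  define w where "w k = (LEAST m. L k m)" for k
  have Lw: "L k (w k)" if "k < n" for k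
  proof -
    have "unit_vec n k \<in> X k" using that by (auto simp: X_def)
    then have "\<exists>m. L k m" using lead_ex that unfolding L_def by blast
    then show ?thesis unfolding w_def by (rule LeastI_ex)
  qed
  then have "\<forall>k. \<exists>x. k < n \<longrightarrow> x \<in> X k \<and> lead (g *\<^sub>v x) (w k)" unfolding L_def by blast
  then obtain x where x: "\<And>k. k < n \<Longrightarrow> x k \<in> X k" "\<And>k. k < n \<Longrightarrow> lead (g *\<^sub>v x k) (w k)" by metis
  have xc: "x k \<in> carrier_vec n" if "k < n" for k using x(1)[OF that] by (simp add: X_def)
  have wn: "w k < n" if "k < n" for k using x(2)[OF that] by (simp add: lead_def)
  have inj: "w k \<noteq> w k'" if kk: "k < k'" "k' < n" for k k'
  proof
    assume eq: "w k = w k'"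
    have kn: "k < n" using kk by simp
    let ?m = "w k" and ?y = "g *\<^sub>v x k" and ?y' = "g *\<^sub>v x k'"
    let ?t = "?y' $ ?m / ?y $ ?m"
    let ?z = "x k' - ?t \<cdot>\<^sub>v x k"
    have z: "?z \<in> X k'" using x(1)[OF kn] x(1)[OF kk(2)] kk by (auto simp: X_def)
    have gz: "g *\<^sub>v ?z = ?y' - ?t \<cdot>\<^sub>v ?y"
      using gc xc[OF kn] xc[OF kk(2)] by (simp add: mult_minus_distrib_mat_vec[of _ n n] mult_mat_vec[of _ n n])
    obtain m where m: "lead (g *\<^sub>v ?z) m" using lead_ex[OF z kk(2)] by blast
    have "(g *\<^sub>v ?z) $ r = 0" if "?m \<le> r" "r < n" for r
      using that x(2)[OF kn] x(2)[OF kk(2)] eq gc xc[OF kn] xc[OF kk(2)] unfolding gz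
      by (cases "r = ?m") (auto simp: lead_def simp del: index_mult_mat_vec)
    then have "m < ?m" using m by (meson lead_def not_le)
    moreover have "w k' \<le> m" unfolding w_def by (rule Least_le) (use m z in \<open>auto simp: L_def\<close>)
    ultimately show False using eq by simp
  qed
  define w' where "w' k = (if k < n then w k else k)" for k
  have w': "w' permutes {..<n}"
  proof (rule bij_imp_permutes)
    have "inj_on w' {..<n}"
    proof (rule inj_onI)
      fix k l assume "k \<in> {..<n}" "l \<in> {..<n}" "w' k = w' l"
      then show "k = l" using inj[of k l] inj[of l k] by (auto simp: w'_def) (metis linorder_neqE_nat)
    qed
    moreover have "w' ` {..<n} \<subseteq> {..<n}" using wn by (auto simp: w'_def)
    ultimately show "bij_betw w' {..<n} {..<n}"
      unfolding bij_betw_def using endo_inj_surj[of "{..<n}" w'] by blast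
  qed (simp add: w'_def)
  define c where "c = mat n n (\<lambda>(r, k). x k $ r)"
  have cU: "c \<in> UT n"
    by (rule UT_I) (use x(1) in \<open>auto simp: c_def X_def\<close>)
  have gce: "(g * c) $$ (r, k) = (g *\<^sub>v x k) $ r" if "r < n" "k < n" for r k
  proof -
    have "col c k = x k" using xc[OF that(2)] that by (intro eq_vecI) (auto simp: c_def)
    then show ?thesis using that gc by (simp add: c_def)
  qed
  define b where "b = g * c * perm_mat n (pinv w')"
  have gcc: "g * c \<in> carrier_mat n n" using gc UT_D[OF cU] by simp
  have be: "b $$ (r, w' k) = (g *\<^sub>v x k) $ r" if "r < n" "k < n" for r k
  proof -
    have "w' k < n" using permutes_in_image[OF w'] that by blast
    then show ?thesis
      unfolding b_def using that gce[OF that]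
      by (subst mult_perm_entry[OF gcc permutes_inv[OF w']]) (simp_all add: permutes_inverses[OF w'])
  qed
  have bU: "b \<in> UT n"
  proof (rule UT_I)
    show "b \<in> carrier_mat n n" unfolding b_def using gcc by simp
    fix r assume r: "r < n"
    let ?k = "pinv w' r"
    have k: "?k < n" using permutes_in_image[OF permutes_inv[OF w']] r by blast
    have wk: "w ?k = r" using k permutes_inverses(1)[OF w', of r] by (simp add: w'_def)
    show "b $$ (r, r) \<noteq> 0"
      using be[OF r k] x(2)[OF k] permutes_inverses(1)[OF w', of r] by (simp add: lead_def wk)
  next
    fix r l assume lr: "l < r" "r < n"
    let ?k = "pinv w' l"
    have k: "?k < n" using permutes_in_image[OF permutes_inv[OF w'], of l] lr by simp
    have wk: "w ?k = l" using k permutes_inverses(1)[OF w', of l] by (simp add: w'_def)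
    show "b $$ (r, l) = 0"
      using be[OF lr(2) k] x(2)[OF k] permutes_inverses(1)[OF w', of l] lr by (simp add: lead_def wk)
  qed
  have "b * perm_mat n w' = g * c"
    unfolding b_def using gcc
    by (simp add: mmult_assoc[of _ n] perm_mat_comp[OF permutes_inv[OF w'] w'] permutes_inv_o[OF w'] perm_mat_id)
  then have "b * perm_mat n w' * minv n c = g"
    using mmult_cancel(3)[OF UT_GL[OF cU] gc] by simp
  then have "in_cell n w' g" using in_cellI[OF w' bU UT_inv[OF cU]] by simp
  then show ?thesis by blast
qed

text \<open>The relative position of the flag of \<open>v\<close> and the standard flag. For a singular matrix it is unspecified.\<close>

definition pos :: "nat \<Rightarrow> complex mat \<Rightarrow> nat \<Rightarrow> nat" where
  "pos n v = (THE w. in_cell n w v)"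

lemma pos_eq: "in_cell n w v \<Longrightarrow> pos n v = w"
  unfolding pos_def using in_cell_unique by blast

lemma in_cell_pos: "v \<in> carrier (GL n) \<Longrightarrow> in_cell n (pos n v) v"
  using in_cell_exists pos_eq by metis

lemma pos_permutes: "v \<in> carrier (GL n) \<Longrightarrow> pos n v permutes {..<n}"
  using in_cell_pos in_cell_def by blast

lemma pos_UT_mult:
  assumes "v \<in> carrier (GL n)" "b \<in> UT n"
  shows "pos n (b * v) = pos n v" "pos n (v * b) = pos n v"
proof -
  have v: "v \<in> carrier_mat n n" using assms(1) by (rule GL_D)
  have bv: "b * v \<in> carrier_mat n n" using v UT_D[OF assms(2)] by simp
  show "pos n (b * v) = pos n v"
    using pos_eq[OF in_cell_mult[OF in_cell_pos[OF assms(1)] assms(2) UT_one]] bv by simp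
  show "pos n (v * b) = pos n v"
    using pos_eq[OF in_cell_mult[OF in_cell_pos[OF assms(1)] UT_one assms(2)]] v by simp
qed

section \<open>Moving a flag along a projective line\<close>

lemma perm_elementary:
  assumes "w permutes {..<n}" "a < n" "b < n"
  shows "perm_mat n w * elementary n a b t = elementary n (w a) (w b) t * perm_mat n w"
proof (rule eq_matI)
  fix k l assume "k < dim_row (elementary n (w a) (w b) t * perm_mat n w)" "l < dim_col (elementary n (w a) (w b) t * perm_mat n w)"
  then have kl: "k < n" "l < n" by (simp_all add: elementary_def perm_mat_def)
  have wn: "w l < n" "pinv w k < n" using permutes_in_image[OF assms(1)] permutes_in_image[OF permutes_inv[OF assms(1)]] kl by blast+
  have "pinv w k = x \<longleftrightarrow> k = w x" for x by (metis assms(1) permutes_inverses)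
  moreover have "w l = w b \<longleftrightarrow> l = b" using permutes_inj[OF assms(1)] by (auto simp: inj_eq)
  ultimately show "(perm_mat n w * elementary n a b t) $$ (k, l) = (elementary n (w a) (w b) t * perm_mat n w) $$ (k, l)"
    using perm_mult_entry'[OF elementary_carrier assms(1) kl, of a b t] mult_perm_entry[OF elementary_carrier assms(1) kl, of "w a" "w b" t]
      kl wn assms by (simp add: elementary_entry)
qed (simp_all add: elementary_def perm_mat_def)

lemma pos_right:
  assumes w: "w permutes {..<n}" "w i < w (Suc i)" and i: "i + 1 < n" and b: "b \<in> UT n" and r: "r \<in> parab n i"
  shows "pos n (b * perm_mat n w * r) = (if r $$ (Suc i, i) = 0 then w else w \<circ> simple_refl i)"
proof (cases "r $$ (Suc i, i) = 0")
  case True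
  then have "r \<in> UT n" using UT_iff_parab i r by blast
  then show ?thesis using True pos_eq[OF in_cellI[OF w(1) b]] by simp
next
  case False
  let ?t = "r $$ (i, i) / r $$ (Suc i, i)"
  obtain c where c: "c \<in> UT n" "r = elementary n i (Suc i) ?t * (smat n i * c)"
    using parab_decomp[OF r i False] by blast
  have wn: "w (Suc i) < n" using permutes_in_image[OF w(1), of "Suc i"] i by simp
  let ?e = "elementary n (w i) (w (Suc i)) ?t"
  have e: "?e \<in> UT n" using w(2) wn by (rule elementary_UT)
  have D: "b \<in> carrier_mat n n" "c \<in> carrier_mat n n" using b c(1) by (auto dest: UT_D)
  have "b * perm_mat n w * r = b * (perm_mat n w * elementary n i (Suc i) ?t) * (smat n i * c)"
    using D by (subst c(2)) (simp add: mmult_assoc[of _ n])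
  also have "\<dots> = b * ?e * (perm_mat n w * smat n i) * c"
    using D i by (simp add: perm_elementary[OF w(1)] mmult_assoc[of _ n])
  also have "\<dots> = b * ?e * perm_mat n (w \<circ> simple_refl i) * c"
    using i by (simp add: perm_mat_comp[OF w(1) simple_refl_permutes])
  finally have "pos n (b * perm_mat n w * r) = w \<circ> simple_refl i"
    using i by (simp add: pos_eq in_cellI UT_mult b e c(1) permutes_compose[OF simple_refl_permutes w(1)])
  then show ?thesis using False by simp
qed

text \<open>Among \<open>w\<close> and \<open>w s\<^sub>i\<close> one is increasing at \<open>i\<close>; if it is the second, the reflection is moved into
  the parabolic factor.\<close>

lemma ascent_right:
  assumes "v \<in> carrier (GL n)" "i + 1 < n"
  obtains w b r where "w permutes {..<n}" "w i < w (Suc i)" "b \<in> UT n" "r \<in> parab n i"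
    "v = b * perm_mat n w * r"
proof -
  obtain w b c where w: "w permutes {..<n}" and b: "b \<in> UT n" and c: "c \<in> UT n" and v: "v = b * perm_mat n w * c"
    using in_cell_pos[OF assms(1)] by (auto simp: in_cell_def)
  show thesis
  proof (cases "w i < w (Suc i)")
    case True
    then show ?thesis using that w b c v UT_parab by blast
  next
    case False
    let ?w = "w \<circ> simple_refl i"
    have s: "simple_refl i permutes {..<n}" by (rule simple_refl_permutes[OF assms(2)])
    have w': "?w permutes {..<n}" by (rule permutes_compose[OF s w])
    have "w = ?w \<circ> simple_refl i" by simp
    then have "perm_mat n w = perm_mat n ?w * smat n i" by (metis perm_mat_comp[OF w' s])
    then have "v = b * perm_mat n ?w * (smat n i * c)"
      using v b c by (simp add: mmult_assoc[of _ n] UT_D)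
    moreover have "?w i < ?w (Suc i)" using False permutes_ne[OF w, of i "Suc i"] by simp
    moreover have "smat n i * c \<in> parab n i"
      by (intro parab_mult smat_parab assms(2) subsetD[OF UT_parab c])
    ultimately show ?thesis using that w' b by blast
  qed
qed

lemma minv_mult:
  "a \<in> carrier (GL n) \<Longrightarrow> b \<in> carrier (GL n) \<Longrightarrow> minv n (a * b) = minv n b * minv n a"
  using GLn.inv_mult_group[of a n b] by simp

lemma minv_minv: "a \<in> carrier (GL n) \<Longrightarrow> minv n (minv n a) = a"
  by (rule GLn.inv_inv)

lemma minv_cell:
  assumes "a \<in> carrier (GL n)" "w permutes {..<n}" "c \<in> carrier (GL n)"
  shows "minv n (a * perm_mat n w * c) = minv n c * perm_mat n (pinv w) * minv n a"
  using assms by (simp add: minv_mult GL_mult perm_mat_inv mmult_assoc[of _ n] GL_D GL_inv(1))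

lemma pos_minv:
  assumes "v \<in> carrier (GL n)"
  shows "pos n (minv n v) = pinv (pos n v)"
proof -
  obtain b c where w: "pos n v permutes {..<n}" and b: "b \<in> UT n" and c: "c \<in> UT n"
    and v: "v = b * perm_mat n (pos n v) * c"
    using in_cell_pos[OF assms(1)] by (auto simp: in_cell_def)
  have "minv n v = minv n c * perm_mat n (pinv (pos n v)) * minv n b"
    by (subst v, rule minv_cell[OF UT_GL[OF b] w UT_GL[OF c]])
  then show ?thesis using pos_eq[OF in_cellI[OF permutes_inv[OF w] UT_inv[OF c] UT_inv[OF b]]] by simp
qed

lemma parab_minv_zero:
  assumes "r \<in> parab n i" "i + 1 < n"
  shows "minv n r $$ (Suc i, i) = 0 \<longleftrightarrow> r $$ (Suc i, i) = 0"
  using UT_iff_parab[OF assms(2)] UT_inv[of r n] UT_inv[of "minv n r" n] parab_inv[OF assms]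
    minv_minv[OF parab_GL[OF assms(1)]] assms(1) by metis

text \<open>Inversion of matrices exchanges left and right multiplication and
  inverts the permutation.\<close>

lemma pos_left:
  assumes w: "w permutes {..<n}" "pinv w i < pinv w (Suc i)" and i: "i + 1 < n"
    and c: "c \<in> UT n" and r: "r \<in> parab n i"
  shows "pos n (r * perm_mat n w * c) = (if r $$ (Suc i, i) = 0 then w else simple_refl i \<circ> w)"
proof -
  let ?v = "r * perm_mat n w * c"
  have s: "simple_refl i permutes {..<n}" by (rule simple_refl_permutes[OF i])
  have v: "?v \<in> carrier (GL n)" by (intro GL_mult parab_GL[OF r] UT_GL[OF c] perm_mat_inv w)
  have "pos n (minv n ?v) = (if minv n r $$ (Suc i, i) = 0 then pinv w else pinv w \<circ> simple_refl i)"
    unfolding minv_cell[OF parab_GL[OF r] w(1) UT_GL[OF c]]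
    by (rule pos_right[OF permutes_inv[OF w(1)] w(2) i UT_inv[OF c] parab_inv[OF r i]])
  then have *: "pinv (pos n ?v) = (if r $$ (Suc i, i) = 0 then pinv w else pinv w \<circ> simple_refl i)"
    by (simp add: pos_minv[OF v] parab_minv_zero[OF r i])
  have "pos n ?v = pinv (pinv (pos n ?v))"
    by (rule inv_inv_eq[OF permutes_bij[OF pos_permutes[OF v]], symmetric])
  also have "\<dots> = (if r $$ (Suc i, i) = 0 then w else simple_refl i \<circ> w)"
    unfolding * using o_inv_distrib[OF permutes_bij[OF permutes_inv[OF w(1)]] permutes_bij[OF s]]
    by (simp add: inv_inv_eq permutes_bij[OF w(1)])
  finally show ?thesis .
qed

lemma ascent_left:
  assumes "v \<in> carrier (GL n)" "i + 1 < n"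
  obtains w c r where "w permutes {..<n}" "pinv w i < pinv w (Suc i)" "c \<in> UT n" "r \<in> parab n i"
    "v = r * perm_mat n w * c"
proof -
  obtain w b r where w: "w permutes {..<n}" "w i < w (Suc i)" and b: "b \<in> UT n" and r: "r \<in> parab n i"
    and v: "minv n v = b * perm_mat n w * r"
    by (rule ascent_right[OF GL_inv(1)[OF assms(1)] assms(2)])
  have "v = minv n r * perm_mat n (pinv w) * minv n b"
    using minv_cell[OF UT_GL[OF b] w(1) parab_GL[OF r]] v minv_minv[OF assms(1)] by simp
  moreover have "pinv (pinv w) = w" by (simp add: inv_inv_eq permutes_bij[OF w(1)])
  ultimately show thesis
    using that[of "pinv w" "minv n b" "minv n r"] w permutes_inv[OF w(1)] UT_inv[OF b] parab_inv[OF r assms(2)]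
    by simp
qed

subsection \<open>Two by two blocks and rank one perturbations\<close>

lemma det2_mult:
  fixes a b c d :: "'a :: comm_ring"
  shows "(a * d - b * c) * (a' * d' - b' * c') =
    (a * a' + b * c') * (c * b' + d * d') - (a * b' + b * d') * (c * a' + d * c')"
  by (simp add: algebra_simps)

lemma cramer2:
  fixes a b c d :: "'a :: comm_ring_1"
  assumes "a * x + b * y = e" "c * x + d * y = f"
  shows "(a * d - b * c) * x = d * e - b * f" "(a * d - b * c) * y = a * f - c * e"
  unfolding assms[symmetric] by (simp_all add: algebra_simps)

lemma parab_block_det:
  assumes "g \<in> parab n i" "i + 1 < n"
  shows "g $$ (i, i) * g $$ (Suc i, Suc i) - g $$ (i, Suc i) * g $$ (Suc i, i) \<noteq> 0"
proof
  assume z: "g $$ (i, i) * g $$ (Suc i, Suc i) - g $$ (i, Suc i) * g $$ (Suc i, i) = 0"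
  let ?h = "minv n g"
  have h: "?h \<in> parab n i" by (rule parab_inv[OF assms])
  have e: "(g * ?h) $$ (k, l) = (if k = l then 1 else 0)" if "k \<in> {i, Suc i}" "l \<in> {i, Suc i}" for k l
    using GL_inv(2)[OF parab_GL[OF assms(1)]] assms(2) that by auto
  have "g $$ (i, i) * ?h $$ (i, i) + g $$ (i, Suc i) * ?h $$ (Suc i, i) = 1"
    "g $$ (Suc i, i) * ?h $$ (i, i) + g $$ (Suc i, Suc i) * ?h $$ (Suc i, i) = 0"
    "g $$ (i, i) * ?h $$ (i, Suc i) + g $$ (i, Suc i) * ?h $$ (Suc i, Suc i) = 0"
    "g $$ (Suc i, i) * ?h $$ (i, Suc i) + g $$ (Suc i, Suc i) * ?h $$ (Suc i, Suc i) = 1"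
    using e parab_mult_entry[OF assms(1) h assms(2)] by simp_all
  then have "(g $$ (i, i) * g $$ (Suc i, Suc i) - g $$ (i, Suc i) * g $$ (Suc i, i)) *
      (?h $$ (i, i) * ?h $$ (Suc i, Suc i) - ?h $$ (i, Suc i) * ?h $$ (Suc i, i)) = 1"
    unfolding det2_mult by simp
  then show False using z by simp
qed

lemma parab_minv_entry:
  assumes "g \<in> parab n i" "i + 1 < n"
  defines "d \<equiv> g $$ (i, i) * g $$ (Suc i, Suc i) - g $$ (i, Suc i) * g $$ (Suc i, i)"
  shows "minv n g $$ (i, i) = g $$ (Suc i, Suc i) / d" "minv n g $$ (i, Suc i) = - g $$ (i, Suc i) / d"
    "minv n g $$ (Suc i, i) = - g $$ (Suc i, i) / d" "minv n g $$ (Suc i, Suc i) = g $$ (i, i) / d"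
proof -
  let ?h = "minv n g"
  have d: "d \<noteq> 0" unfolding d_def by (rule parab_block_det[OF assms(1,2)])
  have h: "?h \<in> parab n i" by (rule parab_inv[OF assms(1,2)])
  have e: "(g * ?h) $$ (k, l) = (if k = l then 1 else 0)" if "k \<in> {i, Suc i}" "l \<in> {i, Suc i}" for k l
    using GL_inv(2)[OF parab_GL[OF assms(1)]] assms(2) that by auto
  have *: "g $$ (i, i) * ?h $$ (i, i) + g $$ (i, Suc i) * ?h $$ (Suc i, i) = 1"
    "g $$ (Suc i, i) * ?h $$ (i, i) + g $$ (Suc i, Suc i) * ?h $$ (Suc i, i) = 0"
    "g $$ (i, i) * ?h $$ (i, Suc i) + g $$ (i, Suc i) * ?h $$ (Suc i, Suc i) = 0"
    "g $$ (Suc i, i) * ?h $$ (i, Suc i) + g $$ (Suc i, Suc i) * ?h $$ (Suc i, Suc i) = 1"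
    using e parab_mult_entry[OF assms(1) h assms(2)] by simp_all
  have "d * ?h $$ (i, i) = g $$ (Suc i, Suc i)" "d * ?h $$ (i, Suc i) = - g $$ (i, Suc i)"
    "d * ?h $$ (Suc i, i) = - g $$ (Suc i, i)" "d * ?h $$ (Suc i, Suc i) = g $$ (i, i)"
    using cramer2[OF *(1,2)] cramer2[OF *(3,4)] by (simp_all add: d_def)
  then show "?h $$ (i, i) = g $$ (Suc i, Suc i) / d" "?h $$ (i, Suc i) = - g $$ (i, Suc i) / d"
    "?h $$ (Suc i, i) = - g $$ (Suc i, i) / d" "?h $$ (Suc i, Suc i) = g $$ (i, i) / d"
    using d by (simp_all add: field_simps)
qed

definition matrix_unit :: "nat \<Rightarrow> nat \<Rightarrow> nat \<Rightarrow> complex mat" where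
  "matrix_unit n a b = mat n n (\<lambda>(k, l). if k = a \<and> l = b then 1 else 0)"

lemma matrix_unit_carrier [simp]: "matrix_unit n a b \<in> carrier_mat n n"
  by (simp add: matrix_unit_def)

text \<open>A product \<open>A E B\<close> with a matrix unit \<open>E\<close> has rank one: it is a column of \<open>A\<close> times a row of \<open>B\<close>.\<close>

lemma matrix_unit_sandwich:
  assumes "A \<in> carrier_mat n n" "B \<in> carrier_mat n n" "a < n" "b < n" "k < n" "l < n"
  shows "(A * matrix_unit n a b * B) $$ (k, l) = A $$ (k, a) * B $$ (b, l)"
proof -
  have "(A * matrix_unit n a b) $$ (k, m) = (if m = b then A $$ (k, a) else 0)" if "m < n" for m
  proof -
    have "(A * matrix_unit n a b) $$ (k, m) = (\<Sum>j<n. A $$ (k, j) * matrix_unit n a b $$ (j, m))"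
      using assms that by (intro mmult_entry) simp_all
    also have "\<dots> = (\<Sum>j<n. if j = a then (if m = b then A $$ (k, a) else 0) else 0)"
      by (rule sum.cong) (use that in \<open>auto simp: matrix_unit_def\<close>)
    finally show ?thesis using assms by simp
  qed
  then have "(\<Sum>m<n. (A * matrix_unit n a b) $$ (k, m) * B $$ (m, l)) = (\<Sum>m<n. if m = b then A $$ (k, a) * B $$ (b, l) else 0)"
    by (intro sum.cong) auto
  moreover have "(A * matrix_unit n a b * B) $$ (k, l) = (\<Sum>m<n. (A * matrix_unit n a b) $$ (k, m) * B $$ (m, l))"
    using assms by (intro mmult_entry) simp_all
  ultimately show ?thesis using assms(4) by simp
qed

lemma perm_matrix_unit_perm:
  assumes "w permutes {..<n}" "u permutes {..<n}" "a < n" "b < n"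
  shows "perm_mat n w * matrix_unit n a b * perm_mat n (pinv u) = matrix_unit n (w a) (u b)"
proof (rule eq_matI)
  fix k l assume "k < dim_row (matrix_unit n (w a) (u b))" "l < dim_col (matrix_unit n (w a) (u b))"
  then have kl: "k < n" "l < n" by (simp_all add: matrix_unit_def)
  then have "pinv u l < n" using permutes_in_image[OF permutes_inv[OF assms(2)]] by blast
  moreover have "b = pinv u l \<longleftrightarrow> l = u b" by (metis assms(2) permutes_inverses)
  ultimately show "(perm_mat n w * matrix_unit n a b * perm_mat n (pinv u)) $$ (k, l) = matrix_unit n (w a) (u b) $$ (k, l)"
    using kl assms by (subst matrix_unit_sandwich) (auto simp: perm_mat_entry matrix_unit_def)
qed (simp_all add: matrix_unit_def perm_mat_def)

text \<open>A matrix of rank one is nilpotent or a multiple of a projection. The scalar \<open>(B A) $$ (b, a)\<close> is its trace.\<close>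

lemma sandwich_square:
  assumes "A \<in> carrier_mat n n" "B \<in> carrier_mat n n" "a < n" "b < n"
  defines "y \<equiv> A * matrix_unit n a b * B"
  shows "y * y = (B * A) $$ (b, a) \<cdot>\<^sub>m y"
proof (rule eq_matI)
  fix k l assume "k < dim_row ((B * A) $$ (b, a) \<cdot>\<^sub>m y)" "l < dim_col ((B * A) $$ (b, a) \<cdot>\<^sub>m y)"
  then have kl: "k < n" "l < n" using assms(1,2) by (simp_all add: y_def)
  have yc: "y \<in> carrier_mat n n" using assms(1,2) by (simp add: y_def)
  have "(y * y) $$ (k, l) = (\<Sum>m<n. y $$ (k, m) * y $$ (m, l))"
    using yc kl by (intro mmult_entry)
  also have "\<dots> = (\<Sum>m<n. A $$ (k, a) * B $$ (b, l) * (B $$ (b, m) * A $$ (m, a)))"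
    by (rule sum.cong) (use assms kl in \<open>auto simp: y_def matrix_unit_sandwich simp del: index_mult_mat\<close>)
  also have "\<dots> = (B * A) $$ (b, a) * y $$ (k, l)"
    unfolding sum_distrib_left[symmetric] mmult_entry[OF assms(2,1,4,3)]
    using assms kl by (simp add: y_def matrix_unit_sandwich mult.commute del: index_mult_mat)
  finally show "(y * y) $$ (k, l) = ((B * A) $$ (b, a) \<cdot>\<^sub>m y) $$ (k, l)" using kl yc by simp
qed (use assms in \<open>simp_all add: y_def\<close>)

definition rank_one_pert :: "nat \<Rightarrow> complex \<Rightarrow> complex mat \<Rightarrow> complex mat" where
  "rank_one_pert n t y = 1\<^sub>m n + t \<cdot>\<^sub>m y"

lemma rank_one_pert_carrier [simp]: "y \<in> carrier_mat n n \<Longrightarrow> rank_one_pert n t y \<in> carrier_mat n n"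
  by (simp add: rank_one_pert_def)

lemma rank_one_pert_entry: "y \<in> carrier_mat n n \<Longrightarrow> k < n \<Longrightarrow> l < n \<Longrightarrow>
    rank_one_pert n t y $$ (k, l) = (if k = l then 1 else 0) + t * y $$ (k, l)"
  by (simp add: rank_one_pert_def)

text \<open>Since \<open>y\<^sup>2\<close> is a multiple of \<open>y\<close>, the matrices \<open>1 + t y\<close> are closed under multiplication, and
  the inverse can be read off.\<close>

lemma rank_one_pert_mult:
  assumes "y \<in> carrier_mat n n" "y * y = \<tau> \<cdot>\<^sub>m y"
  shows "rank_one_pert n s y * rank_one_pert n t y = rank_one_pert n (s + t + s * t * \<tau>) y"
proof (rule eq_matI)
  fix k l assume "k < dim_row (rank_one_pert n (s + t + s * t * \<tau>) y)" "l < dim_col (rank_one_pert n (s + t + s * t * \<tau>) y)"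
  then have kl: "k < n" "l < n" using assms(1) by (simp_all add: rank_one_pert_def)
  have "(\<Sum>m<n. y $$ (k, m) * y $$ (m, l)) = \<tau> * y $$ (k, l)"
    using assms kl mmult_entry[OF assms(1,1) kl] by simp
  moreover have "(rank_one_pert n s y * rank_one_pert n t y) $$ (k, l) = (\<Sum>m<n. rank_one_pert n s y $$ (k, m) * rank_one_pert n t y $$ (m, l))"
    using kl assms(1) by (intro mmult_entry) simp_all
  moreover have "(\<Sum>m<n. rank_one_pert n s y $$ (k, m) * rank_one_pert n t y $$ (m, l)) =
      (\<Sum>m<n. (if m = k then (if m = l then 1 else 0) + t * y $$ (m, l) else 0) +
        ((if m = l then s * y $$ (k, m) else 0) + s * t * (y $$ (k, m) * y $$ (m, l))))"
    by (rule sum.cong) (use kl assms(1) in \<open>auto simp: rank_one_pert_entry algebra_simps\<close>)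
  ultimately have "(rank_one_pert n s y * rank_one_pert n t y) $$ (k, l) =
      (if k = l then 1 else 0) + t * y $$ (k, l) + (s * y $$ (k, l) + s * t * (\<tau> * y $$ (k, l)))"
    using kl by (simp add: sum.distrib flip: sum_distrib_left)
  then show "(rank_one_pert n s y * rank_one_pert n t y) $$ (k, l) = rank_one_pert n (s + t + s * t * \<tau>) y $$ (k, l)"
    using kl assms(1) by (simp add: rank_one_pert_entry algebra_simps)
qed (use assms in \<open>simp_all add: rank_one_pert_def\<close>)

lemma rank_one_pert_GL:
  assumes "y \<in> carrier_mat n n" "y * y = \<tau> \<cdot>\<^sub>m y" "1 + t * \<tau> \<noteq> 0"
  shows "rank_one_pert n t y \<in> carrier (GL n)"
proof (rule GL_I)
  have "t + (- t / (1 + t * \<tau>)) + t * (- t / (1 + t * \<tau>)) * \<tau> = 0"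
    using assms(3) by (simp add: field_simps)
  then show "rank_one_pert n t y * rank_one_pert n (- t / (1 + t * \<tau>)) y = 1\<^sub>m n"
    using assms(1) by (subst rank_one_pert_mult[OF assms(1,2)]) (auto simp: rank_one_pert_def intro!: eq_matI)
qed (use assms(1) in simp_all)

lemma rank_one_pert_conj:
  assumes "v \<in> carrier (GL n)" "y \<in> carrier_mat n n"
  shows "v * rank_one_pert n t y * minv n v = rank_one_pert n t (v * y * minv n v)"
proof -
  have v: "v \<in> carrier_mat n n" "minv n v \<in> carrier_mat n n" using assms(1) GL_inv(1) GL_D by blast+
  have "v * rank_one_pert n t y = v + t \<cdot>\<^sub>m (v * y)"
    unfolding rank_one_pert_def using v assms(2)
    by (subst mult_add_distrib_mat[of _ n n _ n]) (auto simp: mult_smult_distrib[of _ n n _ n])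
  then show ?thesis unfolding rank_one_pert_def using v assms(2) GL_inv(2)[OF assms(1)]
    by (simp only:) (subst add_mult_distrib_mat[of _ n n], auto simp: mult_smult_assoc_mat[of _ n n _ n])
qed

section \<open>The two special points on the projective line\<close>

abbreviation sg :: "nat \<Rightarrow> complex mat" where
  "sg n \<equiv> perm_mat n (sigma n)"

definition lastcol :: "nat \<Rightarrow> complex mat \<Rightarrow> bool" where
  "lastcol n g \<longleftrightarrow> (\<forall>k < n - 1. g $$ (k, n - 1) = 0) \<and> g $$ (n - 1, n - 1) = 1"

lemma pinv_sigma: "j < n \<Longrightarrow> pinv (sigma n) j = (if j = n - 1 then 0 else Suc j)"
  using permutes_inverses(2)[OF sigma_permutes, of n "if j = n - 1 then 0 else Suc j"]
  by (auto simp: sigma_def split: if_splits)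

lemma sg_GL: "sg n \<in> carrier (GL n)" "minv n (sg n) = perm_mat n (pinv (sigma n))"
  using perm_mat_inv[OF sigma_permutes] by blast+

lemma sg_mult_entry:
  assumes "X \<in> carrier_mat n n" "Y \<in> carrier_mat n n" "k < n" "l < n"
  shows "(X * (sg n * Y)) $$ (k, l) = X $$ (k, n - 1) * Y $$ (0, l) + (\<Sum>j<n - 1. X $$ (k, j) * Y $$ (Suc j, l))"
proof -
  have "(X * (sg n * Y)) $$ (k, l) = (\<Sum>j<n. X $$ (k, j) * (sg n * Y) $$ (j, l))"
    using assms by (intro mmult_entry) simp_all
  also have "\<dots> = (\<Sum>j<n. X $$ (k, j) * Y $$ (if j = n - 1 then 0 else Suc j, l))"
    by (rule sum.cong) (use assms perm_mult_entry'[OF assms(2) sigma_permutes] in \<open>auto simp: pinv_sigma simp del: index_mult_mat\<close>)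
  also have "{..<n} = insert (n - 1) {..<n - 1}" using assms(3) by auto
  finally show ?thesis by simp
qed

text \<open>In the matrix of \<open>\<sigma>\<close> the only nonzero entry on or below the diagonal is in the corner. So each
  submatrix on or below the diagonal has rank at most one, and this survives multiplication by
  triangular matrices from both sides. Hence an invertible block of size 2 cannot sit there. The
  inequality makes the perturbations in \<open>line_in_flag_direction\<close> triangular.\<close>

lemma special_points_right:
  assumes i: "i + 1 < n" and b: "b \<in> UT n" and b': "b' \<in> UT n"
    and w: "w permutes {..<n}" "w i < w (Suc i)" and u: "u permutes {..<n}" "u i < u (Suc i)"
    and r: "r \<in> parab n i" and eq: "b * perm_mat n w * r = sg n * (b' * perm_mat n u)"
  shows "w i < u (Suc i)"
proof (rule ccontr)
  assume "\<not> ?thesis"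
  then have le: "u l \<le> w k" if "k \<in> {i, Suc i}" "l \<in> {i, Suc i}" for k l
    using w(2) u(2) that by auto
  note D = UT_D[OF b] UT_D[OF b'] parab_D[OF r] UT_D[OF UT_inv[OF b]]
  have "perm_mat n w * r = minv n b * (b * perm_mat n w * r)"
    using D by (simp add: mmult_assoc[of _ n] mmult_cancel(2)[OF UT_GL[OF b]])
  also have "\<dots> = minv n b * (sg n * b') * perm_mat n u" unfolding eq using D by (simp add: mmult_assoc[of _ n])
  finally have eq': "perm_mat n w * r = minv n b * (sg n * b') * perm_mat n u" .
  have e: "r $$ (k, l) = minv n b $$ (w k, n - 1) * b' $$ (0, u l)" if kl: "k \<in> {i, Suc i}" "l \<in> {i, Suc i}" for k l
  proof -
    have kn: "k < n" "l < n" using kl i by auto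
    then have wn: "w k < n" "u l < n" using permutes_in_image[OF w(1)] permutes_in_image[OF u(1)] by blast+
    have "r $$ (k, l) = (perm_mat n w * r) $$ (w k, l)" using perm_mult_entry[OF D(3) w(1) kn] by simp
    also have "\<dots> = (minv n b * (sg n * b')) $$ (w k, u l)"
      unfolding eq' using D wn kn u(1) by (intro mult_perm_entry) simp_all
    also have "\<dots> = minv n b $$ (w k, n - 1) * b' $$ (0, u l) + (\<Sum>j<n - 1. minv n b $$ (w k, j) * b' $$ (Suc j, u l))"
      using D wn by (intro sg_mult_entry) simp_all
    also have "(\<Sum>j<n - 1. minv n b $$ (w k, j) * b' $$ (Suc j, u l)) = 0"
    proof (intro sum.neutral ballI)
      fix j assume "j \<in> {..<n - 1}"
      then show "minv n b $$ (w k, j) * b' $$ (Suc j, u l) = 0"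
        using UT_zero[OF UT_inv[OF b], of j "w k"] UT_zero[OF b', of "u l" "Suc j"] le[OF kl] wn
        by (cases "j < w k") auto
    qed
    finally show ?thesis by simp
  qed
  have "r $$ (i, i) * r $$ (Suc i, Suc i) - r $$ (i, Suc i) * r $$ (Suc i, i) = 0"
    by (simp add: e)
  then show False using parab_block_det[OF r i] by simp
qed

text \<open>The counterpart for the multiplication from the left. The block of \<open>r'\<close> is shifted by one
  because \<open>\<sigma>\<close> maps \<open>i + 1\<close> and \<open>i + 2\<close> to \<open>i\<close> and \<open>i + 1\<close>.\<close>

lemma special_points_left:
  assumes i: "i + 2 < n" and c: "c \<in> UT n"
    and w: "w permutes {..<n}" "pinv w i < pinv w (Suc i)"
    and u: "u permutes {..<n}" "pinv u (Suc i) < pinv u (Suc (Suc i))"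
    and r: "r \<in> parab n i" and r': "r' \<in> parab n (Suc i)"
    and eq: "r * (perm_mat n w * c) = sg n * (r' * perm_mat n u)"
  shows "pinv w i \<le> pinv u (Suc (Suc i))"
proof (rule ccontr)
  assume "\<not> ?thesis"
  then have less: "pinv u l < pinv w k" if "k \<in> {i, Suc i}" "l \<in> {Suc i, Suc (Suc i)}" for k l
    using w(2) u(2) that by auto
  let ?R = "minv n r"
  have i1: "i + 1 < n" using i by simp
  have R: "?R \<in> parab n i" by (rule parab_inv[OF r i1])
  note D = UT_D[OF c] parab_D[OF r'] parab_D[OF r] parab_D[OF R]
  have "perm_mat n w * c = ?R * (r * (perm_mat n w * c))"
    using D by (simp add: mmult_cancel(2)[OF parab_GL[OF r]])
  also have "\<dots> = ?R * (sg n * r') * perm_mat n u" unfolding eq using D by (simp add: mmult_assoc[of _ n])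
  finally have eq': "perm_mat n w * c = ?R * (sg n * r') * perm_mat n u" .
  have e: "?R $$ (k, n - 1) * r' $$ (0, l) + (?R $$ (k, i) * r' $$ (Suc i, l) + ?R $$ (k, Suc i) * r' $$ (Suc (Suc i), l)) = 0"
    if kl: "k \<in> {i, Suc i}" "l \<in> {Suc i, Suc (Suc i)}" for k l
  proof -
    have kn: "k < n" "l < n" using kl i by auto
    then have wn: "pinv w k < n" "pinv u l < n"
      using permutes_in_image[OF permutes_inv[OF w(1)]] permutes_in_image[OF permutes_inv[OF u(1)]] by blast+
    have "0 = c $$ (pinv w k, pinv u l)" using UT_zero[OF c less[OF kl] wn(1)] by simp
    also have "\<dots> = (perm_mat n w * c) $$ (k, pinv u l)" using perm_mult_entry'[OF D(1) w(1) kn(1) wn(2)] by simp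
    also have "\<dots> = (?R * (sg n * r')) $$ (k, u (pinv u l))"
      unfolding eq' using D wn kn u(1) by (intro mult_perm_entry) simp_all
    also have "u (pinv u l) = l" by (rule permutes_inverses(1)[OF u(1)])
    also have "(?R * (sg n * r')) $$ (k, l) = ?R $$ (k, n - 1) * r' $$ (0, l) + (\<Sum>j<n - 1. ?R $$ (k, j) * r' $$ (Suc j, l))"
      using D kn by (intro sg_mult_entry) simp_all
    also have "(\<Sum>j<n - 1. ?R $$ (k, j) * r' $$ (Suc j, l)) = (\<Sum>j\<in>{i, Suc i}. ?R $$ (k, j) * r' $$ (Suc j, l))"
    proof (rule sum.mono_neutral_right)
      show "\<forall>j\<in>{..<n - 1} - {i, Suc i}. ?R $$ (k, j) * r' $$ (Suc j, l) = 0"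
      proof
        fix j assume j: "j \<in> {..<n - 1} - {i, Suc i}"
        then have "Suc j < n" by auto
        then show "?R $$ (k, j) * r' $$ (Suc j, l) = 0"
          using parab_zero[OF R, of j k] parab_zero[OF r', of l "Suc j"] i kl j by (cases "j < i") auto
      qed
    qed (use i in auto)
    finally show ?thesis by simp
  qed
  have "?R $$ (k, i) * r' $$ (Suc i, l) + ?R $$ (k, Suc i) * r' $$ (Suc (Suc i), l) = - (?R $$ (k, n - 1) * r' $$ (0, l))"
    if kl: "k \<in> {i, Suc i}" "l \<in> {Suc i, Suc (Suc i)}" for k l
    using e[OF kl] by (simp add: eq_neg_iff_add_eq_0 add.commute)
  then have "(?R $$ (i, i) * ?R $$ (Suc i, Suc i) - ?R $$ (i, Suc i) * ?R $$ (Suc i, i)) *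
    (r' $$ (Suc i, Suc i) * r' $$ (Suc (Suc i), Suc (Suc i)) - r' $$ (Suc i, Suc (Suc i)) * r' $$ (Suc (Suc i), Suc i)) = 0"
    unfolding det2_mult by simp
  then show False using parab_block_det[OF R i1] parab_block_det[OF r'] i by simp
qed

text \<open>The flags that differ from the flag of \<open>v\<close> at most in the subspace of dimension \<open>i + 1\<close> form
  the projective line \<open>v P\<^sub>\<alpha> / B\<close>, on which \<open>v m\<close> is the point spanned by the first column of the
  block of \<open>m\<close>. In a decomposition \<open>v = b w r\<close> with \<open>w\<close> increasing at \<open>i\<close>, the permutation of \<open>v m\<close> is
  \<open>w\<close> if and only if the block of \<open>r m\<close> is triangular. This singles out one point \<open>p\<close> of the line, and
  the same argument for \<open>\<sigma>\<^sup>-\<^sup>1 v\<close> gives \<open>q\<close>.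
  The last statement provides elements of \<open>B\<^bsub>n-1\<^esub>\<close>: they act on the line as perturbations of the
  identity by the multiples of an operator with image \<open>p\<close> and kernel \<open>q\<close>.\<close>

lemma line_in_flag_direction:
  assumes i: "i + 1 < n" and v: "v \<in> carrier (GL n)"
  obtains w u p1 p2 q1 q2 where
    "w permutes {..<n}" "u permutes {..<n}" "w i < w (Suc i)" "u i < u (Suc i)"
    "p1 \<noteq> 0 \<or> p2 \<noteq> 0" "q1 \<noteq> 0 \<or> q2 \<noteq> (0 :: complex)"
    "\<And>m. m \<in> parab n i \<Longrightarrow>
       pos n (v * m) = (if m $$ (i, i) * p2 = m $$ (Suc i, i) * p1 then w else w \<circ> simple_refl i)"
    "\<And>m. m \<in> parab n i \<Longrightarrow>
       pos n (minv n (sg n) * (v * m)) = (if m $$ (i, i) * q2 = m $$ (Suc i, i) * q1 then u else u \<circ> simple_refl i)"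
    "\<And>t. 1 + t * (p2 * q1 - p1 * q2) \<noteq> 0 \<Longrightarrow> \<exists>m \<in> parab n i. v * m * minv n v \<in> UT n \<and>
       lastcol n (v * m * minv n v) \<and> m $$ (i, i) = 1 - t * p1 * q2 \<and> m $$ (i, Suc i) = t * p1 * q1 \<and>
       m $$ (Suc i, i) = - t * p2 * q2 \<and> m $$ (Suc i, Suc i) = 1 + t * p2 * q1"
proof -
  have v': "minv n (sg n) * v \<in> carrier (GL n)" by (intro GL_mult GL_inv(1) sg_GL v)
  obtain w b r where w: "w permutes {..<n}" "w i < w (Suc i)" and b: "b \<in> UT n" and r: "r \<in> parab n i"
    and vr: "v = b * perm_mat n w * r" by (rule ascent_right[OF v i])
  obtain u b' r' where u: "u permutes {..<n}" "u i < u (Suc i)" and b': "b' \<in> UT n" and r': "r' \<in> parab n i"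
    and vr': "minv n (sg n) * v = b' * perm_mat n u * r'" by (rule ascent_right[OF v' i])
  let ?R = "minv n r" and ?R' = "minv n r'" and ?V = "minv n v" and ?B' = "minv n b'" and ?T = "minv n (sg n)"
  have R: "?R \<in> parab n i" and R': "?R' \<in> parab n i" by (rule parab_inv[OF _ i], fact)+
  have B': "?B' \<in> UT n" by (rule UT_inv[OF b'])
  note D = GL_D[OF v] UT_D[OF b] UT_D[OF b'] parab_D[OF r] parab_D[OF r'] parab_D[OF R] parab_D[OF R']
    UT_D[OF B'] GL_D[OF GL_inv(1)[OF v]] GL_D[OF GL_inv(1)[OF sg_GL(1)], of n]
  let ?d = "r $$ (i, i) * r $$ (Suc i, Suc i) - r $$ (i, Suc i) * r $$ (Suc i, i)"
  have d: "?d \<noteq> 0" by (rule parab_block_det[OF r i])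
  have d': "r' $$ (i, i) * r' $$ (Suc i, Suc i) - r' $$ (i, Suc i) * r' $$ (Suc i, i) \<noteq> 0" by (rule parab_block_det[OF r' i])
  define p1 where "p1 = r $$ (Suc i, Suc i)"
  define p2 where "p2 = - r $$ (Suc i, i)"
  define q1 where "q1 = r' $$ (Suc i, Suc i)"
  define q2 where "q2 = - r' $$ (Suc i, i)"
  let ?a = "w i" and ?q = "u (Suc i)"
  have wn: "?a < n" "?q < n" "w (Suc i) < n"
    using permutes_in_image[OF w(1), of i] permutes_in_image[OF u(1), of "Suc i"] permutes_in_image[OF w(1), of "Suc i"] i
    by simp_all
  \<comment> \<open>transport the two decompositions of \<open>v\<close> to one identity, in which the parabolic factors are combined\<close>
  have key: "?a < ?q"
  proof (rule special_points_right[OF i b b' w u])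
    show "r * ?R' \<in> parab n i" by (rule parab_mult[OF r R'])
    have "sg n * (?T * v) * ?R' = sg n * (b' * perm_mat n u * r') * ?R'" using vr' by simp
    then have "b * perm_mat n w * r * ?R' = sg n * (b' * perm_mat n u * r') * ?R'"
      using D by (simp add: mmult_cancel(1)[OF sg_GL(1)] flip: vr)
    then show "b * perm_mat n w * (r * ?R') = sg n * (b' * perm_mat n u)"
      using D GL_inv(2)[OF parab_GL[OF r']] by (simp add: mmult_assoc[of _ n])
  qed
  \<comment> \<open>the operator with image \<open>p\<close>, the first column of \<open>r\<^sup>-\<^sup>1\<close> up to a factor, and with the second row of
    the block of \<open>r'\<close>, which annihilates \<open>q\<close>\<close>
  define y where "y = ?R * matrix_unit n i (Suc i) * r'"
  have yc: "y \<in> carrier_mat n n" using D by (simp add: y_def)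
  have ye: "y $$ (k, l) = ?R $$ (k, i) * r' $$ (Suc i, l)" if "k < n" "l < n" for k l
    unfolding y_def using D that i by (intro matrix_unit_sandwich) simp_all
  define \<tau> where "\<tau> = (r' * ?R) $$ (Suc i, i)"
  have ysq: "y * y = \<tau> \<cdot>\<^sub>m y"
    unfolding y_def \<tau>_def using D i by (intro sandwich_square) simp_all
  have \<tau>: "\<tau> * ?d = p2 * q1 - p1 * q2"
    unfolding \<tau>_def using d by (simp add: parab_mult_entry[OF r' R i] parab_minv_entry[OF r i] p1_def p2_def q1_def q2_def divide_simps del: index_mult_mat)
  define x where "x = v * y * ?V"
  have xe: "x $$ (k, l) = b $$ (k, ?a) * ?B' $$ (?q, pinv (sigma n) l)" if kl: "k < n" "l < n" for k l
  proof -
    have "r' * ?V = perm_mat n (pinv u) * (?B' * ?T)"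
    proof -
      have "(b' * perm_mat n u * r') * ?V = ?T"
        unfolding vr'[symmetric] using D by (simp add: mmult_assoc[of _ n] GL_inv(2)[OF v])
      then have "perm_mat n (pinv u) * (?B' * ((b' * perm_mat n u * r') * ?V)) = perm_mat n (pinv u) * (?B' * ?T)" by simp
      moreover have "perm_mat n (pinv u) * (?B' * ((b' * perm_mat n u * r') * ?V)) = r' * ?V"
        using D by (simp add: mmult_assoc[of _ n] mmult_cancel(2)[OF UT_GL[OF b']]
            mmult_cancel(2)[OF perm_mat_inv(1)[OF u(1)], unfolded perm_mat_inv(2)[OF u(1)]])
      ultimately show ?thesis by simp
    qed
    then have "x = v * ?R * matrix_unit n i (Suc i) * (perm_mat n (pinv u) * (?B' * ?T))"
      unfolding x_def y_def using D by (simp add: mmult_assoc[of _ n])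
    also have "v * ?R = b * perm_mat n w"
      unfolding vr using D by (simp add: mmult_assoc[of _ n] GL_inv(2)[OF parab_GL[OF r]])
    also have "b * perm_mat n w * matrix_unit n i (Suc i) * (perm_mat n (pinv u) * (?B' * ?T)) =
        b * (perm_mat n w * matrix_unit n i (Suc i) * perm_mat n (pinv u)) * (?B' * ?T)"
      using D by (simp add: mmult_assoc[of _ n])
    also have "perm_mat n w * matrix_unit n i (Suc i) * perm_mat n (pinv u) = matrix_unit n ?a ?q"
      using perm_matrix_unit_perm[OF w(1) u(1)] i by simp
    finally have "x $$ (k, l) = b $$ (k, ?a) * (?B' * ?T) $$ (?q, l)"
      using matrix_unit_sandwich[OF D(2) _ wn(1,2) kl, of "?B' * ?T"] D by simp
    also have "(?B' * ?T) $$ (?q, l) = ?B' $$ (?q, pinv (sigma n) l)"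
      unfolding sg_GL(2) using D wn kl by (intro mult_perm_entry permutes_inv sigma_permutes)
    finally show ?thesis .
  qed
  \<comment> \<open>the nonzero entries of \<open>x\<close> are in rows up to \<open>w i\<close> and in columns where \<open>\<sigma>\<^sup>-\<^sup>1\<close> is at least \<open>u (i + 1)\<close>\<close>
  have xz: "x $$ (k, l) = 0" if "k < n" "l < n" "l < k \<or> l = n - 1 \<or> k = n - 1" for k l
  proof (cases "k \<le> ?a \<and> ?q \<le> pinv (sigma n) l")
    case True
    then show ?thesis using key that wn by (auto simp: pinv_sigma split: if_splits)
  next
    case False
    have "pinv (sigma n) l < n" using permutes_in_image[OF permutes_inv[OF sigma_permutes]] that by blast
    then show ?thesis using UT_zero[OF b, of ?a k] UT_zero[OF B', of "pinv (sigma n) l" ?q] False that wn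
      by (auto simp: xe not_le)
  qed
  have xc: "x \<in> carrier_mat n n" using D yc by (simp add: x_def)
  show thesis
  proof (rule that[of w u p1 p2 q1 q2])
    show "p1 \<noteq> 0 \<or> p2 \<noteq> 0" using d by (auto simp: p1_def p2_def)
    show "q1 \<noteq> 0 \<or> q2 \<noteq> 0" using d' by (auto simp: q1_def q2_def)
    show "pos n (v * m) = (if m $$ (i, i) * p2 = m $$ (Suc i, i) * p1 then w else w \<circ> simple_refl i)"
      if m: "m \<in> parab n i" for m
    proof -
      have "v * m = b * perm_mat n w * (r * m)" unfolding vr using D parab_D[OF m] by (simp add: mmult_assoc[of _ n])
      moreover have "(r * m) $$ (Suc i, i) = 0 \<longleftrightarrow> m $$ (i, i) * p2 = m $$ (Suc i, i) * p1"
        by (simp add: parab_mult_entry[OF r m i] p1_def p2_def mult.commute add_eq_0_iff eq_commute[of "- _"] del: index_mult_mat)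
      ultimately show ?thesis using pos_right[OF w i b parab_mult[OF r m]] by simp
    qed
    show "pos n (?T * (v * m)) = (if m $$ (i, i) * q2 = m $$ (Suc i, i) * q1 then u else u \<circ> simple_refl i)"
      if m: "m \<in> parab n i" for m
    proof -
      have "?T * (v * m) = (?T * v) * m" using D parab_D[OF m] by (simp add: mmult_assoc[of _ n])
      also have "\<dots> = b' * perm_mat n u * (r' * m)" unfolding vr' using D parab_D[OF m] by (simp add: mmult_assoc[of _ n])
      finally have "?T * (v * m) = b' * perm_mat n u * (r' * m)" .
      moreover have "(r' * m) $$ (Suc i, i) = 0 \<longleftrightarrow> m $$ (i, i) * q2 = m $$ (Suc i, i) * q1"
        by (simp add: parab_mult_entry[OF r' m i] q1_def q2_def mult.commute add_eq_0_iff eq_commute[of "- _"] del: index_mult_mat)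
      ultimately show ?thesis using pos_right[OF u i b' parab_mult[OF r' m]] by simp
    qed
    fix t assume t: "1 + t * (p2 * q1 - p1 * q2) \<noteq> 0"
    \<comment> \<open>the factor \<open>?d\<close> clears the denominator in \<open>r\<^sup>-\<^sup>1\<close>\<close>
    let ?m = "rank_one_pert n (t * ?d) y"
    have mG: "?m \<in> carrier (GL n)"
      by (rule rank_one_pert_GL[OF yc ysq]) (use t in \<open>simp add: mult.assoc mult.commute[of ?d] \<tau>\<close>)
    have "y $$ (k, l) = 0" if "l < k" "k < n" "(k, l) \<noteq> (Suc i, i)" for k l
      using that parab_zero[OF R, of i k] parab_zero[OF r', of l "Suc i"] i
      by (cases "l < i") (auto simp: ye)
    then have mp: "?m \<in> parab n i"
      using mG yc by (auto simp: parab_def rank_one_pert_entry)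
    have me: "v * ?m * ?V = rank_one_pert n (t * ?d) x" unfolding x_def by (rule rank_one_pert_conj[OF v yc])
    have G: "v * ?m * ?V \<in> carrier (GL n)" by (intro GL_mult v mG GL_inv(1))
    show "\<exists>m \<in> parab n i. v * m * ?V \<in> UT n \<and>
       lastcol n (v * m * ?V) \<and> m $$ (i, i) = 1 - t * p1 * q2 \<and> m $$ (i, Suc i) = t * p1 * q1 \<and>
       m $$ (Suc i, i) = - t * p2 * q2 \<and> m $$ (Suc i, Suc i) = 1 + t * p2 * q1"
    proof (intro bexI[OF _ mp] conjI)
      show "v * ?m * ?V \<in> UT n" using G unfolding me by (auto simp: UT_def rank_one_pert_entry xc xz)
      show "lastcol n (v * ?m * ?V)" unfolding me lastcol_def using i by (auto simp: rank_one_pert_entry xc xz)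
    qed (use i d in \<open>simp_all add: rank_one_pert_entry yc ye parab_minv_entry[OF r i] p1_def p2_def q1_def q2_def\<close>)
  qed (use w u in auto)
qed

text \<open>The analogue for multiplication from the left by \<open>P\<^sup>K\<^sub>\<alpha>\<close>. Here \<open>m\<close> is a linear map of the plane, and
  \<open>m v\<close> has the short permutation if and only if \<open>m\<close> carries the line \<open>p\<close> to the first coordinate
  line. For the cell of \<open>\<sigma>\<^sup>-\<^sup>1 m v\<close> the block of \<open>m\<close> appears shifted by one, and the condition on the
  last column of \<open>m\<close> ensures that conjugation by \<open>\<sigma>\<close> stays in the parabolic subgroup.\<close>

lemma line_in_reference_direction:
  assumes i: "i + 2 < n" and v: "v \<in> carrier (GL n)"
  obtains w u p1 p2 q1 q2 where
    "w permutes {..<n}" "u permutes {..<n}" "pinv w i < pinv w (Suc i)" "pinv u (Suc i) < pinv u (Suc (Suc i))"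
    "p1 \<noteq> 0 \<or> p2 \<noteq> 0" "q1 \<noteq> 0 \<or> q2 \<noteq> (0 :: complex)"
    "\<And>m. m \<in> parab n i \<Longrightarrow>
       pos n (m * v) = (if m $$ (Suc i, i) * p1 + m $$ (Suc i, Suc i) * p2 = 0 then w else simple_refl i \<circ> w)"
    "\<And>m. m \<in> parab n i \<Longrightarrow> lastcol n m \<Longrightarrow>
       pos n (minv n (sg n) * (m * v)) =
         (if m $$ (Suc i, i) * q1 + m $$ (Suc i, Suc i) * q2 = 0 then u else simple_refl (Suc i) \<circ> u)"
    "\<And>t. 1 + t * (p2 * q1 - p1 * q2) \<noteq> 0 \<Longrightarrow> \<exists>m \<in> parab n i. minv n v * m * v \<in> UT n \<and>
       lastcol n m \<and> m $$ (i, i) = 1 - t * p1 * q2 \<and> m $$ (i, Suc i) = t * p1 * q1 \<and>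
       m $$ (Suc i, i) = - t * p2 * q2 \<and> m $$ (Suc i, Suc i) = 1 + t * p2 * q1"
proof -
  have i1: "i + 1 < n" and i2: "Suc i + 1 < n" using i by simp_all
  have in1: "i \<noteq> n - Suc 0" "Suc i \<noteq> n - Suc 0" using i by auto
  have v': "minv n (sg n) * v \<in> carrier (GL n)" by (intro GL_mult GL_inv(1) sg_GL v)
  obtain w c r where w: "w permutes {..<n}" "pinv w i < pinv w (Suc i)" and c: "c \<in> UT n" and r: "r \<in> parab n i"
    and vr: "v = r * perm_mat n w * c" by (rule ascent_left[OF v i1])
  obtain u c' r' where u: "u permutes {..<n}" "pinv u (Suc i) < pinv u (Suc (Suc i))" and c': "c' \<in> UT n"
    and r': "r' \<in> parab n (Suc i)"
    and vr': "minv n (sg n) * v = r' * perm_mat n u * c'" by (rule ascent_left[OF v' i2])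
  let ?C = "minv n c" and ?C' = "minv n c'" and ?R' = "minv n r'" and ?V = "minv n v" and ?T = "minv n (sg n)"
  have C: "?C \<in> UT n" and C': "?C' \<in> UT n" by (rule UT_inv, fact)+
  have R': "?R' \<in> parab n (Suc i)" by (rule parab_inv[OF r' i2])
  note D = GL_D[OF v] UT_D[OF c] UT_D[OF c'] parab_D[OF r] parab_D[OF r'] UT_D[OF C] UT_D[OF C']
    parab_D[OF R'] GL_D[OF GL_inv(1)[OF v]] GL_D[OF GL_inv(1)[OF sg_GL(1)], of n]
  let ?d = "r' $$ (Suc i, Suc i) * r' $$ (Suc (Suc i), Suc (Suc i)) - r' $$ (Suc i, Suc (Suc i)) * r' $$ (Suc (Suc i), Suc i)"
  have d': "r $$ (i, i) * r $$ (Suc i, Suc i) - r $$ (i, Suc i) * r $$ (Suc i, i) \<noteq> 0" by (rule parab_block_det[OF r i1])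
  have d: "?d \<noteq> 0" by (rule parab_block_det[OF r' i2])
  define p1 where "p1 = r $$ (i, i)"
  define p2 where "p2 = r $$ (Suc i, i)"
  define q1 where "q1 = r' $$ (Suc i, Suc i)"
  define q2 where "q2 = r' $$ (Suc (Suc i), Suc i)"
  let ?a = "pinv w i" and ?q = "pinv u (Suc (Suc i))"
  have wn: "?a < n" "?q < n"
    using permutes_in_image[OF permutes_inv[OF w(1)], of i] permutes_in_image[OF permutes_inv[OF u(1)], of "Suc (Suc i)"] i
    by simp_all
  have key: "?a \<le> ?q"
  proof (rule special_points_left[OF i _ w u r r'])
    show "c * ?C' \<in> UT n" by (rule UT_mult[OF c C'])
    have "sg n * (?T * v) * ?C' = sg n * (r' * perm_mat n u * c') * ?C'" using vr' by simp
    then have "r * perm_mat n w * c * ?C' = sg n * (r' * perm_mat n u * c') * ?C'"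
      using D by (simp add: mmult_cancel(1)[OF sg_GL(1)] flip: vr)
    then show "r * (perm_mat n w * (c * ?C')) = sg n * (r' * perm_mat n u)"
      using D GL_inv(2)[OF UT_GL[OF c']] by (simp add: mmult_assoc[of _ n])
  qed
  define y where "y = ?C * matrix_unit n ?a ?q * c'"
  have yc: "y \<in> carrier_mat n n" using D by (simp add: y_def)
  have ye: "y $$ (k, l) = ?C $$ (k, ?a) * c' $$ (?q, l)" if "k < n" "l < n" for k l
    unfolding y_def using D that wn by (intro matrix_unit_sandwich) simp_all
  define x where "x = r * matrix_unit n i (Suc (Suc i)) * (?R' * ?T)"
  have xc: "x \<in> carrier_mat n n" using D by (simp add: x_def)
  have xe: "x $$ (k, l) = r $$ (k, i) * ?R' $$ (Suc (Suc i), pinv (sigma n) l)" if kl: "k < n" "l < n" for k l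
  proof -
    have "x $$ (k, l) = r $$ (k, i) * (?R' * ?T) $$ (Suc (Suc i), l)"
      unfolding x_def using D i kl by (intro matrix_unit_sandwich) simp_all
    also have "(?R' * ?T) $$ (Suc (Suc i), l) = ?R' $$ (Suc (Suc i), pinv (sigma n) l)"
      unfolding sg_GL(2) using D i kl by (intro mult_perm_entry permutes_inv sigma_permutes) simp_all
    finally show ?thesis .
  qed
  have xv: "v * y * ?V = x"
  proof -
    have "c' * ?V = perm_mat n (pinv u) * (?R' * ?T)"
    proof -
      have "(r' * perm_mat n u * c') * ?V = ?T"
        unfolding vr'[symmetric] using D by (simp add: mmult_assoc[of _ n] GL_inv(2)[OF v])
      then have "perm_mat n (pinv u) * (?R' * ((r' * perm_mat n u * c') * ?V)) = perm_mat n (pinv u) * (?R' * ?T)" by simp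
      moreover have "perm_mat n (pinv u) * (?R' * ((r' * perm_mat n u * c') * ?V)) = c' * ?V"
        using D by (simp add: mmult_assoc[of _ n] mmult_cancel(2)[OF parab_GL[OF r']]
            mmult_cancel(2)[OF perm_mat_inv(1)[OF u(1)], unfolded perm_mat_inv(2)[OF u(1)]])
      ultimately show ?thesis by simp
    qed
    then have "v * y * ?V = v * ?C * matrix_unit n ?a ?q * (perm_mat n (pinv u) * (?R' * ?T))"
      unfolding y_def using D by (simp add: mmult_assoc[of _ n])
    also have "v * ?C = r * perm_mat n w"
      unfolding vr using D by (simp add: mmult_assoc[of _ n] GL_inv(2)[OF UT_GL[OF c]])
    also have "r * perm_mat n w * matrix_unit n ?a ?q * (perm_mat n (pinv u) * (?R' * ?T)) =
        r * (perm_mat n w * matrix_unit n ?a ?q * perm_mat n (pinv u)) * (?R' * ?T)"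
      using D by (simp add: mmult_assoc[of _ n])
    also have "perm_mat n w * matrix_unit n ?a ?q * perm_mat n (pinv u) = matrix_unit n i (Suc (Suc i))"
      using perm_matrix_unit_perm[OF w(1) u(1) wn] by (simp add: permutes_inverses[OF w(1)] permutes_inverses[OF u(1)])
    finally show ?thesis by (simp add: x_def)
  qed
  have yx: "y = ?V * x * v"
    unfolding xv[symmetric] using D yc by (simp add: mmult_assoc[of _ n] mmult_cancel(2)[OF v] GL_inv(3)[OF v])
  have xz: "x $$ (k, l) = 0" if "k < n" "l < n" "(l < k \<and> (k, l) \<noteq> (Suc i, i)) \<or> l = n - 1 \<or> k = n - 1" for k l
  proof (cases "k \<le> Suc i \<and> Suc i \<le> pinv (sigma n) l")
    case True
    then show ?thesis using that i by (auto simp: pinv_sigma split: if_splits)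
  next
    case False
    have "pinv (sigma n) l < n" using permutes_in_image[OF permutes_inv[OF sigma_permutes]] that by blast
    then show ?thesis
      using parab_zero[OF r, of i k] parab_zero[OF R', of "pinv (sigma n) l" "Suc (Suc i)"] False that i
      by (auto simp: xe not_le)
  qed
  define \<tau> where "\<tau> = (?R' * ?T * r) $$ (Suc (Suc i), i)"
  have xsq: "x * x = \<tau> \<cdot>\<^sub>m x"
    unfolding x_def \<tau>_def using D i by (intro sandwich_square) simp_all
  have Re: "?R' $$ (Suc (Suc i), Suc i) = - q2 / ?d" "?R' $$ (Suc (Suc i), Suc (Suc i)) = q1 / ?d"
    using parab_minv_entry[OF r' i2] by (simp_all add: q1_def q2_def)
  have \<tau>: "\<tau> * ?d = p2 * q1 - p1 * q2"
  proof -
    have "\<tau> = (\<Sum>l<n. (?R' * ?T) $$ (Suc (Suc i), l) * r $$ (l, i))"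
      unfolding \<tau>_def using D i by (intro mmult_entry) simp_all
    also have "\<dots> = (\<Sum>l<n. ?R' $$ (Suc (Suc i), pinv (sigma n) l) * r $$ (l, i))"
      unfolding sg_GL(2) by (rule sum.cong)
        (use D i in \<open>simp_all add: mult_perm_entry[OF _ permutes_inv[OF sigma_permutes]] del: index_mult_mat\<close>)
    also have "\<dots> = (\<Sum>l\<in>{i, Suc i}. ?R' $$ (Suc (Suc i), pinv (sigma n) l) * r $$ (l, i))"
    proof (rule sum.mono_neutral_right)
      show "\<forall>l\<in>{..<n} - {i, Suc i}. ?R' $$ (Suc (Suc i), pinv (sigma n) l) * r $$ (l, i) = 0"
      proof
        fix l assume l: "l \<in> {..<n} - {i, Suc i}"
        show "?R' $$ (Suc (Suc i), pinv (sigma n) l) * r $$ (l, i) = 0"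
          using parab_zero[OF r, of i l] parab_zero[OF R', of "pinv (sigma n) l" "Suc (Suc i)"] l i
          by (cases "l < i") (auto simp: pinv_sigma)
      qed
    qed (use i in auto)
    also have "\<dots> = ?R' $$ (Suc (Suc i), Suc i) * p1 + ?R' $$ (Suc (Suc i), Suc (Suc i)) * p2"
      using i in1 by (simp add: pinv_sigma p1_def p2_def)
    finally show ?thesis using d unfolding Re by (simp add: divide_simps)
  qed
  show thesis
  proof (rule that[of w u p1 p2 q1 q2])
    show "p1 \<noteq> 0 \<or> p2 \<noteq> 0" using d' by (auto simp: p1_def p2_def)
    show "q1 \<noteq> 0 \<or> q2 \<noteq> 0" using d by (auto simp: q1_def q2_def)
    show "pos n (m * v) = (if m $$ (Suc i, i) * p1 + m $$ (Suc i, Suc i) * p2 = 0 then w else simple_refl i \<circ> w)"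
      if m: "m \<in> parab n i" for m
    proof -
      have "m * v = (m * r) * perm_mat n w * c" unfolding vr using D parab_D[OF m] by (simp add: mmult_assoc[of _ n])
      then show ?thesis using pos_left[OF w i1 c parab_mult[OF m r]]
        by (simp add: parab_mult_entry[OF m r i1] p1_def p2_def del: index_mult_mat)
    qed
    show "pos n (?T * (m * v)) =
         (if m $$ (Suc i, i) * q1 + m $$ (Suc i, Suc i) * q2 = 0 then u else simple_refl (Suc i) \<circ> u)"
      if m: "m \<in> parab n i" "lastcol n m" for m
    proof -
      let ?M = "?T * m * sg n"
      have Me: "?M $$ (k, l) = m $$ (sigma n k, sigma n l)" if "k < n" "l < n" for k l
      proof -
        have sk: "sigma n l < n" using permutes_in_image[OF sigma_permutes] that by blast
        have "?M $$ (k, l) = (?T * m) $$ (k, sigma n l)"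
          using D parab_D[OF m(1)] that by (intro mult_perm_entry sigma_permutes) simp_all
        also have "\<dots> = m $$ (pinv (pinv (sigma n)) k, sigma n l)"
          unfolding sg_GL(2) using parab_D[OF m(1)] that sk by (intro perm_mult_entry' permutes_inv sigma_permutes)
        finally show ?thesis by (simp add: inv_inv_eq permutes_bij[OF sigma_permutes])
      qed
      have M: "?M \<in> parab n (Suc i)"
      proof -
        have "?M $$ (k, l) = 0" if "l < k" "k < n" "(k, l) \<noteq> (Suc (Suc i), Suc i)" for k l
          using that m(2) parab_zero[OF m(1), of "l - 1" "k - 1"] i
          by (cases l) (auto simp: Me sigma_def lastcol_def simp del: index_mult_mat)
        moreover have "?M \<in> carrier (GL n)" by (intro GL_mult GL_inv(1) sg_GL(1) parab_GL[OF m(1)])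
        ultimately show ?thesis by (auto simp: parab_def)
      qed
      have "?T * (m * v) = ?M * (?T * v)"
        using D parab_D[OF m(1)] by (simp add: mmult_assoc[of _ n] mmult_cancel(1)[OF sg_GL(1)])
      also have "\<dots> = (?M * r') * perm_mat n u * c'"
        unfolding vr' using D parab_D[OF M] by (simp add: mmult_assoc[of _ n])
      finally have "pos n (?T * (m * v)) = (if (?M * r') $$ (Suc (Suc i), Suc i) = 0 then u else simple_refl (Suc i) \<circ> u)"
        using pos_left[OF u i2 c' parab_mult[OF M r']] by simp
      moreover have "(?M * r') $$ (Suc (Suc i), Suc i) = m $$ (Suc i, i) * q1 + m $$ (Suc i, Suc i) * q2"
        using i by (simp add: parab_mult_entry[OF M r' i2] Me sigma_def q1_def q2_def del: index_mult_mat)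
      ultimately show ?thesis by simp
    qed
    fix t assume t: "1 + t * (p2 * q1 - p1 * q2) \<noteq> 0"
    let ?m = "rank_one_pert n (t * ?d) x"
    have mG: "?m \<in> carrier (GL n)"
      by (rule rank_one_pert_GL[OF xc xsq]) (use t in \<open>simp add: mult.assoc mult.commute[of ?d] \<tau>\<close>)
    have mp: "?m \<in> parab n i"
      using mG by (auto simp: parab_def rank_one_pert_entry xc xz)
    have me: "?V * ?m * v = rank_one_pert n (t * ?d) y"
      using rank_one_pert_conj[OF GL_inv(1)[OF v] xc] by (simp add: yx minv_minv[OF v])
    have G: "?V * ?m * v \<in> carrier (GL n)" by (intro GL_mult v mG GL_inv(1))
    have yz: "y $$ (k, l) = 0" if "l < k" "k < n" for k l
      using that key wn UT_zero[OF C, of ?a k] UT_zero[OF c', of l ?q] by (cases "k \<le> ?a") (auto simp: ye)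
    show "\<exists>m \<in> parab n i. ?V * m * v \<in> UT n \<and>
       lastcol n m \<and> m $$ (i, i) = 1 - t * p1 * q2 \<and> m $$ (i, Suc i) = t * p1 * q1 \<and>
       m $$ (Suc i, i) = - t * p2 * q2 \<and> m $$ (Suc i, Suc i) = 1 + t * p2 * q1"
    proof (intro bexI[OF _ mp] conjI)
      show "?V * ?m * v \<in> UT n" using G unfolding me by (auto simp: UT_def rank_one_pert_entry yc yz)
      show "lastcol n ?m" unfolding lastcol_def using i by (auto simp: rank_one_pert_entry xc xz)
    qed (use i d in1 in \<open>simp_all add: rank_one_pert_entry xc xe pinv_sigma Re p1_def p2_def\<close>)
  qed (use w u in auto)
qed

section \<open>Bruhat cells and regular functions\<close>

text \<open>For \<open>w(k) < w(l)\<close> with \<open>k < l\<close>, the closure of the cell of \<open>w\<close> does not meet the cell of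
  \<open>w' = w \<circ> (k l)\<close>. The separating function is the determinant of the first \<open>k + 1\<close> columns
  of \<open>g\<close> followed by the columns \<open>e\<^bsub>w'(j)\<^esub>\<close> for \<open>j > k\<close>. On the cell of \<open>w\<close> it is the
  determinant of a triangular matrix with a zero on the diagonal.\<close>

lemma cell_separating_function:
  assumes w: "w permutes {..<n}" and kl: "k < l" "l < n" "w k < w l"
    and g0: "in_cell n (w \<circ> Transposition.transpose k l) g0"
  obtains f where "regular n f" "f g0 \<noteq> 0" "\<And>g. in_cell n w g \<Longrightarrow> f g = 0"
proof -
  let ?s = "Transposition.transpose k l"
  define w' where "w' = w \<circ> ?s"
  have s: "?s permutes {..<n}" using kl by (intro permutes_swap_id) auto
  have w': "w' permutes {..<n}" unfolding w'_def by (rule permutes_compose[OF s w])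
  have w'k: "w' k = w l" and w'j: "\<And>j. j < k \<Longrightarrow> w' j = w j" using kl by (auto simp: w'_def transpose_def)
  \<comment> \<open>the first \<open>k + 1\<close> columns of \<open>g\<close>, completed by basis vectors\<close>
  define N where "N g = mat n n (\<lambda>(r, j). if j \<le> k then g $$ (r, j) else if r = w' j then 1 else 0)"
    for g :: "complex mat"
  have Nc: "N g \<in> carrier_mat n n" for g by (simp add: N_def)
  have regN: "regular n (\<lambda>g. det (N g))"
  proof (rule regular_det[OF Nc])
    fix i j assume ij: "i < n" "j < n"
    show "regular n (\<lambda>A. N A $$ (i, j))"
    proof (cases "j \<le> k")
      case True
      then show ?thesis using ij by (simp add: N_def regular_entry)
    next
      case False
      then show ?thesis using ij by (simp add: N_def)
    qed
  qed
  have zero: "det (N g) = 0" if g: "in_cell n w g" for g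
  proof -
    obtain b c where b: "b \<in> UT n" and c: "c \<in> UT n" and gb: "g = b * perm_mat n w * c"
      using g by (auto simp: in_cell_def)
    let ?B = "minv n b"
    have B: "?B \<in> UT n" by (rule UT_inv[OF b])
    note D = UT_D[OF b] UT_D[OF c] UT_D[OF B]
    define Z where "Z = mat n n (\<lambda>(r, j). if pinv w' j < k then (if r = j then 1 else 0)
        else if pinv w' j = k then (if r = w k then 1 else 0) else ?B $$ (r, j))"
    have Zc: "Z \<in> carrier_mat n n" by (simp add: Z_def)
    define C where "C = mat n n (\<lambda>(r, j). if j \<le> k then c $$ (r, j) else if r = j then 1 else 0)"
    have Cc: "C \<in> carrier_mat n n" by (simp add: C_def)
    have Zw: "(Z * perm_mat n w') $$ (r, j) = (if j < k then (if r = w j then 1 else 0)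
        else if j = k then (if r = w k then 1 else 0) else ?B $$ (r, w' j))" if "r < n" "j < n" for r j
    proof -
      have "w' j < n" using permutes_in_image[OF w'] that by blast
      then show ?thesis using that Zc by (subst mult_perm_entry[OF Zc w']) (auto simp: Z_def permutes_inverses(2)[OF w'] w'j)
    qed
    have bZw: "(b * (Z * perm_mat n w')) $$ (r, j) = (if j \<le> k then b $$ (r, w j) else if r = w' j then 1 else 0)"
      if rj: "r < n" "j < n" for r j
    proof -
      have wj: "w j < n" "w' j < n" using permutes_in_image[OF w] permutes_in_image[OF w'] rj by blast+
      have "(b * (Z * perm_mat n w')) $$ (r, j) = (\<Sum>m<n. b $$ (r, m) * (Z * perm_mat n w') $$ (m, j))"
        using D Zc rj by (intro mmult_entry) simp_all
      also have "\<dots> = (if j \<le> k then b $$ (r, w j) else if r = w' j then 1 else 0)"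
      proof (cases "j \<le> k")
        case True
        then have "(\<Sum>m<n. b $$ (r, m) * (Z * perm_mat n w') $$ (m, j)) = (\<Sum>m<n. if m = w j then b $$ (r, w j) else 0)"
          by (intro sum.cong) (use rj in \<open>auto simp: Zw simp del: index_mult_mat\<close>)
        then show ?thesis using True wj by simp
      next
        case False
        then have "(\<Sum>m<n. b $$ (r, m) * (Z * perm_mat n w') $$ (m, j)) = (\<Sum>m<n. b $$ (r, m) * ?B $$ (m, w' j))"
          by (intro sum.cong) (use rj in \<open>auto simp: Zw simp del: index_mult_mat\<close>)
        also have "\<dots> = (b * ?B) $$ (r, w' j)" using D rj wj by (intro mmult_entry[symmetric]) simp_all
        also have "b * ?B = 1\<^sub>m n" by (rule GL_inv(2)[OF UT_GL[OF b]])
        finally show ?thesis using False rj wj by simp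
      qed
      finally show ?thesis .
    qed
    have "N g = b * (Z * perm_mat n w') * C"
    proof (rule eq_matI)
      fix r j assume "r < dim_row (b * (Z * perm_mat n w') * C)" "j < dim_col (b * (Z * perm_mat n w') * C)"
      then have rj: "r < n" "j < n" using D Cc by simp_all
      have *: "(b * (Z * perm_mat n w') * C) $$ (r, j) = (\<Sum>m<n. (b * (Z * perm_mat n w')) $$ (r, m) * C $$ (m, j))"
        using D Zc Cc rj by (intro mmult_entry) simp_all
      show "N g $$ (r, j) = (b * (Z * perm_mat n w') * C) $$ (r, j)"
      proof (cases "j \<le> k")
        case True
        have "N g $$ (r, j) = (b * perm_mat n w * c) $$ (r, j)" using True rj by (simp add: N_def gb)
        also have "\<dots> = (\<Sum>m<n. (b * perm_mat n w) $$ (r, m) * c $$ (m, j))"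
          using D rj by (intro mmult_entry) simp_all
        also have "\<dots> = (\<Sum>m<n. (b * (Z * perm_mat n w')) $$ (r, m) * C $$ (m, j))"
        proof (rule sum.cong)
          fix m assume "m \<in> {..<n}"
          then show "(b * perm_mat n w) $$ (r, m) * c $$ (m, j) = (b * (Z * perm_mat n w')) $$ (r, m) * C $$ (m, j)"
            using True rj D UT_zero[OF c, of j m]
            by (cases "m \<le> k") (simp_all add: bZw mult_perm_entry[OF D(1) w] C_def del: index_mult_mat)
        qed simp
        finally show ?thesis unfolding * .
      next
        case False
        have "(\<Sum>m<n. (b * (Z * perm_mat n w')) $$ (r, m) * C $$ (m, j)) =
            (\<Sum>m<n. if m = j then (b * (Z * perm_mat n w')) $$ (r, j) else 0)"
          by (rule sum.cong) (use False rj in \<open>auto simp: C_def simp del: index_mult_mat\<close>)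
        then show ?thesis unfolding * using False rj by (simp add: bZw N_def del: index_mult_mat)
      qed
    qed (use D Cc in \<open>simp_all add: N_def\<close>)
    moreover have "det Z = 0"
    proof -
      have "Z $$ (r, j) = 0" if "j < r" "r < n" for r j
      proof -
        have "pinv w' j = k \<Longrightarrow> j = w l"
          using permutes_inverses(1)[OF w', of j] w'k by auto
        then show ?thesis using that kl UT_zero[OF B that] by (auto simp: Z_def)
      qed
      moreover have "Z $$ (w l, w l) = 0"
      proof -
        have "w l < n" using permutes_in_image[OF w, of l] kl by simp
        moreover have "pinv w' (w l) = k" using permutes_inverses(2)[OF w', of k] w'k by simp
        ultimately show ?thesis using kl by (simp add: Z_def)
      qed
      moreover have "w l < n" using permutes_in_image[OF w, of l] kl by simp
      ultimately show ?thesis using triangular_det[OF Zc] by blast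
    qed
    ultimately show ?thesis using D Zc Cc by (simp add: det_mult[of _ n])
  qed
  obtain b0 c0 where b0: "b0 \<in> UT n" and c0: "c0 \<in> UT n" and g0e: "g0 = b0 * perm_mat n w' * c0"
    using g0 unfolding w'_def[symmetric] by (auto simp: in_cell_def)
  note B0 = UT_inv[OF b0] and C0 = UT_inv[OF c0]
  note D = UT_D[OF b0] UT_D[OF c0] UT_D[OF B0] UT_D[OF C0]
  show thesis
  proof (rule that[of "\<lambda>g. det (N (minv n b0 * g * minv n c0))"])
    show "regular n (\<lambda>g. det (N (minv n b0 * g * minv n c0)))"
      by (rule regular_translate[OF regN D(3,4)])
    have "minv n b0 * g0 * minv n c0 = perm_mat n w'"
      unfolding g0e using D
      by (simp add: mmult_assoc[of _ n] mmult_cancel(2)[OF UT_GL[OF b0]] GL_inv(2)[OF UT_GL[OF c0]])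
    moreover have "N (perm_mat n w') = perm_mat n w'"
      by (rule eq_matI) (auto simp: N_def perm_mat_def)
    ultimately show "det (N (minv n b0 * g0 * minv n c0)) \<noteq> 0"
      using perm_mat_inv(1)[OF w'] by (simp add: carrier_GL)
    show "det (N (minv n b0 * g * minv n c0)) = 0" if "in_cell n w g" for g
      by (rule zero[OF in_cell_mult[OF that B0 C0]])
  qed
qed

section \<open>Flags as cosets\<close>

text \<open>The span of the first \<open>i + 1\<close> basis vectors, described by coordinates.\<close>

definition std_subspace :: "nat \<Rightarrow> nat \<Rightarrow> complex vec set" where
  "std_subspace n i = {x \<in> carrier_vec n. \<forall>j. i < j \<longrightarrow> j < n \<longrightarrow> x $ j = 0}"

lemma mult_mat_vec_entry:
  assumes "g \<in> carrier_mat n n" "x \<in> carrier_vec n" "k < n"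
  shows "(g *\<^sub>v x) $ k = (\<Sum>j<n. g $$ (k, j) * x $ j)"
  using assms by (simp add: scalar_prod_def lessThan_atLeast0)

lemma submoduleI:
  assumes "W \<subseteq> carrier_vec n" "0\<^sub>v n \<in> W" "\<And>x y. x \<in> W \<Longrightarrow> y \<in> W \<Longrightarrow> x + y \<in> W"
    "\<And>c x. x \<in> W \<Longrightarrow> c \<cdot>\<^sub>v x \<in> W"
  shows "submodule class_ring W (Cn n)"
proof -
  interpret vec_space "TYPE(complex)" n .
  show ?thesis
    using assms by unfold_locales (auto simp: module_vec_simps class_ring_simps)
qed

lemma submoduleD:
  assumes "submodule class_ring W (Cn n)"
  shows "W \<subseteq> carrier_vec n" "0\<^sub>v n \<in> W" "x \<in> W \<Longrightarrow> y \<in> W \<Longrightarrow> x + y \<in> W" "x \<in> W \<Longrightarrow> c \<cdot>\<^sub>v x \<in> W"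
  using submodule.subset[OF assms] submodule.zero_closed[OF assms] submodule.m_closed[OF assms]
    submodule.smult_closed[OF assms, of c] by (auto simp: module_vec_simps class_ring_simps)

lemma image_std_subspace_submodule:
  assumes "g \<in> carrier_mat n n"
  shows "submodule class_ring ((*\<^sub>v) g ` std_subspace n i) (Cn n)"
proof (rule submoduleI)
  show "(*\<^sub>v) g ` std_subspace n i \<subseteq> carrier_vec n" using assms by (auto simp: std_subspace_def)
  have "0\<^sub>v n \<in> std_subspace n i" by (simp add: std_subspace_def)
  then have "g *\<^sub>v 0\<^sub>v n \<in> (*\<^sub>v) g ` std_subspace n i" by blast
  also have "g *\<^sub>v 0\<^sub>v n = 0\<^sub>v n" using assms by (intro eq_vecI) auto
  finally show "0\<^sub>v n \<in> (*\<^sub>v) g ` std_subspace n i" .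
next
  fix x y assume "x \<in> (*\<^sub>v) g ` std_subspace n i" "y \<in> (*\<^sub>v) g ` std_subspace n i"
  then obtain x' y' where "x' \<in> std_subspace n i" "y' \<in> std_subspace n i" "x = g *\<^sub>v x'" "y = g *\<^sub>v y'" by blast
  moreover from this have "x' + y' \<in> std_subspace n i" "x + y = g *\<^sub>v (x' + y')"
    using mult_add_distrib_mat_vec[OF assms, of x' y'] by (auto simp: std_subspace_def)
  ultimately show "x + y \<in> (*\<^sub>v) g ` std_subspace n i" by blast
next
  fix c x assume "x \<in> (*\<^sub>v) g ` std_subspace n i"
  then obtain x' where "x' \<in> std_subspace n i" "x = g *\<^sub>v x'" by blast
  moreover from this have "c \<cdot>\<^sub>v x' \<in> std_subspace n i" "c \<cdot>\<^sub>v x = g *\<^sub>v (c \<cdot>\<^sub>v x')"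
    using mult_mat_vec[OF assms, of x' c] by (auto simp: std_subspace_def)
  ultimately show "c \<cdot>\<^sub>v x \<in> (*\<^sub>v) g ` std_subspace n i" by blast
qed

lemma image_std_subspace_subset:
  assumes g: "g \<in> carrier_mat n n" and W: "submodule class_ring W (Cn n)"
    and cols: "\<And>k. k \<le> i \<Longrightarrow> k < n \<Longrightarrow> col g k \<in> W"
  shows "(*\<^sub>v) g ` std_subspace n i \<subseteq> W"
proof
  fix y assume "y \<in> (*\<^sub>v) g ` std_subspace n i"
  then obtain x where x: "x \<in> std_subspace n i" "y = g *\<^sub>v x" by blast
  note Wd = submoduleD[OF W]
  define part where "part m = vec n (\<lambda>r. \<Sum>j<m. g $$ (r, j) * x $ j)" for m
  have "part m \<in> W" if "m \<le> n" for m
    using that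
  proof (induction m)
    case 0
    have "part 0 = 0\<^sub>v n" by (intro eq_vecI) (auto simp: part_def)
    then show ?case using Wd(2) by simp
  next
    case (Suc m)
    have "part (Suc m) = part m + x $ m \<cdot>\<^sub>v col g m"
      using g Suc(2) by (intro eq_vecI) (auto simp: part_def mult.commute)
    moreover have "x $ m \<cdot>\<^sub>v col g m \<in> W"
    proof (cases "m \<le> i")
      case True
      then show ?thesis using Suc(2) cols Wd(4) by simp
    next
      case False
      then have "x $ m \<cdot>\<^sub>v col g m = 0\<^sub>v n"
        using x(1) Suc(2) g by (intro eq_vecI) (auto simp: std_subspace_def)
      then show ?thesis using Wd(2) by simp
    qed
    ultimately show ?case using Suc Wd(3) by simp
  qed
  moreover have "y = part n"
    unfolding x(2) part_def using g x(1)
    by (intro eq_vecI) (auto simp: std_subspace_def mult_mat_vec_entry simp del: index_mult_mat_vec)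
  ultimately show "y \<in> W" by simp
qed

lemma col_in_image_std_subspace:
  assumes "g \<in> carrier_mat n n" "k \<le> i" "k < n"
  shows "col g k \<in> (*\<^sub>v) g ` std_subspace n i"
proof
  show "col g k = g *\<^sub>v unit_vec n k"
    using assms by (intro eq_vecI) auto
  show "unit_vec n k \<in> std_subspace n i" using assms by (auto simp: std_subspace_def)
qed

lemma span_cols:
  assumes g: "g \<in> carrier_mat n n" and i: "i < n"
  shows "LinearCombinations.module.span class_ring (Cn n) (col g ` {..i}) = (*\<^sub>v) g ` std_subspace n i"
proof -
  interpret vec_space "TYPE(complex)" n .
  have c: "col g ` {..i} \<subseteq> carrier_vec n" using g by auto
  show ?thesis
  proof
    show "span (col g ` {..i}) \<subseteq> (*\<^sub>v) g ` std_subspace n i"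
      by (rule span_is_subset[OF _ image_std_subspace_submodule[OF g]]) (use g i in \<open>auto intro: col_in_image_std_subspace\<close>)
    show "(*\<^sub>v) g ` std_subspace n i \<subseteq> span (col g ` {..i})"
      by (rule image_std_subspace_subset[OF g span_is_submodule[OF c]]) (use c in \<open>auto intro: span_mem\<close>)
  qed
qed

lemma spanned_flag_cols:
  assumes "g \<in> carrier_mat n n" "\<And>k. k < n \<Longrightarrow> v k = col g k"
  shows "spanned_flag n v = map (\<lambda>i. (*\<^sub>v) g ` std_subspace n i) [0..<n]"
  unfolding spanned_flag_def
proof (rule map_cong[OF refl])
  fix i assume "i \<in> set [0..<n]"
  then have i: "i < n" by simp
  then have "v ` {..i} = col g ` {..i}" using assms(2) by (intro image_cong) auto
  then show "LinearCombinations.module.span class_ring (Cn n) (v ` {..i}) = (*\<^sub>v) g ` std_subspace n i"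
    using span_cols[OF assms(1) i] by simp
qed

lemma E_plus_std_subspace: "E_plus n = map (std_subspace n) [0..<n]"
proof -
  have "(*\<^sub>v) (1\<^sub>m n) ` std_subspace n i = std_subspace n i" for i by (force simp: std_subspace_def)
  then show ?thesis
    unfolding E_plus_def by (subst spanned_flag_cols[of "1\<^sub>m n"]) auto
qed

abbreviation flag_of :: "nat \<Rightarrow> complex mat \<Rightarrow> flag" where
  "flag_of n g \<equiv> flag_act g (E_plus n)"

lemma flag_of_eq: "flag_of n g = map (\<lambda>i. (*\<^sub>v) g ` std_subspace n i) [0..<n]"
  by (simp add: flag_act_def E_plus_std_subspace comp_def)

lemma flag_of_one [simp]: "flag_of n (1\<^sub>m n) = E_plus n"
proof -
  have "(*\<^sub>v) (1\<^sub>m n) ` std_subspace n i = std_subspace n i" for i by (force simp: std_subspace_def)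
  then show ?thesis unfolding flag_of_eq by (simp add: E_plus_std_subspace)
qed

lemma flag_act_flag_of:
  assumes "g \<in> carrier_mat n n" "h \<in> carrier_mat n n"
  shows "flag_act g (flag_of n h) = flag_of n (g * h)"
proof -
  have "(*\<^sub>v) g ` (*\<^sub>v) h ` std_subspace n i = (*\<^sub>v) (g * h) ` std_subspace n i" for i
    unfolding image_image using assms by (intro image_cong) (auto simp: std_subspace_def assoc_mult_mat_vec[of _ n n _ n])
  then show ?thesis unfolding flag_of_eq by (simp add: flag_act_def comp_def)
qed

lemma E_star_eq: "n \<ge> 1 \<Longrightarrow> E_star n = flag_of n (sg n)"
  unfolding E_star_def flag_of_eq
  by (rule spanned_flag_cols) (auto intro!: eq_vecI simp: perm_mat_def sigma_def)

lemma flag_of_UT: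
  assumes "g \<in> carrier (GL n)"
  shows "flag_of n g = E_plus n \<longleftrightarrow> g \<in> UT n"
proof -
  have g: "g \<in> carrier_mat n n" using assms by (rule GL_D)
  have sub: "(*\<^sub>v) h ` std_subspace n i \<subseteq> std_subspace n i" if h: "h \<in> UT n" for h i
  proof
    fix y assume "y \<in> (*\<^sub>v) h ` std_subspace n i"
    then obtain x where x: "x \<in> carrier_vec n" "\<And>j. i < j \<Longrightarrow> j < n \<Longrightarrow> x $ j = 0" "y = h *\<^sub>v x"
      by (auto simp: std_subspace_def)
    have "(\<Sum>j<n. h $$ (k, j) * x $ j) = 0" if "i < k" "k < n" for k
      by (intro sum.neutral ballI) (use x(2) UT_zero[OF h, of _ k] that in \<open>metis lessThan_iff less_trans linorder_not_less mult_eq_0_iff nat_less_le\<close>)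
    then show "y \<in> std_subspace n i"
      using x UT_D[OF h] by (auto simp: std_subspace_def mult_mat_vec_entry simp del: index_mult_mat_vec)
  qed
  show ?thesis
  proof
    assume E: "flag_of n g = E_plus n"
    have "g $$ (k, l) = 0" if "l < k" "k < n" for k l
    proof -
      have "col g l \<in> (*\<^sub>v) g ` std_subspace n l" using that by (intro col_in_image_std_subspace[OF g]) auto
      also have "\<dots> = std_subspace n l"
        using arg_cong[OF E, of "\<lambda>F. F ! l"] that unfolding flag_of_eq by (simp add: E_plus_std_subspace)
      finally have "col g l $ k = 0" using that by (auto simp: std_subspace_def)
      then show ?thesis using that g by simp
    qed
    then show "g \<in> UT n" using assms by (simp add: UT_def)
  next
    assume U: "g \<in> UT n"
    have "(*\<^sub>v) g ` std_subspace n i = std_subspace n i" for i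
    proof
      show "(*\<^sub>v) g ` std_subspace n i \<subseteq> std_subspace n i" by (rule sub[OF U])
      show "std_subspace n i \<subseteq> (*\<^sub>v) g ` std_subspace n i"
      proof
        fix x assume x: "x \<in> std_subspace n i"
        have "minv n g *\<^sub>v x \<in> std_subspace n i" using sub[OF UT_inv[OF U]] x by blast
        moreover have "x = g *\<^sub>v (minv n g *\<^sub>v x)"
        proof -
          have "x = (g * minv n g) *\<^sub>v x" using x GL_inv(2)[OF assms] by (simp add: std_subspace_def)
          then show ?thesis using x g GL_D[OF GL_inv(1)[OF assms]]
            by (simp add: assoc_mult_mat_vec[of _ n n _ n] std_subspace_def)
        qed
        ultimately show "x \<in> (*\<^sub>v) g ` std_subspace n i" by (rule rev_image_eqI)
      qed
    qed
    then show "flag_of n g = E_plus n" unfolding flag_of_eq by (simp add: E_plus_std_subspace)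
  qed
qed

lemma flag_of_eq_iff:
  assumes "g \<in> carrier (GL n)" "h \<in> carrier (GL n)"
  shows "flag_of n g = flag_of n h \<longleftrightarrow> (\<exists>b \<in> UT n. h = g * b)"
proof
  assume E: "flag_of n g = flag_of n h"
  note D = GL_D[OF assms(1)] GL_D[OF assms(2)] GL_D[OF GL_inv(1)[OF assms(1)]]
  have "flag_of n (minv n g * h) = flag_act (minv n g) (flag_of n g)"
    using D by (simp add: E flag_act_flag_of)
  also have "\<dots> = E_plus n" using D GL_inv(3)[OF assms(1)] by (simp add: flag_act_flag_of)
  finally have "minv n g * h \<in> UT n"
    using flag_of_UT[OF GL_mult[OF GL_inv(1)[OF assms(1)] assms(2)]] by simp
  moreover have "h = g * (minv n g * h)" using mmult_cancel(1)[OF assms(1) D(2)] by simp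
  ultimately show "\<exists>b \<in> UT n. h = g * b" by blast
next
  assume "\<exists>b \<in> UT n. h = g * b"
  then obtain b where b: "b \<in> UT n" "h = g * b" by blast
  have "flag_of n h = flag_act g (flag_of n b)"
    using b GL_D[OF assms(1)] UT_D by (simp add: flag_act_flag_of)
  also have "flag_of n b = E_plus n" using flag_of_UT[OF UT_GL[OF b(1)]] b(1) by simp
  finally show "flag_of n g = flag_of n h" by simp
qed

lemma cols_basis:
  assumes g: "g \<in> carrier (GL n)" and i: "i < n"
  shows "card (col g ` {..i}) = Suc i" "\<not> LinearCombinations.module.lin_dep class_ring (Cn n) (col g ` {..i})"
proof -
  interpret vec_space "TYPE(complex)" n .
  have gc: "g \<in> carrier_mat n n" and d: "det g \<noteq> 0" using g by (auto simp: carrier_GL)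
  have "inj_on (col g) {..i}"
  proof (rule inj_onI)
    fix k l assume "k \<in> {..i}" "l \<in> {..i}" "col g k = col g l"
    then show "k = l" using det_identical_columns[OF gc, of k l] d i by auto
  qed
  then show "card (col g ` {..i}) = Suc i" by (simp add: card_image)
  have "lin_indpt (set (cols g))" using lin_dep_cols_imp_det_0[OF gc] d by blast
  moreover have "col g ` {..i} \<subseteq> set (cols g)" using gc i by (auto simp: cols_def)
  ultimately show "lin_indpt (col g ` {..i})" by (rule subset_li_is_li)
qed

lemma flag_of_flags:
  assumes g: "g \<in> carrier (GL n)"
  shows "flag_of n g \<in> flags n"
proof -
  interpret vec_space "TYPE(complex)" n .
  have gc: "g \<in> carrier_mat n n" using g by (rule GL_D)
  have "subspace class_ring ((*\<^sub>v) g ` std_subspace n i) V" for i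
    using image_std_subspace_submodule[OF gc] vec_vs by (simp add: subspace_def class_field_def)
  moreover have "vectorspace.dim class_ring (vs ((*\<^sub>v) g ` std_subspace n i)) = Suc i" if i: "i < n" for i
  proof -
    let ?W = "(*\<^sub>v) g ` std_subspace n i" and ?A = "col g ` {..i}"
    have sm: "submodule class_ring ?W V" by (rule image_std_subspace_submodule[OF gc])
    interpret W: vectorspace class_ring "vs ?W"
      by (rule subspace_is_vs) (use calculation in blast)
    have sub: "?A \<subseteq> ?W" using col_in_image_std_subspace[OF gc] i by auto
    have "W.basis ?A"
      unfolding W.basis_def
      using span_li_not_depend[OF sub sm] cols_basis(2)[OF g i] span_cols[OF gc i] sub by simp
    then show ?thesis using W.dim_basis[of ?A] cols_basis(1)[OF g i] by simp
  qed
  moreover have "(*\<^sub>v) g ` std_subspace n i \<subseteq> (*\<^sub>v) g ` std_subspace n (Suc i)" for i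
    by (rule image_mono) (auto simp: std_subspace_def)
  ultimately show ?thesis unfolding flags_def flag_of_eq by (simp del: image_subset_iff)
qed

text \<open>Choose a vector in each step of the flag outside of the preceding one. These vectors form a basis.\<close>

lemma flags_flag_of:
  assumes F: "F \<in> flags n"
  obtains g where "g \<in> carrier (GL n)" "F = flag_of n g"
proof -
  interpret vec_space "TYPE(complex)" n .
  have len: "length F = n" and sub: "\<And>i. i < n \<Longrightarrow> subspace class_ring (F ! i) V"
    and dim: "\<And>i. i < n \<Longrightarrow> vectorspace.dim class_ring (vs (F ! i)) = Suc i"
    and mono: "\<And>i. Suc i < n \<Longrightarrow> F ! i \<subseteq> F ! Suc i"
    using F by (auto simp: flags_def)
  have sm: "submodule class_ring (F ! i) V" if "i < n" for i
    using sub[OF that] by (simp add: subspace_def)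
  define prev where "prev i = (if i = 0 then {0\<^sub>v n} else F ! (i - 1))" for i
  have zero_dim: "F ! 0 \<noteq> {0\<^sub>v n}" if "0 < n"
  proof
    assume z: "F ! 0 = {0\<^sub>v n}"
    interpret W: vectorspace class_ring "vs (F ! 0)" by (rule subspace_is_vs[OF sub[OF that]])
    have e: "{} \<subseteq> F ! 0" by simp
    have "W.span {} = {0\<^sub>v n}"
      using span_li_not_depend(1)[OF e sm[OF that]] span_empty by simp
    then have "W.gen_set {}" by (simp add: z)
    then have "W.dim \<le> 0" using W.gen_ge_dim[of "{}"] by simp
    then show False using dim[OF that] by simp
  qed
  have "\<exists>x. x \<in> F ! i \<and> x \<notin> prev i" if i: "i < n" for i
  proof (cases i)
    case 0
    then show ?thesis using zero_dim i submoduleD(2)[OF sm[OF i]] by (auto simp: prev_def)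
  next
    case (Suc j)
    then have "F ! j \<noteq> F ! i" using dim[of j] dim[of i] i by auto
    then show ?thesis using mono[of j] Suc i by (auto simp: prev_def)
  qed
  then obtain x where x: "\<And>i. i < n \<Longrightarrow> x i \<in> F ! i" "\<And>i. i < n \<Longrightarrow> x i \<notin> prev i" by metis
  have Fc: "F ! i \<subseteq> carrier_vec n" if "i < n" for i by (rule submoduleD(1)[OF sm[OF that]])
  have mono': "F ! i \<subseteq> F ! j" if "i \<le> j" "j < n" for i j
    using that
  proof (induction j)
    case (Suc j)
    then show ?case using mono[of j] by (cases "i = Suc j") auto
  qed simp
  define g where "g = mat n n (\<lambda>(r, k). x k $ r)"
  have gc: "g \<in> carrier_mat n n" by (simp add: g_def)
  have colg: "col g k = x k" if "k < n" for k
    using that x(1)[OF that] Fc[OF that] by (intro eq_vecI) (auto simp: g_def)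
  have det: "det g \<noteq> 0"
  proof
    assume "det g = 0"
    then obtain z where z: "z \<in> carrier_vec n" "z \<noteq> 0\<^sub>v n" "g *\<^sub>v z = 0\<^sub>v n"
      using det_0_iff_vec_prod_zero[OF gc] by blast
    have "{j. j < n \<and> z $ j \<noteq> 0} \<noteq> {}"
      using z(1,2) by (metis (mono_tags, lifting) carrier_vecD empty_iff eq_vecI index_zero_vec mem_Collect_eq)
    then obtain m where m: "m < n" "z $ m \<noteq> 0" "\<And>j. m < j \<Longrightarrow> j < n \<Longrightarrow> z $ j = 0"
    proof -
      let ?M = "{j. j < n \<and> z $ j \<noteq> 0}"
      assume "?M \<noteq> {}"
      then have "Max ?M \<in> ?M" by (intro Max_in) auto
      moreover have "j \<le> Max ?M" if "j \<in> ?M" for j by (rule Max_ge) (use that in auto)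
      ultimately show thesis using that[of "Max ?M"] by fastforce
    qed
    let ?y = "(- 1 / z $ m) \<cdot>\<^sub>v (z - z $ m \<cdot>\<^sub>v unit_vec n m)"
    have y: "?y \<in> carrier_vec n" using z(1) by simp
    have "g *\<^sub>v ?y = (- 1 / z $ m) \<cdot>\<^sub>v (g *\<^sub>v z - z $ m \<cdot>\<^sub>v (g *\<^sub>v unit_vec n m))"
      using gc z(1) by (simp add: mult_mat_vec[of _ n n] mult_minus_distrib_mat_vec[of _ n n])
    also have "g *\<^sub>v unit_vec n m = col g m" using gc m(1) by (intro eq_vecI) auto
    also have "(- 1 / z $ m) \<cdot>\<^sub>v (g *\<^sub>v z - z $ m \<cdot>\<^sub>v col g m) = x m"
      unfolding z(3) colg[OF m(1)] using m(1,2) x(1)[OF m(1)] Fc[OF m(1)] by (intro eq_vecI) auto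
    finally have gy: "g *\<^sub>v ?y = x m" .
    show False
    proof (cases m)
      case 0
      then have "?y = 0\<^sub>v n" using z(1) m(3) by (intro eq_vecI) (auto simp: unit_vec_def)
      then have "x m = g *\<^sub>v 0\<^sub>v n" using gy by simp
      also have "\<dots> = 0\<^sub>v n" using gc by (intro eq_vecI) auto
      finally have "x m = 0\<^sub>v n" .
      then show False using x(2)[OF m(1)] 0 by (simp add: prev_def)
    next
      case (Suc j)
      have "?y \<in> std_subspace n j" using y m(2,3) z(1) Suc by (auto simp: std_subspace_def unit_vec_def)
      then have "x m \<in> (*\<^sub>v) g ` std_subspace n j" using gy by (metis imageI)
      moreover have "(*\<^sub>v) g ` std_subspace n j \<subseteq> F ! j"
        by (rule image_std_subspace_subset[OF gc sm]) (use Suc m(1) colg x(1) mono' in \<open>auto simp: subset_iff\<close>)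
      ultimately show False using x(2)[OF m(1)] Suc by (auto simp: prev_def)
    qed
  qed
  then have G: "g \<in> carrier (GL n)" using gc by (simp add: carrier_GL)
  have "F ! i = (*\<^sub>v) g ` std_subspace n i" if i: "i < n" for i
  proof -
    let ?W = "F ! i" and ?A = "col g ` {..i}"
    interpret W: vectorspace class_ring "vs ?W" by (rule subspace_is_vs[OF sub[OF i]])
    have bound: "finite S \<and> card S \<le> n" if "S \<subseteq> ?W \<and> W.lin_indpt S" for S
    proof -
      have "S \<subseteq> ?W" using that by blast
      then have "lin_indpt S" using span_li_not_depend(2)[OF _ sm[OF i]] that by blast
      moreover have "S \<subseteq> carrier_vec n" using that Fc[OF i] by blast
      ultimately show ?thesis using li_le_dim[OF fin_dim, of S] dim_is_n by simp
    qed
    have "W.lin_indpt {}" by (simp add: W.lin_dep_def)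
    then have "\<exists>S. finite S \<and> maximal S (\<lambda>S. S \<subseteq> ?W \<and> W.lin_indpt S)"
      by (intro maximal_exists[where N = n and B = "{}"]) (use bound in auto)
    then obtain S where S: "finite S" "maximal S (\<lambda>S. S \<subseteq> carrier (vs ?W) \<and> W.lin_indpt S)" by auto
    then have "W.gen_set S" by (intro W.max_li_is_gen)
    moreover have "S \<subseteq> carrier (vs ?W)" using S(2) by (simp add: maximal_def)
    ultimately have fd: "W.fin_dim" unfolding W.fin_dim_def using S(1) by blast
    have subA: "?A \<subseteq> ?W" using colg x(1) mono' i by (auto simp: subset_iff)
    have "W.basis ?A"
    proof (rule W.dim_li_is_basis[OF fd])
      show "W.lin_indpt ?A" using span_li_not_depend(2)[OF subA sm[OF i]] cols_basis(2)[OF G i] by simp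
      show "W.dim \<le> card ?A" using cols_basis(1)[OF G i] dim[OF i] by simp
    qed (use subA in auto)
    then have "W.span ?A = ?W" by (simp add: W.basis_def)
    then show ?thesis using span_li_not_depend(1)[OF subA sm[OF i]] span_cols[OF gc i] by simp
  qed
  then have "F = flag_of n g" using len by (intro nth_equalityI) (simp_all add: flag_of_eq)
  with G show thesis by (rule that)
qed

section \<open>Orbits, Shareshian pairs and sweeps in terms of matrices\<close>

lemma B_plus_UT: "B_plus n = UT n"
  unfolding stabilizer_def using flag_of_UT UT_GL by blast

lemma B_star_UT:
  assumes "n \<ge> 1"
  shows "B_star n = {sg n * b * minv n (sg n) | b. b \<in> UT n}"
proof -
  have "flag_act g (E_star n) = E_star n \<longleftrightarrow> (\<exists>b \<in> UT n. g = sg n * b * minv n (sg n))" if g: "g \<in> carrier (GL n)" for g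
  proof -
    have "flag_act g (E_star n) = E_star n \<longleftrightarrow> flag_of n (sg n) = flag_of n (g * sg n)"
      using g assms by (auto simp: E_star_eq flag_act_flag_of GL_D)
    also have "\<dots> \<longleftrightarrow> (\<exists>b \<in> UT n. g * sg n = sg n * b)"
      by (rule flag_of_eq_iff[OF sg_GL(1) GL_mult[OF g sg_GL(1)]])
    also have "\<dots> \<longleftrightarrow> (\<exists>b \<in> UT n. g = sg n * b * minv n (sg n))"
      using g by (intro bex_cong refl) (metis GL_D UT_D mmult_cancel(3,4) mmult_carrier sg_GL(1))
    finally show ?thesis .
  qed
  moreover have "sg n * b * minv n (sg n) \<in> carrier (GL n)" if "b \<in> UT n" for b
    by (intro GL_mult sg_GL(1) UT_GL that GL_inv(1))
  ultimately show ?thesis by (auto simp: stabilizer_def)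
qed

lemma lastcol_mult_entry:
  assumes "g \<in> carrier_mat n n" "h \<in> carrier_mat n n" "lastcol n h" "k < n"
  shows "(g * h) $$ (k, n - 1) = g $$ (k, n - 1)"
proof -
  have "(g * h) $$ (k, n - 1) = (\<Sum>j<n. g $$ (k, j) * h $$ (j, n - 1))"
    using assms by (intro mmult_entry) auto
  also have "\<dots> = (\<Sum>j<n. if j = n - 1 then g $$ (k, n - 1) else 0)"
    by (rule sum.cong) (use assms(3,4) in \<open>auto simp: lastcol_def\<close>)
  also have "n - 1 < n" using assms(4) by simp
  then have "(\<Sum>j<n. if j = n - 1 then g $$ (k, n - 1) else 0) = g $$ (k, n - 1)" by simp
  finally show ?thesis .
qed

lemma lastcol_mult:
  assumes "g \<in> carrier_mat n n" "h \<in> carrier_mat n n" "lastcol n g" "lastcol n h" "n \<ge> 1"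
  shows "lastcol n (g * h)"
  using assms lastcol_mult_entry[OF assms(1,2,4)] unfolding lastcol_def by (auto simp del: index_mult_mat)

lemma lastcol_one: "n \<ge> 1 \<Longrightarrow> lastcol n (1\<^sub>m n)"
  by (auto simp: lastcol_def)

lemma lastcol_inv:
  assumes "g \<in> carrier (GL n)" "lastcol n g" "n \<ge> 1"
  shows "lastcol n (minv n g)"
proof -
  have "minv n g $$ (k, n - 1) = 1\<^sub>m n $$ (k, n - 1)" if "k < n" for k
    using lastcol_mult_entry[OF GL_D[OF GL_inv(1)[OF assms(1)]] GL_D[OF assms(1)] assms(2) that]
      GL_inv(3)[OF assms(1)] by simp
  then show ?thesis using assms(3) by (simp add: lastcol_def)
qed

definition BK :: "nat \<Rightarrow> complex mat set" where
  "BK n = {g \<in> UT n. lastcol n g}"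

definition PK :: "nat \<Rightarrow> nat \<Rightarrow> complex mat set" where
  "PK n i = {g \<in> parab n i. lastcol n g}"

lemma BK_UT: "g \<in> BK n \<Longrightarrow> g \<in> UT n" and PK_parab: "g \<in> PK n i \<Longrightarrow> g \<in> parab n i"
  by (simp_all add: BK_def PK_def)

lemma BK_GL: "g \<in> BK n \<Longrightarrow> g \<in> carrier (GL n)" and PK_GL: "g \<in> PK n i \<Longrightarrow> g \<in> carrier (GL n)"
  using BK_UT UT_GL PK_parab parab_GL by blast+

lemma BK_one: "n \<ge> 1 \<Longrightarrow> 1\<^sub>m n \<in> BK n"
  by (simp add: BK_def lastcol_one)

lemma BK_mult: "n \<ge> 1 \<Longrightarrow> g \<in> BK n \<Longrightarrow> h \<in> BK n \<Longrightarrow> g * h \<in> BK n"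
  by (auto simp: BK_def UT_mult intro!: lastcol_mult UT_D)

lemma BK_inv: "n \<ge> 1 \<Longrightarrow> g \<in> BK n \<Longrightarrow> minv n g \<in> BK n"
  by (auto simp: BK_def UT_inv intro!: lastcol_inv UT_GL)

lemma PK_mult: "n \<ge> 1 \<Longrightarrow> g \<in> PK n i \<Longrightarrow> h \<in> PK n i \<Longrightarrow> g * h \<in> PK n i"
  unfolding PK_def by (blast intro: parab_mult lastcol_mult parab_D)

lemma PK_inv: "i + 1 < n \<Longrightarrow> g \<in> PK n i \<Longrightarrow> minv n g \<in> PK n i"
  unfolding PK_def by (auto intro!: parab_inv lastcol_inv parab_GL)

lemma BK_PK: "i + 1 < n \<Longrightarrow> g \<in> BK n \<longleftrightarrow> g \<in> PK n i \<and> g $$ (Suc i, i) = 0"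
  by (auto simp: BK_def PK_def UT_iff_parab)

text \<open>The upper triangular matrices with last column \<open>e\<^sub>n\<close> are the block matrices \<open>diag(x, 1)\<close>.\<close>

lemma B_K_BK:
  assumes "n \<ge> 2"
  shows "B_K n = BK n"
proof (intro subset_antisym subsetI)
  fix g assume "g \<in> B_K n"
  then obtain x where x: "x \<in> carrier_mat (n - 1) (n - 1)" "det x \<noteq> 0" "upper_triangular x" "g = embK n x"
    by (auto simp: B_K_def carrier_GL)
  have ge: "g $$ (k, l) = (if k < n - 1 then if l < n - 1 then x $$ (k, l) else 0 else if l < n - 1 then 0 else 1)"
    if "k < n" "l < n" for k l
    using that x(1) assms unfolding x(4) embK_def by auto
  have gc: "g \<in> carrier_mat n n" using x(1) assms unfolding x(4) embK_def by (auto simp: four_block_mat_def Let_def)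
  have xz: "x $$ (k, l) = 0" if "l < k" "k < n - 1" for k l
    using x(1,3) that by (auto simp: upper_triangular_def)
  have xd: "\<forall>k<n - 1. x $$ (k, k) \<noteq> 0" using triangular_det[OF x(1) xz] x(2) by blast
  have "g \<in> UT n" by (rule UT_I[OF gc]) (use ge xz xd in auto)
  moreover have "lastcol n g" using ge assms by (auto simp: lastcol_def)
  ultimately show "g \<in> BK n" by (simp add: BK_def)
next
  fix g assume g: "g \<in> BK n"
  then have gU: "g \<in> UT n" and gl: "lastcol n g" by (auto simp: BK_def)
  define x where "x = mat (n - 1) (n - 1) (\<lambda>(k, l). g $$ (k, l))"
  have x: "x \<in> carrier_mat (n - 1) (n - 1)" by (simp add: x_def)
  have xz: "x $$ (k, l) = 0" if "l < k" "k < n - 1" for k l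
    using that UT_zero[OF gU, of l k] by (simp add: x_def)
  have "\<forall>k<n - 1. x $$ (k, k) \<noteq> 0" using UT_diag[OF gU] by (simp add: x_def)
  then have "det x \<noteq> 0" using triangular_det[OF x xz] by blast
  moreover have "upper_triangular x" using x xz by auto
  moreover have "g = embK n x"
  proof (rule eq_matI)
    fix k l assume "k < dim_row (embK n x)" "l < dim_col (embK n x)"
    then have kl: "k < n" "l < n" using x assms by (auto simp: embK_def)
    have e: "embK n x $$ (k, l) = (if k < n - 1 then if l < n - 1 then x $$ (k, l) else 0 else if l < n - 1 then 0 else 1)"
      using kl x assms unfolding embK_def by auto
    show "g $$ (k, l) = embK n x $$ (k, l)"
    proof (cases "l < n - 1")
      case True
      then show ?thesis unfolding e using kl UT_zero[OF gU, of l k] by (auto simp: x_def)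
    next
      case False
      then have "l = n - 1" using kl by simp
      moreover have "k < n - 1 \<or> k = n - 1" using kl by auto
      ultimately show ?thesis unfolding e using gl by (auto simp: lastcol_def)
    qed
  qed (use x assms UT_D[OF gU] in \<open>auto simp: embK_def\<close>)
  ultimately show "g \<in> B_K n" using x by (auto simp: B_K_def carrier_GL)
qed

lemma min_parabolic_eq:
  "min_parabolic n H i = H \<union> {h * smat n i * h' | h h'. h \<in> H \<and> h' \<in> H}"
  by (auto simp: min_parabolic_def r_coset_def set_mult_def)

lemma P_G_parab:
  assumes i: "i + 1 < n"
  shows "P_G n i = parab n i"
proof (intro subset_antisym subsetI)
  fix g assume "g \<in> P_G n i"
  then consider "g \<in> UT n" | h h' where "h \<in> UT n" "h' \<in> UT n" "g = h * smat n i * h'"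
    by (auto simp: min_parabolic_eq B_plus_UT)
  then show "g \<in> parab n i"
    using UT_parab smat_parab[OF i] by cases (blast intro: parab_mult)+
next
  fix g assume g: "g \<in> parab n i"
  show "g \<in> P_G n i"
  proof (cases "g $$ (Suc i, i) = 0")
    case True
    then show ?thesis using g i by (simp add: min_parabolic_eq B_plus_UT UT_iff_parab)
  next
    case False
    obtain t c where c: "c \<in> UT n" "g = elementary n i (Suc i) t * (smat n i * c)"
      using parab_decomp[OF g i False] by blast
    have "elementary n i (Suc i) t \<in> UT n" using i by (auto intro: elementary_UT)
    moreover have "g = elementary n i (Suc i) t * smat n i * c" using c UT_D by (simp add: mmult_assoc[of _ n])
    ultimately show ?thesis using c(1) by (auto simp: min_parabolic_eq B_plus_UT)
  qed
qed

lemma smat_PK: "i + 2 < n \<Longrightarrow> smat n i \<in> PK n i"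
  using smat_parab[of i n] by (auto simp: PK_def lastcol_def perm_mat_entry transpose_def)

lemma P_K_PK:
  assumes i: "i + 2 < n"
  shows "P_K n i = PK n i"
proof -
  have n: "n \<ge> 2" "n \<ge> 1" and i1: "i + 1 < n" using i by simp_all
  show ?thesis
  proof (intro subset_antisym subsetI)
    fix g assume "g \<in> P_K n i"
    then consider "g \<in> BK n" | h h' where "h \<in> BK n" "h' \<in> BK n" "g = h * smat n i * h'"
      by (auto simp: min_parabolic_eq B_K_BK[OF n(1)])
    then show "g \<in> PK n i"
      using BK_PK[OF i1] smat_PK[OF i] by cases (blast intro: PK_mult[OF n(2)])+
  next
    fix g assume g: "g \<in> PK n i"
    show "g \<in> P_K n i"
    proof (cases "g $$ (Suc i, i) = 0")
      case True
      then show ?thesis using g i1 by (simp add: min_parabolic_eq B_K_BK[OF n(1)] BK_PK)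
    next
      case False
      define t where "t = g $$ (i, i) / g $$ (Suc i, i)"
      define c where "c = smat n i * (elementary n i (Suc i) (- t) * g)"
      have c: "c \<in> UT n" "g = elementary n i (Suc i) t * (smat n i * c)"
        using parab_decomp[OF PK_parab[OF g] i1 False] unfolding c_def t_def by blast+
      have e: "elementary n i (Suc i) s \<in> BK n" for s
        using i elementary_UT[of i "Suc i" n s] by (auto simp: BK_def lastcol_def elementary_entry)
      have "c \<in> PK n i" unfolding c_def
        using PK_mult[OF n(2)] smat_PK[OF i] e[of "- t"] g BK_PK[OF i1] by blast
      then have "c \<in> BK n" using c(1) by (simp add: BK_def PK_def)
      moreover have "g = elementary n i (Suc i) t * smat n i * c" using c UT_D by (simp add: mmult_assoc[of _ n])
      ultimately show ?thesis using e by (auto simp: min_parabolic_eq B_K_BK[OF n(1)])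
    qed
  qed
qed

lemma translates_single: "translates H {F} = (\<lambda>h. flag_act h F) ` H"
  by (auto simp: translates_def)

definition orb :: "nat \<Rightarrow> complex mat \<Rightarrow> flag set" where
  "orb n v = (\<lambda>k. flag_of n (k * v)) ` BK n"

lemma orbit_orb:
  assumes "n \<ge> 2" "v \<in> carrier (GL n)"
  shows "translates (B_K n) {flag_of n v} = orb n v"
  unfolding translates_single B_K_BK[OF assms(1)] orb_def
  by (rule image_cong) (auto simp: flag_act_flag_of GL_D[OF BK_GL] GL_D[OF assms(2)])

lemma represents_iff: "n \<ge> 2 \<Longrightarrow> represents n Q v \<longleftrightarrow> v \<in> carrier (GL n) \<and> Q = orb n v"
  using orbit_orb by (auto simp: represents_def)

lemma orbits_eq:
  assumes "n \<ge> 2"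
  shows "orbits n = orb n ` carrier (GL n)"
proof (intro subset_antisym subsetI)
  fix Q assume "Q \<in> orbits n"
  then obtain F where F: "F \<in> flags n" "Q = translates (B_K n) {F}" by (auto simp: orbits_def)
  obtain g where "g \<in> carrier (GL n)" "F = flag_of n g" by (rule flags_flag_of[OF F(1)])
  then show "Q \<in> orb n ` carrier (GL n)" using F(2) orbit_orb[OF assms] by blast
next
  fix Q assume "Q \<in> orb n ` carrier (GL n)"
  then obtain v where "v \<in> carrier (GL n)" "Q = orb n v" by blast
  then show "Q \<in> orbits n" unfolding orbits_def using orbit_orb[OF assms] flag_of_flags by blast
qed

lemma orb_eq:
  assumes n: "n \<ge> 1" and v: "v \<in> carrier (GL n)" and k: "k \<in> BK n" and b: "b \<in> UT n"
  shows "orb n (k * v * b) = orb n v"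
proof -
  note D = GL_D[OF v] GL_D[OF BK_GL[OF k]] UT_D[OF b]
  have vb: "flag_of n (h * (k * v * b)) = flag_of n (h * k * v)" if "h \<in> BK n" for h
  proof -
    have hkv: "h * k * v \<in> carrier (GL n)" by (intro GL_mult BK_GL that k v)
    have hb: "h * (k * v * b) = (h * k * v) * b" using D GL_D[OF BK_GL[OF that]] by (simp add: mmult_assoc[of _ n])
    moreover have "h * (k * v * b) \<in> carrier (GL n)" unfolding hb by (rule GL_mult[OF hkv UT_GL[OF b]])
    ultimately show ?thesis using flag_of_eq_iff[OF hkv, of "h * (k * v * b)"] b by auto
  qed
  have "(\<lambda>h. h * k) ` BK n = BK n"
  proof (intro subset_antisym subsetI)
    fix h assume h: "h \<in> BK n"
    have "h = (h * minv n k) * k" using mmult_cancel(4)[OF BK_GL[OF k] GL_D[OF BK_GL[OF h]]] by simp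
    moreover have "h * minv n k \<in> BK n" by (intro BK_mult BK_inv n h k)
    ultimately show "h \<in> (\<lambda>h. h * k) ` BK n" by blast
  qed (use BK_mult[OF n _ k] in blast)
  then have "orb n v = (\<lambda>k. flag_of n (k * v)) ` (\<lambda>h. h * k) ` BK n" by (simp add: orb_def)
  also have "\<dots> = orb n (k * v * b)" unfolding image_image orb_def by (rule image_cong) (simp_all add: vb)
  finally show ?thesis by simp
qed

lemma orb_self: "n \<ge> 1 \<Longrightarrow> v \<in> carrier (GL n) \<Longrightarrow> flag_of n v \<in> orb n v"
  unfolding orb_def using BK_one[of n] GL_D[of v n] by (intro image_eqI[of _ _ "1\<^sub>m n"]) simp_all

lemma in_orb:
  assumes n: "n \<ge> 1" and v: "v \<in> carrier (GL n)" and g: "g \<in> carrier (GL n)" and "flag_of n g \<in> orb n v"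
  shows "\<exists>k \<in> BK n. \<exists>b \<in> UT n. g = k * v * b" "orb n g = orb n v"
proof -
  obtain k where k: "k \<in> BK n" "flag_of n (k * v) = flag_of n g" using assms(4) by (auto simp: orb_def)
  then obtain b where "b \<in> UT n" "g = k * v * b"
    using flag_of_eq_iff[OF GL_mult[OF BK_GL[OF k(1)] v] g] by auto
  with k(1) show "\<exists>k \<in> BK n. \<exists>b \<in> UT n. g = k * v * b" "orb n g = orb n v"
    using orb_eq[OF n v] by blast+
qed

text \<open>A subgroup that contains \<open>B\<^bsub>n-1\<^esub>\<close> sweeps out the same set from an orbit as from any of its points.\<close>

lemma translates_translates:
  assumes n: "n \<ge> 1" and v: "v \<in> carrier (GL n)" and H: "BK n \<subseteq> H" "H \<subseteq> carrier (GL n)"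
    and mult: "\<And>g h. g \<in> H \<Longrightarrow> h \<in> H \<Longrightarrow> g * h \<in> H"
  shows "translates H (orb n v) = (\<lambda>h. flag_of n (h * v)) ` H"
proof (intro subset_antisym subsetI)
  fix F assume "F \<in> translates H (orb n v)"
  then obtain h k where h: "h \<in> H" "k \<in> BK n" "F = flag_act h (flag_of n (k * v))"
    by (auto simp: translates_def orb_def)
  then have "F = flag_of n ((h * k) * v)"
    using H GL_D[OF v] by (simp add: flag_act_flag_of GL_D[OF BK_GL] GL_D[OF subsetD[OF H(2)]] mmult_assoc[of _ n])
  then show "F \<in> (\<lambda>h. flag_of n (h * v)) ` H" using mult[of h k] h H(1) by blast
next
  fix F assume "F \<in> (\<lambda>h. flag_of n (h * v)) ` H"
  then obtain h where h: "h \<in> H" "F = flag_of n (h * v)" by blast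
  then have "F = flag_act h (flag_of n v)"
    using GL_D[OF v] GL_D[OF subsetD[OF H(2) h(1)]] by (simp add: flag_act_flag_of)
  then show "F \<in> translates H (orb n v)"
    using h(1) orb_self[OF n v] by (force simp: translates_def)
qed

text \<open>An element of \<open>B\<^bsub>n-1\<^esub>\<close> fixes \<open>e\<^sub>n\<close>, so it stabilizes the flag that begins with \<open>e\<^sub>n\<close>.\<close>

lemma BK_B_star:
  assumes n: "n \<ge> 1" and k: "k \<in> BK n"
  shows "minv n (sg n) * k * sg n \<in> UT n"
proof -
  let ?T = "minv n (sg n)"
  have kc: "k \<in> carrier_mat n n" by (rule GL_D[OF BK_GL[OF k]])
  have "(?T * k * sg n) $$ (i, j) = k $$ (sigma n i, sigma n j)" if "i < n" "j < n" for i j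
  proof -
    have sn: "sigma n j < n" using permutes_in_image[OF sigma_permutes] that by blast
    have "(?T * k * sg n) $$ (i, j) = (?T * k) $$ (i, sigma n j)"
      using kc that sg_GL by (intro mult_perm_entry sigma_permutes) simp_all
    also have "\<dots> = k $$ (pinv (pinv (sigma n)) i, sigma n j)"
      unfolding sg_GL(2) using kc that sn by (intro perm_mult_entry' permutes_inv sigma_permutes)
    finally show ?thesis by (simp add: inv_inv_eq permutes_bij[OF sigma_permutes])
  qed
  moreover have "k $$ (sigma n i, sigma n j) = 0" if "j < i" "i < n" for i j
    using that UT_zero[OF BK_UT[OF k], of "j - 1" "i - 1"] k by (cases j) (auto simp: sigma_def BK_def lastcol_def)
  moreover have "?T * k * sg n \<in> carrier (GL n)" by (intro GL_mult GL_inv(1) sg_GL(1) BK_GL k)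
  ultimately show ?thesis by (simp add: UT_def del: index_mult_mat)
qed

abbreviation pos_star :: "nat \<Rightarrow> complex mat \<Rightarrow> nat \<Rightarrow> nat" where
  "pos_star n v \<equiv> pos n (minv n (sg n) * v)"

text \<open>By the uniqueness in the Bruhat decomposition, the orbits of \<open>B\<close> on flags correspond to permutations.\<close>

lemma cell_flags:
  assumes v: "v \<in> carrier (GL n)" and w: "w permutes {..<n}"
  shows "(\<lambda>h. flag_of n (h * v)) ` UT n = (\<lambda>h. flag_of n (h * perm_mat n w)) ` UT n \<longleftrightarrow> pos n v = w"
proof
  assume eq: "(\<lambda>h. flag_of n (h * v)) ` UT n = (\<lambda>h. flag_of n (h * perm_mat n w)) ` UT n"
  have "flag_of n (1\<^sub>m n * v) \<in> (\<lambda>h. flag_of n (h * v)) ` UT n" by (rule imageI[OF UT_one])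
  then obtain b where b: "b \<in> UT n" "flag_of n (b * perm_mat n w) = flag_of n v"
    using GL_D[OF v] unfolding eq by auto
  then obtain c where "c \<in> UT n" "v = b * perm_mat n w * c"
    using flag_of_eq_iff[OF GL_mult[OF UT_GL[OF b(1)] perm_mat_inv(1)[OF w]] v] by auto
  then show "pos n v = w" using pos_eq[OF in_cellI[OF w b(1)]] by simp
next
  assume "pos n v = w"
  then obtain b c where b: "b \<in> UT n" and c: "c \<in> UT n" and v': "v = b * perm_mat n w * c"
    using in_cell_pos[OF v] by (auto simp: in_cell_def)
  note D = UT_D[OF b] UT_D[OF c]
  have fl: "flag_of n (h * v) = flag_of n (h * b * perm_mat n w)" if h: "h \<in> UT n" for h
  proof -
    have 1: "h * b * perm_mat n w \<in> carrier (GL n)" by (intro GL_mult UT_GL h b perm_mat_inv(1) w)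
    have 2: "h * v = (h * b * perm_mat n w) * c" unfolding v' using D UT_D[OF h] by (simp add: mmult_assoc[of _ n])
    show ?thesis using flag_of_eq_iff[OF 1 GL_mult[OF UT_GL[OF h] v]] 2 c by auto
  qed
  have "(\<lambda>h. h * b) ` UT n = UT n"
  proof (intro subset_antisym subsetI)
    fix h assume h: "h \<in> UT n"
    have "h = (h * minv n b) * b" using mmult_cancel(4)[OF UT_GL[OF b] UT_D[OF h]] by simp
    moreover have "h * minv n b \<in> UT n" by (intro UT_mult UT_inv h b)
    ultimately show "h \<in> (\<lambda>h. h * b) ` UT n" by blast
  qed (use UT_mult b in blast)
  then have "(\<lambda>h. flag_of n (h * perm_mat n w)) ` UT n = (\<lambda>h. flag_of n (h * perm_mat n w)) ` (\<lambda>h. h * b) ` UT n"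
    by simp
  also have "\<dots> = (\<lambda>h. flag_of n (h * v)) ` UT n" unfolding image_image by (rule image_cong) (simp_all add: fl)
  finally show "(\<lambda>h. flag_of n (h * v)) ` UT n = (\<lambda>h. flag_of n (h * perm_mat n w)) ` UT n" by simp
qed

lemma Sh_orb:
  assumes n: "n \<ge> 2" and v: "v \<in> carrier (GL n)"
  shows "Sh n (orb n v) = (pos n v, sigma n \<circ> pos_star n v \<circ> pinv (sigma n))"
proof -
  have n1: "n \<ge> 1" using n by simp
  let ?T = "minv n (sg n)" and ?S = "sigma n"
  note T = sg_GL(1)[of n] GL_inv(1)[OF sg_GL(1)[of n]]
  note D = GL_D[OF v] GL_D[OF T(2)]
  have "(THE w. w \<in> Weyl n \<and> translates (B_plus n) (orb n v) = translates (B_plus n) {flag_of n (perm_mat n w)}) = pos n v"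
  proof -
    have L: "translates (UT n) (orb n v) = (\<lambda>h. flag_of n (h * v)) ` UT n"
      by (rule translates_translates[OF n1 v]) (auto intro: BK_UT UT_GL UT_mult)
    have R: "translates (UT n) {flag_of n (perm_mat n w)} = (\<lambda>h. flag_of n (h * perm_mat n w)) ` UT n" for w
      unfolding translates_single by (rule image_cong) (simp_all add: flag_act_flag_of UT_D)
    have *: "w \<in> Weyl n \<and> translates (B_plus n) (orb n v) = translates (B_plus n) {flag_of n (perm_mat n w)}
        \<longleftrightarrow> w = pos n v" for w
    proof (cases "w permutes {..<n}")
      case True
      then show ?thesis using cell_flags[OF v True] unfolding Weyl_def B_plus_UT L R by blast
    next
      case False
      then show ?thesis using pos_permutes[OF v] by (auto simp: Weyl_def)
    qed
    show ?thesis unfolding * by simp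
  qed
  moreover have "(THE u. u \<in> Weyl n \<and> translates (B_star n) (orb n v) = translates (B_star n) {flag_act (perm_mat n u) (E_star n)})
      = ?S \<circ> pos_star n v \<circ> pinv ?S"
  proof -
    have v': "?T * v \<in> carrier (GL n)" by (intro GL_mult T v)
    have BS: "B_star n = {sg n * b * ?T | b. b \<in> UT n}" by (rule B_star_UT[OF n1])
    have "translates (B_star n) (orb n v) = (\<lambda>h. flag_of n (h * v)) ` B_star n"
    proof (rule translates_translates[OF n1 v])
      show "BK n \<subseteq> B_star n"
      proof
        fix k assume k: "k \<in> BK n"
        have kc: "k \<in> carrier_mat n n" by (rule GL_D[OF BK_GL[OF k]])
        have "k = sg n * (?T * k * sg n) * ?T"
          using D kc by (simp add: mmult_assoc[of _ n] mmult_cancel(1)[OF T(1)] GL_inv(2)[OF T(1)])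
        then show "k \<in> B_star n" unfolding BS using BK_B_star[OF n1 k] by blast
      qed
      show "B_star n \<subseteq> carrier (GL n)" by (auto simp: stabilizer_def)
      fix g h assume "g \<in> B_star n" "h \<in> B_star n"
      then obtain b c where b: "b \<in> UT n" "c \<in> UT n" "g = sg n * b * ?T" "h = sg n * c * ?T" unfolding BS by blast
      have "g * h = sg n * (b * c) * ?T"
        unfolding b using b(1,2)[THEN UT_D] D by (simp add: mmult_assoc[of _ n] mmult_cancel(2)[OF T(1)])
      then show "g * h \<in> B_star n" unfolding BS using UT_mult[OF b(1,2)] by blast
    qed
    also have "\<dots> = (\<lambda>F. flag_act (sg n) F) ` (\<lambda>h. flag_of n (h * (?T * v))) ` UT n"
    proof -
      have "(\<lambda>h. flag_of n (h * v)) ` B_star n = (\<lambda>b. flag_of n (sg n * b * ?T * v)) ` UT n"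
        unfolding BS by blast
      also have "\<dots> = (\<lambda>b. flag_act (sg n) (flag_of n (b * (?T * v)))) ` UT n"
        by (rule image_cong) (use D in \<open>simp_all add: flag_act_flag_of UT_D mmult_assoc[of _ n]\<close>)
      finally show ?thesis by (simp add: image_image)
    qed
    finally have L: "translates (B_star n) (orb n v) = (\<lambda>F. flag_act (sg n) F) ` (\<lambda>h. flag_of n (h * (?T * v))) ` UT n" .
    have R: "translates (B_star n) {flag_act (perm_mat n u) (E_star n)} =
        (\<lambda>F. flag_act (sg n) F) ` (\<lambda>h. flag_of n (h * perm_mat n (pinv ?S \<circ> u \<circ> ?S))) ` UT n"
      if u: "u permutes {..<n}" for u
    proof -
      have "perm_mat n (pinv ?S \<circ> u \<circ> ?S) = ?T * perm_mat n u * sg n"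
        by (simp add: sg_GL(2) perm_mat_comp permutes_inv sigma_permutes u permutes_compose)
      then have e: "flag_act (sg n * b * ?T) (flag_act (perm_mat n u) (E_star n)) =
          flag_act (sg n) (flag_of n (b * perm_mat n (pinv ?S \<circ> u \<circ> ?S)))" if "b \<in> UT n" for b
        using D UT_D[OF that] n1 by (simp add: E_star_eq flag_act_flag_of mmult_assoc[of _ n])
      have "translates (B_star n) {flag_act (perm_mat n u) (E_star n)} =
          (\<lambda>b. flag_act (sg n * b * ?T) (flag_act (perm_mat n u) (E_star n))) ` UT n"
        unfolding translates_single BS by blast
      also have "\<dots> = (\<lambda>b. flag_act (sg n) (flag_of n (b * perm_mat n (pinv ?S \<circ> u \<circ> ?S)))) ` UT n"
        by (rule image_cong) (simp_all add: e)
      finally show ?thesis by (simp add: image_image)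
    qed
    have inj: "(\<lambda>F. flag_act (sg n) F) ` (\<lambda>h. flag_of n (h * x)) ` UT n = (\<lambda>F. flag_act (sg n) F) ` (\<lambda>h. flag_of n (h * y)) ` UT n
        \<longleftrightarrow> (\<lambda>h. flag_of n (h * x)) ` UT n = (\<lambda>h. flag_of n (h * y)) ` UT n"
      if xy: "x \<in> carrier_mat n n" "y \<in> carrier_mat n n" for x y
    proof -
      have "(\<lambda>F. flag_act ?T F) ` (\<lambda>F. flag_act (sg n) F) ` (\<lambda>h. flag_of n (h * x)) ` UT n = (\<lambda>h. flag_of n (h * x)) ` UT n"
        if "x \<in> carrier_mat n n" for x
        unfolding image_image
        by (rule image_cong) (use that D UT_D in \<open>simp_all add: flag_act_flag_of mmult_cancel(2)[OF T(1)]\<close>)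
      from this[OF xy(1)] this[OF xy(2)] show ?thesis by metis
    qed
    have *: "u \<in> Weyl n \<and> translates (B_star n) (orb n v) = translates (B_star n) {flag_act (perm_mat n u) (E_star n)}
        \<longleftrightarrow> u = ?S \<circ> pos_star n v \<circ> pinv ?S" for u
    proof (cases "u permutes {..<n}")
      case True
      have p: "pinv ?S \<circ> u \<circ> ?S permutes {..<n}"
        by (intro permutes_compose permutes_inv sigma_permutes True)
      have "translates (B_star n) (orb n v) = translates (B_star n) {flag_act (perm_mat n u) (E_star n)} \<longleftrightarrow>
          pos_star n v = pinv ?S \<circ> u \<circ> ?S"
        unfolding L R[OF True] using D by (simp add: inj cell_flags[OF v' p])
      also have "\<dots> \<longleftrightarrow> u = ?S \<circ> pos_star n v \<circ> pinv ?S"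
        using permutes_inverses[OF sigma_permutes[of n]] by (auto simp: fun_eq_iff)
      finally show ?thesis using True by (simp add: Weyl_def)
    next
      case False
      moreover have "?S \<circ> pos_star n v \<circ> pinv ?S permutes {..<n}"
        by (intro permutes_compose permutes_inv sigma_permutes pos_permutes v')
      ultimately show ?thesis by (auto simp: Weyl_def)
    qed
    show ?thesis unfolding * by simp
  qed
  ultimately show ?thesis unfolding Sh_def by simp
qed

lemma sweep_K:
  assumes "i + 2 < n" "v \<in> carrier (GL n)"
  shows "sweep n (KRoot i) v = (\<lambda>p. flag_of n (p * v)) ` PK n i"
  unfolding sweep.simps P_K_PK[OF assms(1)] translates_single
  by (rule image_cong) (simp_all add: flag_act_flag_of GL_D[OF PK_GL] GL_D[OF assms(2)])

lemma sweep_G: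
  assumes "i + 1 < n" "v \<in> carrier (GL n)"
  shows "sweep n (GRoot i) v = {flag_of n (k * (v * p)) | k p. k \<in> BK n \<and> p \<in> parab n i}"
proof -
  have n: "n \<ge> 2" using assms(1) by simp
  have e: "flag_act k (flag_act v (flag_of n p)) = flag_of n (k * (v * p))" if "k \<in> BK n" "p \<in> parab n i" for k p
    using that GL_D[OF BK_GL[OF that(1)]] parab_D[OF that(2)] GL_D[OF assms(2)] by (simp add: flag_act_flag_of)
  have "sweep n (GRoot i) v = {flag_act k (flag_act v (flag_of n p)) | k p. k \<in> BK n \<and> p \<in> parab n i}"
    unfolding sweep.simps P_G_parab[OF assms(1)] B_K_BK[OF n] translates_def by fast
  also have "\<dots> = {flag_of n (k * (v * p)) | k p. k \<in> BK n \<and> p \<in> parab n i}"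
    using e by metis
  finally show ?thesis .
qed

section \<open>Solvable subgroups\<close>

lemma (in group) derived_pow_subset:
  assumes "subgroup H G"
  shows "(derived G ^^ k) H \<subseteq> H"
proof (induction k)
  case (Suc k)
  then show ?case using derived_incl[OF Suc assms] by simp
qed simp

lemma (in group) solvable_subgroup_iff:
  assumes "subgroup H G"
  shows "solvable (G\<lparr>carrier := H\<rparr>) \<longleftrightarrow> (\<exists>k. (derived G ^^ k) H \<subseteq> {\<one>})"
proof -
  interpret H: group "G\<lparr>carrier := H\<rparr>" by (rule subgroup_imp_group[OF assms])
  have "(derived (G\<lparr>carrier := H\<rparr>) ^^ k) H = (derived G ^^ k) H" for k
    by (induction k) (simp_all add: derived_consistent[OF derived_pow_subset[OF assms] assms])
  moreover have "(derived G ^^ k) H \<subseteq> {\<one>} \<longleftrightarrow> (derived G ^^ k) H = {\<one>}" for k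
    using subgroup.one_closed[OF exp_of_derived_is_subgroup[OF assms, of k]] by blast
  ultimately show ?thesis unfolding H.solvable_iff_trivial_derived_seq by simp
qed

lemma (in group) derived_pow_le:
  assumes "subgroup H G" "\<And>k. subgroup (N k) G" "H \<subseteq> N 0" "\<And>k. derived_set G (N k) \<subseteq> N (Suc k)"
  shows "(derived G ^^ k) H \<subseteq> N k"
proof (induction k)
  case (Suc k)
  have "derived_set G ((derived G ^^ k) H) \<subseteq> derived_set G (N k)" using mono_derived_set[OF Suc] .
  also have "\<dots> \<subseteq> N (Suc k)" by (rule assms(4))
  finally show ?case unfolding funpow.simps o_apply derived_def
    by (rule generate_subgroup_incl[OF _ assms(2)])
qed (use assms(3) in simp)

text \<open>The unitriangular matrices whose first \<open>k - 1\<close> superdiagonals vanish; for \<open>k = 0\<close> all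
  invertible upper triangular matrices.\<close>

definition lower_central :: "nat \<Rightarrow> nat \<Rightarrow> complex mat set" where
  "lower_central n k = {g \<in> carrier (GL n). \<forall>i j. i < n \<longrightarrow> j < n \<longrightarrow> j < i + k \<longrightarrow> g $$ (i, j) = (if i = j then 1 else 0)}"

lemma lower_central_UT: "g \<in> lower_central n k \<Longrightarrow> g \<in> UT n"
  by (auto simp: lower_central_def UT_def)

lemma lower_central_0: "lower_central n 0 = UT n"
  using lower_central_UT by (auto simp: lower_central_def UT_def)

lemma lower_central_D: "g \<in> lower_central n k \<Longrightarrow> i < n \<Longrightarrow> j < n \<Longrightarrow> j < i + k \<Longrightarrow> g $$ (i, j) = (if i = j then 1 else 0)"
  by (simp add: lower_central_def)

lemma lower_central_mult:
  assumes "g \<in> lower_central n k" "h \<in> lower_central n k"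
  shows "g * h \<in> lower_central n k"
proof -
  note U = lower_central_UT[OF assms(1)] lower_central_UT[OF assms(2)]
  have "(g * h) $$ (i, j) = (if i = j then 1 else 0)" if ij: "i < n" "j < n" "j < i + k" for i j
  proof -
    have "(g * h) $$ (i, j) = (\<Sum>l<n. g $$ (i, l) * h $$ (l, j))"
      using U ij UT_D by (intro mmult_entry)
    also have "\<dots> = (\<Sum>l<n. if l = i then (if i = j then 1 else 0) else 0)"
    proof (rule sum.cong)
      fix l assume "l \<in> {..<n}"
      then show "g $$ (i, l) * h $$ (l, j) = (if l = i then (if i = j then 1 else 0) else 0)"
        using lower_central_D[OF assms(1), of i l] lower_central_D[OF assms(2), of l j] ij
          UT_zero[OF U(1), of l i] UT_zero[OF U(2), of j l]
        by (cases "l < i + k"; cases "l = i") auto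
    qed simp
    finally show ?thesis using ij by simp
  qed
  then show ?thesis using GL_mult[OF U[THEN UT_GL]] by (simp add: lower_central_def)
qed

lemma lower_central_inv:
  assumes "g \<in> lower_central n k"
  shows "minv n g \<in> lower_central n k"
proof (cases k)
  case 0
  then show ?thesis using assms UT_inv by (simp add: lower_central_0)
next
  case (Suc k')
  note U = lower_central_UT[OF assms] UT_inv[OF lower_central_UT[OF assms]]
  have "minv n g $$ (i, j) = (if i = j then 1 else 0)" if ij: "i < n" "j < n" "j < i + k" for i j
  proof -
    have "(g * minv n g) $$ (i, j) = (\<Sum>l<n. g $$ (i, l) * minv n g $$ (l, j))"
      using U ij UT_D by (intro mmult_entry)
    also have "\<dots> = (\<Sum>l<n. if l = i then minv n g $$ (i, j) else 0)"
    proof (rule sum.cong)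
      fix l assume "l \<in> {..<n}"
      then show "g $$ (i, l) * minv n g $$ (l, j) = (if l = i then minv n g $$ (i, j) else 0)"
        using lower_central_D[OF assms, of i l] ij UT_zero[OF U(1), of l i] UT_zero[OF U(2), of j l] Suc
        by (cases "l < i + k") auto
    qed simp
    finally show ?thesis using ij GL_inv(2)[OF UT_GL[OF U(1)]] by simp
  qed
  then show ?thesis using GL_inv(1)[OF UT_GL[OF U(1)]] by (simp add: lower_central_def)
qed

lemma lower_central_subgroup: "subgroup (lower_central n k) (GL n)"
proof (rule GLn.subgroupI)
  have "1\<^sub>m n \<in> lower_central n k" using UT_GL[OF UT_one] by (simp add: lower_central_def)
  then show "lower_central n k \<noteq> {}" by blast
  show "lower_central n k \<subseteq> carrier (GL n)" by (auto simp: lower_central_def)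
qed (simp_all add: lower_central_mult lower_central_inv)

text \<open>Modulo the entries further away from the diagonal, multiplication is commutative: the diagonals are
  multiplied or, if they are equal to one, the first superdiagonal that remains is added.\<close>

lemma lower_central_commute:
  assumes "g \<in> lower_central n k" "h \<in> lower_central n k" "i < n" "j < n" "j < i + Suc k"
  shows "(g * h) $$ (i, j) = (if k = 0 \<and> i = j then g $$ (i, i) * h $$ (i, i)
    else if i = j then 1 else if j = i + k then g $$ (i, j) + h $$ (i, j) else 0)"
proof (cases "j < i + k")
  case True
  then show ?thesis using lower_central_D[OF lower_central_mult[OF assms(1,2)] assms(3,4)] by auto
next
  case False
  then have j: "j = i + k" using assms(5) by simp
  note U = lower_central_UT[OF assms(1)] lower_central_UT[OF assms(2)]
  have e: "(g * h) $$ (i, j) = (\<Sum>l<n. g $$ (i, l) * h $$ (l, j))"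
    using U assms(3,4) UT_D by (intro mmult_entry)
  show ?thesis
  proof (cases "k = 0")
    case True
    have "(\<Sum>l<n. g $$ (i, l) * h $$ (l, j)) = (\<Sum>l<n. if l = i then g $$ (i, i) * h $$ (i, i) else 0)"
    proof (rule sum.cong)
      fix l assume "l \<in> {..<n}"
      then show "g $$ (i, l) * h $$ (l, j) = (if l = i then g $$ (i, i) * h $$ (i, i) else 0)"
        using UT_zero[OF U(1), of l i] UT_zero[OF U(2), of j l] True j assms(3)
        by (cases l i rule: linorder_cases) auto
    qed simp
    then show ?thesis using e assms(3) True j by simp
  next
    case False
    have "(\<Sum>l<n. g $$ (i, l) * h $$ (l, j)) =
        (\<Sum>l<n. (if l = i then h $$ (i, j) else 0) + (if l = j then g $$ (i, j) else 0))"
    proof (rule sum.cong)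
      fix l assume l: "l \<in> {..<n}"
      show "g $$ (i, l) * h $$ (l, j) = (if l = i then h $$ (i, j) else 0) + (if l = j then g $$ (i, j) else 0)"
        using lower_central_D[OF assms(1,3), of l] lower_central_D[OF assms(2) _ assms(4), of l]
          UT_zero[OF U(2), of j l] l j assms(3,4) False
        by (cases "l < j"; cases "l = j") auto
    qed simp
    then show ?thesis using e assms(3,4) False j by (simp add: sum.distrib)
  qed
qed

lemma lower_central_derived: "derived_set (GL n) (lower_central n k) \<subseteq> lower_central n (Suc k)"
proof
  fix z assume "z \<in> derived_set (GL n) (lower_central n k)"
  then obtain g h where gh: "g \<in> lower_central n k" "h \<in> lower_central n k" "z = g * h * minv n g * minv n h" by auto
  note U = lower_central_UT[OF gh(1)] lower_central_UT[OF gh(2)]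
  have hg: "h * g \<in> UT n" by (rule UT_mult[OF U(2,1)])
  let ?u = "minv n (h * g)"
  have u: "?u \<in> UT n" by (rule UT_inv[OF hg])
  have z: "z = g * h * ?u"
    unfolding gh(3) minv_mult[OF U(2,1)[THEN UT_GL]] using U UT_inv[OF U(1)] UT_inv[OF U(2)]
    by (simp add: mmult_assoc[of _ n] UT_D)
  have ghc: "g * h \<in> carrier_mat n n" using U UT_D by simp
  have "z $$ (i, j) = (if i = j then 1 else 0)" if ij: "i < n" "j < n" "j < i + Suc k" for i j
  proof -
    have "z $$ (i, j) = (\<Sum>l<n. (g * h) $$ (i, l) * ?u $$ (l, j))"
      unfolding z using ghc UT_D[OF u] ij by (intro mmult_entry)
    also have "\<dots> = (\<Sum>l<n. (h * g) $$ (i, l) * ?u $$ (l, j))"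
    proof (rule sum.cong)
      fix l assume l: "l \<in> {..<n}"
      show "(g * h) $$ (i, l) * ?u $$ (l, j) = (h * g) $$ (i, l) * ?u $$ (l, j)"
      proof (cases "l < i + Suc k")
        case True
        then have "(g * h) $$ (i, l) = (h * g) $$ (i, l)"
          using lower_central_commute[OF gh(1,2) ij(1), of l] lower_central_commute[OF gh(2,1) ij(1), of l] l
          by (simp add: mult.commute add.commute)
        then show ?thesis by simp
      next
        case False
        then show ?thesis using UT_zero[OF u, of j l] l ij by simp
      qed
    qed simp
    also have "\<dots> = (h * g * ?u) $$ (i, j)" using UT_D[OF hg] UT_D[OF u] ij by (intro mmult_entry[symmetric])
    finally show ?thesis using GL_inv(2)[OF UT_GL[OF hg]] ij by simp
  qed
  moreover have "z \<in> carrier (GL n)" unfolding z by (intro GL_mult UT_GL U u)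
  ultimately show "z \<in> lower_central n (Suc k)" by (simp add: lower_central_def)
qed

text \<open>Commutators of elements of \<open>lower_central n k\<close> lie in \<open>lower_central n (Suc k)\<close>, and the
  sequence reaches the trivial group at \<open>n\<close>.\<close>

lemma UT_subgroup_solvable:
  assumes "subgroup H (GL n)" "H \<subseteq> UT n"
  shows "\<exists>k. (derived (GL n) ^^ k) H \<subseteq> {1\<^sub>m n}"
proof -
  have "(derived (GL n) ^^ n) H \<subseteq> lower_central n n"
  proof (rule GLn.derived_pow_le[where N = "lower_central n"])
    show "derived_set (GL n) (lower_central n k) \<subseteq> lower_central n (Suc k)" for k by (rule lower_central_derived)
  qed (use assms lower_central_subgroup in \<open>simp_all add: lower_central_0\<close>)
  moreover have "lower_central n n \<subseteq> {1\<^sub>m n}"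
    by (auto simp: lower_central_def dest!: GL_D intro!: eq_matI)
  ultimately show ?thesis by blast
qed

section \<open>Groups with a two by two block\<close>

text \<open>A linear group \<open>P\<close> with a surjection \<open>(a, b; c, d)\<close> onto \<open>GL(2)\<close> that is given by linear
  functions. The set \<open>P\<close> contains almost all points of a line through two of its points, so
  that the subsets cut out by linear conditions on the block are irreducible.\<close>

locale block_group =
  fixes n :: nat and P :: "complex mat set" and a b c d :: "complex mat \<Rightarrow> complex"
  assumes P_subgroup: "subgroup P (GL n)"
    and regs: "regular n a" "regular n b" "regular n c" "regular n d"
    and lin: "\<And>A B t. A \<in> carrier_mat n n \<Longrightarrow> B \<in> carrier_mat n n \<Longrightarrow>
      a (seg A B t) = (1 - t) * a A + t * a B \<and> b (seg A B t) = (1 - t) * b A + t * b B \<and>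
      c (seg A B t) = (1 - t) * c A + t * c B \<and> d (seg A B t) = (1 - t) * d A + t * d B"
    and block_mult: "\<And>g h. g \<in> P \<Longrightarrow> h \<in> P \<Longrightarrow>
      a (g * h) = a g * a h + b g * c h \<and> b (g * h) = a g * b h + b g * d h \<and>
      c (g * h) = c g * a h + d g * c h \<and> d (g * h) = c g * b h + d g * d h"
    and block_one: "a (1\<^sub>m n) = 1 \<and> b (1\<^sub>m n) = 0 \<and> c (1\<^sub>m n) = 0 \<and> d (1\<^sub>m n) = 1"
    and P_dense: "line_dense P"
    and block_onto: "\<And>\<alpha> \<beta> \<gamma> \<delta>. \<alpha> * \<delta> - \<beta> * \<gamma> \<noteq> 0 \<Longrightarrow> \<exists>g \<in> P. a g = \<alpha> \<and> b g = \<beta> \<and> c g = \<gamma> \<and> d g = \<delta>"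
    and unipotent_lift: "\<And>\<alpha> \<beta> \<gamma>. \<alpha> * \<alpha> + \<beta> * \<gamma> = 0 \<Longrightarrow>
      \<exists>g \<in> P. a g = 1 + \<alpha> \<and> b g = \<beta> \<and> c g = \<gamma> \<and> d g = 1 - \<alpha> \<and> (g - 1\<^sub>m n) ^\<^sub>m n = 0\<^sub>m n n"
    and unipotent_block: "\<And>g. g \<in> P \<Longrightarrow> (g - 1\<^sub>m n) ^\<^sub>m n = 0\<^sub>m n n \<Longrightarrow> a g + d g = 2 \<and> a g * d g - b g * c g = 1"
begin

lemma P_GL: "g \<in> P \<Longrightarrow> g \<in> carrier (GL n)"
  using subgroup.subset[OF P_subgroup] by blast

lemma P_D: "g \<in> P \<Longrightarrow> g \<in> carrier_mat n n"
  using P_GL GL_D by blast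

lemma P_one: "1\<^sub>m n \<in> P"
  using subgroup.one_closed[OF P_subgroup] by simp

lemma P_mult: "g \<in> P \<Longrightarrow> h \<in> P \<Longrightarrow> g * h \<in> P"
  using subgroup.m_closed[OF P_subgroup, of g h] by simp

lemma P_inv: "g \<in> P \<Longrightarrow> minv n g \<in> P"
  by (rule subgroup.m_inv_closed[OF P_subgroup])

lemma bmult:
  assumes "g \<in> P" "h \<in> P"
  shows "a (g * h) = a g * a h + b g * c h" "b (g * h) = a g * b h + b g * d h"
    "c (g * h) = c g * a h + d g * c h" "d (g * h) = c g * b h + d g * d h"
  using block_mult[OF assms] by blast+

definition bdet :: "complex mat \<Rightarrow> complex" where
  "bdet g = a g * d g - b g * c g"

lemma bdet_mult: "g \<in> P \<Longrightarrow> h \<in> P \<Longrightarrow> bdet (g * h) = bdet g * bdet h"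
  unfolding bdet_def by (simp add: bmult algebra_simps)

lemma bdet_nz: "g \<in> P \<Longrightarrow> bdet g \<noteq> 0"
  using bdet_mult[OF _ P_inv, of g g] GL_inv(2)[OF P_GL, of g] block_one by (auto simp: bdet_def)

lemma binv:
  assumes "g \<in> P"
  shows "bdet g * a (minv n g) = d g" "bdet g * b (minv n g) = - b g"
    "bdet g * c (minv n g) = - c g" "bdet g * d (minv n g) = a g"
proof -
  have "a (g * minv n g) = 1" "b (g * minv n g) = 0" "c (g * minv n g) = 0" "d (g * minv n g) = 1"
    using block_one GL_inv(2)[OF P_GL[OF assms]] by simp_all
  then have *: "a g * a (minv n g) + b g * c (minv n g) = 1" "a g * b (minv n g) + b g * d (minv n g) = 0"
    "c g * a (minv n g) + d g * c (minv n g) = 0" "c g * b (minv n g) + d g * d (minv n g) = 1"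
    using bmult[OF assms P_inv[OF assms]] by simp_all
  show "bdet g * a (minv n g) = d g" "bdet g * b (minv n g) = - b g"
    "bdet g * c (minv n g) = - c g" "bdet g * d (minv n g) = a g"
    using cramer2[OF *(1,3)] cramer2[OF *(2,4)] by (simp_all add: bdet_def)
qed

text \<open>The preimage of the scalars, which turns out to be the solvable radical.\<close>

definition V0 :: "complex mat set" where
  "V0 = {g \<in> P. b g = 0 \<and> c g = 0 \<and> a g = d g}"

abbreviation PG :: "complex mat monoid" where
  "PG \<equiv> (GL n)\<lparr>carrier := P\<rparr>"

lemma PG_group: "group PG"
  by (rule GLn.subgroup_imp_group[OF P_subgroup])

lemma PG_inv: "g \<in> P \<Longrightarrow> inv\<^bsub>PG\<^esub> g = minv n g"
  by (rule GLn.m_inv_consistent[OF P_subgroup])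

lemma V0_P: "V0 \<subseteq> P"
  by (auto simp: V0_def)

lemma V0_a_nz: "z \<in> V0 \<Longrightarrow> a z \<noteq> 0"
  using bdet_nz[of z] by (auto simp: V0_def bdet_def)

lemma V0_normal: "V0 \<lhd> PG"
proof -
  interpret PG: group PG by (rule PG_group)
  have "subgroup V0 PG"
  proof (rule PG.subgroupI)
    show "V0 \<noteq> {}" using P_one block_one by (auto simp: V0_def)
    show "inv\<^bsub>PG\<^esub> g \<in> V0" if "g \<in> V0" for g
    proof -
      have g: "g \<in> P" "b g = 0" "c g = 0" "a g = d g" using that by (auto simp: V0_def)
      have "bdet g * b (minv n g) = 0" "bdet g * c (minv n g) = 0" "bdet g * a (minv n g) = bdet g * d (minv n g)"
        using binv[OF g(1)] g(2-4) by simp_all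
      then show ?thesis using bdet_nz[OF g(1)] P_inv[OF g(1)] PG_inv[OF g(1)] by (simp add: V0_def)
    qed
    show "g \<otimes>\<^bsub>PG\<^esub> h \<in> V0" if "g \<in> V0" "h \<in> V0" for g h
      using that by (auto simp: V0_def bmult P_mult)
  qed (use V0_P in simp)
  moreover have "g \<otimes>\<^bsub>PG\<^esub> h \<otimes>\<^bsub>PG\<^esub> inv\<^bsub>PG\<^esub> g \<in> V0" if "h \<in> V0" "g \<in> carrier PG" for g h
  proof -
    have g: "g \<in> P" "minv n g \<in> P" using that(2) P_inv by auto
    have h: "h \<in> P" "b h = 0" "c h = 0" "d h = a h" using that(1) by (auto simp: V0_def)
    have gh: "a (g * h) = a h * a g" "b (g * h) = a h * b g" "c (g * h) = a h * c g" "d (g * h) = a h * d g"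
      using h by (simp_all add: bmult[OF g(1) h(1)])
    have e: "a (g * h * minv n g) = a h * a (g * minv n g)" "b (g * h * minv n g) = a h * b (g * minv n g)"
      "c (g * h * minv n g) = a h * c (g * minv n g)" "d (g * h * minv n g) = a h * d (g * minv n g)"
      by (simp_all add: bmult[OF P_mult[OF g(1) h(1)] g(2)] bmult[OF g] gh algebra_simps)
    have "b (g * h * minv n g) = 0" "c (g * h * minv n g) = 0" "a (g * h * minv n g) = d (g * h * minv n g)"
      unfolding e GL_inv(2)[OF P_GL[OF g(1)]] using block_one by simp_all
    then show ?thesis using g h PG_inv[OF g(1)] by (simp add: V0_def P_mult)
  qed
  ultimately show ?thesis by (simp add: PG.normal_inv_iff)
qed

text \<open>An element with nonscalar block does not commute, up to scalars, with all of its
  conjugates: if its block has lower left entry \<open>r\<close>, then a comparison with the conjugates by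
  \<open>(1, t; 0, 1)\<close> for \<open>t = 1, 2\<close> shows \<open>r = 0\<close>. So a normal subgroup of \<open>P\<close> with commutators
  in the scalars consists of scalars.\<close>

lemma commutator_scalar:
  assumes g: "g \<in> P" and h: "h \<in> P" and v: "h * g * minv n h * minv n g \<in> V0"
  shows "\<exists>\<mu>. a (h * g) = \<mu> * a (g * h) \<and> b (h * g) = \<mu> * b (g * h) \<and> c (h * g) = \<mu> * c (g * h) \<and>
    d (h * g) = \<mu> * d (g * h) \<and> \<mu> * \<mu> = 1"
proof -
  let ?z = "h * g * minv n h * minv n g"
  have z: "?z \<in> P" "b ?z = 0" "c ?z = 0" "d ?z = a ?z" using v by (auto simp: V0_def)
  note D = P_D[OF g] P_D[OF h] P_D[OF P_inv[OF g]] P_D[OF P_inv[OF h]]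
  have hg: "h * g = ?z * (g * h)"
  proof -
    have "?z * (g * h) = h * g * (minv n h * (minv n g * (g * h)))" using D by (simp add: mmult_assoc[of _ n])
    also have "\<dots> = h * g" using D by (simp add: mmult_cancel(2)[OF P_GL[OF g]] GL_inv(3)[OF P_GL[OF h]])
    finally show ?thesis by simp
  qed
  have gh: "g * h \<in> P" by (rule P_mult[OF g h])
  have e: "a (h * g) = a ?z * a (g * h)" "b (h * g) = a ?z * b (g * h)" "c (h * g) = a ?z * c (g * h)" "d (h * g) = a ?z * d (g * h)"
    by (subst hg, simp add: bmult[OF z(1) gh] z(2-4))+
  have "bdet g * bdet h = bdet (h * g)" by (simp add: bdet_mult g h)
  also have "\<dots> = a ?z * a ?z * bdet (g * h)" unfolding bdet_def e by (simp add: algebra_simps)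
  also have "bdet (g * h) = bdet g * bdet h" by (rule bdet_mult[OF g h])
  finally have "a ?z * a ?z = 1" using bdet_nz[OF g] bdet_nz[OF h] by simp
  then show ?thesis using e by blast
qed

lemma normal_abelian_mod_scalars:
  assumes N: "K \<lhd> PG" and ab: "derived PG K \<subseteq> V0"
  shows "K \<subseteq> V0"
proof -
  interpret PG: group PG by (rule PG_group)
  interpret K: normal K PG by (rule N)
  have KP: "g \<in> P" if "g \<in> K" for g using K.subset that by auto
  have conj: "x * g * minv n x \<in> K" if "g \<in> K" "x \<in> P" for g x
    using K.inv_op_closed2[of x g] that PG_inv[OF that(2)] by simp
  have comm: "h * g * minv n h * minv n g \<in> V0" if "g \<in> K" "h \<in> K" for g h
  proof -
    have "h \<otimes>\<^bsub>PG\<^esub> g \<otimes>\<^bsub>PG\<^esub> inv\<^bsub>PG\<^esub> h \<otimes>\<^bsub>PG\<^esub> inv\<^bsub>PG\<^esub> g \<in> derived_set PG K" using that by blast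
    then have "h * g * minv n h * minv n g \<in> derived_set PG K" using that KP by (simp add: PG_inv)
    then show ?thesis using ab unfolding derived_def by (blast intro: generate.incl)
  qed
  have c0: "c g = 0" if g: "g \<in> K" for g
  proof (rule ccontr)
    assume r: "c g \<noteq> 0"
    have gP: "g \<in> P" by (rule KP[OF g])
    have "t * c g * (t * c g) = 2 * (a g * a g + b g * c g)" if t: "t \<noteq> 0" for t
    proof -
      obtain x where x: "x \<in> P" "a x = 1" "b x = t" "c x = 0" "d x = 1"
        using block_onto[of 1 1 t 0] by auto
      have xi: "a (minv n x) = 1" "b (minv n x) = - t" "c (minv n x) = 0" "d (minv n x) = 1"
        using binv[OF x(1)] x by (simp_all add: bdet_def)
      let ?h = "x * g * minv n x"
      have hK: "?h \<in> K" by (rule conj[OF g x(1)])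
      have hP: "?h \<in> P" by (rule KP[OF hK])
      have he: "a ?h = a g + t * c g" "b ?h = b g + t * d g - t * (a g + t * c g)" "c ?h = c g" "d ?h = d g - t * c g"
        using x xi by (simp_all add: bmult[OF P_mult[OF x(1) gP] P_inv[OF x(1)]] bmult[OF x(1) gP] algebra_simps)
      obtain \<mu> where l: "a (?h * g) = \<mu> * a (g * ?h)" "c (?h * g) = \<mu> * c (g * ?h)" "\<mu> * \<mu> = 1"
        using commutator_scalar[OF gP hP comm[OF g hK]] by blast
      have l2: "\<mu> = 1 \<or> \<mu> = - 1" using l(3) by (metis mult_1 square_eq_iff)
      have c1: "c g * (a g + d g - t * c g) = \<mu> * (c g * (a g + d g + t * c g))"
        using l(2) by (simp add: bmult[OF gP hP] bmult[OF hP gP] he algebra_simps)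
      have "\<mu> \<noteq> 1"
      proof
        assume "\<mu> = 1"
        then have "2 * (t * (c g * c g)) = 0" using c1 by (simp add: algebra_simps)
        then show False using t r by simp
      qed
      then have l1: "\<mu> = - 1" using l2 by blast
      then have "2 * (c g * (a g + d g)) = 0" using c1 by (simp add: algebra_simps)
      then have dg: "d g = - a g" using r by (simp add: add_eq_0_iff)
      show ?thesis using l(1) unfolding l1 by (simp add: bmult[OF gP hP] bmult[OF hP gP] he dg algebra_simps)
    qed
    from this[of 1] this[of 2] have "4 * (c g * c g) = c g * c g" by simp
    then have "c g * c g = 0" unfolding mult_cancel_right2 by simp
    then show False using r by simp
  qed
  show ?thesis
  proof
    fix g assume g: "g \<in> K"
    have gP: "g \<in> P" by (rule KP[OF g])
    obtain x where x: "x \<in> P" "a x = 0" "b x = 1" "c x = 1" "d x = 0"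
      using block_onto[of 0 0 1 1] by auto
    have xi: "a (minv n x) = 0" "b (minv n x) = 1" "c (minv n x) = 1" "d (minv n x) = 0"
      using binv[OF x(1)] x by (simp_all add: bdet_def)
    have "c (x * g * minv n x) = b g"
      using x xi by (simp add: bmult[OF P_mult[OF x(1) gP] P_inv[OF x(1)]] bmult[OF x(1) gP])
    then have bg: "b g = 0" using c0[OF conj[OF g x(1)]] by simp
    obtain y where y: "y \<in> P" "a y = 1" "b y = 0" "c y = 1" "d y = 1"
      using block_onto[of 1 1 0 1] by auto
    have yi: "a (minv n y) = 1" "b (minv n y) = 0" "c (minv n y) = - 1" "d (minv n y) = 1"
      using binv[OF y(1)] y by (simp_all add: bdet_def)
    have "c (y * g * minv n y) = a g - b g + c g - d g"
      using y yi by (simp add: bmult[OF P_mult[OF y(1) gP] P_inv[OF y(1)]] bmult[OF y(1) gP])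
    then have "a g = d g" using c0[OF conj[OF g y(1)]] c0[OF g] bg by simp
    then show "g \<in> V0" using gP bg c0[OF g] by (simp add: V0_def)
  qed
qed

text \<open>The last term of the derived series that is not scalar would contradict the previous lemma.\<close>

lemma normal_solvable_mod_scalars:
  assumes N: "K \<lhd> PG" and ab: "(derived PG ^^ k) K \<subseteq> V0"
  shows "K \<subseteq> V0"
  using ab
proof (induction k)
  case (Suc k)
  interpret PG: group PG by (rule PG_group)
  have "(derived PG ^^ k) K \<lhd> PG" for k
    by (induction k) (simp_all add: N PG.derived_is_normal)
  then show ?case using Suc normal_abelian_mod_scalars by simp
qed simp

lemma not_solvable_mod_scalars: "\<not> (derived PG ^^ k) P \<subseteq> V0"
proof
  assume *: "(derived PG ^^ k) P \<subseteq> V0"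
  interpret PG: group PG by (rule PG_group)
  have "P \<subseteq> V0" using normal_solvable_mod_scalars[of P k] PG.normal_self * by simp
  moreover obtain g where "g \<in> P" "b g = 1" using block_onto[of 1 1 1 0] by auto
  ultimately show False by (auto simp: V0_def)
qed

abbreviation PT :: "complex mat topology" where
  "PT \<equiv> subtopology (zariski n) P"

lemma P_subset: "P \<subseteq> carrier_mat n n"
  using P_D by blast

lemma topspace_PT [simp]: "topspace PT = P"
  using P_subset by auto

lemma closed_PT:
  assumes "regular n f"
  shows "closedin PT {g \<in> P. f g = 0}"
proof -
  have "{g \<in> P. f g = 0} = {A \<in> carrier_mat n n. f A = 0} \<inter> P" using P_subset by blast
  then show ?thesis unfolding closedin_subtopology using closed_zero[OF assms] by blast
qed

lemma block_line_dense:
  assumes "\<And>A B t. A \<in> P \<Longrightarrow> B \<in> P \<Longrightarrow> seg A B t \<in> P \<Longrightarrow> L A \<Longrightarrow> L B \<Longrightarrow> L (seg A B t)"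
  shows "line_dense {g \<in> P. L g}"
  unfolding line_dense_def
proof (intro ballI)
  fix A B assume AB: "A \<in> {g \<in> P. L g}" "B \<in> {g \<in> P. L g}"
  then have "{t. seg A B t \<notin> {g \<in> P. L g}} \<subseteq> {t. seg A B t \<notin> P}" using assms by auto
  then show "finite {t. seg A B t \<notin> {g \<in> P. L g}}"
    using P_dense AB unfolding line_dense_def by (auto intro: finite_subset)
qed

lemma block_connected:
  assumes "\<And>A B t. A \<in> P \<Longrightarrow> B \<in> P \<Longrightarrow> seg A B t \<in> P \<Longrightarrow> L A \<Longrightarrow> L B \<Longrightarrow> L (seg A B t)"
  shows "connectedin PT {g \<in> P. L g}"
  using line_dense_connected[of "{g \<in> P. L g}" n] block_line_dense[of L] assms P_subset
  by (auto simp: connectedin_subtopology)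

lemma V0_closed: "closedin PT V0"
proof -
  have "V0 = {g \<in> P. b g = 0} \<inter> {g \<in> P. c g = 0} \<inter> {g \<in> P. a g - d g = 0}" by (auto simp: V0_def)
  then show ?thesis using closed_PT[OF regs(2)] closed_PT[OF regs(3)] closed_PT[OF regular_diff[OF regs(1,4)]]
    by (simp add: closedin_Int)
qed

lemma V0_connected: "connectedin PT V0"
  unfolding V0_def by (rule block_connected) (simp add: lin[OF P_D P_D])

text \<open>A connected solvable normal subgroup consists of elements with scalar block, by the preceding lemmas;
  and the set of all of these is closed, connected and, as a group of triangular matrices, solvable.\<close>

lemma solvable_radical_V0:
  assumes "V0 \<subseteq> UT n"
  shows "solvable_radical PG PT = V0"
  unfolding solvable_radical_def
proof (rule Greatest_equality)
  interpret PG: group PG by (rule PG_group)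
  have sub: "subgroup V0 PG" using normal_imp_subgroup[OF V0_normal] .
  have subG: "subgroup V0 (GL n)" by (rule GLn.incl_subgroup[OF P_subgroup sub])
  have "solvable (PG\<lparr>carrier := V0\<rparr>)"
    using UT_subgroup_solvable[OF subG assms] GLn.solvable_subgroup_iff[OF subG] by simp
  then show "closedin PT V0 \<and> connectedin PT V0 \<and> V0 \<lhd> PG \<and> solvable (PG\<lparr>carrier := V0\<rparr>)"
    using V0_closed V0_connected V0_normal by blast
  fix R assume R: "closedin PT R \<and> connectedin PT R \<and> R \<lhd> PG \<and> solvable (PG\<lparr>carrier := R\<rparr>)"
  then obtain k where "(derived PG ^^ k) R \<subseteq> {\<one>\<^bsub>PG\<^esub>}"
    using PG.solvable_subgroup_iff[OF normal_imp_subgroup, of R] by blast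
  also have "\<dots> \<subseteq> V0" using P_one block_one by (simp add: V0_def)
  finally show "R \<subseteq> V0" using normal_solvable_mod_scalars R by blast
qed

end

section \<open>The quotient of a block group by its scalars\<close>

context block_group
begin

definition cl :: "complex mat \<Rightarrow> complex mat set" where
  "cl g = V0 #>\<^bsub>GL n\<^esub> g"

abbreviation Q :: "complex mat set monoid" where
  "Q \<equiv> PG Mod V0"

abbreviation QT :: "complex mat set topology" where
  "QT \<equiv> quot_topology PT (\<lambda>p. V0 #>\<^bsub>GL n\<^esub> p)"

abbreviation QU :: "complex mat set set" where
  "QU \<equiv> {x \<in> carrier Q. \<exists>u \<in> x. (u - 1\<^sub>m n) ^\<^sub>m n = 0\<^sub>m n n}"

lemma Q_group: "group Q"
  by (rule normal.factorgroup_is_group[OF V0_normal])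

lemma cl_PG: "cl g = V0 #>\<^bsub>PG\<^esub> g"
  by (simp add: cl_def r_coset_def)

lemma carrier_Q: "carrier Q = cl ` P"
  by (simp add: carrier_FactGroup cl_PG)

lemma one_Q: "\<one>\<^bsub>Q\<^esub> = V0"
  by simp

lemma cl_hom: "group_hom PG Q cl"
proof -
  have "cl = (\<lambda>g. V0 #>\<^bsub>PG\<^esub> g)" by (simp add: cl_PG fun_eq_iff)
  then show ?thesis
    using normal.r_coset_hom_Mod[OF V0_normal] PG_group Q_group by (simp add: group_hom_def group_hom_axioms_def)
qed

lemma cl_mult: "g \<in> P \<Longrightarrow> h \<in> P \<Longrightarrow> cl g \<otimes>\<^bsub>Q\<^esub> cl h = cl (g * h)"
  using group_hom.hom_mult[OF cl_hom, of g h] by simp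

lemma cl_inv: "g \<in> P \<Longrightarrow> inv\<^bsub>Q\<^esub> (cl g) = cl (minv n g)"
  using group_hom.hom_inv[OF cl_hom, of g] PG_inv by simp

lemma cl_one: "cl (1\<^sub>m n) = V0"
  using group_hom.hom_one[OF cl_hom] by simp

lemma in_cl: "u \<in> cl g \<longleftrightarrow> (\<exists>z \<in> V0. u = z * g)"
  by (auto simp: cl_def r_coset_def)

lemma V0_I:
  assumes "g \<in> P" "b g = 0" "c g = 0" "a g = d g"
  shows "g \<in> V0"
  using assms by (simp add: V0_def)

lemma cl_eq:
  assumes g: "g \<in> P" and h: "h \<in> P"
  shows "cl g = cl h \<longleftrightarrow> (\<exists>s. s \<noteq> 0 \<and> a g = s * a h \<and> b g = s * b h \<and> c g = s * c h \<and> d g = s * d h)"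
proof
  assume "cl g = cl h"
  moreover have "g \<in> cl g" unfolding in_cl using P_one block_one g P_D
    by (intro bexI[of _ "1\<^sub>m n"] V0_I) auto
  ultimately obtain z where z: "z \<in> V0" "g = z * h" by (auto simp: in_cl)
  then have "z \<in> P" "b z = 0" "c z = 0" "d z = a z" by (auto simp: V0_def)
  then show "\<exists>s. s \<noteq> 0 \<and> a g = s * a h \<and> b g = s * b h \<and> c g = s * c h \<and> d g = s * d h"
    using z V0_a_nz[OF z(1)] h by (intro exI[of _ "a z"]) (simp add: bmult)
next
  assume "\<exists>s. s \<noteq> 0 \<and> a g = s * a h \<and> b g = s * b h \<and> c g = s * c h \<and> d g = s * d h"
  then obtain s where s: "s \<noteq> 0" "a g = s * a h" "b g = s * b h" "c g = s * c h" "d g = s * d h" by blast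
  interpret hom: group_hom PG Q cl by (rule cl_hom)
  note hi = P_inv[OF h]
  have e: "a (g * minv n h) = s * a (h * minv n h)" "b (g * minv n h) = s * b (h * minv n h)"
    "c (g * minv n h) = s * c (h * minv n h)" "d (g * minv n h) = s * d (h * minv n h)"
    by (simp_all add: bmult[OF g hi] bmult[OF h hi] s algebra_simps)
  have "g * minv n h \<in> V0"
    by (rule V0_I) (use e GL_inv(2)[OF P_GL[OF h]] block_one P_mult[OF g hi] in simp_all)
  moreover have "g = g * minv n h * h" using mmult_cancel(4)[OF P_GL[OF h] P_D[OF g]] by simp
  ultimately have "g \<in> cl h" using in_cl by blast
  then have "V0 #>\<^bsub>PG\<^esub> h = V0 #>\<^bsub>PG\<^esub> g"
    using group.repr_independence[OF PG_group, of g V0 h] normal_imp_subgroup[OF V0_normal] h by (simp add: cl_PG)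
  then show "cl g = cl h" by (simp add: cl_PG)
qed

lemma cl_one_iff: "g \<in> P \<Longrightarrow> cl g = V0 \<longleftrightarrow> b g = 0 \<and> c g = 0 \<and> a g = d g"
  using cl_eq[of g "1\<^sub>m n"] P_one block_one bdet_nz[of g] unfolding cl_one by (auto simp: bdet_def)

lemma openin_QT: "openin QT U \<longleftrightarrow> U \<subseteq> cl ` P \<and> openin PT {g \<in> P. cl g \<in> U}"
  unfolding openin_quot_topology topspace_PT cl_def ..

lemma topspace_QT [simp]: "topspace QT = carrier Q"
proof -
  have "{g \<in> P. cl g \<in> cl ` P} = P" by blast
  then have "openin QT (cl ` P)"
    unfolding openin_QT using openin_topspace[of PT, unfolded topspace_PT] by simp
  then have "\<Union>{U. openin QT U} = cl ` P" unfolding openin_QT by blast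
  then show ?thesis by (simp add: topspace_def carrier_Q)
qed

lemma closed_QT: "closedin QT Z \<longleftrightarrow> Z \<subseteq> carrier Q \<and> closedin PT {g \<in> P. cl g \<in> Z}"
proof -
  have "{g \<in> P. cl g \<in> carrier Q - Z} = P - {g \<in> P. cl g \<in> Z}" by (auto simp: carrier_Q)
  then show ?thesis
    unfolding closedin_def topspace_QT openin_QT topspace_PT by (auto simp: carrier_Q)
qed

lemma cl_continuous: "continuous_map PT QT cl"
  unfolding continuous_map_def topspace_QT topspace_PT openin_QT by (auto simp: carrier_Q)

lemma cl_connected: "connectedin PT Z \<Longrightarrow> connectedin QT (cl ` Z)"
  by (rule connectedin_continuous_map_image[OF cl_continuous])

definition cls :: "(complex mat \<Rightarrow> bool) \<Rightarrow> complex mat set set" where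
  "cls L = cl ` {g \<in> P. L g}"

lemma cl_in_cls:
  assumes "g \<in> P" "\<And>h. h \<in> P \<Longrightarrow> cl h = cl g \<Longrightarrow> L h \<Longrightarrow> L g"
  shows "cl g \<in> cls L \<longleftrightarrow> L g"
  using assms by (auto simp: cls_def)

text \<open>The topology of the quotient is the quotient topology, so a condition that is invariant under scalars
  can be tested on \<open>P\<close>.\<close>

lemma cls_closed:
  assumes "closedin PT {g \<in> P. L g}" "\<And>g h. g \<in> P \<Longrightarrow> h \<in> P \<Longrightarrow> cl h = cl g \<Longrightarrow> L h \<Longrightarrow> L g"
  shows "closedin QT (cls L)"
proof -
  have "{g \<in> P. cl g \<in> cls L} = {g \<in> P. L g}" using cl_in_cls assms(2) by blast
  then show ?thesis unfolding closed_QT using assms(1) by (auto simp: cls_def carrier_Q)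
qed

lemma derived_cl:
  assumes "H \<subseteq> P"
  shows "(derived Q ^^ k) (cl ` H) = cl ` ((derived PG ^^ k) H)"
  using group_hom.exp_of_derived_img[OF cl_hom, of H k] assms by simp

text \<open>The preimages in \<open>P\<close> of the standard Borel subgroup of the quotient and of its unipotent radical.\<close>

definition Bp :: "complex mat set" where "Bp = {g \<in> P. c g = 0}"
definition Up :: "complex mat set" where "Up = {g \<in> P. c g = 0 \<and> a g = d g}"

lemma Bp_iff [simp]: "g \<in> Bp \<longleftrightarrow> g \<in> P \<and> c g = 0"
  by (simp add: Bp_def)

lemma Up_iff [simp]: "g \<in> Up \<longleftrightarrow> g \<in> P \<and> c g = 0 \<and> a g = d g"
  by (simp add: Up_def)

lemma Bp_nz: "g \<in> P \<Longrightarrow> c g = 0 \<Longrightarrow> a g \<noteq> 0 \<and> d g \<noteq> 0"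
  using bdet_nz[of g] by (auto simp: bdet_def)

lemma Bp_inv:
  assumes "g \<in> P" "c g = 0"
  shows "a (minv n g) = 1 / a g" "c (minv n g) = 0" "d (minv n g) = 1 / d g" "b (minv n g) = - b g / (a g * d g)"
  using binv[OF assms(1)] Bp_nz[OF assms] assms(2) by (auto simp: bdet_def field_simps)

lemma Bp_subgroup: "subgroup Bp PG"
proof (rule group.subgroupI[OF PG_group])
  have "1\<^sub>m n \<in> Bp" using P_one block_one by simp
  then show "Bp \<noteq> {}" by blast
  show "Bp \<subseteq> carrier PG" by auto
next
  fix g assume "g \<in> Bp"
  then have g: "g \<in> P" "c g = 0" by simp_all
  show "inv\<^bsub>PG\<^esub> g \<in> Bp"
    unfolding PG_inv[OF g(1)] using P_inv[OF g(1)] Bp_inv[OF g(1,2)] by simp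
next
  fix g h assume "g \<in> Bp" "h \<in> Bp"
  then have g: "g \<in> P" "c g = 0" and h: "h \<in> P" "c h = 0" by simp_all
  have 1: "g * h \<in> P" by (rule P_mult[OF g(1) h(1)])
  have 2: "c (g * h) = 0" unfolding bmult(3)[OF g(1) h(1)] g(2) h(2) by simp
  have 3: "g \<otimes>\<^bsub>PG\<^esub> h = g * h" by simp
  show "g \<otimes>\<^bsub>PG\<^esub> h \<in> Bp" unfolding 3 using 1 2 by simp
qed

lemma Up_subgroup: "subgroup Up PG"
proof (rule group.subgroupI[OF PG_group])
  have "1\<^sub>m n \<in> Up" using P_one block_one by simp
  then show "Up \<noteq> {}" by blast
  show "Up \<subseteq> carrier PG" by auto
next
  fix g assume "g \<in> Up"
  then have g: "g \<in> P" "c g = 0" "a g = d g" by simp_all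
  show "inv\<^bsub>PG\<^esub> g \<in> Up"
    unfolding PG_inv[OF g(1)] using P_inv[OF g(1)] Bp_inv[OF g(1,2)] g(3) by simp
next
  fix g h assume "g \<in> Up" "h \<in> Up"
  then have g: "g \<in> P" "c g = 0" "a g = d g" and h: "h \<in> P" "c h = 0" "a h = d h" by simp_all
  have 1: "g * h \<in> P" by (rule P_mult[OF g(1) h(1)])
  have 2: "c (g * h) = 0" unfolding bmult(3)[OF g(1) h(1)] g(2) h(2) by simp
  have 3: "a (g * h) = d (g * h)" unfolding bmult[OF g(1) h(1)] g(2,3) h(2,3) by simp
  have 4: "g \<otimes>\<^bsub>PG\<^esub> h = g * h" by simp
  show "g \<otimes>\<^bsub>PG\<^esub> h \<in> Up" unfolding 4 using 1 2 3 by simp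
qed

lemma Bp_derived: "derived PG Bp \<subseteq> Up"
  unfolding derived_def
proof (rule group.generate_subgroup_incl[OF PG_group _ Up_subgroup], rule subsetI)
  fix z assume "z \<in> derived_set PG Bp"
  then obtain g h where gh: "g \<in> Bp" "h \<in> Bp" "z = g \<otimes>\<^bsub>PG\<^esub> h \<otimes>\<^bsub>PG\<^esub> inv\<^bsub>PG\<^esub> g \<otimes>\<^bsub>PG\<^esub> inv\<^bsub>PG\<^esub> h"
    by blast
  then have g: "g \<in> P" "c g = 0" and h: "h \<in> P" "c h = 0" by simp_all
  have z: "z = g * h * minv n g * minv n h" using gh(3) PG_inv[OF g(1)] PG_inv[OF h(1)] by simp
  have m: "g * h \<in> P" "g * h * minv n g \<in> P" "z \<in> P" unfolding z by (intro P_mult P_inv g h)+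
  show "z \<in> Up"
    using m(3) g h Bp_nz[OF g] Bp_nz[OF h] unfolding z
    by (simp add: bmult[OF m(2) P_inv[OF h(1)]] bmult[OF m(1) P_inv[OF g(1)]] bmult[OF g(1) h(1)] Bp_inv)
qed

lemma Up_derived: "derived PG Up \<subseteq> V0"
  unfolding derived_def
proof (rule group.generate_subgroup_incl[OF PG_group _ normal_imp_subgroup[OF V0_normal]], rule subsetI)
  fix z assume "z \<in> derived_set PG Up"
  then obtain g h where gh: "g \<in> Up" "h \<in> Up" "z = g \<otimes>\<^bsub>PG\<^esub> h \<otimes>\<^bsub>PG\<^esub> inv\<^bsub>PG\<^esub> g \<otimes>\<^bsub>PG\<^esub> inv\<^bsub>PG\<^esub> h"
    by blast
  then have g: "g \<in> P" "c g = 0" "a g = d g" and h: "h \<in> P" "c h = 0" "a h = d h" by simp_all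
  have z: "z = g * h * minv n g * minv n h" using gh(3) PG_inv[OF g(1)] PG_inv[OF h(1)] by simp
  have m: "g * h \<in> P" "g * h * minv n g \<in> P" "z \<in> P" unfolding z by (intro P_mult P_inv g h)+
  show "z \<in> V0"
    using m(3) g h Bp_nz[OF g(1,2)] Bp_nz[OF h(1,2)] unfolding z
    by (simp add: V0_def bmult[OF m(2) P_inv[OF h(1)]] bmult[OF m(1) P_inv[OF g(1)]] bmult[OF g(1) h(1)] Bp_inv field_simps)
qed

lemma Bp_solvable_mod: "(derived PG ^^ 2) Bp \<subseteq> V0"
proof -
  have "(derived PG ^^ 2) Bp = derived PG (derived PG Bp)" by (simp add: numeral_2_eq_2)
  also have "\<dots> \<subseteq> derived PG Up" by (rule group.mono_derived[OF PG_group Bp_derived])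
  finally show ?thesis using Up_derived by blast
qed

lemma subgroup_of_Borel_solvable:
  assumes "subgroup H Q" "H \<subseteq> cl ` Bp"
  shows "solvable (Q\<lparr>carrier := H\<rparr>)"
proof -
  interpret Q: group Q by (rule Q_group)
  have "(derived Q ^^ 2) H \<subseteq> (derived Q ^^ 2) (cl ` Bp)" by (rule Q.mono_exp_of_derived[OF assms(2)])
  also have "\<dots> = cl ` ((derived PG ^^ 2) Bp)" by (rule derived_cl) auto
  also have "\<dots> \<subseteq> cl ` V0" using Bp_solvable_mod by blast
  also have "\<dots> \<subseteq> {\<one>\<^bsub>Q\<^esub>}" using cl_one_iff V0_P by (auto simp: V0_def)
  finally show ?thesis using Q.solvable_subgroup_iff[OF assms(1)] by blast
qed

lemma cls_Bp: "cl ` Bp = cls (\<lambda>g. c g = 0)" and cls_Up: "cl ` Up = cls (\<lambda>g. c g = 0 \<and> a g = d g)"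
  by (auto simp: cls_def Bp_def Up_def)

lemma Bp_closed: "closedin QT (cl ` Bp)"
  unfolding cls_Bp by (rule cls_closed[OF closed_PT[OF regs(3)]]) (auto simp: cl_eq)

lemma Up_closed: "closedin QT (cl ` Up)"
  unfolding cls_Up
proof (rule cls_closed)
  have "{g \<in> P. c g = 0 \<and> a g = d g} = {g \<in> P. c g = 0} \<inter> {g \<in> P. a g - d g = 0}" by auto
  then show "closedin PT {g \<in> P. c g = 0 \<and> a g = d g}"
    using closed_PT[OF regs(3)] closed_PT[OF regular_diff[OF regs(1,4)]] by (simp add: closedin_Int)
qed (auto simp: cl_eq)

lemma Bp_connected: "connectedin QT (cl ` Bp)"
  unfolding Bp_def by (rule cl_connected, rule block_connected) (simp add: lin[OF P_D P_D])

lemma Up_connected: "connectedin QT (cl ` Up)"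
  unfolding Up_def by (rule cl_connected, rule block_connected) (simp add: lin[OF P_D P_D])

lemma cl_subgroup: "subgroup H PG \<Longrightarrow> subgroup (cl ` H) Q"
  by (rule group_hom.subgroup_img_is_subgroup[OF cl_hom])

text \<open>A larger subgroup is the whole quotient, because \<open>B\<close> acts transitively on the points of the
  projective line other than its fixed point, and the quotient is not solvable.\<close>

lemma Bp_maximal:
  assumes D: "subgroup D Q" "solvable (Q\<lparr>carrier := D\<rparr>)" and sub: "cl ` Bp \<subseteq> D"
  shows "D = cl ` Bp"
proof (rule ccontr)
  assume "D \<noteq> cl ` Bp"
  have DQ: "D \<subseteq> cl ` P" using subgroup.subset[OF D(1)] by (simp add: carrier_Q)
  then obtain g where g: "g \<in> P" "cl g \<in> D" "c g \<noteq> 0"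
    using sub \<open>D \<noteq> cl ` Bp\<close> Bp_iff by blast
  have "cl h \<in> D" if h: "h \<in> P" for h
  proof (cases "c h = 0")
    case True
    then show ?thesis using h sub by (auto simp: image_subset_iff)
  next
    case False
    obtain u where u: "u \<in> P" "a u = 1" "b u = (c g * d h / c h - d g) / c g" "c u = 0" "d u = 1"
      using block_onto[of 1 1 _ 0] by auto
    let ?x = "g * u * minv n h"
    have gu: "g * u \<in> P" by (rule P_mult[OF g(1) u(1)])
    have x: "?x \<in> P" by (rule P_mult[OF gu P_inv[OF h]])
    have "c ?x = c g * a (minv n h) + (c g * b u + d g) * c (minv n h)"
      by (simp add: bmult[OF gu P_inv[OF h]] bmult[OF g(1) u(1)] u)
    also have "c g * b u + d g = c g * d h / c h" using g(3) by (simp add: u(3))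
    finally have "bdet h * c ?x = c g * (bdet h * a (minv n h)) + c g * d h / c h * (bdet h * c (minv n h))"
      by (simp add: algebra_simps)
    also have "\<dots> = 0" unfolding binv[OF h] using False by simp
    finally have cx: "c ?x = 0" using bdet_nz[OF h] by simp
    have "h = minv n ?x * (g * u)"
    proof -
      have "?x * h = g * u" using mmult_cancel(4)[OF P_GL[OF h] P_D[OF gu]] by simp
      then show ?thesis using mmult_cancel(2)[OF P_GL[OF x] P_D[OF h]] by simp
    qed
    then have "cl h = inv\<^bsub>Q\<^esub> (cl ?x) \<otimes>\<^bsub>Q\<^esub> (cl g \<otimes>\<^bsub>Q\<^esub> cl u)"
      using cl_inv[OF x] cl_mult[OF g(1) u(1)] cl_mult[OF P_inv[OF x] gu] by simp
    moreover have "cl ?x \<in> D" "cl u \<in> D" using sub x cx u by (auto simp: image_subset_iff)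
    ultimately show ?thesis using g(2) subgroup.m_closed[OF D(1)] subgroup.m_inv_closed[OF D(1)] by simp
  qed
  then have DP: "D = cl ` P" using DQ by blast
  interpret Q: group Q by (rule Q_group)
  obtain k where "(derived Q ^^ k) D \<subseteq> {\<one>\<^bsub>Q\<^esub>}" using Q.solvable_subgroup_iff[OF D(1)] D(2) by blast
  then have k: "cl ` ((derived PG ^^ k) P) \<subseteq> {V0}" unfolding DP derived_cl[OF subset_refl] by simp
  have "(derived PG ^^ k) P \<subseteq> P"
    using group.derived_pow_subset[OF PG_group group.subgroup_self[OF PG_group], of k] by simp
  then have "g \<in> V0" if "g \<in> (derived PG ^^ k) P" for g
    using k cl_one_iff[of g] V0_I[of g] that by blast
  then have "(derived PG ^^ k) P \<subseteq> V0" by blast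
  then show False using not_solvable_mod_scalars by blast
qed

lemma Bp_Borel: "is_Borel_subgroup Q QT (cl ` Bp)"
  unfolding is_Borel_subgroup_def closed_connected_solvable_def
  using cl_subgroup[OF Bp_subgroup] Bp_closed Bp_connected
    subgroup_of_Borel_solvable[OF cl_subgroup[OF Bp_subgroup] subset_refl] Bp_maximal by blast

text \<open>A unipotent representative of the class has trace 2 and determinant 1. A triangular block with these
  invariants and its scalar multiples have equal diagonal entries.\<close>

lemma QU_Bp: "g \<in> P \<Longrightarrow> cl g \<in> QU \<Longrightarrow> c g = 0 \<Longrightarrow> a g = d g"
proof -
  assume g: "g \<in> P" "cl g \<in> QU" "c g = 0"
  then obtain z where z: "z \<in> V0" "(z * g - 1\<^sub>m n) ^\<^sub>m n = 0\<^sub>m n n" by (auto simp: in_cl)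
  then have zP: "z \<in> P" "b z = 0" "c z = 0" "d z = a z" by (auto simp: V0_def)
  have zg: "z * g \<in> P" by (rule P_mult[OF zP(1) g(1)])
  have e: "a (z * g) = a z * a g" "c (z * g) = 0" "d (z * g) = a z * d g"
    using zP g(3) by (simp_all add: bmult[OF zP(1) g(1)])
  have s: "a (z * g) + d (z * g) = 2" and p: "a (z * g) * d (z * g) = 1"
    using unipotent_block[OF zg z(2)] e(2) by simp_all
  have "(a (z * g) - d (z * g)) * (a (z * g) - d (z * g)) =
      (a (z * g) + d (z * g)) * (a (z * g) + d (z * g)) - 4 * (a (z * g) * d (z * g))"
    by (simp add: algebra_simps)
  also have "\<dots> = 0" unfolding s p by simp
  finally have "(a (z * g) - d (z * g)) * (a (z * g) - d (z * g)) = 0" .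
  then have "a (z * g) = d (z * g)" by simp
  then show "a g = d g" using e V0_a_nz[OF z(1)] by simp
qed

end

section \<open>Borel subgroups and their unipotent radicals\<close>

context block_group
begin

lemma Up_unipotent: "cl ` Up \<subseteq> QU"
proof
  fix x assume "x \<in> cl ` Up"
  then obtain g where g: "g \<in> P" "c g = 0" "a g = d g" "x = cl g" by auto
  have nz: "a g \<noteq> 0" using Bp_nz[OF g(1,2)] by simp
  obtain u where u: "u \<in> P" "a u = 1" "b u = b g / a g" "c u = 0" "d u = 1" "(u - 1\<^sub>m n) ^\<^sub>m n = 0\<^sub>m n n"
    using unipotent_lift[of 0 "b g / a g" 0] by auto
  have "cl u = cl g" unfolding cl_eq[OF u(1) g(1)]
    by (rule exI[of _ "1 / a g"]) (use nz u g in simp)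
  moreover have "u \<in> cl u" unfolding in_cl using P_one block_one u(1) P_D
    by (intro bexI[of _ "1\<^sub>m n"] V0_I) auto
  ultimately show "x \<in> QU" using u(6) g by (auto simp: carrier_Q)
qed

lemma QU_in_Bp: "QU \<inter> cl ` Bp \<subseteq> cl ` Up"
proof
  fix x assume "x \<in> QU \<inter> cl ` Bp"
  then have x: "x \<in> QU" "x \<in> cl ` Bp" by blast+
  from x(2) obtain g where g: "g \<in> P" "c g = 0" "x = cl g" by auto
  have q: "cl g \<in> QU" using x(1) g(3) by simp
  from QU_Bp[OF g(1) q g(2)] g show "x \<in> cl ` Up" by auto
qed

lemma Up_normal_in:
  assumes M: "subgroup M Q" and sub: "cl ` Up \<subseteq> M" "M \<subseteq> cl ` Bp"
  shows "cl ` Up \<lhd> Q\<lparr>carrier := M\<rparr>"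
proof -
  interpret Q: group Q by (rule Q_group)
  interpret M: group "Q\<lparr>carrier := M\<rparr>" by (rule Q.subgroup_imp_group[OF M])
  have "subgroup (cl ` Up) (Q\<lparr>carrier := M\<rparr>)"
    by (rule Q.subgroup_incl[OF cl_subgroup[OF Up_subgroup] M sub(1)])
  moreover have "x \<otimes>\<^bsub>Q\<^esub> y \<otimes>\<^bsub>Q\<^esub> inv\<^bsub>Q\<lparr>carrier := M\<rparr>\<^esub> x \<in> cl ` Up" if xy: "x \<in> M" "y \<in> cl ` Up" for x y
  proof -
    have "x \<in> cl ` Bp" using xy(1) sub(2) by blast
    then obtain g where g: "g \<in> P" "c g = 0" "x = cl g" by auto
    obtain h where h: "h \<in> P" "c h = 0" "a h = d h" "y = cl h" using xy(2) by auto
    have m: "g * h \<in> P" by (rule P_mult[OF g(1) h(1)])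
    have "x \<otimes>\<^bsub>Q\<^esub> y \<otimes>\<^bsub>Q\<^esub> inv\<^bsub>Q\<lparr>carrier := M\<rparr>\<^esub> x = cl g \<otimes>\<^bsub>Q\<^esub> cl h \<otimes>\<^bsub>Q\<^esub> inv\<^bsub>Q\<^esub> (cl g)"
      using Q.m_inv_consistent[OF M xy(1)] g h by simp
    also have "\<dots> = cl (g * h * minv n g)"
      unfolding cl_inv[OF g(1)] cl_mult[OF g(1) h(1)] by (rule cl_mult[OF m P_inv[OF g(1)]])
    also have "\<dots> \<in> cl ` Up"
    proof (rule imageI)
      show "g * h * minv n g \<in> Up"
        using P_mult[OF m P_inv[OF g(1)]] Bp_nz[OF g(1,2)] h g
        by (simp add: bmult[OF m P_inv[OF g(1)]] bmult[OF g(1) h(1)] Bp_inv[OF g(1,2)])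
    qed
    finally show ?thesis .
  qed
  ultimately show ?thesis by (simp add: M.normal_inv_iff)
qed

lemma Up_unipotent_radical:
  "is_unipotent_radical (Q\<lparr>carrier := cl ` Bp\<rparr>) (subtopology QT (cl ` Bp)) QU (cl ` Up)"
proof -
  have UB: "cl ` Up \<subseteq> cl ` Bp" by auto
  have "cl ` Up \<lhd> Q\<lparr>carrier := cl ` Bp\<rparr>"
    by (rule Up_normal_in[OF cl_subgroup[OF Bp_subgroup] UB subset_refl])
  moreover have "N \<subseteq> cl ` Up" if N: "N \<lhd> Q\<lparr>carrier := cl ` Bp\<rparr>" "N \<subseteq> QU" for N
  proof -
    have "N \<subseteq> cl ` Bp" using subgroup.subset[OF normal_imp_subgroup[OF N(1)]] by simp
    then show ?thesis using N(2) QU_in_Bp by blast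
  qed
  ultimately show ?thesis
    unfolding is_unipotent_radical_def
    using closedin_subset_topspace[OF Up_closed UB] Up_connected UB Up_unipotent
    by (auto simp: connectedin_subtopology)
qed

lemma Up_nontrivial: "\<exists>r \<in> cl ` Up. r \<noteq> V0"
proof -
  obtain g where g: "g \<in> P" "a g = 1" "b g = 1" "c g = 0" "d g = 1" using block_onto[of 1 1 1 0] by auto
  have "cl g \<in> cl ` Up" using g by simp
  moreover have "cl g \<noteq> V0" using cl_one_iff[OF g(1)] g by simp
  ultimately show ?thesis by blast
qed

text \<open>If \<open>M\<close> lies between the unipotent radical and the Borel subgroup, then it is solvable and
  contains the unipotent radical of a Borel subgroup, and it is not reductive.\<close>

lemma unipotent_case:
  assumes M: "subgroup M Q" and sub: "cl ` Up \<subseteq> M" "M \<subseteq> cl ` Bp"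
  shows "solvable (Q\<lparr>carrier := M\<rparr>)"
    and "\<exists>C R. is_Borel_subgroup Q QT C \<and>
        is_unipotent_radical (Q\<lparr>carrier := C\<rparr>) (subtopology QT C) QU R \<and> R \<subseteq> M"
    and "\<not> is_reductive (Q\<lparr>carrier := M\<rparr>) (subtopology QT M) QU"
proof -
  show "solvable (Q\<lparr>carrier := M\<rparr>)" by (rule subgroup_of_Borel_solvable[OF M sub(2)])
  show "\<exists>C R. is_Borel_subgroup Q QT C \<and>
        is_unipotent_radical (Q\<lparr>carrier := C\<rparr>) (subtopology QT C) QU R \<and> R \<subseteq> M"
    using Bp_Borel Up_unipotent_radical sub(1) by blast
  show "\<not> is_reductive (Q\<lparr>carrier := M\<rparr>) (subtopology QT M) QU"
  proof
    assume r: "is_reductive (Q\<lparr>carrier := M\<rparr>) (subtopology QT M) QU"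
    have "closedin (subtopology QT M) (cl ` Up)" by (rule closedin_subset_topspace[OF Up_closed sub(1)])
    moreover have "connectedin (subtopology QT M) (cl ` Up)"
      using Up_connected sub(1) by (simp add: connectedin_subtopology)
    ultimately have "cl ` Up \<subseteq> {\<one>\<^bsub>Q\<lparr>carrier := M\<rparr>\<^esub>}"
      using r Up_normal_in[OF M sub] Up_unipotent
      unfolding is_reductive_def is_unipotent_radical_def by blast
    then show False using Up_nontrivial by auto
  qed
qed

subsection \<open>Borel subgroups contain unipotent elements\<close>

text \<open>By maximality such a subgroup is the standard Borel subgroup, whose unipotent radical is known.\<close>

lemma Borel_in_Bp_unipotent:
  assumes C: "is_Borel_subgroup Q QT C" "C \<subseteq> cl ` Bp"
    and R: "is_unipotent_radical (Q\<lparr>carrier := C\<rparr>) (subtopology QT C) QU R"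
  shows "\<exists>r \<in> R. r \<noteq> V0"
proof -
  have "closed_connected_solvable Q QT (cl ` Bp)" using Bp_Borel by (simp add: is_Borel_subgroup_def)
  then have CB: "C = cl ` Bp" using C unfolding is_Borel_subgroup_def by blast
  have "cl ` Up \<subseteq> R"
    by (rule mp[OF spec[OF conjunct2[OF R[unfolded CB is_unipotent_radical_def]]]
          conjunct1[OF Up_unipotent_radical[unfolded is_unipotent_radical_def]]])
  then show ?thesis using Up_nontrivial by blast
qed

text \<open>Let \<open>g\<close> be a nonscalar triangular element that commutes up to scalars with its conjugates
  under \<open>C\<close>; taking determinants, the scalars are \<open>\<plusminus>1\<close>. For the scalar \<open>1\<close> the conjugate of \<open>g\<close> by \<open>h\<close>
  fixes \<open>e\<^sub>1\<close>, and so \<open>h\<^sup>-\<^sup>1\<close> carries \<open>e\<^sub>1\<close> to an eigenline of \<open>g\<close>. If \<open>g\<close> has a single eigenline, this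
  is the claim. Otherwise \<open>C\<close> is covered by the stabilizer of \<open>e\<^sub>1\<close> and by the closed set of those \<open>h\<close> for
  which the second eigenline is involved or the scalar is \<open>-1\<close>. The two sets are disjoint, and \<open>C\<close> is
  connected.\<close>

lemma connected_fixes_eigenline:
  assumes C: "subgroup C Q" "connectedin QT C" and g: "g \<in> P" "c g = 0" "b g \<noteq> 0 \<or> a g \<noteq> d g"
    and comm: "\<And>h. h \<in> P \<Longrightarrow> cl h \<in> C \<Longrightarrow>
      (h * g * minv n h) * g * minv n (h * g * minv n h) * minv n g \<in> V0"
  shows "C \<subseteq> cl ` Bp"
proof -
  have nz: "a g \<noteq> 0" "d g \<noteq> 0" using Bp_nz[OF g(1,2)] by auto
  define H1 where "H1 h = a h * a g * d h - (a h * b g + b h * d g) * c h" for h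
  define H2 where "H2 h = c h * (d h * (a g - d g) - c h * b g)" for h
  have cases: "H2 h = 0 \<or> (2 * a g * H1 h + b g * H2 h = 0 \<and> a g \<noteq> d g)" if h: "h \<in> P" "cl h \<in> C" for h
  proof -
    let ?h = "h * g * minv n h"
    have hg: "h * g \<in> P" by (rule P_mult[OF h(1) g(1)])
    have hP: "?h \<in> P" by (rule P_mult[OF hg P_inv[OF h(1)]])
    have "bdet h * a ?h = a (h * g) * (bdet h * a (minv n h)) + b (h * g) * (bdet h * c (minv n h))"
      by (simp add: bmult[OF hg P_inv[OF h(1)]] algebra_simps)
    then have e1: "bdet h * a ?h = H1 h"
      unfolding binv[OF h(1)] by (simp add: bmult[OF h(1) g(1)] g(2) H1_def algebra_simps)
    have "bdet h * c ?h = c (h * g) * (bdet h * a (minv n h)) + d (h * g) * (bdet h * c (minv n h))"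
      by (simp add: bmult[OF hg P_inv[OF h(1)]] algebra_simps)
    then have e2: "bdet h * c ?h = H2 h"
      unfolding binv[OF h(1)] by (simp add: bmult[OF h(1) g(1)] g(2) H2_def algebra_simps)
    obtain \<mu> where m: "a (?h * g) = \<mu> * a (g * ?h)" "c (?h * g) = \<mu> * c (g * ?h)" "\<mu> * \<mu> = 1"
      using commutator_scalar[OF g(1) hP comm[OF h]] by blast
    have m1: "a ?h * a g = \<mu> * (a g * a ?h + b g * c ?h)" "c ?h * a g = \<mu> * (d g * c ?h)"
      using m(1,2) g(2) by (simp_all add: bmult[OF g(1) hP] bmult[OF hP g(1)])
    have "\<mu> = 1 \<or> \<mu> = - 1" using m(3) by (metis mult_1 square_eq_iff)
    then show ?thesis
    proof
      assume "\<mu> = 1"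
      then have "b g * c ?h = 0" "(a g - d g) * c ?h = 0" using m1 by (simp_all add: algebra_simps)
      then have "c ?h = 0" using g(3) by auto
      then show ?thesis using e2 by simp
    next
      assume mu: "\<mu> = - 1"
      have 1: "2 * a g * a ?h + b g * c ?h = 0" using m1(1) unfolding mu by (simp add: algebra_simps add_eq_0_iff)
      have 2: "(a g + d g) * c ?h = 0" using m1(2) unfolding mu by (simp add: algebra_simps)
      have "c ?h \<noteq> 0" using 1 nz bdet_nz[OF hP] by (auto simp: bdet_def)
      then have dg: "d g = - a g" using 2 by (simp add: add_eq_0_iff)
      have "bdet h * (2 * a g * a ?h + b g * c ?h) = 2 * a g * H1 h + b g * H2 h"
        unfolding e1[symmetric] e2[symmetric] by (simp add: algebra_simps)
      moreover have "a g \<noteq> d g" using dg nz by simp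
      ultimately show ?thesis using 1 by simp
    qed
  qed
  have CP: "C \<subseteq> cl ` P" using subgroup.subset[OF C(1)] by (simp add: carrier_Q)
  show ?thesis
  proof (cases "a g = d g")
    case True
    show ?thesis
    proof
      fix x assume x: "x \<in> C"
      then obtain h where h: "h \<in> P" "x = cl h" using CP by blast
      then have "H2 h = 0" using cases[of h] x True by blast
      then have "c h = 0" using True g(3) by (auto simp: H2_def)
      then show "x \<in> cl ` Bp" using h by simp
    qed
  next
    case False
    define L where "L h \<longleftrightarrow> (d h * (a g - d g) - c h * b g) * (2 * a g * H1 h + b g * H2 h) = 0" for h
    have scale: "L g'" if h: "g' \<in> P" "h \<in> P" "cl h = cl g'" "L h" for g' h
    proof -
      have "\<exists>s. s \<noteq> 0 \<and> a h = s * a g' \<and> b h = s * b g' \<and> c h = s * c g' \<and> d h = s * d g'"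
        using h(3) unfolding cl_eq[OF h(2,1)] .
      then obtain s where s: "s \<noteq> 0" "a h = s * a g'" "b h = s * b g'" "c h = s * c g'" "d h = s * d g'"
        by (elim exE conjE)
      have "d h * (a g - d g) - c h * b g = s * (d g' * (a g - d g) - c g' * b g)"
        unfolding s by (simp add: algebra_simps)
      moreover have "2 * a g * H1 h + b g * H2 h = s * s * (2 * a g * H1 g' + b g * H2 g')"
        unfolding H1_def H2_def s by (simp add: algebra_simps)
      ultimately show "L g'" using h(4) s(1) by (simp add: L_def)
    qed
    have closedL: "closedin QT (cls L)"
    proof (rule cls_closed)
      show "closedin PT {g \<in> P. L g}"
        unfolding L_def H1_def H2_def
        by (intro closed_PT regular_add regular_diff regular_mult regular_const regs)
    qed (rule scale)
    have disj: "cls L \<inter> cl ` Bp = {}"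
    proof (rule ccontr)
      assume "cls L \<inter> cl ` Bp \<noteq> {}"
      then obtain h h' where h: "h \<in> P" "L h" "cl h = cl h'" "h' \<in> P" "c h' = 0" by (auto simp: cls_def)
      have "L h'" by (rule scale[OF h(4,1,3,2)])
      moreover have "a h' \<noteq> 0" "d h' \<noteq> 0" using Bp_nz[OF h(4,5)] by auto
      ultimately show False using False nz h(5) by (simp add: L_def H1_def H2_def)
    qed
    have cover: "C \<subseteq> cl ` Bp \<union> cls L"
    proof
      fix x assume x: "x \<in> C"
      then obtain h where h: "h \<in> P" "x = cl h" using CP by blast
      show "x \<in> cl ` Bp \<union> cls L"
      proof (cases "c h = 0")
        case False
        then have "L h" using cases[of h] h x by (auto simp: L_def H2_def)
        then show ?thesis using h by (auto simp: cls_def)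
      qed (use h in simp)
    qed
    have "V0 \<in> C" using subgroup.one_closed[OF C(1)] by simp
    moreover have "V0 \<in> cl ` Bp" using subgroup.one_closed[OF cl_subgroup[OF Bp_subgroup]] by simp
    ultimately have "cl ` Bp \<inter> C \<noteq> {}" by blast
    then have "cls L \<inter> C = {}"
      using C(2) Bp_closed closedL cover disj unfolding connectedin_closedin by blast
    then show ?thesis using cover by blast
  qed
qed

text \<open>The conditions on the block do not depend on the basis. A change of basis of determinant one moves any
  line to the first coordinate line, so that one Borel subgroup and one torus represent all of them.\<close>

lemma change_basis:
  assumes D: "h11 * h22 - h12 * h21 = (1 :: complex)"
  shows "block_group n P
    (\<lambda>g. h22 * (a g * h11 + b g * h21) - h12 * (c g * h11 + d g * h21))
    (\<lambda>g. h22 * (a g * h12 + b g * h22) - h12 * (c g * h12 + d g * h22))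
    (\<lambda>g. h11 * (c g * h11 + d g * h21) - h21 * (a g * h11 + b g * h21))
    (\<lambda>g. h11 * (c g * h12 + d g * h22) - h21 * (a g * h12 + b g * h22))"
proof (rule block_group.intro)
  let ?a = "\<lambda>g. h22 * (a g * h11 + b g * h21) - h12 * (c g * h11 + d g * h21)"
  let ?b = "\<lambda>g. h22 * (a g * h12 + b g * h22) - h12 * (c g * h12 + d g * h22)"
  let ?c = "\<lambda>g. h11 * (c g * h11 + d g * h21) - h21 * (a g * h11 + b g * h21)"
  let ?d = "\<lambda>g. h11 * (c g * h12 + d g * h22) - h21 * (a g * h12 + b g * h22)"
  show "subgroup P (GL n)" by (rule P_subgroup)
  show "regular n ?a" "regular n ?b" "regular n ?c" "regular n ?d"
    by (intro regular_add regular_diff regular_mult regular_const regs)+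
  show "?a (seg A B t) = (1 - t) * ?a A + t * ?a B \<and> ?b (seg A B t) = (1 - t) * ?b A + t * ?b B \<and>
      ?c (seg A B t) = (1 - t) * ?c A + t * ?c B \<and> ?d (seg A B t) = (1 - t) * ?d A + t * ?d B"
    if "A \<in> carrier_mat n n" "B \<in> carrier_mat n n" for A B t
  proof -
    have e: "a (seg A B t) = (1 - t) * a A + t * a B" "b (seg A B t) = (1 - t) * b A + t * b B"
      "c (seg A B t) = (1 - t) * c A + t * c B" "d (seg A B t) = (1 - t) * d A + t * d B"
      using lin[OF that, of t] by blast+
    show ?thesis unfolding e by (simp add: algebra_simps)
  qed
  show "?a (g * h) = ?a g * ?a h + ?b g * ?c h \<and> ?b (g * h) = ?a g * ?b h + ?b g * ?d h \<and>
      ?c (g * h) = ?c g * ?a h + ?d g * ?c h \<and> ?d (g * h) = ?c g * ?b h + ?d g * ?d h" if "g \<in> P" "h \<in> P" for g h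
  proof -
    have "?a g * ?a h + ?b g * ?c h = (h11 * h22 - h12 * h21) * ?a (g * h)"
      "?a g * ?b h + ?b g * ?d h = (h11 * h22 - h12 * h21) * ?b (g * h)"
      "?c g * ?a h + ?d g * ?c h = (h11 * h22 - h12 * h21) * ?c (g * h)"
      "?c g * ?b h + ?d g * ?d h = (h11 * h22 - h12 * h21) * ?d (g * h)"
      unfolding bmult[OF that] by (simp_all add: algebra_simps)
    then show ?thesis unfolding D by simp
  qed
  show "?a (1\<^sub>m n) = 1 \<and> ?b (1\<^sub>m n) = 0 \<and> ?c (1\<^sub>m n) = 0 \<and> ?d (1\<^sub>m n) = 1"
    using D block_one by (simp add: algebra_simps)
  show "line_dense P" by (rule P_dense)
  have conj: "\<exists>\<alpha>' \<beta>' \<gamma>' \<delta>'. \<alpha>' * \<delta>' - \<beta>' * \<gamma>' = \<alpha> * \<delta> - \<beta> * \<gamma> \<and> \<alpha>' + \<delta>' = \<alpha> + \<delta> \<and>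
      (\<forall>g. a g = \<alpha>' \<longrightarrow> b g = \<beta>' \<longrightarrow> c g = \<gamma>' \<longrightarrow> d g = \<delta>' \<longrightarrow> ?a g = \<alpha> \<and> ?b g = \<beta> \<and> ?c g = \<gamma> \<and> ?d g = \<delta>)"
    for \<alpha> \<beta> \<gamma> \<delta> :: complex
  proof -
    let ?\<alpha> = "h11 * (\<alpha> * h22 - \<beta> * h21) + h12 * (\<gamma> * h22 - \<delta> * h21)"
    let ?\<beta> = "h11 * (\<beta> * h11 - \<alpha> * h12) + h12 * (\<delta> * h11 - \<gamma> * h12)"
    let ?\<gamma> = "h21 * (\<alpha> * h22 - \<beta> * h21) + h22 * (\<gamma> * h22 - \<delta> * h21)"
    let ?\<delta> = "h21 * (\<beta> * h11 - \<alpha> * h12) + h22 * (\<delta> * h11 - \<gamma> * h12)"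
    let ?D = "h11 * h22 - h12 * h21"
    have "?\<alpha> * ?\<delta> - ?\<beta> * ?\<gamma> = ?D * ?D * (\<alpha> * \<delta> - \<beta> * \<gamma>)" by (simp add: algebra_simps)
    moreover have "?\<alpha> + ?\<delta> = ?D * (\<alpha> + \<delta>)" by (simp add: algebra_simps)
    moreover have "h22 * (?\<alpha> * h11 + ?\<beta> * h21) - h12 * (?\<gamma> * h11 + ?\<delta> * h21) = ?D * ?D * \<alpha>"
      "h22 * (?\<alpha> * h12 + ?\<beta> * h22) - h12 * (?\<gamma> * h12 + ?\<delta> * h22) = ?D * ?D * \<beta>"
      "h11 * (?\<gamma> * h11 + ?\<delta> * h21) - h21 * (?\<alpha> * h11 + ?\<beta> * h21) = ?D * ?D * \<gamma>"
      "h11 * (?\<gamma> * h12 + ?\<delta> * h22) - h21 * (?\<alpha> * h12 + ?\<beta> * h22) = ?D * ?D * \<delta>"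
      by (simp_all add: algebra_simps)
    ultimately show ?thesis unfolding D
      by (intro exI[of _ ?\<alpha>] exI[of _ ?\<beta>] exI[of _ ?\<gamma>] exI[of _ ?\<delta>]) simp
  qed
  show "\<exists>g\<in>P. ?a g = \<alpha> \<and> ?b g = \<beta> \<and> ?c g = \<gamma> \<and> ?d g = \<delta>" if nz: "\<alpha> * \<delta> - \<beta> * \<gamma> \<noteq> 0" for \<alpha> \<beta> \<gamma> \<delta>
  proof -
    obtain \<alpha>' \<beta>' \<gamma>' \<delta>' where e: "\<alpha>' * \<delta>' - \<beta>' * \<gamma>' = \<alpha> * \<delta> - \<beta> * \<gamma>"
      "\<forall>g. a g = \<alpha>' \<longrightarrow> b g = \<beta>' \<longrightarrow> c g = \<gamma>' \<longrightarrow> d g = \<delta>' \<longrightarrow> ?a g = \<alpha> \<and> ?b g = \<beta> \<and> ?c g = \<gamma> \<and> ?d g = \<delta>"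
      using conj[of \<alpha> \<delta> \<beta> \<gamma>] by blast
    obtain g where "g \<in> P" "a g = \<alpha>'" "b g = \<beta>'" "c g = \<gamma>'" "d g = \<delta>'"
      using block_onto[of \<alpha>' \<delta>' \<beta>' \<gamma>'] e(1) nz by auto
    then show ?thesis using e(2) by blast
  qed
  show "\<exists>g\<in>P. ?a g = 1 + \<alpha> \<and> ?b g = \<beta> \<and> ?c g = \<gamma> \<and> ?d g = 1 - \<alpha> \<and> (g - 1\<^sub>m n) ^\<^sub>m n = 0\<^sub>m n n"
    if z: "\<alpha> * \<alpha> + \<beta> * \<gamma> = 0" for \<alpha> \<beta> \<gamma>
  proof -
    obtain \<alpha>' \<beta>' \<gamma>' \<delta>' where e: "\<alpha>' * \<delta>' - \<beta>' * \<gamma>' = (1 + \<alpha>) * (1 - \<alpha>) - \<beta> * \<gamma>" "\<alpha>' + \<delta>' = 2"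
      "\<forall>g. a g = \<alpha>' \<longrightarrow> b g = \<beta>' \<longrightarrow> c g = \<gamma>' \<longrightarrow> d g = \<delta>' \<longrightarrow> ?a g = 1 + \<alpha> \<and> ?b g = \<beta> \<and> ?c g = \<gamma> \<and> ?d g = 1 - \<alpha>"
      using conj[of "1 + \<alpha>" "1 - \<alpha>" \<beta> \<gamma>] by auto
    have d': "\<delta>' = 2 - \<alpha>'" using e(2) by (simp add: eq_diff_eq add.commute)
    have "(1 + \<alpha>) * (1 - \<alpha>) - \<beta> * \<gamma> = 1 - (\<alpha> * \<alpha> + \<beta> * \<gamma>)" by (simp add: algebra_simps)
    then have "\<alpha>' * \<delta>' - \<beta>' * \<gamma>' = 1" using e(1) z by simp
    then have "(\<alpha>' - 1) * (\<alpha>' - 1) + \<beta>' * \<gamma>' = 0"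
      unfolding d' by (simp add: algebra_simps)
    then obtain g where "g \<in> P" "a g = 1 + (\<alpha>' - 1)" "b g = \<beta>'" "c g = \<gamma>'" "d g = 1 - (\<alpha>' - 1)" "(g - 1\<^sub>m n) ^\<^sub>m n = 0\<^sub>m n n"
      using unipotent_lift by blast
    then show ?thesis using e(3) d' by (intro bexI[of _ g]) auto
  qed
  show "?a g + ?d g = 2 \<and> ?a g * ?d g - ?b g * ?c g = 1" if g: "g \<in> P" "(g - 1\<^sub>m n) ^\<^sub>m n = 0\<^sub>m n n" for g
  proof -
    let ?D = "h11 * h22 - h12 * h21"
    have "?a g + ?d g = ?D * (a g + d g)" by (simp add: algebra_simps)
    moreover have "?a g * ?d g - ?b g * ?c g = ?D * ?D * (a g * d g - b g * c g)" by (simp add: algebra_simps)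
    ultimately show ?thesis unfolding D using unipotent_block[OF g] by simp
  qed
qed

text \<open>A block is scalar in one basis if and only if it is scalar in the other. Hence the quotient is the same
  group with the same topology.\<close>

lemma V0_change_basis:
  assumes D: "h11 * h22 - h12 * h21 = (1 :: complex)"
  shows "block_group.V0 P
    (\<lambda>g. h22 * (a g * h11 + b g * h21) - h12 * (c g * h11 + d g * h21))
    (\<lambda>g. h22 * (a g * h12 + b g * h22) - h12 * (c g * h12 + d g * h22))
    (\<lambda>g. h11 * (c g * h11 + d g * h21) - h21 * (a g * h11 + b g * h21))
    (\<lambda>g. h11 * (c g * h12 + d g * h22) - h21 * (a g * h12 + b g * h22)) = V0"
proof -
  have "(b' = 0 \<and> c' = 0 \<and> a' = d') \<longleftrightarrow> (b0 = 0 \<and> c0 = 0 \<and> a0 = d0)"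
    if e: "a' = h22 * (a0 * h11 + b0 * h21) - h12 * (c0 * h11 + d0 * h21)"
      "b' = h22 * (a0 * h12 + b0 * h22) - h12 * (c0 * h12 + d0 * h22)"
      "c' = h11 * (c0 * h11 + d0 * h21) - h21 * (a0 * h11 + b0 * h21)"
      "d' = h11 * (c0 * h12 + d0 * h22) - h21 * (a0 * h12 + b0 * h22)" for a' b' c' d' a0 b0 c0 d0
  proof
    assume z: "b' = 0 \<and> c' = 0 \<and> a' = d'"
    let ?D = "h11 * h22 - h12 * h21"
    have "?D * ?D * b0 = h11 * (b' * h11 - a' * h12) + h12 * (d' * h11 - c' * h12)"
      "?D * ?D * c0 = h21 * (a' * h22 - b' * h21) + h22 * (c' * h22 - d' * h21)"
      "?D * ?D * (a0 - d0) = (h11 * (a' * h22 - b' * h21) + h12 * (c' * h22 - d' * h21)) -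
        (h21 * (b' * h11 - a' * h12) + h22 * (d' * h11 - c' * h12))"
      unfolding e by (simp_all add: algebra_simps)
    then show "b0 = 0 \<and> c0 = 0 \<and> a0 = d0" unfolding D using z by (simp add: algebra_simps)
  next
    assume z: "b0 = 0 \<and> c0 = 0 \<and> a0 = d0"
    then show "b' = 0 \<and> c' = 0 \<and> a' = d'" unfolding e by (simp add: algebra_simps)
  qed
  then show ?thesis unfolding block_group.V0_def[OF change_basis[OF D]] V0_def by blast
qed

text \<open>The Lie-Kolchin theorem for \<open>PGL(2)\<close>: the last nontrivial derived group of a Borel
  subgroup is normal and abelian, and an eigenline of one of its elements is fixed.\<close>

lemma Borel_unipotent:
  assumes C: "is_Borel_subgroup Q QT C"
    and R: "is_unipotent_radical (Q\<lparr>carrier := C\<rparr>) (subtopology QT C) QU R"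
  shows "\<exists>r \<in> R. r \<noteq> V0"
proof (cases "C \<subseteq> {V0}")
  case True
  moreover have "V0 \<in> cl ` Bp" using subgroup.one_closed[OF cl_subgroup[OF Bp_subgroup]] by simp
  ultimately show ?thesis using Borel_in_Bp_unipotent[OF C _ R] by blast
next
  case False
  interpret Q: group Q by (rule Q_group)
  have sub: "subgroup C Q" and con: "connectedin QT C" and sol: "solvable (Q\<lparr>carrier := C\<rparr>)"
    using C by (auto simp: is_Borel_subgroup_def closed_connected_solvable_def)
  let ?QC = "Q\<lparr>carrier := C\<rparr>"
  interpret QC: group ?QC by (rule Q.subgroup_imp_group[OF sub])
  define K where "K j = (derived ?QC ^^ j) C" for j
  have Kn: "K j \<lhd> ?QC" for j
    unfolding K_def by (induction j) (use QC.normal_self in \<open>simp_all add: QC.derived_is_normal\<close>)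
  obtain k where "K k \<subseteq> {V0}"
    using sol unfolding QC.solvable_iff_trivial_derived_seq K_def by auto
  then have "\<exists>j. \<not> K j \<subseteq> {V0} \<and> K (Suc j) \<subseteq> {V0}"
  proof (induction k)
    case 0
    then show ?case using False by (simp add: K_def)
  qed blast
  then obtain j where j: "\<not> K j \<subseteq> {V0}" "K (Suc j) \<subseteq> {V0}" by blast
  then obtain m where m: "m \<in> K j" "m \<noteq> V0" by blast
  interpret Kj: normal "K j" ?QC by (rule Kn)
  have CP: "C \<subseteq> cl ` P" using subgroup.subset[OF sub] by (simp add: carrier_Q)
  have KC: "K j \<subseteq> C" using Kj.subset by simp
  obtain g where g: "g \<in> P" "m = cl g" using m(1) KC CP by blast
  have gV: "g \<notin> V0" using m(2) g cl_one_iff[OF g(1)] by (auto simp: V0_def)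
  have comm: "(h * g * minv n h) * g * minv n (h * g * minv n h) * minv n g \<in> V0" if h: "h \<in> P" "cl h \<in> C" for h
  proof -
    let ?h = "h * g * minv n h"
    have hg: "h * g \<in> P" by (rule P_mult[OF h(1) g(1)])
    have hP: "?h \<in> P" by (rule P_mult[OF hg P_inv[OF h(1)]])
    have "cl h \<otimes>\<^bsub>?QC\<^esub> m \<otimes>\<^bsub>?QC\<^esub> inv\<^bsub>?QC\<^esub> (cl h) \<in> K j"
      using Kj.inv_op_closed2[of "cl h" m] h(2) m(1) by simp
    moreover have "cl h \<otimes>\<^bsub>?QC\<^esub> m \<otimes>\<^bsub>?QC\<^esub> inv\<^bsub>?QC\<^esub> (cl h) = cl ?h"
      using Q.m_inv_consistent[OF sub h(2)] cl_mult[OF h(1) g(1)] cl_mult[OF hg P_inv[OF h(1)]] cl_inv[OF h(1)] g(2) by simp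
    ultimately have hK: "cl ?h \<in> K j" by simp
    have "cl ?h \<otimes>\<^bsub>?QC\<^esub> m \<otimes>\<^bsub>?QC\<^esub> inv\<^bsub>?QC\<^esub> (cl ?h) \<otimes>\<^bsub>?QC\<^esub> inv\<^bsub>?QC\<^esub> m \<in> derived_set ?QC (K j)"
      using hK m(1) by blast
    also have "\<dots> \<subseteq> K (Suc j)" unfolding K_def funpow.simps o_apply derived_def by (rule subsetI) (rule generate.incl)
    also have "\<dots> \<subseteq> {V0}" by (rule j(2))
    finally have z: "cl ?h \<otimes>\<^bsub>?QC\<^esub> m \<otimes>\<^bsub>?QC\<^esub> inv\<^bsub>?QC\<^esub> (cl ?h) \<otimes>\<^bsub>?QC\<^esub> inv\<^bsub>?QC\<^esub> m = V0" by simp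
    have 1: "?h * g \<in> P" by (rule P_mult[OF hP g(1)])
    have 2: "?h * g * minv n ?h \<in> P" by (rule P_mult[OF 1 P_inv[OF hP]])
    have 3: "?h * g * minv n ?h * minv n g \<in> P" by (rule P_mult[OF 2 P_inv[OF g(1)]])
    have i: "inv\<^bsub>?QC\<^esub> (cl ?h) = cl (minv n ?h)" "inv\<^bsub>?QC\<^esub> m = cl (minv n g)"
      using Q.m_inv_consistent[OF sub] hK m(1) KC cl_inv[OF hP] cl_inv[OF g(1)] g(2) by auto
    have mm: "x \<otimes>\<^bsub>?QC\<^esub> y = x \<otimes>\<^bsub>Q\<^esub> y" for x y by simp
    have "cl (?h * g * minv n ?h * minv n g) = V0"
      using z unfolding i mm unfolding g(2) cl_mult[OF hP g(1)] cl_mult[OF 1 P_inv[OF hP]] cl_mult[OF 2 P_inv[OF g(1)]] .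
    then show ?thesis using cl_one_iff[OF 3] 3 by (simp add: V0_def)
  qed
  obtain h11 h12 h21 h22 :: complex where D: "h11 * h22 - h12 * h21 = 1"
    and c': "h11 * (c g * h11 + d g * h21) - h21 * (a g * h11 + b g * h21) = 0"
  proof (cases "c g = 0")
    case True
    then show thesis using that[of 1 1 0 0] by simp
  next
    case False
    define r where "r = csqrt ((a g - d g) * (a g - d g) + 4 * b g * c g)"
    have r: "r * r = (a g - d g) * (a g - d g) + 4 * b g * c g"
      unfolding r_def using power2_csqrt[of "(a g - d g) * (a g - d g) + 4 * b g * c g"] by (simp add: power2_eq_square)
    define p where "p = (a g - d g + r) / (2 * c g)"
    have p: "2 * c g * p = a g - d g + r" using False by (simp add: p_def)
    have "4 * c g * (p * (c g * p + d g) - (a g * p + b g)) =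
        (2 * c g * p) * (2 * c g * p) + 2 * (d g - a g) * (2 * c g * p) - 4 * b g * c g"
      by (simp add: algebra_simps)
    also have "\<dots> = r * r - (a g - d g) * (a g - d g) - 4 * b g * c g"
      unfolding p by (simp add: algebra_simps)
    also have "\<dots> = 0" unfolding r by simp
    finally have "p * (c g * p + d g) - (a g * p + b g) = 0" using False by simp
    then show thesis using that[of p 0 "-1" 1] by simp
  qed
  interpret B: block_group n P
    "\<lambda>g. h22 * (a g * h11 + b g * h21) - h12 * (c g * h11 + d g * h21)"
    "\<lambda>g. h22 * (a g * h12 + b g * h22) - h12 * (c g * h12 + d g * h22)"
    "\<lambda>g. h11 * (c g * h11 + d g * h21) - h21 * (a g * h11 + b g * h21)"
    "\<lambda>g. h11 * (c g * h12 + d g * h22) - h21 * (a g * h12 + b g * h22)"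
    by (rule change_basis[OF D])
  note V = V0_change_basis[OF D]
  have clB: "B.cl = cl" by (rule ext) (simp add: B.cl_def cl_def V)
  have "C \<subseteq> cl ` B.Bp"
  proof (rule B.connected_fixes_eigenline[unfolded V clB, OF sub con g(1) c' _ comm])
    show "h22 * (a g * h12 + b g * h22) - h12 * (c g * h12 + d g * h22) \<noteq> 0 \<or>
        h22 * (a g * h11 + b g * h21) - h12 * (c g * h11 + d g * h21) \<noteq>
        h11 * (c g * h12 + d g * h22) - h21 * (a g * h12 + b g * h22)"
      using gV g(1) c' unfolding V[symmetric] B.V0_def by blast
  qed
  then show ?thesis using B.Borel_in_Bp_unipotent[unfolded V clB, OF C _ R] by blast
qed

end

lemma complete_basis:
  assumes "p1 \<noteq> 0 \<or> p2 \<noteq> (0 :: complex)"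
  obtains r1 r2 where "p1 * r2 - r1 * p2 = 1"
proof (cases "p1 = 0")
  case True
  then show thesis using assms by (intro that[of 0 "- 1 / p2"]) auto
next
  case False
  then show thesis by (intro that[of "1 / p1" 0]) auto
qed

section \<open>Tori\<close>

context block_group
begin

definition Tp :: "complex mat set" where "Tp = {g \<in> P. b g = 0 \<and> c g = 0}"

lemma Tp_iff [simp]: "g \<in> Tp \<longleftrightarrow> g \<in> P \<and> b g = 0 \<and> c g = 0"
  by (simp add: Tp_def)

lemma Tp_subgroup: "subgroup Tp PG"
proof (rule group.subgroupI[OF PG_group])
  have "1\<^sub>m n \<in> Tp" using P_one block_one by simp
  then show "Tp \<noteq> {}" by blast
  show "Tp \<subseteq> carrier PG" by auto
next
  fix g assume "g \<in> Tp"
  then have g: "g \<in> P" "b g = 0" "c g = 0" by simp_all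
  show "inv\<^bsub>PG\<^esub> g \<in> Tp"
    unfolding PG_inv[OF g(1)] using P_inv[OF g(1)] Bp_inv[OF g(1,3)] g(2) by simp
next
  fix g h assume "g \<in> Tp" "h \<in> Tp"
  then have g: "g \<in> P" "b g = 0" "c g = 0" and h: "h \<in> P" "b h = 0" "c h = 0" by simp_all
  have "g * h \<in> P" "b (g * h) = 0" "c (g * h) = 0"
    using P_mult[OF g(1) h(1)] by (simp_all add: bmult[OF g(1) h(1)] g h)
  then show "g \<otimes>\<^bsub>PG\<^esub> h \<in> Tp" by simp
qed

lemma Tp_closed: "closedin QT (cl ` Tp)"
proof -
  have "cl ` Tp = cls (\<lambda>g. b g = 0 \<and> c g = 0)" by (auto simp: cls_def Tp_def)
  moreover have "closedin QT (cls (\<lambda>g. b g = 0 \<and> c g = 0))"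
  proof (rule cls_closed)
    have "{g \<in> P. b g = 0 \<and> c g = 0} = {g \<in> P. b g = 0} \<inter> {g \<in> P. c g = 0}" by auto
    then show "closedin PT {g \<in> P. b g = 0 \<and> c g = 0}"
      using closed_PT[OF regs(2)] closed_PT[OF regs(3)] by (simp add: closedin_Int)
  qed (auto simp: cl_eq)
  ultimately show ?thesis by simp
qed

lemma Tp_point_closed:
  assumes x: "x \<in> cl ` Tp"
  shows "closedin QT {x}"
proof -
  obtain h where h: "h \<in> P" "b h = 0" "c h = 0" "x = cl h" using x by auto
  have hz: "a h \<noteq> 0" "d h \<noteq> 0" using Bp_nz[OF h(1,3)] by auto
  let ?L = "\<lambda>g. b g = 0 \<and> c g = 0 \<and> a g * d h - d g * a h = 0"
  have "cl g = x \<longleftrightarrow> ?L g" if g: "g \<in> P" for g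
  proof
    assume "cl g = x"
    then obtain s where "a g = s * a h" "b g = s * b h" "c g = s * c h" "d g = s * d h"
      using cl_eq[OF g h(1)] h(4) by auto
    then show "?L g" using h by simp
  next
    assume L: "?L g"
    then have "a g \<noteq> 0" using Bp_nz[OF g] by blast
    then show "cl g = x" unfolding h(4) cl_eq[OF g h(1)]
      using L h hz by (intro exI[of _ "a g / a h"]) (auto simp: field_simps)
  qed
  then have "{g \<in> P. cl g \<in> {x}} = {g \<in> P. b g = 0} \<inter> {g \<in> P. c g = 0} \<inter> {g \<in> P. a g * d h - d g * a h = 0}"
    by auto
  moreover have "closedin PT {g \<in> P. a g * d h - d g * a h = 0}"
    by (intro closed_PT regular_diff regular_mult regular_const regs)
  ultimately show ?thesis
    unfolding closed_QT using closed_PT[OF regs(2)] closed_PT[OF regs(3)] h by (simp add: closedin_Int carrier_Q)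
qed

lemma torus_point:
  fixes s :: complex
  assumes "s \<noteq> 0"
  obtains g where "g \<in> P" "a g = s" "b g = 0" "c g = 0" "d g = 1"
  using block_onto[of s 1 0 0] assms by auto

text \<open>The torus is a line without one point: a proper closed subset is finite, because it meets
  the line \<open>t \<mapsto> diag (1 + t, 1)\<close> through a point outside it in the zeros of a nonzero polynomial.\<close>

lemma Tp_closed_finite:
  assumes Z: "closedin QT Z" "Z \<subset> cl ` Tp"
  shows "finite Z"
proof -
  obtain x where x: "x \<in> cl ` Tp" "x \<notin> Z" using Z(2) by blast
  then obtain g where g: "g \<in> P" "b g = 0" "c g = 0" "cl g \<notin> Z" by auto
  have gz: "a g \<noteq> 0" "d g \<noteq> 0" using Bp_nz[OF g(1,3)] by auto
  have "closedin PT {h \<in> P. cl h \<in> Z}" using Z(1) unfolding closed_QT by blast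
  then have "openin PT (P - {h \<in> P. cl h \<in> Z})" unfolding closedin_def topspace_PT by blast
  then obtain U where U: "openin (zariski n) U" "P - {h \<in> P. cl h \<in> Z} = U \<inter> P"
    by (auto simp: openin_subtopology)
  have "g \<in> U" using U(2) g by blast
  from open_basic[OF U(1) this] obtain f where f: "regular n f" "f g \<noteq> 0"
    "\<And>B. B \<in> carrier_mat n n \<Longrightarrow> f B \<noteq> 0 \<Longrightarrow> B \<in> U" by blast
  have fz: "f h = 0" if "h \<in> P" "cl h \<in> Z" for h
    using f(3)[OF P_D[OF that(1)]] U(2) that by blast
  obtain e where e: "e \<in> P" "a e = 2" "b e = 0" "c e = 0" "d e = 1" by (rule torus_point[of 2]) auto
  have ge: "g * e \<in> P" by (rule P_mult[OF g(1) e(1)])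
  let ?s = "seg g (g * e)"
  let ?T = "{t. f (?s t) = 0} \<union> {t. ?s t \<notin> P}"
  have "finite {t. f (?s t) = 0}"
    by (rule finite_zeros_on_seg[OF f(1) P_D[OF g(1)] P_D[OF ge], of 0])
      (simp add: seg_ends[OF P_D[OF g(1)] P_D[OF ge]] f(2))
  moreover have "finite {t. ?s t \<notin> P}" using P_dense g(1) ge by (simp add: line_dense_def)
  ultimately have fin: "finite ?T" by simp
  have se: "a (?s t) = (1 + t) * a g" "b (?s t) = 0" "c (?s t) = 0" "d (?s t) = d g" for t
    using lin[OF P_D[OF g(1)] P_D[OF ge], of t] g e by (simp_all add: bmult[OF g(1) e(1)] algebra_simps)
  have "\<forall>t. \<exists>k. t \<noteq> - 1 \<longrightarrow> k \<in> P \<and> a k = (1 + t) * a g \<and> b k = 0 \<and> c k = 0 \<and> d k = d g"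
    using block_onto[of "(1 + t) * a g" "d g" 0 0 for t] gz
    by (metis add.right_inverse add_left_cancel diff_zero mult_eq_0_iff mult_zero_left)
  then obtain k where k: "\<And>t. t \<noteq> - 1 \<Longrightarrow> k t \<in> P \<and> a (k t) = (1 + t) * a g \<and> b (k t) = 0 \<and> c (k t) = 0 \<and> d (k t) = d g"
    by metis
  have "Z \<subseteq> (\<lambda>t. cl (k t)) ` ?T"
  proof
    fix z assume z: "z \<in> Z"
    then have "z \<in> cl ` Tp" using Z(2) by blast
    then obtain h where h: "h \<in> P" "b h = 0" "c h = 0" "z = cl h" by auto
    have hz: "a h \<noteq> 0" "d h \<noteq> 0" using Bp_nz[OF h(1,3)] by auto
    \<comment> \<open>the parameter at which the line through \<open>g\<close> meets the class of \<open>h\<close>\<close>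
    define t where "t = a h * d g / (d h * a g) - 1"
    have t: "(1 + t) * a g = d g / d h * a h" using gz hz by (simp add: t_def field_simps)
    have t1: "t \<noteq> - 1" using gz hz by (simp add: t_def)
    have kz: "cl (k t) = z"
      unfolding h(4) cl_eq[OF conjunct1[OF k[OF t1]] h(1)]
      by (rule exI[of _ "d g / d h"]) (use k[OF t1] t gz hz h in simp)
    have "t \<in> ?T"
    proof (rule ccontr)
      assume nt: "t \<notin> ?T"
      then have sP: "?s t \<in> P" by simp
      have "cl (?s t) = z" unfolding h(4) cl_eq[OF sP h(1)]
        by (rule exI[of _ "d g / d h"]) (use se[of t] t gz hz h in simp)
      then show False using fz[OF sP] z nt by simp
    qed
    with kz show "z \<in> (\<lambda>t. cl (k t)) ` ?T" by blast
  qed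
  then show ?thesis using fin by (rule finite_surj[rotated])
qed

lemma Tp_infinite: "infinite (cl ` Tp)"
proof
  assume fin: "finite (cl ` Tp)"
  have "\<forall>s. \<exists>g. s \<noteq> 0 \<longrightarrow> g \<in> P \<and> a g = s \<and> b g = 0 \<and> c g = 0 \<and> d g = 1" using torus_point by metis
  then obtain k where k: "\<And>s. s \<noteq> 0 \<Longrightarrow> k s \<in> P \<and> a (k s) = s \<and> b (k s) = 0 \<and> c (k s) = 0 \<and> d (k s) = 1"
    by metis
  have "inj_on (\<lambda>s. cl (k s)) (- {0})"
  proof (rule inj_onI)
    fix s t :: complex assume st: "s \<in> - {0}" "t \<in> - {0}" "cl (k s) = cl (k t)"
    then have ks: "k s \<in> P" "a (k s) = s" "d (k s) = 1" and kt: "k t \<in> P" "a (k t) = t" "d (k t) = 1"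
      using k by auto
    obtain u where "a (k s) = u * a (k t)" "d (k s) = u * d (k t)" using st(3) cl_eq[OF ks(1) kt(1)] by auto
    then show "s = t" using ks kt by simp
  qed
  moreover have "(\<lambda>s. cl (k s)) ` (- {0}) \<subseteq> cl ` Tp" using k by auto
  ultimately have "finite (- {0 :: complex})" using fin by (rule inj_on_finite)
  then have "finite (insert 0 (- {0 :: complex}))" by simp
  moreover have "insert 0 (- {0 :: complex}) = UNIV" by auto
  ultimately show False using infinite_UNIV_char_0[where 'a = complex] by simp
qed

text \<open>The proper closed subsets of the infinite torus are finite, so an irreducible one is a point, and the chains
  of irreducible closed sets have length at most one.\<close>

lemma torus_dimension: "krull_dimension (subtopology QT (cl ` Tp)) = 1"
proof -
  let ?M = "cl ` Tp" and ?X = "subtopology QT (cl ` Tp)"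
  have cX: "closedin ?X Z \<longleftrightarrow> closedin QT Z \<and> Z \<subseteq> ?M" for Z by (rule closedin_closed_subtopology[OF Tp_closed])
  have pt: "closedin ?X {x}" if "x \<in> ?M" for x using Tp_point_closed[OF that] that cX by blast
  have fin: "closedin ?X F" if "finite F" "F \<subseteq> ?M" for F
    using that
  proof induction
    case (insert x F)
    then have "closedin ?X ({x} \<union> F)" by (intro closedin_Un pt) auto
    then show ?case by simp
  qed simp
  have small: "finite Z" if "closedin ?X Z" "Z \<noteq> ?M" for Z
    using that Tp_closed_finite[of Z] cX by blast
  have irrM: "irreducible_closed ?X ?M"
    unfolding irreducible_closed_def
  proof (intro conjI allI impI)
    show "closedin ?X ?M" using cX Tp_closed by blast
    show "?M \<noteq> {}" using Tp_infinite by auto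
    fix A B assume AB: "closedin ?X A" "closedin ?X B" "?M \<subseteq> A \<union> B"
    show "?M \<subseteq> A \<or> ?M \<subseteq> B"
    proof (rule ccontr)
      assume "\<not> ?thesis"
      then have "finite A" "finite B" using small[OF AB(1)] small[OF AB(2)] by blast+
      then show False using AB(3) Tp_infinite finite_subset by blast
    qed
  qed
  obtain x where x: "x \<in> ?M" using Tp_infinite by fastforce
  have irrx: "irreducible_closed ?X {x}"
    unfolding irreducible_closed_def using pt[OF x] by auto
  have chain1: "\<exists>Z. (\<forall>i \<le> 1. irreducible_closed ?X (Z i)) \<and> (\<forall>i < 1. Z i \<subset> Z (Suc i))"
  proof (intro exI[of _ "\<lambda>i. if i = 0 then {x} else ?M"] conjI allI impI)
    show "(if i = 0 then {x} else ?M) \<subset> (if Suc i = 0 then {x} else ?M)" if "i < 1" for i :: nat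
      using that x Tp_infinite by (auto simp: psubset_eq) (metis finite.emptyI finite_insert)
  qed (use irrx irrM in simp)
  have bound: "k \<le> 1" if k: "\<exists>Z. (\<forall>i \<le> k. irreducible_closed ?X (Z i)) \<and> (\<forall>i < k. Z i \<subset> Z (Suc i))" for k
  proof (rule ccontr)
    assume "\<not> k \<le> 1"
    then have k2: "2 \<le> k" by simp
    obtain Z where Z: "\<forall>i \<le> k. irreducible_closed ?X (Z i)" "\<forall>i < k. Z i \<subset> Z (Suc i)" using k by blast
    have irr: "irreducible_closed ?X (Z 0)" "irreducible_closed ?X (Z 1)" "irreducible_closed ?X (Z (Suc 1))"
      using Z(1) k2 by auto
    have sub: "Z 0 \<subset> Z 1" "Z 1 \<subset> Z (Suc 1)" using Z(2) k2 by auto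
    have c1: "closedin ?X (Z 1)" using irr(2) unfolding irreducible_closed_def by (elim conjE)
    have "closedin ?X (Z (Suc 1))" using irr(3) unfolding irreducible_closed_def by (elim conjE)
    then have M2: "Z (Suc 1) \<subseteq> ?M" unfolding cX by (elim conjE)
    have ne: "Z 0 \<noteq> {}" using irr(1) unfolding irreducible_closed_def by (elim conjE)
    have s1: "Z 1 \<subset> ?M" by (rule psubset_subset_trans[OF sub(2) M2])
    have f1: "finite (Z 1)" by (rule small[OF c1 less_imp_neq[OF s1]])
    obtain z where z: "z \<in> Z 0" using ne unfolding ex_in_conv[symmetric] by (elim exE)
    have zM: "z \<in> ?M" by (rule subsetD[OF psubset_imp_subset[OF psubset_subset_trans[OF sub(1) psubset_imp_subset[OF s1]]] z])
    have c2: "closedin ?X (Z 1 - {z})"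
      by (rule fin[OF finite_Diff[OF f1] subset_trans[OF Diff_subset psubset_imp_subset[OF s1]]])
    have "\<forall>A B. closedin ?X A \<longrightarrow> closedin ?X B \<longrightarrow> Z 1 \<subseteq> A \<union> B \<longrightarrow> Z 1 \<subseteq> A \<or> Z 1 \<subseteq> B"
      using irr(2) unfolding irreducible_closed_def by (elim conjE)
    moreover have "Z 1 \<subseteq> {z} \<union> (Z 1 - {z})" by blast
    ultimately have "Z 1 \<subseteq> {z} \<or> Z 1 \<subseteq> Z 1 - {z}" using pt[OF zM] c2 by meson
    then show False using z sub(1) by blast
  qed
  define chain where "chain k \<longleftrightarrow>
    (\<exists>Z. (\<forall>i \<le> k. irreducible_closed ?X (Z i)) \<and> (\<forall>i < k. Z i \<subset> Z (Suc i)))" for k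
  have ch: "chain 1" "\<And>k. chain k \<Longrightarrow> k \<le> 1" unfolding chain_def by (rule chain1, rule bound)
  have "Sup {enat k | k. chain k} \<le> 1"
  proof (rule Sup_least)
    fix x assume "x \<in> {enat k | k. chain k}"
    then show "x \<le> 1" using ch(2) by (auto simp: one_enat_def)
  qed
  moreover have "enat 1 \<in> {enat k | k. chain k}" using ch(1) by blast
  then have "enat 1 \<le> Sup {enat k | k. chain k}" by (rule Sup_upper)
  ultimately show ?thesis unfolding krull_dimension_def chain_def[symmetric] by (simp add: one_enat_def)
qed

lemma Tp_QU: "cl ` Tp \<inter> QU \<subseteq> {V0}"
proof
  fix x assume "x \<in> cl ` Tp \<inter> QU"
  then have x: "x \<in> cl ` Tp" "x \<in> QU" by blast+
  obtain g where g: "g \<in> P" "b g = 0" "c g = 0" "x = cl g" using x(1) by auto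
  have "cl g \<in> QU" using x(2) g(4) by simp
  then have "a g = d g" by (rule QU_Bp[OF g(1) _ g(3)])
  then show "x \<in> {V0}" using cl_one_iff[OF g(1)] g by simp
qed

text \<open>The torus contains no unipotent element other than the neutral one.\<close>

lemma torus_reductive: "is_reductive (Q\<lparr>carrier := cl ` Tp\<rparr>) (subtopology QT (cl ` Tp)) QU"
proof -
  interpret Q: group Q by (rule Q_group)
  let ?M = "cl ` Tp"
  have M: "subgroup ?M Q" by (rule cl_subgroup[OF Tp_subgroup])
  interpret M: group "Q\<lparr>carrier := ?M\<rparr>" by (rule Q.subgroup_imp_group[OF M])
  have V: "V0 \<in> ?M" using subgroup.one_closed[OF M] by simp
  have VU: "V0 \<in> QU"
    by (rule subsetD[OF Up_unipotent subgroup.one_closed[OF cl_subgroup[OF Up_subgroup], unfolded one_Q]])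
  have 1: "closedin (subtopology QT ?M) {V0}"
    using closedin_subset_topspace[OF Tp_point_closed[OF V]] V by simp
  have "V0 \<in> topspace QT" unfolding topspace_QT using V subgroup.subset[OF M] by blast
  then have 2: "connectedin (subtopology QT ?M) {V0}"
    using V by (simp add: connectedin_subtopology del: topspace_QT)
  have 3: "{V0} \<lhd> Q\<lparr>carrier := ?M\<rparr>" using M.one_is_normal by simp
  have 4: "N \<subseteq> {V0}" if N: "N \<lhd> Q\<lparr>carrier := ?M\<rparr>" "N \<subseteq> QU" for N
  proof -
    have "N \<subseteq> ?M" using subgroup.subset[OF normal_imp_subgroup[OF N(1)]] by simp
    then show ?thesis using Tp_QU N(2) by (meson Int_greatest order_trans)
  qed
  have one: "\<one>\<^bsub>Q\<lparr>carrier := ?M\<rparr>\<^esub> = V0" by simp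
  show ?thesis
    unfolding is_reductive_def is_unipotent_radical_def one
  proof (intro conjI allI impI)
    show "{V0} \<subseteq> QU" by (rule insert_subsetI[OF VU empty_subsetI])
    fix N assume "closedin (subtopology QT ?M) N \<and> connectedin (subtopology QT ?M) N \<and>
      N \<lhd> Q\<lparr>carrier := ?M\<rparr> \<and> N \<subseteq> QU"
    then show "N \<subseteq> {V0}" by (elim conjE) (rule 4)
  qed (rule 1 2 3)+
qed

text \<open>The unipotent radical of each Borel subgroup contains a nontrivial unipotent element by \<open>Borel_unipotent\<close>.\<close>

lemma torus_no_unipotent_radical:
  assumes "is_Borel_subgroup Q QT C"
    "is_unipotent_radical (Q\<lparr>carrier := C\<rparr>) (subtopology QT C) QU R"
  shows "\<not> R \<subseteq> cl ` Tp"
proof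
  assume R: "R \<subseteq> cl ` Tp"
  obtain r where "r \<in> R" "r \<noteq> V0" using Borel_unipotent[OF assms] by blast
  moreover have "R \<subseteq> QU"
    using conjunct1[OF assms(2)[unfolded is_unipotent_radical_def]] by (elim conjE)
  ultimately have "r \<in> cl ` Tp \<inter> QU" using R by (meson IntI subsetD)
  then show False using Tp_QU \<open>r \<noteq> V0\<close> by (meson singletonD subsetD)
qed

section \<open>The dichotomy\<close>

text \<open>Let \<open>A\<close> be a subgroup of \<open>P\<close> that preserves two lines \<open>p\<close> and \<open>q\<close> and contains the
  perturbations of the identity by the multiples of an operator with image \<open>p\<close> and kernel \<open>q\<close>.
  If the lines coincide, the operator is nilpotent and the image of \<open>A\<close> in \<open>PGL(2)\<close> lies
  between the unipotent radical of a Borel subgroup and this Borel subgroup.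
  If they differ, the operator is semisimple and the image of \<open>A\<close> is a torus.\<close>

lemma dichotomy_equal:
  assumes A: "subgroup A PG" and p: "p1 \<noteq> 0 \<or> p2 \<noteq> 0" and q: "q1 \<noteq> 0 \<or> q2 \<noteq> 0" and par: "p1 * q2 = p2 * q1"
    and fixp: "\<And>g. g \<in> A \<Longrightarrow> (a g * p1 + b g * p2) * p2 = (c g * p1 + d g * p2) * p1"
    and elt: "\<And>t. \<exists>g \<in> A. a g = 1 - t * p1 * q2 \<and> b g = t * p1 * q1 \<and> c g = - t * p2 * q2 \<and> d g = 1 + t * p2 * q1"
  shows "solvable (Q\<lparr>carrier := cl ` A\<rparr>)"
    and "\<exists>C R. is_Borel_subgroup Q QT C \<and>
        is_unipotent_radical (Q\<lparr>carrier := C\<rparr>) (subtopology QT C) QU R \<and> R \<subseteq> cl ` A"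
    and "\<not> is_reductive (Q\<lparr>carrier := cl ` A\<rparr>) (subtopology QT (cl ` A)) QU"
    and "A \<subseteq> {g \<in> P. c g = 0} \<longleftrightarrow> p2 = 0"
proof -
  obtain r1 r2 where D: "p1 * r2 - r1 * p2 = 1" by (rule complete_basis[OF p])
  \<comment> \<open>the basis \<open>p, r\<close>; the coordinate of \<open>q\<close> along \<open>p\<close> is \<open>\<kappa>\<close>\<close>
  define \<kappa> where "\<kappa> = q1 * r2 - q2 * r1"
  have q': "q1 = \<kappa> * p1" "q2 = \<kappa> * p2"
  proof -
    have "q1 = q1 * (p1 * r2 - r1 * p2)" "q2 = q2 * (p1 * r2 - r1 * p2)" using D by simp_all
    moreover have "q1 * (p1 * r2 - r1 * p2) = \<kappa> * p1 + r1 * (p1 * q2 - p2 * q1)"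
      "q2 * (p1 * r2 - r1 * p2) = \<kappa> * p2 + r2 * (p1 * q2 - p2 * q1)"
      by (simp_all add: \<kappa>_def algebra_simps)
    ultimately show "q1 = \<kappa> * p1" "q2 = \<kappa> * p2" using par by simp_all
  qed
  then have \<kappa>: "\<kappa> \<noteq> 0" using q by auto
  interpret B: block_group n P
    "\<lambda>g. r2 * (a g * p1 + b g * p2) - r1 * (c g * p1 + d g * p2)"
    "\<lambda>g. r2 * (a g * r1 + b g * r2) - r1 * (c g * r1 + d g * r2)"
    "\<lambda>g. p1 * (c g * p1 + d g * p2) - p2 * (a g * p1 + b g * p2)"
    "\<lambda>g. p1 * (c g * r1 + d g * r2) - p2 * (a g * r1 + b g * r2)"
    by (rule change_basis[OF D])
  note V = V0_change_basis[OF D]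
  have clB: "B.cl = cl" by (rule ext) (simp add: B.cl_def cl_def V)
  have AP: "A \<subseteq> P" using subgroup.subset[OF A] by simp
  have M: "subgroup (cl ` A) Q" by (rule cl_subgroup[OF A])
  have "A \<subseteq> B.Bp"
  proof
    fix g assume g: "g \<in> A"
    have "p1 * (c g * p1 + d g * p2) - p2 * (a g * p1 + b g * p2) = 0" using fixp[OF g] by (simp add: mult.commute)
    then show "g \<in> B.Bp" unfolding B.Bp_iff using g AP by blast
  qed
  then have sub: "cl ` A \<subseteq> cl ` B.Bp" by (rule image_mono)
  have Dr: "p1 * r2 - p2 * r1 = 1" using D by (simp add: mult.commute)
  have sup: "cl ` B.Up \<subseteq> cl ` A"
  proof
    fix x assume "x \<in> cl ` B.Up"
    then obtain g where g: "g \<in> B.Up" "x = cl g" by blast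
    let ?a = "\<lambda>g. r2 * (a g * p1 + b g * p2) - r1 * (c g * p1 + d g * p2)"
    let ?b = "\<lambda>g. r2 * (a g * r1 + b g * r2) - r1 * (c g * r1 + d g * r2)"
    let ?c = "\<lambda>g. p1 * (c g * p1 + d g * p2) - p2 * (a g * p1 + b g * p2)"
    let ?d = "\<lambda>g. p1 * (c g * r1 + d g * r2) - p2 * (a g * r1 + b g * r2)"
    have gP: "g \<in> P" and g': "?c g = 0" "?a g = ?d g" using g(1) unfolding B.Up_iff by blast+
    have nz: "?a g \<noteq> 0" using B.Bp_nz[OF gP g'(1)] by blast
    define t where "t = ?b g / ?a g / \<kappa>"
    obtain h where h: "h \<in> A" "a h = 1 - t * p1 * q2" "b h = t * p1 * q1" "c h = - t * p2 * q2" "d h = 1 + t * p2 * q1"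
      using elt by blast
    have hP: "h \<in> P" using h(1) AP by blast
    have e1: "a h * p1 + b h * p2 = p1" "c h * p1 + d h * p2 = p2"
      unfolding h q' by (simp_all add: algebra_simps)
    have ha: "?a h = 1" unfolding e1 using Dr by (simp add: mult.commute)
    have hc: "?c h = 0" unfolding e1 by simp
    have "a h * r1 + b h * r2 = r1 + t * \<kappa> * p1 * (p1 * r2 - p2 * r1)" "c h * r1 + d h * r2 = r2 + t * \<kappa> * p2 * (p1 * r2 - p2 * r1)"
      unfolding h q' by (simp_all add: algebra_simps)
    then have e2: "a h * r1 + b h * r2 = r1 + t * \<kappa> * p1" "c h * r1 + d h * r2 = r2 + t * \<kappa> * p2" unfolding Dr by simp_all
    have hd: "?d h = 1" unfolding e2 using Dr by (simp add: algebra_simps)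
    have "?b h = t * \<kappa> * (p1 * r2 - p2 * r1)" unfolding e2 by (simp add: algebra_simps)
    then have hb: "?b h * ?a g = ?b g" unfolding Dr t_def using \<kappa> nz by simp
    have "?a g = ?a g * ?a h" unfolding ha by (rule mult_1_right[symmetric])
    moreover have "?b g = ?a g * ?b h" by (rule trans[OF hb[symmetric] mult.commute])
    moreover have "?c g = ?a g * ?c h" unfolding hc g'(1) by (rule mult_zero_right[symmetric])
    moreover have "?d g = ?a g * ?d h" unfolding hd g'(2) by (rule mult_1_right[symmetric])
    ultimately have "cl g = cl h" unfolding clB[symmetric] B.cl_eq[OF gP hP]
      by (intro exI[of _ "?a g"] conjI nz)
    then show "x \<in> cl ` A" using h(1) g(2) by simp
  qed
  note U = B.unipotent_case[unfolded V clB, OF M sup sub]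
  show "solvable (Q\<lparr>carrier := cl ` A\<rparr>)" by (rule U(1))
  show "\<exists>C R. is_Borel_subgroup Q QT C \<and>
        is_unipotent_radical (Q\<lparr>carrier := C\<rparr>) (subtopology QT C) QU R \<and> R \<subseteq> cl ` A" by (rule U(2))
  show "\<not> is_reductive (Q\<lparr>carrier := cl ` A\<rparr>) (subtopology QT (cl ` A)) QU" by (rule U(3))
  show "A \<subseteq> {g \<in> P. c g = 0} \<longleftrightarrow> p2 = 0"
  proof
    assume s: "A \<subseteq> {g \<in> P. c g = 0}"
    obtain h where "h \<in> A" "c h = - 1 * p2 * q2" using elt[of 1] by blast
    then have "p2 * q2 = 0" using s by auto
    then show "p2 = 0" using \<kappa> by (auto simp: q')
  next
    assume "p2 = 0"
    then show "A \<subseteq> {g \<in> P. c g = 0}" using fixp p AP by fastforce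
  qed
qed

lemma dichotomy_different:
  assumes A: "subgroup A PG" and ne: "p1 * q2 \<noteq> p2 * q1"
    and fixp: "\<And>g. g \<in> A \<Longrightarrow> (a g * p1 + b g * p2) * p2 = (c g * p1 + d g * p2) * p1"
    and fixq: "\<And>g. g \<in> A \<Longrightarrow> (a g * q1 + b g * q2) * q2 = (c g * q1 + d g * q2) * q1"
    and elt: "\<And>t. 1 + t * (p2 * q1 - p1 * q2) \<noteq> 0 \<Longrightarrow>
      \<exists>g \<in> A. a g = 1 - t * p1 * q2 \<and> b g = t * p1 * q1 \<and> c g = - t * p2 * q2 \<and> d g = 1 + t * p2 * q1"
  shows "krull_dimension (subtopology QT (cl ` A)) = 1"
    and "is_reductive (Q\<lparr>carrier := cl ` A\<rparr>) (subtopology QT (cl ` A)) QU"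
    and "\<not> (\<exists>C R. is_Borel_subgroup Q QT C \<and>
        is_unipotent_radical (Q\<lparr>carrier := C\<rparr>) (subtopology QT C) QU R \<and> R \<subseteq> cl ` A)"
    and "A \<subseteq> {g \<in> P. c g = 0} \<longleftrightarrow> p2 = 0 \<or> q2 = 0"
proof -
  define \<delta> where "\<delta> = p1 * q2 - p2 * q1"
  have \<delta>: "\<delta> \<noteq> 0" using ne by (simp add: \<delta>_def)
  \<comment> \<open>the basis of the eigenlines \<open>p\<close> and \<open>q\<close>, with \<open>q\<close> scaled to make the determinant one\<close>
  define r1 where "r1 = q1 / \<delta>"
  define r2 where "r2 = q2 / \<delta>"
  have "p1 * r2 - r1 * p2 = (p1 * q2 - p2 * q1) / \<delta>"
    by (simp add: r1_def r2_def diff_divide_distrib mult.commute)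
  also have "\<dots> = \<delta> / \<delta>" by (simp only: \<delta>_def)
  finally have D: "p1 * r2 - r1 * p2 = 1" using \<delta> by simp
  interpret B: block_group n P
    "\<lambda>g. r2 * (a g * p1 + b g * p2) - r1 * (c g * p1 + d g * p2)"
    "\<lambda>g. r2 * (a g * r1 + b g * r2) - r1 * (c g * r1 + d g * r2)"
    "\<lambda>g. p1 * (c g * p1 + d g * p2) - p2 * (a g * p1 + b g * p2)"
    "\<lambda>g. p1 * (c g * r1 + d g * r2) - p2 * (a g * r1 + b g * r2)"
    by (rule change_basis[OF D])
  let ?a = "\<lambda>g. r2 * (a g * p1 + b g * p2) - r1 * (c g * p1 + d g * p2)"
  let ?b = "\<lambda>g. r2 * (a g * r1 + b g * r2) - r1 * (c g * r1 + d g * r2)"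
  let ?c = "\<lambda>g. p1 * (c g * p1 + d g * p2) - p2 * (a g * p1 + b g * p2)"
  let ?d = "\<lambda>g. p1 * (c g * r1 + d g * r2) - p2 * (a g * r1 + b g * r2)"
  note V = V0_change_basis[OF D]
  have clB: "B.cl = cl" by (rule ext) (simp add: B.cl_def cl_def V)
  have AP: "A \<subseteq> P" using subgroup.subset[OF A] by simp
  have rq: "q1 = \<delta> * r1" "q2 = \<delta> * r2" using \<delta> by (simp_all add: r1_def r2_def)
  have Dr: "p1 * r2 - p2 * r1 = 1" using D by (simp add: mult.commute)
  have "A \<subseteq> B.Tp"
  proof
    fix g assume g: "g \<in> A"
    have "?c g = 0" using fixp[OF g] by (simp add: mult.commute)
    moreover have "\<delta> * \<delta> * ?b g = (a g * q1 + b g * q2) * q2 - (c g * q1 + d g * q2) * q1"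
      unfolding rq by (simp add: algebra_simps)
    then have "?b g = 0" using fixq[OF g] \<delta> by simp
    ultimately show "g \<in> B.Tp" unfolding B.Tp_iff using g AP by blast
  qed
  moreover have "cl ` B.Tp \<subseteq> cl ` A"
  proof
    fix x assume "x \<in> cl ` B.Tp"
    then obtain g where g: "g \<in> B.Tp" "x = cl g" by blast
    have gP: "g \<in> P" and g': "?b g = 0" "?c g = 0" using g(1) unfolding B.Tp_iff by blast+
    have nz: "?a g \<noteq> 0" "?d g \<noteq> 0" using B.Bp_nz[OF gP g'(2)] by blast+
    define t where "t = (1 - ?a g / ?d g) / \<delta>"
    have t: "1 - t * \<delta> = ?a g / ?d g" using \<delta> by (simp add: t_def)
    have "1 + t * (p2 * q1 - p1 * q2) = 1 - t * \<delta>" by (simp add: \<delta>_def algebra_simps)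
    then have "1 + t * (p2 * q1 - p1 * q2) \<noteq> 0" unfolding t using nz by simp
    then obtain h where h: "h \<in> A" "a h = 1 - t * p1 * q2" "b h = t * p1 * q1" "c h = - t * p2 * q2" "d h = 1 + t * p2 * q1"
      using elt by blast
    have hP: "h \<in> P" using h(1) AP by blast
    have "a h * p1 + b h * p2 = (1 - t * \<delta> * (p1 * r2 - p2 * r1)) * p1" "c h * p1 + d h * p2 = (1 - t * \<delta> * (p1 * r2 - p2 * r1)) * p2"
      unfolding h rq by (simp_all add: algebra_simps)
    then have e1: "a h * p1 + b h * p2 = (1 - t * \<delta>) * p1" "c h * p1 + d h * p2 = (1 - t * \<delta>) * p2" unfolding Dr by simp_all
    have e2: "a h * r1 + b h * r2 = r1" "c h * r1 + d h * r2 = r2"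
      unfolding h rq by (simp_all add: algebra_simps)
    have "?a h = (1 - t * \<delta>) * (p1 * r2 - p2 * r1)" unfolding e1 by (simp add: algebra_simps)
    then have ha: "?a h = ?a g / ?d g" unfolding Dr t by simp
    have hb: "?b h = 0" unfolding e2 by simp
    have hc: "?c h = 0" unfolding e1 by simp
    have hd: "?d h = 1" unfolding e2 using Dr by simp
    have "?a g = ?d g * ?a h" unfolding ha using nz(2) by simp
    then have "cl g = cl h" unfolding clB[symmetric] B.cl_eq[OF gP hP]
      using nz(2) g' hb hc hd by (intro exI[of _ "?d g"] conjI) simp_all
    then show "x \<in> cl ` A" using h(1) g(2) by simp
  qed
  ultimately have M: "cl ` A = cl ` B.Tp" by blast
  show "krull_dimension (subtopology QT (cl ` A)) = 1"
    unfolding M using B.torus_dimension unfolding V clB .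
  show "is_reductive (Q\<lparr>carrier := cl ` A\<rparr>) (subtopology QT (cl ` A)) QU"
    unfolding M using B.torus_reductive unfolding V clB .
  show "\<not> (\<exists>C R. is_Borel_subgroup Q QT C \<and>
        is_unipotent_radical (Q\<lparr>carrier := C\<rparr>) (subtopology QT C) QU R \<and> R \<subseteq> cl ` A)"
    unfolding M using B.torus_no_unipotent_radical unfolding V clB by blast
  show "A \<subseteq> {g \<in> P. c g = 0} \<longleftrightarrow> p2 = 0 \<or> q2 = 0"
  proof
    assume s: "A \<subseteq> {g \<in> P. c g = 0}"
    have "p2 * q1 - p1 * q2 = - \<delta>" by (simp add: \<delta>_def)
    then have "1 + (- 1 / \<delta>) * (p2 * q1 - p1 * q2) = 1 + \<delta> / \<delta>" by simp
    then have "1 + (- 1 / \<delta>) * (p2 * q1 - p1 * q2) \<noteq> 0" using \<delta> by simp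
    then obtain h where "h \<in> A" "c h = - (- 1 / \<delta>) * p2 * q2" using elt by blast
    then have "(- (- 1 / \<delta>)) * (p2 * q2) = 0" using s by auto
    then show "p2 = 0 \<or> q2 = 0" using \<delta> by simp
  next
    assume "p2 = 0 \<or> q2 = 0"
    then show "A \<subseteq> {g \<in> P. c g = 0}"
    proof
      assume "p2 = 0"
      then show ?thesis using fixp ne AP by fastforce
    next
      assume "q2 = 0"
      then show ?thesis using fixq ne AP by fastforce
    qed
  qed
qed

end

section \<open>The parabolic subgroups as block groups\<close>

definition block_mat :: "nat \<Rightarrow> nat \<Rightarrow> complex \<Rightarrow> complex \<Rightarrow> complex \<Rightarrow> complex \<Rightarrow> complex mat" where
  "block_mat n i \<alpha> \<beta> \<gamma> \<delta> = mat n n (\<lambda>(k, l).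
    if k = i \<and> l = i then \<alpha> else if k = i \<and> l = Suc i then \<beta>
    else if k = Suc i \<and> l = i then \<gamma> else if k = Suc i \<and> l = Suc i then \<delta>
    else if k = l then 1 else 0)"

lemma block_mat_carrier [simp]: "block_mat n i \<alpha> \<beta> \<gamma> \<delta> \<in> carrier_mat n n"
  by (simp add: block_mat_def)

lemma block_mat_entries:
  assumes "i + 1 < n"
  shows "block_mat n i \<alpha> \<beta> \<gamma> \<delta> $$ (i, i) = \<alpha>" "block_mat n i \<alpha> \<beta> \<gamma> \<delta> $$ (i, Suc i) = \<beta>"
    "block_mat n i \<alpha> \<beta> \<gamma> \<delta> $$ (Suc i, i) = \<gamma>" "block_mat n i \<alpha> \<beta> \<gamma> \<delta> $$ (Suc i, Suc i) = \<delta>"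
  using assms by (simp_all add: block_mat_def)

text \<open>Square matrices with zeros at the places where the elements of the parabolic subgroup
  vanish. They form an algebra, and taking the block is multiplicative on it.\<close>

definition block_shape :: "nat \<Rightarrow> nat \<Rightarrow> complex mat \<Rightarrow> bool" where
  "block_shape n i X \<longleftrightarrow> X \<in> carrier_mat n n \<and>
    (\<forall>k l. l < k \<longrightarrow> k < n \<longrightarrow> (k, l) \<noteq> (Suc i, i) \<longrightarrow> X $$ (k, l) = 0)"

lemma block_shape_mult:
  assumes X: "block_shape n i X" and Y: "block_shape n i Y" and i: "i + 1 < n"
  shows "block_shape n i (X * Y)"
    and "k \<in> {i, Suc i} \<Longrightarrow> l \<in> {i, Suc i} \<Longrightarrow>
      (X * Y) $$ (k, l) = X $$ (k, i) * Y $$ (i, l) + X $$ (k, Suc i) * Y $$ (Suc i, l)"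
proof -
  have c: "X \<in> carrier_mat n n" "Y \<in> carrier_mat n n" using X Y by (auto simp: block_shape_def)
  have X0: "X $$ (k, l) = 0" if "l < k" "k < n" "(k, l) \<noteq> (Suc i, i)" for k l using X that by (simp add: block_shape_def)
  have Y0: "Y $$ (k, l) = 0" if "l < k" "k < n" "(k, l) \<noteq> (Suc i, i)" for k l using Y that by (simp add: block_shape_def)
  have "(X * Y) $$ (k, l) = 0" if kl: "l < k" "k < n" "(k, l) \<noteq> (Suc i, i)" for k l
  proof -
    have "X $$ (k, m) * Y $$ (m, l) = 0" if "m < n" for m
      using X0[of m k] Y0[of l m] kl that by (cases "m < k"; cases "l < m") auto
    then show ?thesis using c kl by (subst mmult_entry[of _ n]) (auto intro!: sum.neutral)
  qed
  then show "block_shape n i (X * Y)" using c by (simp add: block_shape_def)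
  assume kl: "k \<in> {i, Suc i}" "l \<in> {i, Suc i}"
  have "(X * Y) $$ (k, l) = (\<Sum>m<n. X $$ (k, m) * Y $$ (m, l))" using c kl i by (intro mmult_entry) auto
  also have "\<dots> = (\<Sum>m\<in>{i, Suc i}. X $$ (k, m) * Y $$ (m, l))"
  proof (rule sum.mono_neutral_right)
    show "\<forall>m\<in>{..<n} - {i, Suc i}. X $$ (k, m) * Y $$ (m, l) = 0"
    proof
      fix m assume m: "m \<in> {..<n} - {i, Suc i}"
      show "X $$ (k, m) * Y $$ (m, l) = 0"
        using X0[of m k] Y0[of l m] i kl m by (cases "m < i") auto
    qed
  qed (use i in auto)
  finally show "(X * Y) $$ (k, l) = X $$ (k, i) * Y $$ (i, l) + X $$ (k, Suc i) * Y $$ (Suc i, l)" by simp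
qed

lemma block_mat_shape: "block_shape n i (block_mat n i \<alpha> \<beta> \<gamma> \<delta>)"
  by (auto simp: block_shape_def block_mat_def)

lemma parab_shape: "g \<in> parab n i \<longleftrightarrow> g \<in> carrier (GL n) \<and> block_shape n i g"
  by (auto simp: parab_def block_shape_def GL_D)

lemma block_mat_mult:
  assumes i: "i + 1 < n"
  shows "block_mat n i \<alpha> \<beta> \<gamma> \<delta> * block_mat n i \<alpha>' \<beta>' \<gamma>' \<delta>' =
    block_mat n i (\<alpha> * \<alpha>' + \<beta> * \<gamma>') (\<alpha> * \<beta>' + \<beta> * \<delta>') (\<gamma> * \<alpha>' + \<delta> * \<gamma>') (\<gamma> * \<beta>' + \<delta> * \<delta>')"
    (is "?X * ?Y = ?Z")
proof (rule eq_matI)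
  fix k l assume "k < dim_row ?Z" "l < dim_col ?Z"
  then have kl: "k < n" "l < n" by (simp_all add: block_mat_def)
  show "(?X * ?Y) $$ (k, l) = ?Z $$ (k, l)"
  proof (cases "k \<in> {i, Suc i} \<and> l \<in> {i, Suc i}")
    case True
    then show ?thesis
      using block_shape_mult(2)[OF block_mat_shape block_mat_shape i, of k l]
      by (elim conjE insertE emptyE; simp only: block_mat_entries[OF i] insert_iff simp_thms)
  next
    case False
    have off: "block_mat n i a b c d $$ (r, s) = (if r = s then 1 else 0)"
      if "r \<notin> {i, Suc i} \<or> s \<notin> {i, Suc i}" "r < n" "s < n" for r s a b c d
    proof -
      have "(r = i \<and> s = i) = False" "(r = i \<and> s = Suc i) = False" "(r = Suc i \<and> s = i) = False"
        "(r = Suc i \<and> s = Suc i) = False" using that(1) by (elim disjE; simp)+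
      then show ?thesis unfolding block_mat_def index_mat(1)[OF that(2,3)] case_prod_conv
        by (simp only: if_False)
    qed
    have e: "(?X * ?Y) $$ (k, l) = (\<Sum>m<n. ?X $$ (k, m) * ?Y $$ (m, l))"
      using kl by (intro mmult_entry) simp_all
    have "(?X * ?Y) $$ (k, l) = (if k = l then 1 else 0)"
    proof (cases "k \<in> {i, Suc i}")
      case True
      then have l: "l \<notin> {i, Suc i}" using False by blast
      have "(\<Sum>m<n. ?X $$ (k, m) * ?Y $$ (m, l)) = (\<Sum>m<n. if m = l then ?X $$ (k, l) else 0)"
        by (rule sum.cong) (use l kl in \<open>simp_all add: off\<close>)
      then show ?thesis using kl l e by (simp add: off)
    next
      case k: False
      have "(\<Sum>m<n. ?X $$ (k, m) * ?Y $$ (m, l)) = (\<Sum>m<n. if m = k then ?Y $$ (k, l) else 0)"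
        by (rule sum.cong) (use k kl in \<open>simp_all add: off\<close>)
      then show ?thesis using kl k e by (simp add: off)
    qed
    then show ?thesis using off[of k l] False kl by simp
  qed
qed (simp_all add: block_mat_def)

lemma block_mat_parab:
  assumes i: "i + 1 < n" and d: "\<alpha> * \<delta> - \<beta> * \<gamma> \<noteq> 0"
  shows "block_mat n i \<alpha> \<beta> \<gamma> \<delta> \<in> parab n i"
proof -
  let ?D = "\<alpha> * \<delta> - \<beta> * \<gamma>"
  define r where "r = 1 / ?D"
  have "?D * r = 1" using d by (simp add: r_def)
  then have "\<alpha> * (\<delta> * r) + \<beta> * (- \<gamma> * r) = 1" "\<alpha> * (- \<beta> * r) + \<beta> * (\<alpha> * r) = 0"
      "\<gamma> * (\<delta> * r) + \<delta> * (- \<gamma> * r) = 0" "\<gamma> * (- \<beta> * r) + \<delta> * (\<alpha> * r) = 1"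
    by (simp_all add: algebra_simps)
  then have "block_mat n i \<alpha> \<beta> \<gamma> \<delta> * block_mat n i (\<delta> * r) (- \<beta> * r) (- \<gamma> * r) (\<alpha> * r) =
      block_mat n i 1 0 0 1"
    unfolding block_mat_mult[OF i] by (simp only:)
  also have "\<dots> = 1\<^sub>m n"
  proof (rule eq_matI)
    fix k l assume "k < dim_row (1\<^sub>m n :: complex mat)" "l < dim_col (1\<^sub>m n :: complex mat)"
    then have kl: "k < n" "l < n" by simp_all
    show "block_mat n i 1 0 0 1 $$ (k, l) = 1\<^sub>m n $$ (k, l)"
    proof (cases "k = l")
      case True
      then have "(k = i \<and> l = Suc i) = False" "(k = Suc i \<and> l = i) = False" by simp_all
      then show ?thesis unfolding block_mat_def index_mat(1)[OF kl] case_prod_conv using kl True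
        by (simp only: if_False if_cancel index_one_mat if_True simp_thms)
    next
      case False
      then have "(k = i \<and> l = i) = False" "(k = Suc i \<and> l = Suc i) = False" by simp_all
      then show ?thesis unfolding block_mat_def index_mat(1)[OF kl] case_prod_conv using kl False
        by (simp only: if_False if_cancel index_one_mat)
    qed
  qed (simp_all add: block_mat_def)
  finally have "block_mat n i \<alpha> \<beta> \<gamma> \<delta> \<in> carrier (GL n)" by (intro GL_I) simp_all
  then show ?thesis by (simp add: parab_shape block_mat_shape)
qed

text \<open>Passing to the block is multiplicative, so the block is nilpotent; a two by two matrix \<open>X\<close> satisfies
  \<open>X\<^sup>2 = tr(X) X - det(X)\<close>, which excludes a nonzero trace once the determinant vanishes.\<close>

lemma nilpotent_block:
  assumes X: "block_shape n i X" and i: "i + 1 < n" and nil: "X ^\<^sub>m n = 0\<^sub>m n n"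
  shows "X $$ (i, i) + X $$ (Suc i, Suc i) = 0"
    "X $$ (i, i) * X $$ (Suc i, Suc i) - X $$ (i, Suc i) * X $$ (Suc i, i) = 0"
proof -
  define D where "D Y = Y $$ (i, i) * Y $$ (Suc i, Suc i) - Y $$ (i, Suc i) * Y $$ (Suc i, i)" for Y :: "complex mat"
  define T where "T = X $$ (i, i) + X $$ (Suc i, Suc i)"
  have Xc: "X \<in> carrier_mat n n" using X by (simp add: block_shape_def)
  have sh: "block_shape n i (X ^\<^sub>m k)" for k
  proof (induction k)
    case 0
    then show ?case using Xc by (auto simp: block_shape_def)
  next
    case (Suc k)
    then show ?case using block_shape_mult(1)[OF Suc X i] by simp
  qed
  note bm = block_shape_mult(2)[OF sh X i]
  have DX: "D (X ^\<^sub>m k) = D X ^ k" for k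
  proof (induction k)
    case 0
    then show ?case using Xc i by (simp add: D_def)
  next
    case (Suc k)
    have "D (X ^\<^sub>m Suc k) = D (X ^\<^sub>m k) * D X"
      unfolding D_def pow_mat.simps by (simp add: bm algebra_simps del: index_mult_mat)
    then show ?case using Suc by simp
  qed
  have n: "n = Suc (n - 1)" using i by simp
  have "D X ^ n = 0" using DX[of n] nil i by (simp add: D_def)
  then have D0: "D X = 0" by simp
  then show "X $$ (i, i) * X $$ (Suc i, Suc i) - X $$ (i, Suc i) * X $$ (Suc i, i) = 0" by (simp add: D_def)
  have p: "(X ^\<^sub>m Suc k) $$ (j, l) = T ^ k * X $$ (j, l)" if jl: "j \<in> {i, Suc i}" "l \<in> {i, Suc i}" for k j l
    using jl
  proof (induction k arbitrary: j l)
    case 0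
    have "1\<^sub>m n * X = X" using Xc by simp
    then show ?case using Xc by simp
  next
    case (Suc k)
    have "(X ^\<^sub>m Suc (Suc k)) $$ (j, l) = (X ^\<^sub>m Suc k * X) $$ (j, l)" by simp
    also have "\<dots> = (X ^\<^sub>m Suc k) $$ (j, i) * X $$ (i, l) + (X ^\<^sub>m Suc k) $$ (j, Suc i) * X $$ (Suc i, l)"
      by (rule bm[OF Suc.prems])
    also have "\<dots> = T ^ k * (X $$ (j, i) * X $$ (i, l) + X $$ (j, Suc i) * X $$ (Suc i, l))"
      using Suc.IH[of j i] Suc.IH[of j "Suc i"] Suc.prems by (simp only: insert_iff) (simp add: algebra_simps)
    also have "X $$ (j, i) * X $$ (i, l) + X $$ (j, Suc i) * X $$ (Suc i, l) = T * X $$ (j, l) - (if j = l then D X else 0)"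
      using Suc.prems by (auto simp: T_def D_def algebra_simps)
    finally show ?case using D0 by simp
  qed
  have "(X ^\<^sub>m n) $$ (i, i) + (X ^\<^sub>m n) $$ (Suc i, Suc i) = T ^ (n - 1) * T"
    using p[of i i "n - 1"] p[of "Suc i" "Suc i" "n - 1"] n by (simp add: T_def distrib_left)
  then have "T ^ (n - 1) * T = 0" using nil i by simp
  then have "T = 0" by (cases "T = 0") simp_all
  then show "X $$ (i, i) + X $$ (Suc i, Suc i) = 0" by (simp add: T_def)
qed

text \<open>A unipotent block is realized by a unipotent matrix with the identity outside of the block.\<close>

lemma block_group_standard:
  assumes P: "subgroup P (GL n)" "P \<subseteq> parab n i" "line_dense P" and i: "i + 1 < n"
    and mem: "\<And>\<alpha> \<beta> \<gamma> \<delta>. \<alpha> * \<delta> - \<beta> * \<gamma> \<noteq> 0 \<Longrightarrow> block_mat n i \<alpha> \<beta> \<gamma> \<delta> \<in> P"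
  shows "block_group n P (\<lambda>g. g $$ (i, i)) (\<lambda>g. g $$ (i, Suc i)) (\<lambda>g. g $$ (Suc i, i)) (\<lambda>g. g $$ (Suc i, Suc i))"
proof (rule block_group.intro)
  show "subgroup P (GL n)" "line_dense P" by fact+
  show "regular n (\<lambda>g. g $$ (i, i))" "regular n (\<lambda>g. g $$ (i, Suc i))" "regular n (\<lambda>g. g $$ (Suc i, i))"
    "regular n (\<lambda>g. g $$ (Suc i, Suc i))" using i by (intro regular_entry; simp)+
  show "seg A B t $$ (i, i) = (1 - t) * A $$ (i, i) + t * B $$ (i, i) \<and>
      seg A B t $$ (i, Suc i) = (1 - t) * A $$ (i, Suc i) + t * B $$ (i, Suc i) \<and>
      seg A B t $$ (Suc i, i) = (1 - t) * A $$ (Suc i, i) + t * B $$ (Suc i, i) \<and>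
      seg A B t $$ (Suc i, Suc i) = (1 - t) * A $$ (Suc i, Suc i) + t * B $$ (Suc i, Suc i)"
    if "A \<in> carrier_mat n n" "B \<in> carrier_mat n n" for A B t
    using i by (simp add: seg_entry[OF that])
  show "(g * h) $$ (i, i) = g $$ (i, i) * h $$ (i, i) + g $$ (i, Suc i) * h $$ (Suc i, i) \<and>
      (g * h) $$ (i, Suc i) = g $$ (i, i) * h $$ (i, Suc i) + g $$ (i, Suc i) * h $$ (Suc i, Suc i) \<and>
      (g * h) $$ (Suc i, i) = g $$ (Suc i, i) * h $$ (i, i) + g $$ (Suc i, Suc i) * h $$ (Suc i, i) \<and>
      (g * h) $$ (Suc i, Suc i) = g $$ (Suc i, i) * h $$ (i, Suc i) + g $$ (Suc i, Suc i) * h $$ (Suc i, Suc i)"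
    if "g \<in> P" "h \<in> P" for g h
    using parab_mult_entry[OF subsetD[OF P(2) that(1)] subsetD[OF P(2) that(2)] i] by blast
  show "1\<^sub>m n $$ (i, i) = 1 \<and> 1\<^sub>m n $$ (i, Suc i) = 0 \<and> 1\<^sub>m n $$ (Suc i, i) = 0 \<and> 1\<^sub>m n $$ (Suc i, Suc i) = (1 :: complex)"
    using i by simp
  show "\<exists>g\<in>P. g $$ (i, i) = \<alpha> \<and> g $$ (i, Suc i) = \<beta> \<and> g $$ (Suc i, i) = \<gamma> \<and> g $$ (Suc i, Suc i) = \<delta>"
    if "\<alpha> * \<delta> - \<beta> * \<gamma> \<noteq> 0" for \<alpha> \<beta> \<gamma> \<delta>
    using mem[OF that] block_mat_entries[OF i] by blast
  show "\<exists>g\<in>P. g $$ (i, i) = 1 + \<alpha> \<and> g $$ (i, Suc i) = \<beta> \<and> g $$ (Suc i, i) = \<gamma> \<and> g $$ (Suc i, Suc i) = 1 - \<alpha> \<and>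
      (g - 1\<^sub>m n) ^\<^sub>m n = 0\<^sub>m n n" if z: "\<alpha> * \<alpha> + \<beta> * \<gamma> = 0" for \<alpha> \<beta> \<gamma>
  proof -
    let ?g = "block_mat n i (1 + \<alpha>) \<beta> \<gamma> (1 - \<alpha>)" and ?X = "block_mat n i (1 + \<alpha>) \<beta> \<gamma> (1 - \<alpha>) - 1\<^sub>m n"
    have "(1 + \<alpha>) * (1 - \<alpha>) - \<beta> * \<gamma> = 1 - (\<alpha> * \<alpha> + \<beta> * \<gamma>)" by (simp add: algebra_simps)
    then have gP: "?g \<in> P" using z by (intro mem) simp
    have z': "\<beta> * \<gamma> = - (\<alpha> * \<alpha>)" using z by (simp add: eq_neg_iff_add_eq_0 add.commute)
    have Xc: "?X \<in> carrier_mat n n" by (rule minus_carrier_mat) simp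
    have "?X * ?X = 0\<^sub>m n n"
    proof (rule eq_matI)
      fix k l assume "k < dim_row (0\<^sub>m n n :: complex mat)" "l < dim_col (0\<^sub>m n n :: complex mat)"
      then have kl: "k < n" "l < n" by simp_all
      have Xe: "?X $$ (k, l) = (if k = i \<and> l = i then \<alpha> else if k = i \<and> l = Suc i then \<beta>
          else if k = Suc i \<and> l = i then \<gamma> else if k = Suc i \<and> l = Suc i then - \<alpha> else 0)" if "k < n" "l < n" for k l
        using that by (simp add: block_mat_def)
      have "(?X * ?X) $$ (k, l) = (\<Sum>m<n. ?X $$ (k, m) * ?X $$ (m, l))" using kl by (intro mmult_entry Xc)
      also have "\<dots> = (\<Sum>m\<in>{i, Suc i}. ?X $$ (k, m) * ?X $$ (m, l))"
        by (rule sum.mono_neutral_right) (use i kl in \<open>auto simp: Xe simp del: index_minus_mat\<close>)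
      also have "\<dots> = 0" using i kl z' by (auto simp: Xe algebra_simps simp del: index_minus_mat)
      finally show "(?X * ?X) $$ (k, l) = 0\<^sub>m n n $$ (k, l)" using kl by simp
    qed simp_all
    then have "?X ^\<^sub>m Suc (Suc k) = 0\<^sub>m n n" for k
    proof (induction k)
      case 0
      then show ?case using Xc by simp
    next
      case (Suc k)
      have "?X ^\<^sub>m Suc (Suc (Suc k)) = 0\<^sub>m n n * ?X" using Suc by (simp only: pow_mat.simps)
      then show ?case using Xc by simp
    qed
    from this[of "n - 2"] have "?X ^\<^sub>m n = 0\<^sub>m n n" using i by (simp add: numeral_2_eq_2 Suc_diff_Suc)
    then show ?thesis using gP block_mat_entries[OF i] by blast
  qed
  show "g $$ (i, i) + g $$ (Suc i, Suc i) = 2 \<and> g $$ (i, i) * g $$ (Suc i, Suc i) - g $$ (i, Suc i) * g $$ (Suc i, i) = 1"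
    if g: "g \<in> P" "(g - 1\<^sub>m n) ^\<^sub>m n = 0\<^sub>m n n" for g
  proof -
    have gp: "g \<in> parab n i" using g(1) P(2) by blast
    have sh: "block_shape n i (g - 1\<^sub>m n)"
      using gp parab_D[OF gp] by (auto simp: parab_def block_shape_def)
    have "(g $$ (i, i) - 1) + (g $$ (Suc i, Suc i) - 1) = 0"
      "(g $$ (i, i) - 1) * (g $$ (Suc i, Suc i) - 1) - g $$ (i, Suc i) * g $$ (Suc i, i) = 0"
      using nilpotent_block[OF sh i g(2)] parab_D[OF gp] i by simp_all
    then show ?thesis by (auto simp: algebra_simps eq_diff_eq)
  qed
qed

lemma parab_subgroup: "i + 1 < n \<Longrightarrow> subgroup (parab n i) (GL n)"
proof (rule GLn.subgroupI)
  show "parab n i \<noteq> {}" using UT_one UT_parab by blast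
qed (auto simp: parab_mult parab_inv parab_GL)

lemma PK_subgroup:
  assumes "i + 2 < n"
  shows "subgroup (PK n i) (GL n)"
proof (rule GLn.subgroupI)
  show "PK n i \<noteq> {}" using smat_PK[OF assms] by blast
qed (use assms in \<open>auto simp: PK_mult PK_inv PK_GL\<close>)

lemma block_group_parab:
  assumes i: "i + 1 < n"
  shows "block_group n (parab n i) (\<lambda>g. g $$ (i, i)) (\<lambda>g. g $$ (i, Suc i)) (\<lambda>g. g $$ (Suc i, i)) (\<lambda>g. g $$ (Suc i, Suc i))"
proof (rule block_group_standard[OF parab_subgroup[OF i] subset_refl _ i])
  show "line_dense (parab n i)"
    unfolding parab_def by (rule line_dense_units) (auto simp: seg_entry)
qed (rule block_mat_parab[OF i])

lemma block_group_PK: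
  assumes i: "i + 2 < n"
  shows "block_group n (PK n i) (\<lambda>g. g $$ (i, i)) (\<lambda>g. g $$ (i, Suc i)) (\<lambda>g. g $$ (Suc i, i)) (\<lambda>g. g $$ (Suc i, Suc i))"
proof (rule block_group_standard[OF PK_subgroup[OF i]])
  show "i + 1 < n" "PK n i \<subseteq> parab n i" using i by (auto simp: PK_def)
  have "PK n i = {g \<in> carrier (GL n). (\<forall>k l. l < k \<longrightarrow> k < n \<longrightarrow> (k, l) \<noteq> (Suc i, i) \<longrightarrow> g $$ (k, l) = 0) \<and> lastcol n g}"
    by (auto simp: PK_def parab_def)
  moreover have "line_dense \<dots>"
    by (rule line_dense_units) (use i in \<open>auto simp: seg_entry lastcol_def\<close>)
  ultimately show "line_dense (PK n i)" by simp
  show "block_mat n i \<alpha> \<beta> \<gamma> \<delta> \<in> PK n i" if "\<alpha> * \<delta> - \<beta> * \<gamma> \<noteq> 0" for \<alpha> \<beta> \<gamma> \<delta>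
    using block_mat_parab[OF _ that, of i n] i by (auto simp: PK_def lastcol_def block_mat_def)
qed

lemma conj_pow:
  assumes v: "v \<in> carrier (GL n)" and X: "X \<in> carrier_mat n n"
  shows "(v * X * minv n v) ^\<^sub>m k = v * X ^\<^sub>m k * minv n v"
proof (induction k)
  case 0
  then show ?case using GL_D[OF v] GL_inv[OF v] X by simp
next
  case (Suc k)
  have Xk: "X ^\<^sub>m k \<in> carrier_mat n n" using X by simp
  show ?case
    using Suc GL_D[OF v] GL_D[OF GL_inv(1)[OF v]] X Xk
    by (simp add: mmult_assoc[of _ n] mmult_cancel(2)[OF v])
qed

lemma conj_by_eq: "conj_by n v H = {v * h * minv n v | h. h \<in> H}"
  by (auto simp: conj_by_def)

lemma in_conj_by:
  assumes v: "v \<in> carrier (GL n)" and g: "g \<in> carrier_mat n n" and H: "H \<subseteq> carrier_mat n n"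
  shows "g \<in> conj_by n v H \<longleftrightarrow> minv n v * g * v \<in> H"
proof -
  note D = GL_D[OF v] GL_D[OF GL_inv(1)[OF v]]
  have 1: "minv n v * (v * h * minv n v) * v = h" if "h \<in> carrier_mat n n" for h
    using D that by (simp add: mmult_assoc[of _ n] mmult_cancel(2)[OF v] GL_inv(3)[OF v])
  have 2: "v * (minv n v * g * v) * minv n v = g"
    using D g by (simp add: mmult_assoc[of _ n] mmult_cancel(1)[OF v] GL_inv(2)[OF v])
  show ?thesis
  proof
    assume "g \<in> conj_by n v H"
    then show "minv n v * g * v \<in> H" using 1 H by (auto simp: conj_by_eq)
  next
    assume "minv n v * g * v \<in> H"
    then show "g \<in> conj_by n v H" unfolding conj_by_eq mem_Collect_eq using 2 by (intro exI[of _ "minv n v * g * v"]) simp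
  qed
qed

lemma conj_by_GL: "v \<in> carrier (GL n) \<Longrightarrow> H \<subseteq> carrier (GL n) \<Longrightarrow> conj_by n v H \<subseteq> carrier (GL n)"
  by (auto simp: conj_by_eq intro!: GL_mult GL_inv(1))

lemma conj_by_subgroup:
  assumes v: "v \<in> carrier (GL n)" and H: "subgroup H (GL n)"
  shows "subgroup (conj_by n v H) (GL n)"
proof (rule GLn.subgroupI)
  have HG: "H \<subseteq> carrier (GL n)" by (rule subgroup.subset[OF H])
  note D = GL_D[OF v] GL_D[OF GL_inv(1)[OF v]]
  show "conj_by n v H \<subseteq> carrier (GL n)" by (rule conj_by_GL[OF v HG])
  show "conj_by n v H \<noteq> {}" using subgroup.one_closed[OF H] by (auto simp: conj_by_def)
  fix g assume "g \<in> conj_by n v H"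
  then obtain x where x: "x \<in> H" "g = v * x * minv n v" by (auto simp: conj_by_eq)
  have xG: "x \<in> carrier (GL n)" using x(1) HG by blast
  have "minv n g = v * minv n x * minv n v"
    unfolding x(2) using xG v D GL_D[OF xG] GL_D[OF GL_inv(1)[OF xG]]
    by (simp add: minv_mult GL_mult GL_inv(1) minv_minv mmult_assoc[of _ n])
  then show "minv n g \<in> conj_by n v H" using subgroup.m_inv_closed[OF H x(1)] by (auto simp: conj_by_eq)
  fix h assume "h \<in> conj_by n v H"
  then obtain y where y: "y \<in> H" "h = v * y * minv n v" by (auto simp: conj_by_eq)
  have yG: "y \<in> carrier (GL n)" using y(1) HG by blast
  have "g * h = v * (x * y) * minv n v"
    unfolding x(2) y(2) using D GL_D[OF xG] GL_D[OF yG] by (simp add: mmult_assoc[of _ n] mmult_cancel(2)[OF v])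
  moreover have "x * y \<in> H" using subgroup.m_closed[OF H x(1) y(1)] by simp
  ultimately show "g \<otimes>\<^bsub>GL n\<^esub> h \<in> conj_by n v H" by (auto simp: conj_by_eq)
qed

text \<open>Conjugate subgroups inherit the structure; this is needed for \<open>v P\<^sub>\<alpha> v\<^sup>-\<^sup>1\<close>.\<close>

lemma block_group_conj:
  assumes B: "block_group n P a b c d" and v: "v \<in> carrier (GL n)"
  defines "f \<equiv> \<lambda>g. minv n v * g * v"
  shows "block_group n (conj_by n v P) (\<lambda>g. a (f g)) (\<lambda>g. b (f g)) (\<lambda>g. c (f g)) (\<lambda>g. d (f g))"
    and "block_group.V0 (conj_by n v P) (\<lambda>g. a (f g)) (\<lambda>g. b (f g)) (\<lambda>g. c (f g)) (\<lambda>g. d (f g)) =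
      conj_by n v (block_group.V0 P a b c d)"
proof -
  interpret block_group n P a b c d by (rule B)
  note D = GL_D[OF v] GL_D[OF GL_inv(1)[OF v]]
  have f1: "f (v * h * minv n v) = h" if "h \<in> carrier_mat n n" for h
    unfolding f_def using D that by (simp add: mmult_assoc[of _ n] mmult_cancel(2)[OF v] GL_inv(3)[OF v])
  have fm: "f (g * h) = f g * f h" if "g \<in> carrier_mat n n" "h \<in> carrier_mat n n" for g h
    unfolding f_def using D that by (simp add: mmult_assoc[of _ n] mmult_cancel(1)[OF v])
  have cG: "conj_by n v P \<subseteq> carrier (GL n)" by (rule conj_by_GL[OF v]) (use P_GL in blast)
  have cD: "g \<in> carrier_mat n n" if "g \<in> conj_by n v P" for g using cG that GL_D by blast
  have fP: "f g \<in> P" if "g \<in> conj_by n v P" for g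
    using that f1 P_D by (auto simp: conj_by_eq)
  have fc: "f g \<in> carrier_mat n n" if "g \<in> carrier_mat n n" for g unfolding f_def using D that by simp
  have fs: "f (seg A B t) = seg (f A) (f B) t" if "A \<in> carrier_mat n n" "B \<in> carrier_mat n n" for A B t
    unfolding f_def using seg_mult[OF that D(2,1)] .
  have conjP: "v * h * minv n v \<in> conj_by n v P" if "h \<in> P" for h using that by (auto simp: conj_by_eq)
  have pow0: "(v * X * minv n v - 1\<^sub>m n) ^\<^sub>m n = v * (X - 1\<^sub>m n) ^\<^sub>m n * minv n v" if "X \<in> carrier_mat n n" for X
  proof -
    have "v * X * minv n v - 1\<^sub>m n = v * (X - 1\<^sub>m n) * minv n v"
    proof -
      have "v * (X - 1\<^sub>m n) = v * X - v" using mult_minus_distrib_mat[OF D(1) that, of "1\<^sub>m n"] D by simp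
      then have "v * (X - 1\<^sub>m n) * minv n v = v * X * minv n v - v * minv n v"
        using minus_mult_distrib_mat[of "v * X" n n v "minv n v" n] D that by simp
      then show ?thesis using GL_inv(2)[OF v] by simp
    qed
    then show ?thesis using conj_pow[OF v minus_carrier_mat[OF one_carrier_mat], of X n] by simp
  qed
  show "block_group n (conj_by n v P) (\<lambda>g. a (f g)) (\<lambda>g. b (f g)) (\<lambda>g. c (f g)) (\<lambda>g. d (f g))"
  proof (rule block_group.intro)
    show "subgroup (conj_by n v P) (GL n)" by (rule conj_by_subgroup[OF v P_subgroup])
    show "regular n (\<lambda>g. a (f g))" "regular n (\<lambda>g. b (f g))" "regular n (\<lambda>g. c (f g))" "regular n (\<lambda>g. d (f g))"
      unfolding f_def by (rule regular_translate[OF _ D(2,1)], rule regs)+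
    show "a (f (seg A B t)) = (1 - t) * a (f A) + t * a (f B) \<and> b (f (seg A B t)) = (1 - t) * b (f A) + t * b (f B) \<and>
        c (f (seg A B t)) = (1 - t) * c (f A) + t * c (f B) \<and> d (f (seg A B t)) = (1 - t) * d (f A) + t * d (f B)"
      if "A \<in> carrier_mat n n" "B \<in> carrier_mat n n" for A B t
      unfolding fs[OF that] by (rule lin[OF fc[OF that(1)] fc[OF that(2)]])
    show "a (f (g * h)) = a (f g) * a (f h) + b (f g) * c (f h) \<and> b (f (g * h)) = a (f g) * b (f h) + b (f g) * d (f h) \<and>
        c (f (g * h)) = c (f g) * a (f h) + d (f g) * c (f h) \<and> d (f (g * h)) = c (f g) * b (f h) + d (f g) * d (f h)"
      if "g \<in> conj_by n v P" "h \<in> conj_by n v P" for g h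
      unfolding fm[OF cD[OF that(1)] cD[OF that(2)]] by (rule block_mult[OF fP[OF that(1)] fP[OF that(2)]])
    have "f (1\<^sub>m n) = 1\<^sub>m n" unfolding f_def using D GL_inv(3)[OF v] by simp
    then show "a (f (1\<^sub>m n)) = 1 \<and> b (f (1\<^sub>m n)) = 0 \<and> c (f (1\<^sub>m n)) = 0 \<and> d (f (1\<^sub>m n)) = 1"
      using block_one by simp
    show "line_dense (conj_by n v P)"
      unfolding line_dense_def
    proof (intro ballI)
      fix A B assume AB: "A \<in> conj_by n v P" "B \<in> conj_by n v P"
      have "{t. seg A B t \<notin> conj_by n v P} \<subseteq> {t. seg (f A) (f B) t \<notin> P}"
        using in_conj_by[OF v seg_carrier[OF cD[OF AB(1)] cD[OF AB(2)]] P_subset] fs[OF cD[OF AB(1)] cD[OF AB(2)]]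
        unfolding f_def by auto
      then show "finite {t. seg A B t \<notin> conj_by n v P}"
        using P_dense fP[OF AB(1)] fP[OF AB(2)] unfolding line_dense_def by (auto intro: finite_subset)
    qed
    show "\<exists>g\<in>conj_by n v P. a (f g) = \<alpha> \<and> b (f g) = \<beta> \<and> c (f g) = \<gamma> \<and> d (f g) = \<delta>"
      if nz: "\<alpha> * \<delta> - \<beta> * \<gamma> \<noteq> 0" for \<alpha> \<beta> \<gamma> \<delta>
    proof -
      obtain g where "g \<in> P" "a g = \<alpha> \<and> b g = \<beta> \<and> c g = \<gamma> \<and> d g = \<delta>" using block_onto[OF nz] by blast
      then show ?thesis using conjP f1[OF P_D] by (intro bexI[of _ "v * g * minv n v"]) simp_all
    qed
    show "\<exists>g\<in>conj_by n v P. a (f g) = 1 + \<alpha> \<and> b (f g) = \<beta> \<and> c (f g) = \<gamma> \<and> d (f g) = 1 - \<alpha> \<and>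
        (g - 1\<^sub>m n) ^\<^sub>m n = 0\<^sub>m n n" if nz: "\<alpha> * \<alpha> + \<beta> * \<gamma> = 0" for \<alpha> \<beta> \<gamma>
    proof -
      obtain g where "g \<in> P" "a g = 1 + \<alpha> \<and> b g = \<beta> \<and> c g = \<gamma> \<and> d g = 1 - \<alpha> \<and> (g - 1\<^sub>m n) ^\<^sub>m n = 0\<^sub>m n n"
        using unipotent_lift[OF nz] by blast
      then show ?thesis using conjP f1[OF P_D] pow0[OF P_D] D by (intro bexI[of _ "v * g * minv n v"]) simp_all
    qed
    show "a (f g) + d (f g) = 2 \<and> a (f g) * d (f g) - b (f g) * c (f g) = 1"
      if g: "g \<in> conj_by n v P" "(g - 1\<^sub>m n) ^\<^sub>m n = 0\<^sub>m n n" for g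
    proof (rule unipotent_block[OF fP[OF g(1)]])
      obtain h where h: "h \<in> P" "g = v * h * minv n v" using g(1) by (auto simp: conj_by_eq)
      have hp: "(h - 1\<^sub>m n) ^\<^sub>m n \<in> carrier_mat n n"
        by (intro pow_carrier_mat minus_carrier_mat one_carrier_mat)
      have "v * (h - 1\<^sub>m n) ^\<^sub>m n * minv n v = 0\<^sub>m n n" using g(2) pow0[OF P_D[OF h(1)]] h(2) by simp
      then have "f (0\<^sub>m n n) = (h - 1\<^sub>m n) ^\<^sub>m n" using f1[OF hp] by simp
      moreover have "f (0\<^sub>m n n) = 0\<^sub>m n n" unfolding f_def using D by simp
      ultimately show "(f g - 1\<^sub>m n) ^\<^sub>m n = 0\<^sub>m n n" using f1[OF P_D[OF h(1)]] h(2) by simp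
    qed
  qed
  then show "block_group.V0 (conj_by n v P) (\<lambda>g. a (f g)) (\<lambda>g. b (f g)) (\<lambda>g. c (f g)) (\<lambda>g. d (f g)) =
      conj_by n v V0"
    using f1[OF P_D] by (auto simp: block_group.V0_def V0_def conj_by_eq) 
qed

section \<open>Types of roots in terms of two lines\<close>

lemma radical_parab:
  assumes i: "i + 1 < n"
  shows "radical_in_GL n (parab n i) = block_group.V0 (parab n i)
    (\<lambda>g. g $$ (i, i)) (\<lambda>g. g $$ (i, Suc i)) (\<lambda>g. g $$ (Suc i, i)) (\<lambda>g. g $$ (Suc i, Suc i))"
proof -
  interpret block_group n "parab n i" "\<lambda>g. g $$ (i, i)" "\<lambda>g. g $$ (i, Suc i)" "\<lambda>g. g $$ (Suc i, i)"
    "\<lambda>g. g $$ (Suc i, Suc i)" by (rule block_group_parab[OF i])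
  show ?thesis unfolding radical_in_GL_def
    by (rule solvable_radical_V0) (use i in \<open>auto simp: V0_def UT_iff_parab\<close>)
qed

lemma radical_PK:
  assumes i: "i + 2 < n"
  shows "radical_in_GL n (PK n i) = block_group.V0 (PK n i)
    (\<lambda>g. g $$ (i, i)) (\<lambda>g. g $$ (i, Suc i)) (\<lambda>g. g $$ (Suc i, i)) (\<lambda>g. g $$ (Suc i, Suc i))"
proof -
  interpret block_group n "PK n i" "\<lambda>g. g $$ (i, i)" "\<lambda>g. g $$ (i, Suc i)" "\<lambda>g. g $$ (Suc i, i)"
    "\<lambda>g. g $$ (Suc i, Suc i)" by (rule block_group_PK[OF i])
  have i1: "i + 1 < n" using i by simp
  show ?thesis unfolding radical_in_GL_def
    by (rule solvable_radical_V0) (auto simp: V0_def UT_iff_parab[OF i1] PK_parab)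
qed

context block_group
begin

text \<open>A class fixes the base point if and only if it lies in the stabilizer of the base point, as in any
  homogeneous space.\<close>

lemma fixes_Bp:
  assumes A: "A \<subseteq> P"
  shows "(\<forall>x \<in> cl ` A. x <#>\<^bsub>GL n\<^esub> {g \<in> P. c g = 0} = {g \<in> P. c g = 0}) \<longleftrightarrow> A \<subseteq> {g \<in> P. c g = 0}"
proof
  let ?B = "{g \<in> P. c g = 0}"
  assume *: "\<forall>x \<in> cl ` A. x <#>\<^bsub>GL n\<^esub> ?B = ?B"
  show "A \<subseteq> ?B"
  proof
    fix g assume g: "g \<in> A"
    then have gP: "g \<in> P" using A by blast
    have "1\<^sub>m n \<in> V0" "1\<^sub>m n \<in> ?B" using P_one block_one by (simp_all add: V0_def)
    then have "(1\<^sub>m n * g) * 1\<^sub>m n \<in> cl g <#>\<^bsub>GL n\<^esub> ?B"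
      unfolding set_mult_def in_cl using in_cl[of "1\<^sub>m n * g" g] by (auto simp del: mmult_one)
    moreover have "(1\<^sub>m n * g) * 1\<^sub>m n = g" using P_D[OF gP] by simp
    ultimately show "g \<in> ?B" using * g by simp
  qed
next
  let ?B = "{g \<in> P. c g = 0}"
  assume AB: "A \<subseteq> ?B"
  show "\<forall>x \<in> cl ` A. x <#>\<^bsub>GL n\<^esub> ?B = ?B"
  proof
    fix x assume "x \<in> cl ` A"
    then obtain g where g: "g \<in> A" "x = cl g" by blast
    have gB: "g \<in> P" "c g = 0" using g(1) AB by auto
    show "x <#>\<^bsub>GL n\<^esub> ?B = ?B"
    proof (rule subset_antisym; rule subsetI)
      fix y assume "y \<in> x <#>\<^bsub>GL n\<^esub> ?B"
      then obtain z h where y: "z \<in> V0" "h \<in> P" "c h = 0" "y = z * g * h"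
        unfolding set_mult_def g(2) using in_cl by auto
      have zP: "z \<in> P" "c z = 0" using y(1) by (simp_all add: V0_def)
      show "y \<in> ?B" unfolding y(4) mem_Collect_eq
        using zP gB y by (simp add: P_mult bmult)
    next
      fix y assume y: "y \<in> ?B"
      have gi: "minv n g \<in> P" "c (minv n g) = 0"
        using P_inv[OF gB(1)] Bp_inv[of g] gB by simp_all
      have "minv n g * y \<in> ?B" using gi y by (simp add: P_mult bmult)
      moreover have "1\<^sub>m n * g \<in> cl g" unfolding in_cl using P_one block_one by (auto simp: V0_def)
      moreover have "(1\<^sub>m n * g) * (minv n g * y) = y"
        using y gB mmult_cancel(1)[OF P_GL[OF gB(1)] P_D] P_D[OF gB(1)] by simp
      ultimately show "y \<in> x <#>\<^bsub>GL n\<^esub> ?B" unfolding set_mult_def g(2) UN_iff singleton_iff mult_GL by metis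
    qed
  qed
qed

end

text \<open>The base point is the first coordinate line, so \<open>p2 = 0\<close> and \<open>q2 = 0\<close> say that \<open>p\<close> and \<open>q\<close> are the base
  point. The dichotomy between equal and different lines gives the types.\<close>

lemma types_from_lines:
  assumes B: "block_group n (type_P n \<alpha> v) a b c d"
    and V: "type_V n \<alpha> v = block_group.V0 (type_P n \<alpha> v) a b c d"
    and C: "base_point n \<alpha> v = {g \<in> type_P n \<alpha> v. c g = 0}"
    and A: "subgroup (type_A n \<alpha> v) (GL n)" "type_A n \<alpha> v \<subseteq> type_P n \<alpha> v"
    and p: "p1 \<noteq> 0 \<or> p2 \<noteq> 0" and q: "q1 \<noteq> 0 \<or> q2 \<noteq> 0"
    and fixp: "\<And>g. g \<in> type_A n \<alpha> v \<Longrightarrow> (a g * p1 + b g * p2) * p2 = (c g * p1 + d g * p2) * p1"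
    and fixq: "\<And>g. g \<in> type_A n \<alpha> v \<Longrightarrow> (a g * q1 + b g * q2) * q2 = (c g * q1 + d g * q2) * q1"
    and elt: "\<And>t. 1 + t * (p2 * q1 - p1 * q2) \<noteq> 0 \<Longrightarrow> \<exists>g \<in> type_A n \<alpha> v.
      a g = 1 - t * p1 * q2 \<and> b g = t * p1 * q1 \<and> c g = - t * p2 * q2 \<and> d g = 1 + t * p2 * q1"
  shows "type_at n \<alpha> v Complex_Stable \<longleftrightarrow> p2 = 0 \<and> q2 = 0"
    and "type_at n \<alpha> v Noncompact \<longleftrightarrow> p2 = 0 \<and> q2 \<noteq> 0 \<or> p2 \<noteq> 0 \<and> q2 = 0"
    and "type_at n \<alpha> v Real \<or> type_at n \<alpha> v Complex_Unstable \<longleftrightarrow> p2 \<noteq> 0 \<and> q2 \<noteq> 0"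
proof -
  interpret block_group n "type_P n \<alpha> v" a b c d by (rule B)
  define A where "A = type_A n \<alpha> v"
  have S: "S_grp n \<alpha> v = Q" "S_top n \<alpha> v = QT" "S_unip n \<alpha> v = QU"
    unfolding S_grp_def S_top_def S_unip_def V by simp_all
  have M: "M_set n \<alpha> v = cl ` A" unfolding M_set_def V A_def cl_def ..
  have AP: "A \<subseteq> type_P n \<alpha> v" using assms(5) by (simp add: A_def)
  have Asub: "subgroup A PG"
    using assms(4) AP unfolding A_def by (rule group.subgroup_incl[OF GLn.is_group _ P_subgroup])
  have fb: "fixes_base_point n \<alpha> v \<longleftrightarrow> A \<subseteq> {g \<in> type_P n \<alpha> v. c g = 0}"
    unfolding fixes_base_point_def M C by (rule fixes_Bp[OF AP])
  have ca: "complex_at n \<alpha> v \<longleftrightarrow> solvable (Q\<lparr>carrier := cl ` A\<rparr>) \<and>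
     (\<exists>C R. is_Borel_subgroup Q QT C \<and>
        is_unipotent_radical (Q\<lparr>carrier := C\<rparr>) (subtopology QT C) QU R \<and> R \<subseteq> cl ` A)"
    unfolding complex_at_def M S ..
  have ra: "one_dim_reductive_at n \<alpha> v \<longleftrightarrow> krull_dimension (subtopology QT (cl ` A)) = 1 \<and>
     is_reductive (Q\<lparr>carrier := cl ` A\<rparr>) (subtopology QT (cl ` A)) QU"
    unfolding one_dim_reductive_at_def M S ..
  note fixp' = fixp[folded A_def] and fixq' = fixq[folded A_def] and elt' = elt[folded A_def]
  have "(type_at n \<alpha> v Complex_Stable \<longleftrightarrow> p2 = 0 \<and> q2 = 0) \<and>
     (type_at n \<alpha> v Noncompact \<longleftrightarrow> p2 = 0 \<and> q2 \<noteq> 0 \<or> p2 \<noteq> 0 \<and> q2 = 0) \<and>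
     (type_at n \<alpha> v Real \<or> type_at n \<alpha> v Complex_Unstable \<longleftrightarrow> p2 \<noteq> 0 \<and> q2 \<noteq> 0)"
  proof (cases "p1 * q2 = p2 * q1")
    case True
    have elt0: "\<exists>g \<in> A. a g = 1 - t * p1 * q2 \<and> b g = t * p1 * q1 \<and> c g = - t * p2 * q2 \<and> d g = 1 + t * p2 * q1" for t
      by (rule elt') (simp add: True)
    note E = dichotomy_equal[OF Asub p q True fixp' elt0]
    have "complex_at n \<alpha> v" "\<not> one_dim_reductive_at n \<alpha> v" "fixes_base_point n \<alpha> v \<longleftrightarrow> p2 = 0"
      unfolding ca ra fb using E by blast+
    moreover have "p2 = 0 \<longleftrightarrow> q2 = 0" using True p q by auto
    ultimately show ?thesis by simp
  next
    case False
    note E = dichotomy_different[OF Asub False fixp' fixq' elt']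
    have "\<not> complex_at n \<alpha> v" "one_dim_reductive_at n \<alpha> v" "fixes_base_point n \<alpha> v \<longleftrightarrow> p2 = 0 \<or> q2 = 0"
      unfolding ca ra fb using E by blast+
    moreover have "\<not> (p2 = 0 \<and> q2 = 0)" using False by auto
    ultimately show ?thesis by auto
  qed
  then show "type_at n \<alpha> v Complex_Stable \<longleftrightarrow> p2 = 0 \<and> q2 = 0"
    and "type_at n \<alpha> v Noncompact \<longleftrightarrow> p2 = 0 \<and> q2 \<noteq> 0 \<or> p2 \<noteq> 0 \<and> q2 = 0"
    and "type_at n \<alpha> v Real \<or> type_at n \<alpha> v Complex_Unstable \<longleftrightarrow> p2 \<noteq> 0 \<and> q2 \<noteq> 0" by blast+
qed

section \<open>Stability for the two components of a pair\<close>

abbreviation star :: "nat \<Rightarrow> (nat \<Rightarrow> nat) \<Rightarrow> nat \<Rightarrow> nat" where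
  "star n u \<equiv> sigma n \<circ> u \<circ> pinv (sigma n)"

lemma star_comp: "star n u \<circ> star n w = star n (u \<circ> w)"
  using permutes_inv_o(2)[OF sigma_permutes, of n] by (auto simp: fun_eq_iff)

text \<open>Conjugation by \<open>\<sigma>\<close> identifies the reflections in \<open>S\<^sup>*\<close> with those in \<open>S\<close>, and a root of
  \<open>\<kk>\<close> appears with its index shifted by one.\<close>

lemma refl_u_star:
  "refl_u n (GRoot i) (star n u) = star n (u \<circ> simple_refl i)"
  "i + 2 < n \<Longrightarrow> refl_u n (KRoot i) (star n u) = star n (simple_refl (Suc i) \<circ> u)"
  unfolding refl_u.simps star_comp[symmetric] by (simp_all only: star_refl_def star_refl_Suc[symmetric])

lemma stable_w_simps:
  assumes "w permutes {..<n}"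
  shows "i + 1 < n \<Longrightarrow> stable_w n (GRoot i) w \<longleftrightarrow> w i < w (Suc i)"
    and "i + 2 < n \<Longrightarrow> stable_w n (KRoot i) w \<longleftrightarrow> pinv w i < pinv w (Suc i)"
  using len_less_right[OF assms] len_less_left[OF assms] by (simp_all add: stable_w_def)

lemma stable_u_simps:
  assumes "u permutes {..<n}"
  shows "i + 1 < n \<Longrightarrow> stable_u n (GRoot i) (star n u) \<longleftrightarrow> u i < u (Suc i)"
    and "i + 2 < n \<Longrightarrow> stable_u n (KRoot i) (star n u) \<longleftrightarrow> pinv u (Suc i) < pinv u (Suc (Suc i))"
proof -
  show "stable_u n (GRoot i) (star n u) \<longleftrightarrow> u i < u (Suc i)" if i: "i + 1 < n"
    using len_less_right[OF assms i] i unfolding stable_u_def refl_u_star(1) by (simp only: len_star_conj)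
  show "stable_u n (KRoot i) (star n u) \<longleftrightarrow> pinv u (Suc i) < pinv u (Suc (Suc i))" if i: "i + 2 < n"
    using len_less_left[OF assms, of "Suc i"] i unfolding stable_u_def refl_u_star(2)[OF i]
    by (simp only: len_star_conj)
qed

lemma ascent_refl_right:
  assumes "w i < w (Suc i)"
  shows "(w \<circ> simple_refl i) i > (w \<circ> simple_refl i) (Suc i)"
  using assms by simp

lemma ascent_refl_left:
  assumes "w permutes {..<n}" "pinv w i < pinv w (Suc i)"
  shows "pinv (simple_refl i \<circ> w) i > pinv (simple_refl i \<circ> w) (Suc i)"
proof -
  have "pinv (simple_refl i \<circ> w) = pinv w \<circ> simple_refl i"
    using o_inv_distrib[OF bij_transpose permutes_bij[OF assms(1)], of i "Suc i"] by simp
  then show ?thesis using assms(2) by simp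
qed


section \<open>Types of the simple roots\<close>

lemma block_mat_PK:
  assumes i: "i + 2 < n" and d: "\<alpha> * \<delta> - \<beta> * \<gamma> \<noteq> 0"
  shows "block_mat n i \<alpha> \<beta> \<gamma> \<delta> \<in> PK n i"
  using block_mat_parab[OF _ d, of i n] i by (auto simp: PK_def lastcol_def block_mat_def)

lemma parab_with_column:
  assumes i: "i + 1 < n" and x: "x1 \<noteq> 0 \<or> x2 \<noteq> 0"
  obtains m where "m \<in> parab n i" "m $$ (i, i) = x1" "m $$ (Suc i, i) = x2"
proof -
  obtain r1 r2 where "x1 * r2 - r1 * x2 = 1" by (rule complete_basis[OF x])
  then have "block_mat n i x1 r1 x2 r2 \<in> parab n i" by (intro block_mat_parab[OF i]) simp
  then show thesis using block_mat_entries[OF i] by (intro that[of "block_mat n i x1 r1 x2 r2"])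
qed

lemma PK_with_row:
  assumes i: "i + 2 < n" and x: "x1 \<noteq> 0 \<or> x2 \<noteq> 0"
  obtains m where "m \<in> PK n i" "m $$ (Suc i, i) = x1" "m $$ (Suc i, Suc i) = x2"
proof -
  obtain r1 r2 where "x1 * r2 - r1 * x2 = 1" by (rule complete_basis[OF x])
  then have "block_mat n i (- r1) (- r2) x1 x2 \<in> PK n i" by (intro block_mat_PK[OF i]) (simp add: algebra_simps)
  moreover have i1: "i + 1 < n" using i by simp
  ultimately show thesis using block_mat_entries[OF i1] by (intro that[of "block_mat n i (- r1) (- r2) x1 x2"])
qed

text \<open>An element \<open>g\<close> of \<open>B\<^bsub>n-1\<^esub>\<close> preserves both permutations; if it lies in \<open>v P\<^sub>\<alpha> v\<^sup>-\<^sup>1\<close>, it acts on the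
  line \<open>v P\<^sub>\<alpha> / B\<close> and must fix the points \<open>p\<close> and \<open>q\<close>, where the permutations are exceptional. The base
  point corresponds to \<open>m = 1\<close>.\<close>

lemma types_GRoot:
  assumes n: "n \<ge> 2" and i: "i + 1 < n" and v: "v \<in> carrier (GL n)"
  defines "sw \<equiv> stable_w n (GRoot i) (pos n v)" and "su \<equiv> stable_u n (GRoot i) (star n (pos_star n v))"
  shows "type_at n (GRoot i) v Complex_Stable \<longleftrightarrow> sw \<and> su"
    and "type_at n (GRoot i) v Noncompact \<longleftrightarrow> sw \<and> \<not> su \<or> \<not> sw \<and> su"
    and "type_at n (GRoot i) v Real \<or> type_at n (GRoot i) v Complex_Unstable \<longleftrightarrow> \<not> sw \<and> \<not> su"
proof -
  obtain w u p1 p2 q1 q2 where w: "w permutes {..<n}" "w i < w (Suc i)" and u: "u permutes {..<n}" "u i < u (Suc i)"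
    and p: "p1 \<noteq> 0 \<or> p2 \<noteq> 0" and q: "q1 \<noteq> 0 \<or> q2 \<noteq> (0 :: complex)"
    and posw: "\<And>m. m \<in> parab n i \<Longrightarrow>
       pos n (v * m) = (if m $$ (i, i) * p2 = m $$ (Suc i, i) * p1 then w else w \<circ> simple_refl i)"
    and posu: "\<And>m. m \<in> parab n i \<Longrightarrow>
       pos n (minv n (sg n) * (v * m)) = (if m $$ (i, i) * q2 = m $$ (Suc i, i) * q1 then u else u \<circ> simple_refl i)"
    and elt: "\<And>t. 1 + t * (p2 * q1 - p1 * q2) \<noteq> 0 \<Longrightarrow> \<exists>m \<in> parab n i. v * m * minv n v \<in> UT n \<and>
       lastcol n (v * m * minv n v) \<and> m $$ (i, i) = 1 - t * p1 * q2 \<and> m $$ (i, Suc i) = t * p1 * q1 \<and>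
       m $$ (Suc i, i) = - t * p2 * q2 \<and> m $$ (Suc i, Suc i) = 1 + t * p2 * q1"
    by (rule line_in_flag_direction[OF i v]) blast
  have i': "Suc i < n" and n1: "n \<ge> 1" using i n by simp_all
  have one: "1\<^sub>m n \<in> parab n i" using UT_one UT_parab by blast
  have ws: "w \<circ> simple_refl i \<noteq> w" and us: "u \<circ> simple_refl i \<noteq> u"
    using ascent_refl_right[OF w(2)] ascent_refl_right[OF u(2)] w(2) u(2) by (metis less_asym')+
  have sw: "sw \<longleftrightarrow> p2 = 0"
    using posw[OF one] stable_w_simps(1)[OF pos_permutes[OF v] i] ascent_refl_right[OF w(2)] w(2) i GL_D[OF v]
    unfolding sw_def by (simp split: if_splits)
  have v': "minv n (sg n) * v \<in> carrier (GL n)" by (intro GL_mult GL_inv(1) sg_GL v)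
  have su: "su \<longleftrightarrow> q2 = 0"
    using posu[OF one] stable_u_simps(1)[OF pos_permutes[OF v'] i] ascent_refl_right[OF u(2)] u(2) i GL_D[OF v]
    unfolding su_def by (simp split: if_splits)
  define f where "f = (\<lambda>g. minv n v * g * v)"
  have tP: "type_P n (GRoot i) v = conj_by n v (parab n i)" by (simp add: P_G_parab[OF i])
  have tV: "type_V n (GRoot i) v = conj_by n v (radical_in_GL n (parab n i))" by (simp add: P_G_parab[OF i])
  have tA: "type_A n (GRoot i) v = BK n \<inter> conj_by n v (parab n i)" by (simp add: P_G_parab[OF i] B_K_BK[OF n])
  have tC: "base_point n (GRoot i) v = conj_by n v (UT n)" by (simp add: B_plus_UT)
  have cin: "g \<in> conj_by n v (parab n i) \<longleftrightarrow> f g \<in> parab n i" if "g \<in> carrier_mat n n" for g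
    unfolding f_def by (rule in_conj_by[OF v that]) (use parab_D in blast)
  have cinU: "g \<in> conj_by n v (UT n) \<longleftrightarrow> f g \<in> UT n" if "g \<in> carrier_mat n n" for g
    unfolding f_def by (rule in_conj_by[OF v that]) (use UT_D in blast)
  have cD: "g \<in> carrier_mat n n" if "g \<in> conj_by n v (parab n i)" for g
    using conj_by_GL[OF v, of "parab n i"] that GL_D parab_GL by blast
  have cDU: "g \<in> carrier_mat n n" if "g \<in> conj_by n v (UT n)" for g
    using conj_by_GL[OF v, of "UT n"] that GL_D UT_GL by blast
  have f2: "f (v * h * minv n v) = h" if "h \<in> carrier_mat n n" for h
    unfolding f_def using GL_D[OF v] GL_D[OF GL_inv(1)[OF v]] that
    by (simp add: mmult_assoc[of _ n] mmult_cancel(2)[OF v] GL_inv(3)[OF v])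
  have fm: "v * (f g * m) = g * (v * m)" if "g \<in> carrier_mat n n" "m \<in> carrier_mat n n" for g m
    unfolding f_def using GL_D[OF v] GL_D[OF GL_inv(1)[OF v]] that
    by (simp add: mmult_assoc[of _ n] mmult_cancel(1)[OF v])
  note bg = block_group_conj[OF block_group_parab[OF i] v]
  have shift: "f g * m \<in> parab n i \<and> pos n (v * (f g * m)) = pos n (v * m) \<and>
      pos n (minv n (sg n) * (v * (f g * m))) = pos n (minv n (sg n) * (v * m)) \<and>
      (f g * m) $$ (i, i) = f g $$ (i, i) * m $$ (i, i) + f g $$ (i, Suc i) * m $$ (Suc i, i) \<and>
      (f g * m) $$ (Suc i, i) = f g $$ (Suc i, i) * m $$ (i, i) + f g $$ (Suc i, Suc i) * m $$ (Suc i, i)"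
    if g: "g \<in> type_A n (GRoot i) v" and m: "m \<in> parab n i" for g m
  proof -
    have gB: "g \<in> BK n" and gP: "g \<in> conj_by n v (parab n i)" using g unfolding tA by auto
    have gD: "g \<in> carrier_mat n n" by (rule cD[OF gP])
    have fP: "f g \<in> parab n i" using cin[OF gD] gP by simp
    have vm: "v * m \<in> carrier (GL n)" by (intro GL_mult v parab_GL[OF m])
    let ?T = "minv n (sg n)"
    have Tvm: "?T * (v * m) \<in> carrier (GL n)" by (intro GL_mult GL_inv(1) sg_GL vm)
    have "?T * (g * (v * m)) = (?T * g * sg n) * (?T * (v * m))"
      using gD GL_D[OF vm] GL_D[OF sg_GL(1)] GL_D[OF GL_inv(1)[OF sg_GL(1)]]
      by (simp add: mmult_assoc[of _ n] mmult_cancel(1)[OF sg_GL(1)])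
    then have "pos n (?T * (g * (v * m))) = pos n (?T * (v * m))"
      using pos_UT_mult(1)[OF Tvm BK_B_star[OF n1 gB]] by simp
    then show ?thesis
      using parab_mult[OF fP m] pos_UT_mult(1)[OF vm BK_UT[OF gB]] fm[OF gD parab_D[OF m]]
        parab_mult_entry[OF fP m i, of i i] parab_mult_entry[OF fP m i, of "Suc i" i] by simp
  qed
  have Asub: "subgroup (type_A n (GRoot i) v) (GL n)"
  proof -
    have "subgroup (BK n) (GL n)"
    proof (rule GLn.subgroupI)
      show "BK n \<noteq> {}" using BK_one[OF n1] by blast
    qed (auto simp: BK_GL BK_mult[OF n1] BK_inv[OF n1])
    then show ?thesis unfolding tA
      by (rule GLn.subgroups_Inter_pair[OF _ conj_by_subgroup[OF v parab_subgroup[OF i]]])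
  qed
  have t1: "block_group n (type_P n (GRoot i) v) (\<lambda>g. f g $$ (i, i)) (\<lambda>g. f g $$ (i, Suc i))
      (\<lambda>g. f g $$ (Suc i, i)) (\<lambda>g. f g $$ (Suc i, Suc i))" unfolding tP f_def by (rule bg(1))
  have t2: "type_V n (GRoot i) v = block_group.V0 (type_P n (GRoot i) v) (\<lambda>g. f g $$ (i, i)) (\<lambda>g. f g $$ (i, Suc i))
      (\<lambda>g. f g $$ (Suc i, i)) (\<lambda>g. f g $$ (Suc i, Suc i))"
    unfolding tP tV f_def bg(2) radical_parab[OF i] ..
  have t3: "base_point n (GRoot i) v = {g \<in> type_P n (GRoot i) v. f g $$ (Suc i, i) = 0}"
    unfolding tP tC using cin cinU cD cDU UT_iff_parab[OF i] by blast
  have t4: "type_A n (GRoot i) v \<subseteq> type_P n (GRoot i) v" unfolding tA tP by blast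
  have fixpq: "(f g $$ (i, i) * p1 + f g $$ (i, Suc i) * p2) * p2 = (f g $$ (Suc i, i) * p1 + f g $$ (Suc i, Suc i) * p2) * p1"
    "(f g $$ (i, i) * q1 + f g $$ (i, Suc i) * q2) * q2 = (f g $$ (Suc i, i) * q1 + f g $$ (Suc i, Suc i) * q2) * q1"
    if g: "g \<in> type_A n (GRoot i) v" for g
  proof -
    obtain m where m: "m \<in> parab n i" "m $$ (i, i) = p1" "m $$ (Suc i, i) = p2" by (rule parab_with_column[OF i p])
    have e1: "(f g $$ (i, i) * p1 + f g $$ (i, Suc i) * p2) * p2 = (f g $$ (Suc i, i) * p1 + f g $$ (Suc i, Suc i) * p2) * p1"
      using shift[OF g m(1)] posw[of "f g * m"] posw[OF m(1)] m(2,3) ws by (simp split: if_splits del: index_mult_mat)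
    obtain m' where m': "m' \<in> parab n i" "m' $$ (i, i) = q1" "m' $$ (Suc i, i) = q2" by (rule parab_with_column[OF i q])
    have e2: "(f g $$ (i, i) * q1 + f g $$ (i, Suc i) * q2) * q2 = (f g $$ (Suc i, i) * q1 + f g $$ (Suc i, Suc i) * q2) * q1"
      using shift[OF g m'(1)] posu[of "f g * m'"] posu[OF m'(1)] m'(2,3) us by (simp split: if_splits del: index_mult_mat)
    show "(f g $$ (i, i) * p1 + f g $$ (i, Suc i) * p2) * p2 = (f g $$ (Suc i, i) * p1 + f g $$ (Suc i, Suc i) * p2) * p1"
      "(f g $$ (i, i) * q1 + f g $$ (i, Suc i) * q2) * q2 = (f g $$ (Suc i, i) * q1 + f g $$ (Suc i, Suc i) * q2) * q1" by fact+
  qed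
  have elts: "\<exists>g \<in> type_A n (GRoot i) v. f g $$ (i, i) = 1 - t * p1 * q2 \<and> f g $$ (i, Suc i) = t * p1 * q1 \<and>
    f g $$ (Suc i, i) = - t * p2 * q2 \<and> f g $$ (Suc i, Suc i) = 1 + t * p2 * q1"
    if t: "1 + t * (p2 * q1 - p1 * q2) \<noteq> 0" for t
  proof -
    obtain m where m: "m \<in> parab n i" "v * m * minv n v \<in> UT n" "lastcol n (v * m * minv n v)"
      "m $$ (i, i) = 1 - t * p1 * q2" "m $$ (i, Suc i) = t * p1 * q1"
      "m $$ (Suc i, i) = - t * p2 * q2" "m $$ (Suc i, Suc i) = 1 + t * p2 * q1" using elt[OF t] by blast
    have "v * m * minv n v \<in> type_A n (GRoot i) v"
      unfolding tA using m(1-3) by (auto simp: BK_def conj_by_eq)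
    then show "\<exists>g \<in> type_A n (GRoot i) v. f g $$ (i, i) = 1 - t * p1 * q2 \<and> f g $$ (i, Suc i) = t * p1 * q1 \<and>
      f g $$ (Suc i, i) = - t * p2 * q2 \<and> f g $$ (Suc i, Suc i) = 1 + t * p2 * q1"
      using m(4-) f2[OF parab_D[OF m(1)]] by (intro bexI[of _ "v * m * minv n v"]) simp_all
  qed
  note T = types_from_lines[OF t1 t2 t3 Asub t4 p q fixpq elts]
  show "type_at n (GRoot i) v Complex_Stable \<longleftrightarrow> sw \<and> su" unfolding sw su by (rule T(1))
  show "type_at n (GRoot i) v Noncompact \<longleftrightarrow> sw \<and> \<not> su \<or> \<not> sw \<and> su" unfolding sw su by (rule T(2))
  show "type_at n (GRoot i) v Real \<or> type_at n (GRoot i) v Complex_Unstable \<longleftrightarrow> \<not> sw \<and> \<not> su" unfolding sw su by (rule T(3))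
qed

text \<open>An element \<open>g\<close> of \<open>v B v\<^sup>-\<^sup>1\<close> fixes the flag of \<open>v\<close>, so \<open>m g v\<close> has the same permutations as \<open>m v\<close>. Hence
  \<open>g\<close> fixes \<open>p\<close> and \<open>q\<close>.\<close>

lemma types_KRoot:
  assumes i: "i + 2 < n" and v: "v \<in> carrier (GL n)"
  defines "sw \<equiv> stable_w n (KRoot i) (pos n v)" and "su \<equiv> stable_u n (KRoot i) (star n (pos_star n v))"
  shows "type_at n (KRoot i) v Complex_Stable \<longleftrightarrow> sw \<and> su"
    and "type_at n (KRoot i) v Noncompact \<longleftrightarrow> sw \<and> \<not> su \<or> \<not> sw \<and> su"
    and "type_at n (KRoot i) v Real \<or> type_at n (KRoot i) v Complex_Unstable \<longleftrightarrow> \<not> sw \<and> \<not> su"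
proof -
  obtain w u p1 p2 q1 q2 where w: "w permutes {..<n}" "pinv w i < pinv w (Suc i)"
    and u: "u permutes {..<n}" "pinv u (Suc i) < pinv u (Suc (Suc i))"
    and p: "p1 \<noteq> 0 \<or> p2 \<noteq> 0" and q: "q1 \<noteq> 0 \<or> q2 \<noteq> (0 :: complex)"
    and posw: "\<And>m. m \<in> parab n i \<Longrightarrow>
       pos n (m * v) = (if m $$ (Suc i, i) * p1 + m $$ (Suc i, Suc i) * p2 = 0 then w else simple_refl i \<circ> w)"
    and posu: "\<And>m. m \<in> parab n i \<Longrightarrow> lastcol n m \<Longrightarrow>
       pos n (minv n (sg n) * (m * v)) =
         (if m $$ (Suc i, i) * q1 + m $$ (Suc i, Suc i) * q2 = 0 then u else simple_refl (Suc i) \<circ> u)"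
    and elt: "\<And>t. 1 + t * (p2 * q1 - p1 * q2) \<noteq> 0 \<Longrightarrow> \<exists>m \<in> parab n i. minv n v * m * v \<in> UT n \<and>
       lastcol n m \<and> m $$ (i, i) = 1 - t * p1 * q2 \<and> m $$ (i, Suc i) = t * p1 * q1 \<and>
       m $$ (Suc i, i) = - t * p2 * q2 \<and> m $$ (Suc i, Suc i) = 1 + t * p2 * q1"
    by (rule line_in_reference_direction[OF i v]) blast
  have i1: "i + 1 < n" and i': "Suc i < n" "i < n" and n: "n \<ge> 2" and n1: "n \<ge> 1" using i by simp_all
  have one: "1\<^sub>m n \<in> parab n i" "lastcol n (1\<^sub>m n)" using UT_one UT_parab lastcol_one[OF n1] by blast+
  have ws: "simple_refl i \<circ> w \<noteq> w" and us: "simple_refl (Suc i) \<circ> u \<noteq> u"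
    using ascent_refl_left[OF w] ascent_refl_left[OF u] w(2) u(2) by auto
  have sw: "sw \<longleftrightarrow> p2 = 0"
    using posw[OF one(1)] stable_w_simps(2)[OF pos_permutes[OF v] i] ascent_refl_left[OF w] w(2) i' GL_D[OF v]
    unfolding sw_def by (simp split: if_splits)
  have v': "minv n (sg n) * v \<in> carrier (GL n)" by (intro GL_mult GL_inv(1) sg_GL v)
  have su: "su \<longleftrightarrow> q2 = 0"
    using posu[OF one] stable_u_simps(2)[OF pos_permutes[OF v'] i] ascent_refl_left[OF u] u(2) i' GL_D[OF v]
    unfolding su_def by (simp split: if_splits)
  have tP: "type_P n (KRoot i) v = PK n i" by (simp add: P_K_PK[OF i])
  have tV: "type_V n (KRoot i) v = radical_in_GL n (PK n i)" by (simp add: P_K_PK[OF i])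
  have tA: "type_A n (KRoot i) v = PK n i \<inter> conj_by n v (UT n)" by (simp add: P_K_PK[OF i] B_plus_UT)
  have tC: "base_point n (KRoot i) v = BK n" by (simp add: B_K_BK[OF n])
  have cinU: "g \<in> conj_by n v (UT n) \<longleftrightarrow> minv n v * g * v \<in> UT n" if "g \<in> carrier_mat n n" for g
    by (rule in_conj_by[OF v that]) (use UT_D in blast)
  have shift: "m * g \<in> parab n i \<and> lastcol n (m * g) \<and> pos n (m * g * v) = pos n (m * v) \<and>
      pos n (minv n (sg n) * (m * g * v)) = pos n (minv n (sg n) * (m * v)) \<and>
      (m * g) $$ (Suc i, i) = m $$ (Suc i, i) * g $$ (i, i) + m $$ (Suc i, Suc i) * g $$ (Suc i, i) \<and>
      (m * g) $$ (Suc i, Suc i) = m $$ (Suc i, i) * g $$ (i, Suc i) + m $$ (Suc i, Suc i) * g $$ (Suc i, Suc i)"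
    if g: "g \<in> type_A n (KRoot i) v" and m: "m \<in> PK n i" for g m
  proof -
    have gP: "g \<in> PK n i" and gU: "g \<in> conj_by n v (UT n)" using g unfolding tA by auto
    have gD: "g \<in> carrier_mat n n" by (rule parab_D[OF PK_parab[OF gP]])
    have mD: "m \<in> carrier_mat n n" by (rule parab_D[OF PK_parab[OF m]])
    define b where "b = minv n v * g * v"
    have b: "b \<in> UT n" using cinU[OF gD] gU by (simp add: b_def)
    have mv: "m * v \<in> carrier (GL n)" by (intro GL_mult v PK_GL[OF m])
    let ?T = "minv n (sg n)"
    have Tmv: "?T * (m * v) \<in> carrier (GL n)" by (intro GL_mult GL_inv(1) sg_GL mv)
    have e: "m * g * v = m * v * b"
      unfolding b_def using gD mD GL_D[OF v] GL_D[OF GL_inv(1)[OF v]]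
      by (simp add: mmult_assoc[of _ n] mmult_cancel(1)[OF v])
    then have "?T * (m * g * v) = ?T * (m * v) * b"
      using UT_D[OF b] GL_D[OF mv] GL_D[OF GL_inv(1)[OF sg_GL(1)]] by (simp add: mmult_assoc[of _ n])
    then have "pos n (m * g * v) = pos n (m * v)" "pos n (?T * (m * g * v)) = pos n (?T * (m * v))"
      using pos_UT_mult(2)[OF mv b] pos_UT_mult(2)[OF Tmv b] e by simp_all
    then show ?thesis
      using PK_mult[OF n1 m gP] parab_mult_entry[OF PK_parab[OF m] PK_parab[OF gP] i1, of "Suc i" i]
        parab_mult_entry[OF PK_parab[OF m] PK_parab[OF gP] i1, of "Suc i" "Suc i"] by (simp add: PK_def)
  qed
  have Asub: "subgroup (type_A n (KRoot i) v) (GL n)"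
  proof -
    have "subgroup (UT n) (GL n)"
    proof (rule GLn.subgroupI)
      show "UT n \<noteq> {}" using UT_one by blast
    qed (auto simp: UT_GL UT_mult UT_inv)
    then show ?thesis unfolding tA
      by (intro GLn.subgroups_Inter_pair conj_by_subgroup PK_subgroup i v)
  qed
  have t1: "block_group n (type_P n (KRoot i) v) (\<lambda>g. g $$ (i, i)) (\<lambda>g. g $$ (i, Suc i))
      (\<lambda>g. g $$ (Suc i, i)) (\<lambda>g. g $$ (Suc i, Suc i))" unfolding tP by (rule block_group_PK[OF i])
  have t2: "type_V n (KRoot i) v = block_group.V0 (type_P n (KRoot i) v) (\<lambda>g. g $$ (i, i)) (\<lambda>g. g $$ (i, Suc i))
      (\<lambda>g. g $$ (Suc i, i)) (\<lambda>g. g $$ (Suc i, Suc i))"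
    unfolding tP tV radical_PK[OF i] ..
  have t3: "base_point n (KRoot i) v = {g \<in> type_P n (KRoot i) v. g $$ (Suc i, i) = 0}"
    unfolding tP tC using BK_PK[OF i1] by blast
  have t4: "type_A n (KRoot i) v \<subseteq> type_P n (KRoot i) v" unfolding tA tP by blast
  have fixpq: "(g $$ (i, i) * p1 + g $$ (i, Suc i) * p2) * p2 = (g $$ (Suc i, i) * p1 + g $$ (Suc i, Suc i) * p2) * p1"
    "(g $$ (i, i) * q1 + g $$ (i, Suc i) * q2) * q2 = (g $$ (Suc i, i) * q1 + g $$ (Suc i, Suc i) * q2) * q1"
    if g: "g \<in> type_A n (KRoot i) v" for g
  proof -
    \<comment> \<open>a matrix whose second row annihilates \<open>p\<close> carries \<open>p\<close> to the base point\<close>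
    have p': "- p2 \<noteq> 0 \<or> p1 \<noteq> 0" and q': "- q2 \<noteq> 0 \<or> q1 \<noteq> 0" using p q by auto
    have fixed: "(a * x1 + b * x2) * x2 = (c * x1 + d * x2) * x1"
      if "(- x2 * a + x1 * c) * x1 + (- x2 * b + x1 * d) * x2 = 0" for a b c d x1 x2 :: complex
    proof -
      have "(c * x1 + d * x2) * x1 - (a * x1 + b * x2) * x2 = (- x2 * a + x1 * c) * x1 + (- x2 * b + x1 * d) * x2"
        by (simp add: algebra_simps)
      then show ?thesis using that by simp
    qed
    obtain m where m: "m \<in> PK n i" "m $$ (Suc i, i) = - p2" "m $$ (Suc i, Suc i) = p1" by (rule PK_with_row[OF i p'])
    have "(- p2 * g $$ (i, i) + p1 * g $$ (Suc i, i)) * p1 + (- p2 * g $$ (i, Suc i) + p1 * g $$ (Suc i, Suc i)) * p2 = 0"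
      using shift[OF g m(1)] posw[of "m * g"] posw[OF PK_parab[OF m(1)]] m(2,3) ws
      by (simp split: if_splits del: index_mult_mat)
    then have e1: "(g $$ (i, i) * p1 + g $$ (i, Suc i) * p2) * p2 = (g $$ (Suc i, i) * p1 + g $$ (Suc i, Suc i) * p2) * p1"
      by (rule fixed)
    obtain m' where m': "m' \<in> PK n i" "m' $$ (Suc i, i) = - q2" "m' $$ (Suc i, Suc i) = q1" by (rule PK_with_row[OF i q'])
    have "lastcol n m'" using m'(1) by (simp add: PK_def)
    then have "(- q2 * g $$ (i, i) + q1 * g $$ (Suc i, i)) * q1 + (- q2 * g $$ (i, Suc i) + q1 * g $$ (Suc i, Suc i)) * q2 = 0"
      using shift[OF g m'(1)] posu[of "m' * g"] posu[OF PK_parab[OF m'(1)]] m'(2,3) us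
      by (simp split: if_splits del: index_mult_mat)
    then have e2: "(g $$ (i, i) * q1 + g $$ (i, Suc i) * q2) * q2 = (g $$ (Suc i, i) * q1 + g $$ (Suc i, Suc i) * q2) * q1"
      by (rule fixed)
    show "(g $$ (i, i) * p1 + g $$ (i, Suc i) * p2) * p2 = (g $$ (Suc i, i) * p1 + g $$ (Suc i, Suc i) * p2) * p1"
      "(g $$ (i, i) * q1 + g $$ (i, Suc i) * q2) * q2 = (g $$ (Suc i, i) * q1 + g $$ (Suc i, Suc i) * q2) * q1" by fact+
  qed
  have elts: "\<exists>g \<in> type_A n (KRoot i) v. g $$ (i, i) = 1 - t * p1 * q2 \<and> g $$ (i, Suc i) = t * p1 * q1 \<and>
    g $$ (Suc i, i) = - t * p2 * q2 \<and> g $$ (Suc i, Suc i) = 1 + t * p2 * q1"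
    if t: "1 + t * (p2 * q1 - p1 * q2) \<noteq> 0" for t
  proof -
    obtain m where m: "m \<in> parab n i" "minv n v * m * v \<in> UT n" "lastcol n m"
      "m $$ (i, i) = 1 - t * p1 * q2" "m $$ (i, Suc i) = t * p1 * q1"
      "m $$ (Suc i, i) = - t * p2 * q2" "m $$ (Suc i, Suc i) = 1 + t * p2 * q1" using elt[OF t] by blast
    have "m \<in> type_A n (KRoot i) v"
      unfolding tA using m(1-3) cinU[OF parab_D[OF m(1)]] by (simp add: PK_def)
    then show "\<exists>g \<in> type_A n (KRoot i) v. g $$ (i, i) = 1 - t * p1 * q2 \<and> g $$ (i, Suc i) = t * p1 * q1 \<and>
      g $$ (Suc i, i) = - t * p2 * q2 \<and> g $$ (Suc i, Suc i) = 1 + t * p2 * q1"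
      using m(4-) by blast
  qed
  note T = types_from_lines[OF t1 t2 t3 Asub t4 p q fixpq elts]
  show "type_at n (KRoot i) v Complex_Stable \<longleftrightarrow> sw \<and> su" unfolding sw su by (rule T(1))
  show "type_at n (KRoot i) v Noncompact \<longleftrightarrow> sw \<and> \<not> su \<or> \<not> sw \<and> su" unfolding sw su by (rule T(2))
  show "type_at n (KRoot i) v Real \<or> type_at n (KRoot i) v Complex_Unstable \<longleftrightarrow> \<not> sw \<and> \<not> su" unfolding sw su by (rule T(3))
qed

section \<open>The open orbit of a sweep\<close>

text \<open>The maps \<open>1 + t y\<close> with \<open>y\<close> of image \<open>p\<close> and kernel \<open>q\<close> act transitively on the lines other than
  \<open>p\<close> and \<open>q\<close>. The invertibility of the solution is a Pluecker relation between \<open>p\<close>, \<open>q\<close>, \<open>x\<close> and \<open>y\<close>.\<close>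

lemma two_lines:
  fixes p1 :: complex
  assumes xp: "p1 * x2 \<noteq> p2 * x1" and xq: "q1 * x2 \<noteq> q2 * x1" and yp: "p1 * y2 \<noteq> p2 * y1" and yq: "q1 * y2 \<noteq> q2 * y1"
  obtains t where "1 + t * (p2 * q1 - p1 * q2) \<noteq> 0"
    "((1 - t * p1 * q2) * x1 + (t * p1 * q1) * x2) * y2 = ((- t * p2 * q2) * x1 + (1 + t * p2 * q1) * x2) * y1"
proof -
  define \<xi> \<eta> z where "\<xi> = q1 * x2 - q2 * x1" and "\<eta> = p1 * y2 - p2 * y1" and "z = x2 * y1 - x1 * y2"
  have nz: "\<xi> * \<eta> \<noteq> 0" using xq yp by (simp add: \<xi>_def \<eta>_def)
  define t where "t = z / (\<xi> * \<eta>)"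
  have t: "t * (\<xi> * \<eta>) = z" using nz by (simp add: t_def)
  have "(1 + t * (p2 * q1 - p1 * q2)) * (\<xi> * \<eta>) = \<xi> * \<eta> + t * (\<xi> * \<eta>) * (p2 * q1 - p1 * q2)"
    by (simp add: algebra_simps)
  also have "\<dots> = (q1 * y2 - q2 * y1) * (p1 * x2 - p2 * x1)"
    unfolding t by (simp add: \<xi>_def \<eta>_def z_def algebra_simps)
  also have "\<dots> \<noteq> 0" using xp yq by simp
  finally have "1 + t * (p2 * q1 - p1 * q2) \<noteq> 0" by auto
  moreover have "((1 - t * p1 * q2) * x1 + (t * p1 * q1) * x2) * y2 - ((- t * p2 * q2) * x1 + (1 + t * p2 * q1) * x2) * y1
      = t * (\<xi> * \<eta>) - z"
    by (simp add: \<xi>_def \<eta>_def z_def algebra_simps)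
  then have "((1 - t * p1 * q2) * x1 + (t * p1 * q1) * x2) * y2 = ((- t * p2 * q2) * x1 + (1 + t * p2 * q1) * x2) * y1"
    using t by simp
  ultimately show thesis by (rule that)
qed

lemma third_line:
  fixes p1 :: complex
  assumes p: "p1 \<noteq> 0 \<or> p2 \<noteq> 0" and q: "q1 \<noteq> 0 \<or> q2 \<noteq> 0"
  obtains x1 x2 where "p1 * x2 \<noteq> p2 * x1" "q1 * x2 \<noteq> q2 * x1"
proof -
  consider "p2 \<noteq> 0" "q2 \<noteq> 0" | "p1 \<noteq> 0" "q1 \<noteq> 0" | "p1 = 0" "q2 = 0" | "p2 = 0" "q1 = 0" using p q by blast
  then show thesis
  proof cases
    case 1
    then show ?thesis by (intro that[of 0 1]) simp_all
  next
    case 2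
    then show ?thesis by (intro that[of 1 0]) simp_all
  next
    case 3
    then show ?thesis using p q by (intro that[of 1 1]) simp_all
  next
    case 4
    then show ?thesis using p q by (intro that[of 1 1]) simp_all
  qed
qed

lemma line_dense_translate:
  assumes S: "line_dense S" "S \<subseteq> carrier_mat n n" and x: "x \<in> carrier_mat n n" "y \<in> carrier_mat n n"
  shows "line_dense ((\<lambda>m. x * m * y) ` S)"
  unfolding line_dense_def
proof (intro ballI)
  fix A' B' assume "A' \<in> (\<lambda>m. x * m * y) ` S" "B' \<in> (\<lambda>m. x * m * y) ` S"
  then obtain A B where A: "A \<in> S" "A' = x * A * y" and B: "B \<in> S" "B' = x * B * y" by blast
  have c: "A \<in> carrier_mat n n" "B \<in> carrier_mat n n" using A B S by auto
  have "{t. seg A' B' t \<notin> (\<lambda>m. x * m * y) ` S} \<subseteq> {t. seg A B t \<notin> S}"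
    unfolding A(2) B(2) seg_mult[OF c x, symmetric] by blast
  then show "finite {t. seg A' B' t \<notin> (\<lambda>m. x * m * y) ` S}"
    using S(1) A(1) B(1) unfolding line_dense_def by (auto intro: finite_subset)
qed

lemma orb_pos:
  assumes n: "n \<ge> 1" and v: "v \<in> carrier (GL n)" and g: "g \<in> carrier (GL n)" and eq: "orb n g = orb n v"
  shows "pos n g = pos n v" "pos_star n g = pos_star n v"
proof -
  obtain k b where k: "k \<in> BK n" and b: "b \<in> UT n" and gk: "g = k * v * b"
    using in_orb(1)[OF n v g] orb_self[OF n g] eq by auto
  have kv: "k * v \<in> carrier (GL n)" by (intro GL_mult BK_GL[OF k] v)
  show "pos n g = pos n v" unfolding gk using pos_UT_mult(2)[OF kv b] pos_UT_mult(1)[OF v BK_UT[OF k]] by simp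
  let ?T = "minv n (sg n)"
  have Tv: "?T * v \<in> carrier (GL n)" by (intro GL_mult GL_inv(1) sg_GL v)
  have Tk: "?T * k * sg n * (?T * v) \<in> carrier (GL n)" by (intro GL_mult GL_inv(1) sg_GL v BK_GL[OF k])
  have "?T * g = ?T * k * sg n * (?T * v) * b"
    unfolding gk using GL_D[OF v] GL_D[OF BK_GL[OF k]] UT_D[OF b] GL_D[OF sg_GL(1)] GL_D[OF GL_inv(1)[OF sg_GL(1)]]
    by (simp add: mmult_assoc[of _ n] mmult_cancel(1)[OF sg_GL(1)])
  then show "pos_star n g = pos_star n v"
    using pos_UT_mult(2)[OF Tk b] pos_UT_mult(1)[OF Tv BK_B_star[OF n k]] by simp
qed

text \<open>The preimage in the group is the union of the translates of a basic open set by \<open>B\<^bsub>n-1\<^esub>\<close> from the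
  left and by \<open>B\<close> from the right.\<close>

lemma open_union_of_orbits:
  assumes n: "n \<ge> 1" and f: "regular n f"
  shows "openin (flag_topology n) (\<Union>g \<in> {g \<in> carrier (GL n). f g \<noteq> 0}. orb n g)" (is "openin _ ?U")
  unfolding flag_topology_def openin_quot_topology
proof
  let ?X = "subtopology (zariski n) (carrier (GL n))"
  have top: "topspace ?X = carrier (GL n)" using GL_D by auto
  show "?U \<subseteq> flag_of n ` topspace ?X"
    unfolding top orb_def using GL_mult[OF BK_GL] by blast
  have eq: "{h \<in> topspace ?X. flag_of n h \<in> ?U} =
      (\<Union>k \<in> BK n. \<Union>b \<in> UT n. carrier (GL n) \<inter> {h \<in> carrier_mat n n. f (k * h * b) \<noteq> 0})" (is "?L = ?R")
  proof (rule subset_antisym; rule subsetI)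
    fix h assume "h \<in> ?L"
    then obtain g where h: "h \<in> carrier (GL n)" and g: "g \<in> carrier (GL n)" "f g \<noteq> 0" "flag_of n h \<in> orb n g"
      unfolding top by blast
    obtain k b where k: "k \<in> BK n" and b: "b \<in> UT n" and hk: "h = k * g * b" using in_orb(1)[OF n g(1) h g(3)] by blast
    have "minv n k * h * minv n b = g"
      unfolding hk using GL_D[OF g(1)] GL_D[OF BK_GL[OF k]] UT_D[OF b] GL_D[OF GL_inv(1)[OF BK_GL[OF k]]]
        GL_D[OF GL_inv(1)[OF UT_GL[OF b]]]
      by (simp add: mmult_assoc[of _ n] mmult_cancel(2)[OF BK_GL[OF k]] GL_inv(2)[OF UT_GL[OF b]])
    then show "h \<in> ?R" using BK_inv[OF n k] UT_inv[OF b] g(2) h GL_D[OF h] by auto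
  next
    fix h assume "h \<in> ?R"
    then obtain k b where k: "k \<in> BK n" and b: "b \<in> UT n" and h: "h \<in> carrier (GL n)" "f (k * h * b) \<noteq> 0" by blast
    have "flag_of n h \<in> orb n (k * h * b)" unfolding orb_eq[OF n h(1) k b] by (rule orb_self[OF n h(1)])
    moreover have "k * h * b \<in> carrier (GL n)" by (intro GL_mult h(1) BK_GL[OF k] UT_GL[OF b])
    ultimately show "h \<in> ?L" unfolding top using h by blast
  qed
  have op: "openin ?X (carrier (GL n) \<inter> {h \<in> carrier_mat n n. f (k * h * b) \<noteq> 0})" if "k \<in> BK n" "b \<in> UT n" for k b
    unfolding openin_subtopology
    using open_nonzero[OF regular_translate[OF f GL_D[OF BK_GL[OF that(1)]] UT_D[OF that(2)]]] by blast
  show "openin ?X {h \<in> topspace ?X. flag_of n h \<in> ?U}" unfolding eq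
    by (rule openin_Union, elim imageE, hypsubst, rule openin_Union, elim imageE, hypsubst, rule op)
qed

text \<open>A criterion for the open orbit of a sweep \<open>X\<close>. The set \<open>S\<close> of matrices meets all orbits in \<open>X\<close> and is
  irreducible, so two open orbits have a point in common. The function \<open>f\<close> vanishes on the
  orbits in \<open>X\<close> other than the one of \<open>v0\<close>, which is therefore open.\<close>

lemma orbit_act_eqI:
  assumes n: "n \<ge> 2" and v: "v \<in> carrier (GL n)"
    and rep: "\<And>v'. v' \<in> carrier (GL n) \<Longrightarrow> orb n v' = orb n v \<Longrightarrow> sweep n \<alpha> v' = X"
    and S: "S \<subseteq> carrier (GL n)" "line_dense S" "\<And>s. s \<in> S \<Longrightarrow> orb n s \<subseteq> X"
    and X: "X \<subseteq> flag_of n ` carrier (GL n)"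
    and hit: "\<And>g. g \<in> carrier (GL n) \<Longrightarrow> flag_of n g \<in> X \<Longrightarrow> \<exists>s \<in> S. orb n s = orb n g"
    and v0: "v0 \<in> S" and f: "regular n f" "f v0 \<noteq> 0"
    and same: "\<And>s g. s \<in> S \<Longrightarrow> g \<in> carrier (GL n) \<Longrightarrow> orb n g = orb n s \<Longrightarrow> f g \<noteq> 0 \<Longrightarrow> orb n s = orb n v0"
  shows "orbit_act n \<alpha> (orb n v) = orb n v0"
proof -
  have n1: "n \<ge> 1" using n by simp
  have v0G: "v0 \<in> carrier (GL n)" using v0 S(1) by blast
  have op: "openin (subtopology (flag_topology n) X) (orb n v0)"
  proof -
    let ?U = "\<Union>g \<in> {g \<in> carrier (GL n). f g \<noteq> 0}. orb n g"
    have "orb n v0 = ?U \<inter> X"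
    proof (rule subset_antisym; rule subsetI)
      fix F assume "F \<in> orb n v0"
      then show "F \<in> ?U \<inter> X" using f(2) v0G S(3)[OF v0] by blast
    next
      fix F assume F: "F \<in> ?U \<inter> X"
      then obtain g where g: "g \<in> carrier (GL n)" "f g \<noteq> 0" "F \<in> orb n g" by blast
      obtain h where h: "h \<in> carrier (GL n)" "F = flag_of n h" using F X by blast
      have hg: "orb n h = orb n g" using in_orb(2)[OF n1 g(1) h(1)] g(3) h(2) by simp
      obtain s where s: "s \<in> S" "orb n s = orb n h" using hit[OF h(1)] F h(2) by blast
      have "orb n s = orb n v0" by (rule same[OF s(1) g(1) _ g(2)]) (use s hg in simp)
      then show "F \<in> orb n v0" using g(3) s hg by simp
    qed
    then show ?thesis unfolding openin_subtopology using open_union_of_orbits[OF n1 f(1)] by blast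
  qed
  have open_in_S: "\<exists>W. openin (zariski n) W \<and> W \<inter> S \<noteq> {} \<and> (\<forall>s \<in> W \<inter> S. orb n s = orb n g)"
    if g: "g \<in> carrier (GL n)" "orb n g \<subseteq> X" "openin (subtopology (flag_topology n) X) (orb n g)" for g
  proof -
    obtain U where U: "openin (flag_topology n) U" "orb n g = U \<inter> X"
      using g(3) unfolding openin_subtopology by blast
    have "openin (subtopology (zariski n) (carrier (GL n)))
        {h \<in> topspace (subtopology (zariski n) (carrier (GL n))). flag_of n h \<in> U}"
      using U(1) unfolding flag_topology_def openin_quot_topology by blast
    then obtain W where W: "openin (zariski n) W"
      "{h \<in> topspace (subtopology (zariski n) (carrier (GL n))). flag_of n h \<in> U} = W \<inter> carrier (GL n)"
      unfolding openin_subtopology by blast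
    have Wiff: "h \<in> W \<longleftrightarrow> flag_of n h \<in> U" if "h \<in> S" for h
    proof -
      have h: "h \<in> carrier (GL n)" using that S(1) by blast
      then have "h \<in> topspace (subtopology (zariski n) (carrier (GL n)))" using GL_D[OF h] by simp
      then show ?thesis using W(2) h by blast
    qed
    obtain s where s: "s \<in> S" "orb n s = orb n g" using hit[OF g(1)] orb_self[OF n1 g(1)] g(2) by blast
    have sG: "s \<in> carrier (GL n)" using s(1) S(1) by blast
    have "flag_of n s \<in> U" using orb_self[OF n1 sG] s(2) U(2) by blast
    then have "s \<in> W \<inter> S" using Wiff s(1) by blast
    moreover have "orb n s' = orb n g" if s': "s' \<in> W \<inter> S" for s'
    proof -
      have s'G: "s' \<in> carrier (GL n)" using s' S(1) by blast
      have "flag_of n s' \<in> U \<inter> X" using s' Wiff S(3)[of s'] orb_self[OF n1 s'G] by blast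
      then show ?thesis using in_orb(2)[OF n1 g(1) s'G] U(2) by blast
    qed
    ultimately show ?thesis using W(1) by blast
  qed
  have Sc: "S \<subseteq> carrier_mat n n" using S(1) GL_D by blast
  show ?thesis unfolding orbit_act_def
  proof (rule the_equality)
    have "represents n (orb n v) v" using represents_iff[OF n] v by blast
    moreover have "orb n v0 \<in> orbits n" using orbits_eq[OF n] v0G by blast
    ultimately show "orb n v0 \<in> orbits n \<and> (\<exists>v'. represents n (orb n v) v' \<and> orb n v0 \<subseteq> sweep n \<alpha> v' \<and>
        openin (subtopology (flag_topology n) (sweep n \<alpha> v')) (orb n v0))"
      using rep[OF v refl] S(3)[OF v0] op by auto
  next
    fix Q' assume Q': "Q' \<in> orbits n \<and> (\<exists>v'. represents n (orb n v) v' \<and> Q' \<subseteq> sweep n \<alpha> v' \<and>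
        openin (subtopology (flag_topology n) (sweep n \<alpha> v')) Q')"
    then obtain v' where v': "v' \<in> carrier (GL n)" "orb n v' = orb n v" "Q' \<subseteq> sweep n \<alpha> v'"
      "openin (subtopology (flag_topology n) (sweep n \<alpha> v')) Q'" using represents_iff[OF n] by metis
    obtain g where g: "g \<in> carrier (GL n)" "Q' = orb n g" using Q' orbits_eq[OF n] by blast
    obtain W where W: "openin (zariski n) W" "W \<inter> S \<noteq> {}" "\<forall>s \<in> W \<inter> S. orb n s = orb n g"
      using open_in_S[OF g(1)] v'(3,4) rep[OF v'(1,2)] g(2) by blast
    obtain W' where W': "openin (zariski n) W'" "W' \<inter> S \<noteq> {}" "\<forall>s \<in> W' \<inter> S. orb n s = orb n v0"
      using open_in_S[OF v0G S(3)[OF v0] op] by blast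
    obtain s where "s \<in> W \<inter> W' \<inter> S" using line_dense_open_meet[OF Sc S(2) W(1) W'(1) W(2) W'(2)] by blast
    then show "Q' = orb n v0" using W(3) W'(3) g(2) by blast
  qed
qed

lemma separating_product:
  assumes "regular n f1" "regular n f2" "f1 v0 \<noteq> 0" "f2 (minv n (sg n) * v0) \<noteq> 0" "v0 \<in> carrier (GL n)"
    and "\<And>g. in_cell n w g \<Longrightarrow> f1 g = 0" "\<And>g. in_cell n u g \<Longrightarrow> f2 g = 0"
  obtains f where "regular n f" "f v0 \<noteq> 0"
    "\<And>g. g \<in> carrier (GL n) \<Longrightarrow> f g \<noteq> 0 \<Longrightarrow> pos n g \<noteq> w \<and> pos_star n g \<noteq> u"
proof -
  let ?f = "\<lambda>g. f1 g * f2 (minv n (sg n) * g * 1\<^sub>m n)"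
  have T: "minv n (sg n) \<in> carrier_mat n n" by (rule GL_D[OF GL_inv(1)[OF sg_GL(1)]])
  have e: "minv n (sg n) * g * 1\<^sub>m n = minv n (sg n) * g" if "g \<in> carrier (GL n)" for g
    using GL_D[OF that] T by simp
  show thesis
  proof (rule that[of ?f])
    show "regular n ?f" by (intro regular_mult assms(1) regular_translate[OF assms(2) T]) simp
    show "?f v0 \<noteq> 0" using assms(3-5) e by simp
    fix g assume g: "g \<in> carrier (GL n)" "?f g \<noteq> 0"
    have g': "minv n (sg n) * g \<in> carrier (GL n)" by (intro GL_mult GL_inv(1) sg_GL g(1))
    show "pos n g \<noteq> w \<and> pos_star n g \<noteq> u"
      using g(2) e[OF g(1)] assms(6,7) in_cell_pos[OF g(1)] in_cell_pos[OF g'] by auto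
  qed
qed

text \<open>The open orbit consists of the points of the line other than \<open>p\<close> and \<open>q\<close>, where both permutations
  are long.\<close>

lemma orbit_act_GRoot:
  assumes n: "n \<ge> 2" and i: "i + 1 < n" and v: "v \<in> carrier (GL n)"
  obtains v0 where "v0 \<in> carrier (GL n)" "orbit_act n (GRoot i) (orb n v) = orb n v0"
    "Sh n (orb n v0) = pair_act n (GRoot i) (Sh n (orb n v))"
proof -
  obtain w u p1 p2 q1 q2 where w: "w permutes {..<n}" "w i < w (Suc i)" and u: "u permutes {..<n}" "u i < u (Suc i)"
    and p: "p1 \<noteq> 0 \<or> p2 \<noteq> 0" and q: "q1 \<noteq> 0 \<or> q2 \<noteq> (0 :: complex)"
    and posw: "\<And>m. m \<in> parab n i \<Longrightarrow>
       pos n (v * m) = (if m $$ (i, i) * p2 = m $$ (Suc i, i) * p1 then w else w \<circ> simple_refl i)"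
    and posu: "\<And>m. m \<in> parab n i \<Longrightarrow>
       pos n (minv n (sg n) * (v * m)) = (if m $$ (i, i) * q2 = m $$ (Suc i, i) * q1 then u else u \<circ> simple_refl i)"
    and elt: "\<And>t. 1 + t * (p2 * q1 - p1 * q2) \<noteq> 0 \<Longrightarrow> \<exists>m \<in> parab n i. v * m * minv n v \<in> UT n \<and>
       lastcol n (v * m * minv n v) \<and> m $$ (i, i) = 1 - t * p1 * q2 \<and> m $$ (i, Suc i) = t * p1 * q1 \<and>
       m $$ (Suc i, i) = - t * p2 * q2 \<and> m $$ (Suc i, Suc i) = 1 + t * p2 * q1"
    by (rule line_in_flag_direction[OF i v]) blast
  have i': "Suc i < n" and n1: "n \<ge> 1" using i n by simp_all
  have one: "1\<^sub>m n \<in> parab n i" using UT_one UT_parab by blast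
  note vD = GL_D[OF v] GL_D[OF GL_inv(1)[OF v]]
  \<comment> \<open>a point of the line other than \<open>p\<close> and \<open>q\<close> represents the open orbit\<close>
  obtain y1 y2 where y: "p1 * y2 \<noteq> p2 * y1" "q1 * y2 \<noteq> q2 * y1" by (rule third_line[OF p q])
  then have "y1 \<noteq> 0 \<or> y2 \<noteq> 0" by auto
  then obtain m0 where m0: "m0 \<in> parab n i" "m0 $$ (i, i) = y1" "m0 $$ (Suc i, i) = y2"
    by (rule parab_with_column[OF i])
  define v0 where "v0 = v * m0"
  have v0: "v0 \<in> carrier (GL n)" unfolding v0_def by (intro GL_mult v parab_GL[OF m0(1)])
  have pos0: "pos n v0 = w \<circ> simple_refl i" "pos_star n v0 = u \<circ> simple_refl i"
    using posw[OF m0(1)] posu[OF m0(1)] y m0(2,3) unfolding v0_def by (auto simp: mult.commute)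
  have v0': "minv n (sg n) * v0 \<in> carrier (GL n)" by (intro GL_mult GL_inv(1) sg_GL v0)
  obtain f1 where f1: "regular n f1" "f1 v0 \<noteq> 0" "\<And>g. in_cell n w g \<Longrightarrow> f1 g = 0"
    using cell_separating_function[OF w(1) _ i' w(2), of v0] in_cell_pos[OF v0] pos0 by auto
  obtain f2 where f2: "regular n f2" "f2 (minv n (sg n) * v0) \<noteq> 0" "\<And>g. in_cell n u g \<Longrightarrow> f2 g = 0"
    using cell_separating_function[OF u(1) _ i' u(2), of "minv n (sg n) * v0"] in_cell_pos[OF v0'] pos0 by auto
  obtain f where f: "regular n f" "f v0 \<noteq> 0"
    "\<And>g. g \<in> carrier (GL n) \<Longrightarrow> f g \<noteq> 0 \<Longrightarrow> pos n g \<noteq> w \<and> pos_star n g \<noteq> u"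
    using separating_product[OF f1(1) f2(1) f1(2) f2(2) v0 f1(3) f2(3)] by blast
  have sub: "sweep n (GRoot i) g \<subseteq> sweep n (GRoot i) h"
    if g: "g \<in> carrier (GL n)" and h: "h \<in> carrier (GL n)" and eq: "orb n g = orb n h" for g h
  proof
    fix F assume "F \<in> sweep n (GRoot i) g"
    then obtain k m where k: "k \<in> BK n" and m: "m \<in> parab n i" and F: "F = flag_of n (k * (g * m))"
      unfolding sweep_G[OF i g] by blast
    obtain k' b where k': "k' \<in> BK n" and b: "b \<in> UT n" and gk: "g = k' * h * b"
      using in_orb(1)[OF n1 h g] orb_self[OF n1 g] eq by auto
    have "k * (g * m) = (k * k') * (h * (b * m))"
      unfolding gk using GL_D[OF h] GL_D[OF BK_GL[OF k]] GL_D[OF BK_GL[OF k']] UT_D[OF b] parab_D[OF m]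
      by (simp add: mmult_assoc[of _ n])
    then show "F \<in> sweep n (GRoot i) h"
      unfolding sweep_G[OF i h] F using BK_mult[OF n1 k k'] parab_mult[OF subsetD[OF UT_parab b] m] by auto
  qed
  define S where "S = (\<lambda>m. v * m * 1\<^sub>m n) ` parab n i"
  have Sv: "v * m * 1\<^sub>m n = v * m" if "m \<in> parab n i" for m using parab_D[OF that] vD by simp
  have SG: "S \<subseteq> carrier (GL n)" unfolding S_def using Sv GL_mult[OF v parab_GL] by auto
  have act: "orbit_act n (GRoot i) (orb n v) = orb n v0"
  proof (rule orbit_act_eqI[OF n v _ SG])
    show "sweep n (GRoot i) v' = sweep n (GRoot i) v" if "v' \<in> carrier (GL n)" "orb n v' = orb n v" for v'
      using sub[OF that(1) v that(2)] sub[OF v that(1) that(2)[symmetric]] by blast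
    show "line_dense S" unfolding S_def
    proof (rule line_dense_translate)
      show "line_dense (parab n i)" by (rule block_group.P_dense[OF block_group_parab[OF i]])
      show "parab n i \<subseteq> carrier_mat n n" using parab_D by blast
    qed (use vD in simp_all)
    show "orb n s \<subseteq> sweep n (GRoot i) v" if "s \<in> S" for s
      using that unfolding sweep_G[OF i v] S_def orb_def using Sv by auto
    show "sweep n (GRoot i) v \<subseteq> flag_of n ` carrier (GL n)"
      unfolding sweep_G[OF i v] using GL_mult[OF BK_GL GL_mult[OF v parab_GL]] by blast
    show "\<exists>s \<in> S. orb n s = orb n g" if g: "g \<in> carrier (GL n)" "flag_of n g \<in> sweep n (GRoot i) v" for g
    proof -
      obtain k m where k: "k \<in> BK n" and m: "m \<in> parab n i" and F: "flag_of n g = flag_of n (k * (v * m))"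
        using g(2) unfolding sweep_G[OF i v] by blast
      have vm: "v * m \<in> carrier (GL n)" by (intro GL_mult v parab_GL[OF m])
      have "flag_of n g \<in> orb n (v * m)" unfolding F orb_def using k by blast
      then have "orb n g = orb n (v * m)" by (rule in_orb(2)[OF n1 vm g(1)])
      then show ?thesis unfolding S_def using m Sv by (intro bexI[of _ "v * m * 1\<^sub>m n"]) simp_all
    qed
    show "v0 \<in> S" unfolding S_def v0_def using m0(1) Sv by (intro image_eqI[of _ _ m0]) simp_all
    show "regular n f" "f v0 \<noteq> 0" by fact+
    show "orb n s = orb n v0" if s: "s \<in> S" and g: "g \<in> carrier (GL n)" "orb n g = orb n s" "f g \<noteq> 0" for s g
    proof -
      obtain m where m: "m \<in> parab n i" and sm: "s = v * m" using s Sv unfolding S_def by auto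
      have sG: "s \<in> carrier (GL n)" using s SG by blast
      have "pos n s \<noteq> w" "pos_star n s \<noteq> u" using f(3)[OF g(1,3)] orb_pos[OF n1 sG g(1,2)] by simp_all
      then have x: "p1 * m $$ (Suc i, i) \<noteq> p2 * m $$ (i, i)" "q1 * m $$ (Suc i, i) \<noteq> q2 * m $$ (i, i)"
        using posw[OF m] posu[OF m] unfolding sm by (auto simp: mult.commute)
      obtain t where t: "1 + t * (p2 * q1 - p1 * q2) \<noteq> 0"
        "((1 - t * p1 * q2) * m $$ (i, i) + (t * p1 * q1) * m $$ (Suc i, i)) * y2 =
         ((- t * p2 * q2) * m $$ (i, i) + (1 + t * p2 * q1) * m $$ (Suc i, i)) * y1"
        by (rule two_lines[OF x y])
      obtain h where h: "h \<in> parab n i" "v * h * minv n v \<in> UT n" "lastcol n (v * h * minv n v)"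
        "h $$ (i, i) = 1 - t * p1 * q2" "h $$ (i, Suc i) = t * p1 * q1"
        "h $$ (Suc i, i) = - t * p2 * q2" "h $$ (Suc i, Suc i) = 1 + t * p2 * q1" using elt[OF t(1)] by blast
      have hm: "h * m \<in> parab n i" by (rule parab_mult[OF h(1) m])
      have par: "(h * m) $$ (i, i) * y2 = (h * m) $$ (Suc i, i) * y1"
        using parab_mult_entry[OF h(1) m i, of i i] parab_mult_entry[OF h(1) m i, of "Suc i" i] t(2) h(4-)
        by (simp del: index_mult_mat)
      \<comment> \<open>\<open>h m\<close> and \<open>m0\<close> have proportional first columns in the block, so they differ by a triangular factor\<close>
      define b where "b = minv n m0 * (h * m)"
      have m0i: "minv n m0 \<in> parab n i" by (rule parab_inv[OF m0(1) i])
      have "b $$ (Suc i, i) = 0"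
        unfolding b_def using parab_mult_entry[OF m0i hm i, of "Suc i" i] parab_minv_entry(3,4)[OF m0(1) i] m0(2,3) par
        by (simp add: add_divide_distrib[symmetric] mult.commute del: index_mult_mat)
      then have b: "b \<in> UT n" unfolding UT_iff_parab[OF i] using parab_mult[OF m0i hm] by (simp add: b_def)
      have hB: "v * h * minv n v \<in> BK n" using h(2,3) by (simp add: BK_def)
      have "v0 * b = (v * h * minv n v) * s * 1\<^sub>m n"
        unfolding v0_def b_def sm using vD parab_D[OF h(1)] parab_D[OF m] parab_D[OF m0(1)] parab_D[OF m0i]
        by (simp add: mmult_assoc[of _ n] mmult_cancel(2)[OF v] mmult_cancel(1)[OF parab_GL[OF m0(1)]])
      then have "orb n (v0 * b) = orb n s" using orb_eq[OF n1 sG hB UT_one] by simp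
      moreover have "orb n (v0 * b) = orb n v0" using orb_eq[OF n1 v0 BK_one[OF n1] b] GL_D[OF v0] by simp
      ultimately show ?thesis by simp
    qed
  qed
  have v': "minv n (sg n) * v \<in> carrier (GL n)" by (intro GL_mult GL_inv(1) sg_GL v)
  have "pos n v = w \<or> pos n v = w \<circ> simple_refl i" using posw[OF one] vD by (auto split: if_splits)
  then have 1: "(if stable_w n (GRoot i) (pos n v) then refl_w n (GRoot i) (pos n v) else pos n v) = w \<circ> simple_refl i"
    using stable_w_simps(1)[OF pos_permutes[OF v] i] w(2) ascent_refl_right[OF w(2)] by auto
  have "pos_star n v = u \<or> pos_star n v = u \<circ> simple_refl i" using posu[OF one] vD by (auto split: if_splits)
  then have 2: "(if stable_u n (GRoot i) (star n (pos_star n v)) then refl_u n (GRoot i) (star n (pos_star n v))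
      else star n (pos_star n v)) = star n (u \<circ> simple_refl i)"
    unfolding stable_u_simps(1)[OF pos_permutes[OF v'] i] refl_u_star(1)
    using u(2) ascent_refl_right[OF u(2)] by (auto simp del: comp_apply)
  show thesis
  proof (rule that[OF v0 act])
    show "Sh n (orb n v0) = pair_act n (GRoot i) (Sh n (orb n v))"
      unfolding Sh_orb[OF n v0] Sh_orb[OF n v] pos0 pair_act.simps 1 2 ..
  qed
qed

text \<open>The separating functions of cells are available for reflections on the right, so a reflection on the
  left is moved there by conjugation with \<open>w\<close>.\<close>

lemma refl_comp_left:
  assumes w: "w permutes {..<n}" and j: "Suc j < n" and asc: "pinv w j < pinv w (Suc j)"
  shows "w \<circ> Transposition.transpose (pinv w j) (pinv w (Suc j)) = simple_refl j \<circ> w"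
    and "pinv w (Suc j) < n" and "w (pinv w j) < w (pinv w (Suc j))"
proof -
  have e: "w (pinv w k) = k" for k by (rule permutes_inverses(1)[OF w])
  have "w (Transposition.transpose (pinv w j) (pinv w (Suc j)) k) = simple_refl j (w k)" for k
    using e permutes_inverses(2)[OF w] by (metis transpose_apply_first transpose_apply_other transpose_apply_second)
  then show "w \<circ> Transposition.transpose (pinv w j) (pinv w (Suc j)) = simple_refl j \<circ> w"
    by (simp add: fun_eq_iff)
  show "pinv w (Suc j) < n" using permutes_in_image[OF permutes_inv[OF w], of "Suc j"] j by simp
  show "w (pinv w j) < w (pinv w (Suc j))" by (simp add: e)
qed

lemma orbit_act_KRoot:
  assumes i: "i + 2 < n" and v: "v \<in> carrier (GL n)"
  obtains v0 where "v0 \<in> carrier (GL n)" "orbit_act n (KRoot i) (orb n v) = orb n v0"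
    "Sh n (orb n v0) = pair_act n (KRoot i) (Sh n (orb n v))"
proof -
  obtain w u p1 p2 q1 q2 where w: "w permutes {..<n}" "pinv w i < pinv w (Suc i)"
    and u: "u permutes {..<n}" "pinv u (Suc i) < pinv u (Suc (Suc i))"
    and p: "p1 \<noteq> 0 \<or> p2 \<noteq> 0" and q: "q1 \<noteq> 0 \<or> q2 \<noteq> (0 :: complex)"
    and posw: "\<And>m. m \<in> parab n i \<Longrightarrow>
       pos n (m * v) = (if m $$ (Suc i, i) * p1 + m $$ (Suc i, Suc i) * p2 = 0 then w else simple_refl i \<circ> w)"
    and posu: "\<And>m. m \<in> parab n i \<Longrightarrow> lastcol n m \<Longrightarrow>
       pos n (minv n (sg n) * (m * v)) =
         (if m $$ (Suc i, i) * q1 + m $$ (Suc i, Suc i) * q2 = 0 then u else simple_refl (Suc i) \<circ> u)"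
    and elt: "\<And>t. 1 + t * (p2 * q1 - p1 * q2) \<noteq> 0 \<Longrightarrow> \<exists>m \<in> parab n i. minv n v * m * v \<in> UT n \<and>
       lastcol n m \<and> m $$ (i, i) = 1 - t * p1 * q2 \<and> m $$ (i, Suc i) = t * p1 * q1 \<and>
       m $$ (Suc i, i) = - t * p2 * q2 \<and> m $$ (Suc i, Suc i) = 1 + t * p2 * q1"
    by (rule line_in_reference_direction[OF i v]) blast
  have i1: "i + 1 < n" and i': "Suc i < n" "Suc (Suc i) < n" and n: "n \<ge> 2" and n1: "n \<ge> 1" using i by simp_all
  have one: "1\<^sub>m n \<in> parab n i" "lastcol n (1\<^sub>m n)" using UT_one UT_parab lastcol_one[OF n1] by blast+
  have PKl: "lastcol n m" if "m \<in> PK n i" for m using that by (simp add: PK_def)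
  note vD = GL_D[OF v] GL_D[OF GL_inv(1)[OF v]]
  obtain Y1 Y2 where Y: "p1 * Y2 \<noteq> p2 * Y1" "q1 * Y2 \<noteq> q2 * Y1" by (rule third_line[OF p q])
  then have "- Y2 \<noteq> 0 \<or> Y1 \<noteq> 0" by auto
  then obtain m0 where m0: "m0 \<in> PK n i" "m0 $$ (Suc i, i) = - Y2" "m0 $$ (Suc i, Suc i) = Y1"
    by (rule PK_with_row[OF i])
  have line: "m $$ (Suc i, i) * r1 + m $$ (Suc i, Suc i) * r2 = 0 \<longleftrightarrow> r1 * (- m $$ (Suc i, i)) = r2 * m $$ (Suc i, Suc i)"
    for m :: "complex mat" and r1 r2
  proof -
    have "r1 * (- m $$ (Suc i, i)) = - (m $$ (Suc i, i) * r1)" "r2 * m $$ (Suc i, Suc i) = m $$ (Suc i, Suc i) * r2"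
      by (simp_all add: mult.commute)
    then show ?thesis by (simp only: neg_eq_iff_add_eq_0)
  qed
  define v0 where "v0 = m0 * v"
  have v0: "v0 \<in> carrier (GL n)" unfolding v0_def by (intro GL_mult v PK_GL[OF m0(1)])
  have pos0: "pos n v0 = simple_refl i \<circ> w" "pos_star n v0 = simple_refl (Suc i) \<circ> u"
    using posw[OF PK_parab[OF m0(1)]] posu[OF PK_parab[OF m0(1)] PKl[OF m0(1)]] Y m0(2,3)
    unfolding v0_def line by simp_all
  have v0': "minv n (sg n) * v0 \<in> carrier (GL n)" by (intro GL_mult GL_inv(1) sg_GL v0)
  have cell1: "in_cell n (w \<circ> Transposition.transpose (pinv w i) (pinv w (Suc i))) v0"
    unfolding refl_comp_left(1)[OF w(1) i'(1) w(2)] using in_cell_pos[OF v0] pos0 by simp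
  have cell2: "in_cell n (u \<circ> Transposition.transpose (pinv u (Suc i)) (pinv u (Suc (Suc i)))) (minv n (sg n) * v0)"
    unfolding refl_comp_left(1)[OF u(1) i'(2) u(2)] using in_cell_pos[OF v0'] pos0 by simp
  obtain f1 where f1: "regular n f1" "f1 v0 \<noteq> 0" "\<And>g. in_cell n w g \<Longrightarrow> f1 g = 0"
    using cell_separating_function[OF w(1) w(2) refl_comp_left(2,3)[OF w(1) i'(1) w(2)] cell1] by blast
  obtain f2 where f2: "regular n f2" "f2 (minv n (sg n) * v0) \<noteq> 0" "\<And>g. in_cell n u g \<Longrightarrow> f2 g = 0"
    using cell_separating_function[OF u(1) u(2) refl_comp_left(2,3)[OF u(1) i'(2) u(2)] cell2] by blast
  obtain f where f: "regular n f" "f v0 \<noteq> 0"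
    "\<And>g. g \<in> carrier (GL n) \<Longrightarrow> f g \<noteq> 0 \<Longrightarrow> pos n g \<noteq> w \<and> pos_star n g \<noteq> u"
    using separating_product[OF f1(1) f2(1) f1(2) f2(2) v0 f1(3) f2(3)] by blast
  have sub: "sweep n (KRoot i) g \<subseteq> sweep n (KRoot i) h"
    if g: "g \<in> carrier (GL n)" and h: "h \<in> carrier (GL n)" and eq: "orb n g = orb n h" for g h
  proof
    fix F assume "F \<in> sweep n (KRoot i) g"
    then obtain m where m: "m \<in> PK n i" and F: "F = flag_of n (m * g)"
      unfolding sweep_K[OF i g] by blast
    obtain k b where k: "k \<in> BK n" and b: "b \<in> UT n" and gk: "g = k * h * b"
      using in_orb(1)[OF n1 h g] orb_self[OF n1 g] eq by auto
    have mk: "m * k \<in> PK n i" using k BK_PK[OF i1] PK_mult[OF n1 m] by blast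
    have mkh: "m * k * h \<in> carrier (GL n)" by (intro GL_mult[OF PK_GL[OF mk] h])
    have "m * g = m * k * h * b"
      unfolding gk using GL_D[OF h] GL_D[OF BK_GL[OF k]] UT_D[OF b] parab_D[OF PK_parab[OF m]]
      by (simp add: mmult_assoc[of _ n])
    moreover have "flag_of n (m * k * h) = flag_of n (m * k * h * b)"
      using flag_of_eq_iff[OF mkh GL_mult[OF mkh UT_GL[OF b]]] b by blast
    ultimately have "F = flag_of n (m * k * h)" using F by (simp only:)
    then show "F \<in> sweep n (KRoot i) h" unfolding sweep_K[OF i h] using mk by (rule image_eqI)
  qed
  define S where "S = (\<lambda>m. 1\<^sub>m n * m * v) ` PK n i"
  have Sv: "1\<^sub>m n * m * v = m * v" if "m \<in> PK n i" for m using parab_D[OF PK_parab[OF that]] vD by simp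
  have Sm: "\<exists>m \<in> PK n i. s = m * v" if s: "s \<in> S" for s
  proof -
    obtain m where "m \<in> PK n i" "s = 1\<^sub>m n * m * v" using s unfolding S_def by (elim imageE)
    then show ?thesis using Sv by (intro bexI[of _ m]) simp_all
  qed
  have SG: "S \<subseteq> carrier (GL n)" unfolding S_def using Sv GL_mult[OF PK_GL v] by auto
  have act: "orbit_act n (KRoot i) (orb n v) = orb n v0"
  proof (rule orbit_act_eqI[OF n v _ SG])
    show "sweep n (KRoot i) v' = sweep n (KRoot i) v" if "v' \<in> carrier (GL n)" "orb n v' = orb n v" for v'
      using sub[OF that(1) v that(2)] sub[OF v that(1) that(2)[symmetric]] by blast
    show "line_dense S" unfolding S_def
    proof (rule line_dense_translate)
      show "line_dense (PK n i)" by (rule block_group.P_dense[OF block_group_PK[OF i]])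
      show "PK n i \<subseteq> carrier_mat n n" using parab_D PK_parab by blast
    qed (use vD in simp_all)
    show "orb n s \<subseteq> sweep n (KRoot i) v" if s: "s \<in> S" for s
    proof -
      obtain m where m: "m \<in> PK n i" "s = m * v" using Sm[OF s] by blast
      have "k * (m * v) = (k * m) * v" "k * m \<in> PK n i" if "k \<in> BK n" for k
        using that GL_D[OF BK_GL[OF that]] parab_D[OF PK_parab[OF m(1)]] vD BK_PK[OF i1] PK_mult[OF n1 _ m(1)]
        by (simp_all add: mmult_assoc[of _ n])
      then show ?thesis unfolding orb_def sweep_K[OF i v] m(2) by auto
    qed
    show "sweep n (KRoot i) v \<subseteq> flag_of n ` carrier (GL n)"
      unfolding sweep_K[OF i v] using GL_mult[OF PK_GL v] by blast
    show "\<exists>s \<in> S. orb n s = orb n g" if g: "g \<in> carrier (GL n)" "flag_of n g \<in> sweep n (KRoot i) v" for g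
    proof -
      obtain m where m: "m \<in> PK n i" and F: "flag_of n g = flag_of n (m * v)"
        using g(2) unfolding sweep_K[OF i v] by blast
      have mv: "m * v \<in> carrier (GL n)" by (rule GL_mult[OF PK_GL[OF m] v])
      have "flag_of n g \<in> orb n (m * v)" unfolding F by (rule orb_self[OF n1 mv])
      then have "orb n g = orb n (m * v)" by (rule in_orb(2)[OF n1 mv g(1)])
      then show ?thesis unfolding S_def using m Sv by (intro bexI[of _ "1\<^sub>m n * m * v"]) simp_all
    qed
    show "v0 \<in> S" unfolding S_def v0_def using m0(1) Sv by (intro image_eqI[of _ _ m0]) simp_all
    show "regular n f" "f v0 \<noteq> 0" by fact+
    show "orb n s = orb n v0" if s: "s \<in> S" and g: "g \<in> carrier (GL n)" "orb n g = orb n s" "f g \<noteq> 0" for s g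
    proof -
      obtain m where m: "m \<in> PK n i" and sm: "s = m * v" using Sm[OF s] by blast
      note mP = PK_parab[OF m]
      have sG: "s \<in> carrier (GL n)" using s SG by blast
      \<comment> \<open>rows are treated as the lines that they annihilate; this exchanges the roles of \<open>p\<close> and \<open>q\<close> and the sign of \<open>t\<close>\<close>
      define X1 X2 where "X1 = m $$ (Suc i, Suc i)" and "X2 = - m $$ (Suc i, i)"
      have mX: "m $$ (Suc i, Suc i) = X1" "m $$ (Suc i, i) = - X2" by (simp_all add: X1_def X2_def)
      have "pos n s \<noteq> w" "pos_star n s \<noteq> u" using f(3)[OF g(1,3)] orb_pos[OF n1 sG g(1,2)] by simp_all
      then have x: "p1 * X2 \<noteq> p2 * X1" "q1 * X2 \<noteq> q2 * X1"
        using posw[OF mP] posu[OF mP PKl[OF m]] unfolding sm line mX by (auto simp: mult.commute)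
      obtain t where t: "1 + t * (q2 * p1 - q1 * p2) \<noteq> 0"
        "((1 - t * q1 * p2) * X1 + (t * q1 * p1) * X2) * Y2 = ((- t * q2 * p2) * X1 + (1 + t * q2 * p1) * X2) * Y1"
        by (rule two_lines[OF x(2,1) Y(2,1)])
      have "1 + (- t) * (p2 * q1 - p1 * q2) \<noteq> 0" using t(1) by (simp add: algebra_simps)
      then obtain h where h: "h \<in> parab n i" "minv n v * h * v \<in> UT n" "lastcol n h"
        "h $$ (i, i) = 1 - (- t) * p1 * q2" "h $$ (i, Suc i) = (- t) * p1 * q1"
        "h $$ (Suc i, i) = - (- t) * p2 * q2" "h $$ (Suc i, Suc i) = 1 + (- t) * p2 * q1" using elt[of "- t"] by blast
      have hP: "h \<in> PK n i" using h(1,3) by (simp add: PK_def)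
      have mh: "m * h \<in> PK n i" by (rule PK_mult[OF n1 m hP])
      have r: "(m * h) $$ (Suc i, i) = - ((- t * q2 * p2) * X1 + (1 + t * q2 * p1) * X2)"
        "(m * h) $$ (Suc i, Suc i) = (1 - t * q1 * p2) * X1 + (t * q1 * p1) * X2"
        using parab_mult_entry[OF mP h(1) i1, of "Suc i" i] parab_mult_entry[OF mP h(1) i1, of "Suc i" "Suc i"]
        unfolding h(4-) mX by (simp_all add: algebra_simps del: index_mult_mat)
      have par: "(m * h) $$ (Suc i, i) * Y1 + (m * h) $$ (Suc i, Suc i) * Y2 = 0"
        unfolding r t(2) by (simp only: mult_minus_left left_minus)
      define b where "b = m * h * minv n m0"
      have m0i: "minv n m0 \<in> PK n i" by (rule PK_inv[OF i1 m0(1)])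
      have "b $$ (Suc i, i) = 0"
        unfolding b_def using parab_mult_entry[OF PK_parab[OF mh] PK_parab[OF m0i] i1, of "Suc i" i]
          parab_minv_entry(1,3)[OF PK_parab[OF m0(1)] i1] m0(2,3) par
        by (simp add: add_divide_distrib[symmetric] del: index_mult_mat)
      then have b: "b \<in> BK n" unfolding BK_PK[OF i1] using PK_mult[OF n1 mh m0i] by (simp add: b_def)
      note D = vD parab_D[OF h(1)] parab_D[OF mP] parab_D[OF PK_parab[OF m0(1)]] parab_D[OF PK_parab[OF m0i]]
      have "b * v0 * 1\<^sub>m n = 1\<^sub>m n * s * (minv n v * h * v)"
        unfolding v0_def b_def sm using D
        by (simp add: mmult_assoc[of _ n] mmult_cancel(1)[OF v] mmult_cancel(2)[OF PK_GL[OF m0(1)]])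
      then show ?thesis
        using orb_eq[OF n1 v0 b UT_one] orb_eq[OF n1 sG BK_one[OF n1] h(2)] by simp
    qed
  qed
  have v': "minv n (sg n) * v \<in> carrier (GL n)" by (intro GL_mult GL_inv(1) sg_GL v)
  have "pos n v = w \<or> pos n v = simple_refl i \<circ> w" using posw[OF one(1)] vD by (auto split: if_splits)
  then have 1: "(if stable_w n (KRoot i) (pos n v) then refl_w n (KRoot i) (pos n v) else pos n v) = simple_refl i \<circ> w"
    using stable_w_simps(2)[OF pos_permutes[OF v] i] w(2) ascent_refl_left[OF w] by auto
  have "pos_star n v = u \<or> pos_star n v = simple_refl (Suc i) \<circ> u" using posu[OF one] vD by (auto split: if_splits)
  then have 2: "(if stable_u n (KRoot i) (star n (pos_star n v)) then refl_u n (KRoot i) (star n (pos_star n v))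
      else star n (pos_star n v)) = star n (simple_refl (Suc i) \<circ> u)"
    unfolding stable_u_simps(2)[OF pos_permutes[OF v'] i] refl_u_star(2)[OF i]
    using u(2) ascent_refl_left[OF u] by (auto simp del: comp_apply)
  show thesis
  proof (rule that[OF v0 act])
    show "Sh n (orb n v0) = pair_act n (KRoot i) (Sh n (orb n v))"
      unfolding Sh_orb[OF n v0] Sh_orb[OF n v] pos0 pair_act.simps 1 2 ..
  qed
qed

section \<open>The orbits and the pairs\<close>

lemma orbit_act_pair_act:
  assumes n: "n \<ge> 2" and Q: "Q \<in> orbits n" and \<alpha>: "\<alpha> \<in> simple_roots n"
  shows "orbit_act n \<alpha> Q \<in> orbits n" "Sh n (orbit_act n \<alpha> Q) = pair_act n \<alpha> (Sh n Q)"
proof -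
  obtain v where v: "v \<in> carrier (GL n)" "Q = orb n v" using Q orbits_eq[OF n] by blast
  have "\<exists>v0 \<in> carrier (GL n). orbit_act n \<alpha> Q = orb n v0 \<and> Sh n (orb n v0) = pair_act n \<alpha> (Sh n Q)"
  proof (cases \<alpha>)
    case (KRoot i)
    then have "i + 2 < n" using \<alpha> by (auto simp: simple_roots_def)
    then obtain v0 where "v0 \<in> carrier (GL n)" "orbit_act n (KRoot i) (orb n v) = orb n v0"
      "Sh n (orb n v0) = pair_act n (KRoot i) (Sh n (orb n v))" by (rule orbit_act_KRoot[OF _ v(1)])
    then show ?thesis unfolding v(2) KRoot by (intro bexI conjI)
  next
    case (GRoot i)
    then have "i + 1 < n" using \<alpha> by (auto simp: simple_roots_def)
    then obtain v0 where "v0 \<in> carrier (GL n)" "orbit_act n (GRoot i) (orb n v) = orb n v0"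
      "Sh n (orb n v0) = pair_act n (GRoot i) (Sh n (orb n v))" by (rule orbit_act_GRoot[OF n _ v(1)])
    then show ?thesis unfolding v(2) GRoot by (intro bexI conjI)
  qed
  then show "orbit_act n \<alpha> Q \<in> orbits n" "Sh n (orbit_act n \<alpha> Q) = pair_act n \<alpha> (Sh n Q)"
    using orbits_eq[OF n] by auto
qed

lemma type_at_iff:
  assumes n: "n \<ge> 2" and \<alpha>: "\<alpha> \<in> simple_roots n" and v: "represents n Q v" and Sh: "Sh n Q = (w, u)"
  shows "type_at n \<alpha> v Complex_Stable \<longleftrightarrow> stable_w n \<alpha> w \<and> stable_u n \<alpha> u"
    and "type_at n \<alpha> v Noncompact \<longleftrightarrow>
      stable_w n \<alpha> w \<and> \<not> stable_u n \<alpha> u \<or> \<not> stable_w n \<alpha> w \<and> stable_u n \<alpha> u"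
    and "type_at n \<alpha> v Real \<or> type_at n \<alpha> v Complex_Unstable \<longleftrightarrow> \<not> stable_w n \<alpha> w \<and> \<not> stable_u n \<alpha> u"
proof -
  have vG: "v \<in> carrier (GL n)" and Q: "Q = orb n v" using v represents_iff[OF n] by blast+
  have wu: "w = pos n v" "u = star n (pos_star n v)" using Sh Sh_orb[OF n vG] Q by simp_all
  have "(type_at n \<alpha> v Complex_Stable \<longleftrightarrow> stable_w n \<alpha> w \<and> stable_u n \<alpha> u) \<and>
    (type_at n \<alpha> v Noncompact \<longleftrightarrow>
      stable_w n \<alpha> w \<and> \<not> stable_u n \<alpha> u \<or> \<not> stable_w n \<alpha> w \<and> stable_u n \<alpha> u) \<and>
    (type_at n \<alpha> v Real \<or> type_at n \<alpha> v Complex_Unstable \<longleftrightarrow> \<not> stable_w n \<alpha> w \<and> \<not> stable_u n \<alpha> u)"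
  proof (cases \<alpha>)
    case (KRoot i)
    then have i: "i + 2 < n" using \<alpha> by (auto simp: simple_roots_def)
    show ?thesis unfolding KRoot wu by (intro conjI types_KRoot[OF i vG])
  next
    case (GRoot i)
    then have i: "i + 1 < n" using \<alpha> by (auto simp: simple_roots_def)
    show ?thesis unfolding GRoot wu by (intro conjI types_GRoot[OF n i vG])
  qed
  then show "type_at n \<alpha> v Complex_Stable \<longleftrightarrow> stable_w n \<alpha> w \<and> stable_u n \<alpha> u"
    and "type_at n \<alpha> v Noncompact \<longleftrightarrow>
      stable_w n \<alpha> w \<and> \<not> stable_u n \<alpha> u \<or> \<not> stable_w n \<alpha> w \<and> stable_u n \<alpha> u"
    and "type_at n \<alpha> v Real \<or> type_at n \<alpha> v Complex_Unstable \<longleftrightarrow> \<not> stable_w n \<alpha> w \<and> \<not> stable_u n \<alpha> u" by blast+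
qed

theorem theorem4p8:
  fixes n :: nat
  assumes "n \<ge> 2"
  shows "(\<forall>Q \<in> orbits n. \<forall>\<alpha> \<in> simple_roots n.
            Sh n (orbit_act n \<alpha> Q) = pair_act n \<alpha> (Sh n Q)) \<and>
         (\<forall>\<alpha> \<in> simple_roots n. \<forall>p \<in> Sp n. pair_act n \<alpha> p \<in> Sp n) \<and>
         (\<forall>Q \<in> orbits n. \<forall>\<alpha> \<in> simple_roots n. \<forall>w u. Sh n Q = (w, u) \<longrightarrow>
            (has_type n \<alpha> Q Complex_Stable \<longleftrightarrow> stable_w n \<alpha> w \<and> stable_u n \<alpha> u) \<and>
            (has_type n \<alpha> Q Noncompact \<longleftrightarrow>
               stable_w n \<alpha> w \<and> \<not> stable_u n \<alpha> u \<or> \<not> stable_w n \<alpha> w \<and> stable_u n \<alpha> u) \<and>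
            (has_type n \<alpha> Q Real \<or> has_type n \<alpha> Q Complex_Unstable \<longleftrightarrow>
               \<not> stable_w n \<alpha> w \<and> \<not> stable_u n \<alpha> u))"
proof (intro conjI ballI allI impI)
  fix Q \<alpha> assume "Q \<in> orbits n" "\<alpha> \<in> simple_roots n"
  then show "Sh n (orbit_act n \<alpha> Q) = pair_act n \<alpha> (Sh n Q)" by (rule orbit_act_pair_act(2)[OF assms])
next
  fix \<alpha> p assume \<alpha>: "\<alpha> \<in> simple_roots n" and "p \<in> Sp n"
  then obtain Q where Q: "Q \<in> orbits n" "p = Sh n Q" by (auto simp: Sp_def)
  have "pair_act n \<alpha> p = Sh n (orbit_act n \<alpha> Q)" using orbit_act_pair_act(2)[OF assms Q(1) \<alpha>] Q(2) by simp
  then show "pair_act n \<alpha> p \<in> Sp n"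
    unfolding Sp_def using orbit_act_pair_act(1)[OF assms Q(1) \<alpha>] by (rule image_eqI)
next
  fix Q \<alpha> w u assume Q: "Q \<in> orbits n" and \<alpha>: "\<alpha> \<in> simple_roots n" and Sh: "Sh n Q = (w, u)"
  obtain v where "v \<in> carrier (GL n)" "Q = orb n v" using Q unfolding orbits_eq[OF assms] by (elim imageE)
  then have v: "represents n Q v" unfolding represents_iff[OF assms] by simp
  note type_iff = type_at_iff[OF assms \<alpha> _ Sh]
  show "has_type n \<alpha> Q Complex_Stable \<longleftrightarrow> stable_w n \<alpha> w \<and> stable_u n \<alpha> u"
    unfolding has_type_def using type_iff(1) v by blast
  show "has_type n \<alpha> Q Noncompact \<longleftrightarrow>
      stable_w n \<alpha> w \<and> \<not> stable_u n \<alpha> u \<or> \<not> stable_w n \<alpha> w \<and> stable_u n \<alpha> u"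
    unfolding has_type_def using type_iff(2) v by blast
  show "has_type n \<alpha> Q Real \<or> has_type n \<alpha> Q Complex_Unstable \<longleftrightarrow> \<not> stable_w n \<alpha> w \<and> \<not> stable_u n \<alpha> u"
    unfolding has_type_def using type_iff(3) v by blast
qed

end
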